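(* Let $H$ be a complex Banach space, let $n\ge 1$, and let $\mathcal T=(T_1,\dots,T_n)$ be a polynomially bounded $n$-tuple of commuting contractions on $H$. Then $\mathcal T$ is absolutely continuous if and only if $\mathcal T$ satisfies Apostol's condition, i.e. if and only if for every $(x,y)\in H\times H^*$ and every $j\in\{1,\dots,n\}$, $$\lim_{m\to\infty}\ \sup\left\{\,|\langle p(T_1,\dots,T_n)\,T_j^m x,\,y\rangle| \;:\; p\in\mathbb C[z_1,\dots,z_n],\ \|p\|_\infty\le 1\right\}=0 .$$
   Context: Notation: $\mathbb D$ is the open unit disc in $\mathbb C$, $\Gamma=\partial\mathbb D$ is the unit circle, and $\Gamma^n$ is the $n$-torus. $H^*$ is the dual space of $H$, and $\langle x,y\rangle:=y(x)$ for $x\in H$, $y\in H^*$. A contraction on $H$ is a bounded linear operator of norm at most $1$. For a polynomial $p\in\mathbb C[z_1,\dots,z_n]$, $\|p\|_\infty$ denotes the supremum of $|p|$ over $\Gamma^n$ (equivalently, over $\mathbb D^n$). Polynomially bounded: the commuting tuple $\mathcal T$ is polynomially bounded if there is a constant $C>0$ such that $\|p(T_1,\dots,T_n)\|\le C\|p\|_\infty$ for all $p\in\mathbb C[z_1,\dots,z_n]$. Polydisc algebra and natural representation: $A(\mathbb D^n)$ is the algebra of analytic functions on $\mathbb D^n$ having continuous extensions to $\overline{\mathbb D^n}$, with the supremum norm; it is regarded as a closed unital subalgebra of $C(\Gamma^n)$. For polynomially bounded $\mathcal T$, the map $p\mapsto p(T_1,\dots,T_n)$ extends by continuity to a bounded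 representation $\Phi^{\mathcal T}:A(\mathbb D^n)\to B(H)$, where $B(H)$ is the algebra of bounded linear operators on $H$. Measures: $M(\Gamma^n)$ is the space of complex regular Borel measures on $\Gamma^n$. A system of elementary measures for $\Phi^{\mathcal T}$ is a family $\{\mu_{x,y}\}_{(x,y)\in H\times H^*}\subset M(\Gamma^n)$ such that $$\langle \Phi^{\mathcal T}(u)x,y\rangle=\int_{\Gamma^n}u\,d\mu_{x,y}\quad\text{for all } u\in A(\mathbb D^n),\ (x,y)\in H\times H^*.$$ (Such systems exist but are not unique.) A representing measure at a point $z\in\mathbb D^n$ is a Borel probability measure $\mu$ on $\Gamma^n$ with $u(z)=\int u\,d\mu$ for all $u\in A(\mathbb D^n)$. $\mathcal M_0$ denotes the set of all $\eta\in M(\Gamma^n)$ that are absolutely continuous with respect to some representing measure at the point $0$; it contains all measures representing points of $\mathbb D^n$. Absolutely continuous tuple: a polynomially bounded $n$-tuple $\mathcal T$ of commuting contractions is absolutely continuous if $\Phi^{\mathcal T}$ has a system of elementary measures $\{\mu_{x,y}\}_{(x,y)\in H\times H^*}$ with $\mu_{x,y}\in\mathcal M_0$ for all $(x,y)\in H\times H^*$. *)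

theory Defs
  imports "HOL-Probability.Probability" "HOL-Library.Poly_Mapping"
begin

section \<open>Complex normed spaces\<close>

class complex_normed_vector = real_normed_vector +
  fixes scaleC :: "complex \<Rightarrow> 'a \<Rightarrow> 'a"  (infixr "*\<^sub>C" 75)
  assumes scaleC_add_right: "c *\<^sub>C (x + y) = c *\<^sub>C x + c *\<^sub>C y"
    and scaleC_add_left: "(c + d) *\<^sub>C x = c *\<^sub>C x + d *\<^sub>C x"
    and scaleC_scaleC: "c *\<^sub>C d *\<^sub>C x = (c * d) *\<^sub>C x"
    and scaleC_of_real: "complex_of_real r *\<^sub>C x = r *\<^sub>R x"
    and norm_scaleC: "norm (c *\<^sub>C x) = cmod c * norm x"

instantiation complex :: complex_normed_vector
begin

definition scaleC_complex :: "complex \<Rightarrow> complex \<Rightarrow> complex" where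
  "scaleC_complex c x = c * x"

instance
  by standard (auto simp: scaleC_complex_def algebra_simps norm_mult scaleR_conv_of_real)

end

lemma bounded_linear_scaleC:
  "bounded_linear (\<lambda>x :: 'a::complex_normed_vector. c *\<^sub>C x)"
proof (rule bounded_linear_intro)
  fix x y :: 'a and r :: real
  show "c *\<^sub>C (x + y) = c *\<^sub>C x + c *\<^sub>C y"
    by (rule scaleC_add_right)
  show "c *\<^sub>C r *\<^sub>R x = r *\<^sub>R c *\<^sub>C x"
    by (simp only: scaleC_of_real [symmetric] scaleC_scaleC mult.commute)
  show "norm (c *\<^sub>C x) \<le> norm x * cmod c"
    by (simp add: norm_scaleC mult.commute)
qed

text \<open>The type \<open>'a \<Rightarrow>\<^sub>L 'b\<close> consists of the bounded \<^emph>\<open>real\<close>-linear maps; \<open>B(H)\<close> and \<open>H\<^sup>*\<close> are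
  the subsets of complex-homogeneous elements of \<open>H \<Rightarrow>\<^sub>L H\<close> and of \<open>H \<Rightarrow>\<^sub>L \<complex>\<close>.\<close>

instantiation blinfun :: (real_normed_vector, complex_normed_vector) complex_normed_vector
begin

lift_definition scaleC_blinfun :: "complex \<Rightarrow> ('a \<Rightarrow>\<^sub>L 'b) \<Rightarrow> ('a \<Rightarrow>\<^sub>L 'b)"
  is "\<lambda>c f x. c *\<^sub>C f x"
  by (rule bounded_linear_compose [OF bounded_linear_scaleC])

instance
proof
  fix c d :: complex and f g :: "'a \<Rightarrow>\<^sub>L 'b" and r :: real
  show "c *\<^sub>C (f + g) = c *\<^sub>C f + c *\<^sub>C g"
    by transfer (simp add: scaleC_add_right)
  show "(c + d) *\<^sub>C f = c *\<^sub>C f + d *\<^sub>C f"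
    by transfer (simp add: scaleC_add_left)
  show "c *\<^sub>C d *\<^sub>C f = (c * d) *\<^sub>C f"
    by transfer (simp add: scaleC_scaleC)
  show "complex_of_real r *\<^sub>C f = r *\<^sub>R f"
    by transfer (simp add: scaleC_of_real)
  have le: "norm (b *\<^sub>C h) \<le> cmod b * norm h" for b and h :: "'a \<Rightarrow>\<^sub>L 'b"
  proof (rule norm_blinfun_bound)
    fix x
    show "norm (blinfun_apply (b *\<^sub>C h) x) \<le> cmod b * norm h * norm x"
      using norm_blinfun [of h x]
      by (simp add: scaleC_blinfun.rep_eq norm_scaleC mult.assoc mult_left_mono)
  qed simp
  show "norm (c *\<^sub>C f) = cmod c * norm f"
  proof (cases "c = 0")
    case True
    then show ?thesis
      using le [of 0 f] by simp
  next
    case False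
    have "inverse c *\<^sub>C c *\<^sub>C f = f"
      using False scaleC_of_real [of 1, where 'a = 'b]
      by (intro blinfun_eqI) (simp add: scaleC_blinfun.rep_eq scaleC_scaleC)
    then have "norm f \<le> cmod (inverse c) * norm (c *\<^sub>C f)"
      using le [of "inverse c" "c *\<^sub>C f"] by simp
    then have "cmod c * norm f \<le> norm (c *\<^sub>C f)"
      using False by (simp add: norm_divide field_simps)
    with le [of c f] show ?thesis by simp
  qed
qed

end

definition complex_homogeneous ::
    "('a::complex_normed_vector \<Rightarrow>\<^sub>L 'b::complex_normed_vector) \<Rightarrow> bool" where
  "complex_homogeneous f \<longleftrightarrow>
     (\<forall>c x. blinfun_apply f (c *\<^sub>C x) = c *\<^sub>C blinfun_apply f x)"

definition complex_dual :: "('a::complex_normed_vector \<Rightarrow>\<^sub>L complex) set" where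
  "complex_dual = {y. complex_homogeneous y}"

definition contraction :: "('a::complex_normed_vector \<Rightarrow>\<^sub>L 'a) \<Rightarrow> bool" where
  "contraction S \<longleftrightarrow> complex_homogeneous S \<and> norm S \<le> 1"


section \<open>Polydisc, torus and polydisc algebra\<close>

definition polydisc :: "(complex^'n) set" where
  "polydisc = {z. \<forall>i. cmod (z $ i) < 1}"

definition torus :: "(complex^'n) set" where
  "torus = {z. \<forall>i. cmod (z $ i) = 1}"

definition sup_norm :: "(complex^'n \<Rightarrow> complex) \<Rightarrow> real" where
  "sup_norm u = (SUP z\<in>torus. cmod (u z))"

definition holomorphic_at :: "(complex^'n \<Rightarrow> complex) \<Rightarrow> complex^'n \<Rightarrow> bool" where
  "holomorphic_at u z \<longleftrightarrow>
     (\<exists>D. (u has_derivative D) (at z) \<and> (\<forall>c v. D (c *s v) = c * D v))"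

text \<open>Elements of the polydisc algebra are represented by total functions; their values
  outside the closed polydisc are irrelevant.\<close>

definition polydisc_algebra :: "(complex^'n \<Rightarrow> complex) set" where
  "polydisc_algebra =
     {u. continuous_on (closure polydisc) u \<and> (\<forall>z\<in>polydisc. holomorphic_at u z)}"


section \<open>Polynomials and the natural representation\<close>

text \<open>The ring of polynomials in finitely many variables indexed by \<open>'n\<close>: finitely supported
  maps from exponent vectors to coefficients.\<close>

type_synonym 'n cpoly = "('n \<Rightarrow>\<^sub>0 nat) \<Rightarrow>\<^sub>0 complex"

definition eval_poly :: "('n::finite) cpoly \<Rightarrow> complex^'n \<Rightarrow> complex" where
  "eval_poly p z = (\<Sum>\<alpha>\<in>Poly_Mapping.keys p.
     Poly_Mapping.lookup p \<alpha> * (\<Prod>i\<in>UNIV. z $ i ^ Poly_Mapping.lookup \<alpha> i))"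

definition op_power :: "('a::real_normed_vector \<Rightarrow>\<^sub>L 'a) \<Rightarrow> nat \<Rightarrow> ('a \<Rightarrow>\<^sub>L 'a)" where
  "op_power S k = (((o\<^sub>L) S) ^^ k) id_blinfun"

text \<open>The \<open>fold\<close> is the product of the powers of the \<open>T i\<close>; it does not depend on the order of
  the indices, since it is only used for commuting tuples.\<close>

definition op_monomial ::
    "('n::finite \<Rightarrow> 'a::real_normed_vector \<Rightarrow>\<^sub>L 'a) \<Rightarrow> ('n \<Rightarrow>\<^sub>0 nat) \<Rightarrow> ('a \<Rightarrow>\<^sub>L 'a)" where
  "op_monomial T \<alpha> = Finite_Set.fold
     (\<lambda>i S. op_power (T i) (Poly_Mapping.lookup \<alpha> i) o\<^sub>L S) id_blinfun UNIV"

definition op_poly ::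
    "('n::finite \<Rightarrow> 'a::complex_normed_vector \<Rightarrow>\<^sub>L 'a) \<Rightarrow> 'n cpoly \<Rightarrow> ('a \<Rightarrow>\<^sub>L 'a)" where
  "op_poly T p = (\<Sum>\<alpha>\<in>Poly_Mapping.keys p. Poly_Mapping.lookup p \<alpha> *\<^sub>C op_monomial T \<alpha>)"

definition commuting_tuple ::
    "('n::finite \<Rightarrow> 'a::complex_normed_vector \<Rightarrow>\<^sub>L 'a) \<Rightarrow> bool" where
  "commuting_tuple T \<longleftrightarrow> (\<forall>i j. T i o\<^sub>L T j = T j o\<^sub>L T i)"

definition polynomially_bounded ::
    "('n::finite \<Rightarrow> 'a::complex_normed_vector \<Rightarrow>\<^sub>L 'a) \<Rightarrow> bool" where
  "polynomially_bounded T \<longleftrightarrow>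
     (\<exists>C>0. \<forall>p. norm (op_poly T p) \<le> C * sup_norm (eval_poly p))"

text \<open>Extension by continuity: the operator-norm limit of \<open>p(T)\<close> as the polynomial \<open>p\<close> tends to
  \<open>u\<close> uniformly on the torus.\<close>

definition natural_rep ::
    "('n::finite \<Rightarrow> 'a::complex_normed_vector \<Rightarrow>\<^sub>L 'a) \<Rightarrow> (complex^'n \<Rightarrow> complex) \<Rightarrow> ('a \<Rightarrow>\<^sub>L 'a)"
  where
  "natural_rep T u =
     Lim (filtercomap (\<lambda>p. sup_norm (\<lambda>z. eval_poly p z - u z)) (nhds 0)) (op_poly T)"


section \<open>Complex measures\<close>

text \<open>A complex measure on the \<open>\<sigma>\<close>-algebra of \<open>M\<close> is a countably additive set function; only its
  values on \<open>sets M\<close> matter. The condition forces the value \<open>0\<close> on the empty set.\<close>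

definition complex_measure :: "'b measure \<Rightarrow> ('b set \<Rightarrow> complex) \<Rightarrow> bool" where
  "complex_measure M \<mu> \<longleftrightarrow>
     (\<forall>A :: nat \<Rightarrow> 'b set. range A \<subseteq> sets M \<longrightarrow> disjoint_family A \<longrightarrow>
        (\<lambda>i. \<mu> (A i)) sums \<mu> (\<Union>i. A i))"

definition total_variation :: "'b measure \<Rightarrow> ('b set \<Rightarrow> complex) \<Rightarrow> 'b set \<Rightarrow> ennreal" where
  "total_variation M \<mu> A =
     (SUP F\<in>{F :: nat \<Rightarrow> 'b set. range F \<subseteq> sets M \<and> disjoint_family F \<and> (\<Union>i. F i) = A}.
        suminf (\<lambda>i. ennreal (cmod (\<mu> (F i)))))"

text \<open>The positive part of the Jordan decomposition of a finite signed measure \<open>\<nu>\<close>. Negative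
  values of \<open>\<nu> B\<close> are cut off by \<^const>\<open>ennreal\<close>, harmlessly because \<open>B = {}\<close> is admitted.\<close>

definition positive_variation :: "'b measure \<Rightarrow> ('b set \<Rightarrow> real) \<Rightarrow> 'b measure" where
  "positive_variation M \<nu> =
     measure_of (space M) (sets M) (\<lambda>A. SUP B\<in>{B \<in> sets M. B \<subseteq> A}. ennreal (\<nu> B))"

definition signed_integral ::
    "'b measure \<Rightarrow> ('b set \<Rightarrow> real) \<Rightarrow> ('b \<Rightarrow> complex) \<Rightarrow> complex" where
  "signed_integral M \<nu> u =
     (LINT z|positive_variation M \<nu>. u z) - (LINT z|positive_variation M (\<lambda>A. - \<nu> A). u z)"

definition complex_measure_integral ::
    "'b measure \<Rightarrow> ('b set \<Rightarrow> complex) \<Rightarrow> ('b \<Rightarrow> complex) \<Rightarrow> complex" where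
  "complex_measure_integral M \<mu> u =
     signed_integral M (\<lambda>A. Re (\<mu> A)) u + \<i> * signed_integral M (\<lambda>A. Im (\<mu> A)) u"

definition torus_borel :: "(complex^'n) measure" where
  "torus_borel = restrict_space borel torus"

definition torus_measures :: "((complex^'n) set \<Rightarrow> complex) set" where
  "torus_measures = {\<mu>. complex_measure torus_borel \<mu> \<and>
     (\<forall>A\<in>sets torus_borel. \<forall>e>0. \<exists>K U. compact K \<and> open U \<and> K \<subseteq> A \<and> A \<subseteq> U \<and>
        total_variation torus_borel \<mu> (U \<inter> torus - K) < e)}"

definition representing_measure :: "complex^'n \<Rightarrow> (complex^'n) measure \<Rightarrow> bool" where
  "representing_measure z \<mu> \<longleftrightarrow> prob_space \<mu> \<and> sets \<mu> = sets torus_borel \<and>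
     (\<forall>u\<in>polydisc_algebra. u z = (LINT w|\<mu>. u w))"

definition M\<^sub>0 :: "((complex^'n) set \<Rightarrow> complex) set" where
  "M\<^sub>0 = {\<eta> \<in> torus_measures. \<exists>\<mu>. representing_measure 0 \<mu> \<and> (\<forall>A\<in>null_sets \<mu>. \<eta> A = 0)}"


section \<open>Absolutely continuous tuples and Apostol's condition\<close>

text \<open>A family of elementary measures is only constrained at functionals in \<^const>\<open>complex_dual\<close>.\<close>

definition elementary_measures ::
    "('n::finite \<Rightarrow> 'a::complex_normed_vector \<Rightarrow>\<^sub>L 'a) \<Rightarrow>
     ('a \<Rightarrow> ('a \<Rightarrow>\<^sub>L complex) \<Rightarrow> (complex^'n) set \<Rightarrow> complex) \<Rightarrow> bool" where
  "elementary_measures T \<mu> \<longleftrightarrow> (\<forall>x. \<forall>y\<in>complex_dual. \<mu> x y \<in> torus_measures \<and>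
     (\<forall>u\<in>polydisc_algebra. blinfun_apply y (blinfun_apply (natural_rep T u) x) =
        complex_measure_integral torus_borel (\<mu> x y) u))"

definition absolutely_continuous_tuple ::
    "('n::finite \<Rightarrow> 'a::complex_normed_vector \<Rightarrow>\<^sub>L 'a) \<Rightarrow> bool" where
  "absolutely_continuous_tuple T \<longleftrightarrow>
     (\<exists>\<mu>. elementary_measures T \<mu> \<and> (\<forall>x. \<forall>y\<in>complex_dual. \<mu> x y \<in> M\<^sub>0))"

definition apostol_condition ::
    "('n::finite \<Rightarrow> 'a::complex_normed_vector \<Rightarrow>\<^sub>L 'a) \<Rightarrow> bool" where
  "apostol_condition T \<longleftrightarrow> (\<forall>x. \<forall>y\<in>complex_dual. \<forall>j.
     (\<lambda>m. SUP p\<in>{p. sup_norm (eval_poly p) \<le> 1}.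
        cmod (blinfun_apply y (blinfun_apply (op_poly T p) (blinfun_apply (op_power (T j) m) x))))
     \<longlonglongrightarrow> 0)"

end

theory Submission
  imports Defs "HOL-Complex_Analysis.Complex_Analysis" "HOL-Real_Asymp.Real_Asymp"
begin

text \<open>Suppose that an elementary measure has a density \<open>h\<close> with respect to a measure \<open>\<nu>\<close> representing
  \<open>0\<close>. If \<open>h\<close> paired with the products of \<open>z\<^sub>j\<^sup>m\<close> and polynomials bounded by \<open>1\<close> did not tend to \<open>0\<close>,
  one could select arbitrarily long almost orthogonal families of such products that all correlate
  with \<open>h\<close>; this contradicts the Cauchy-Schwarz inequality.

  Conversely, Apostol's condition is a property of the functional \<open>\<phi> u = \<langle>\<Phi> u x, y\<rangle>\<close>. A Hahn-Banach
  argument for cones and Riesz representation yield \<open>\<phi> u = \<integral> \<kappa> u d\<theta>\<close> with a finite measure \<open>\<theta>\<close>. Let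
  \<open>F\<close> be a Borel set of maximal \<open>\<theta>\<close>-mass on which \<open>\<theta>\<close> is absolutely continuous with respect to a
  measure \<open>\<nu>\<close> representing \<open>0\<close>. By maximality, \<open>\<theta>\<close> is singular to all representing measures off
  \<open>F\<close>, and duality gives functions \<open>G\<^sub>k = exp (- s\<^sub>k u\<^sub>k)\<close> of the polydisc algebra, bounded by \<open>1\<close> on the torus,
  with \<open>G\<^sub>k 0 \<longlonglongrightarrow> 1\<close> and \<open>G\<^sub>k \<longlonglongrightarrow> 1\<^sub>F\<close> in \<open>L\<^sup>1(\<theta>)\<close>. Apostol's condition forces
  \<open>\<phi> ((1 - G\<^sub>k) u) \<longlonglongrightarrow> 0\<close>, so that \<open>\<phi> u = \<integral>\<^sub>F \<kappa> u d\<theta>\<close>.\<close>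

section \<open>Measures from convex cones\<close>

text \<open>With several variables the measures representing 0 are far from unique, and no single
  finite measure dominates them: for two variables, normalised arc length on each curve
  \<open>z_2 = c z_1\<close> with \<open>c\<close> unimodular represents 0, and distinct curves give
  mutually singular measures. Nor are monomials orthogonal for them; on such a curve
  \<open>z_1\<close> and \<open>z_2\<close> are proportional. The only identity at hand is that an
  element of the algebra integrates to its value at 0. Hence almost orthogonality comes from an
  induction on the number of variables that cancels conjugate coordinates one at a time, and
  \<open>F\<close> comes from a maximality argument and not from one Lebesgue decomposition.

  In the converse \<open>1 - G\<^sub>k\<close> is not uniformly small, so continuity of
  \<open>\<phi>\<close> alone gives nothing. Its Taylor coefficients are small, which settles
  finitely many terms of low degree; the others are multiples of high powers of coordinates, where
  Apostol's condition applies. The exponential turns a real part that is large off \<open>F\<close>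
  and tiny at 0 into a modulus near 0 off \<open>F\<close> and near 1 at 0.\<close>

lemma cone_linear_functional:
  fixes X :: "('b \<Rightarrow> real) set" and C :: "(('b \<Rightarrow> real) \<times> real) set"
  assumes X_scale: "\<And>f t. f \<in> X \<Longrightarrow> (\<lambda>x. t * f x) \<in> X"
    and C_X: "\<And>f c. (f, c) \<in> C \<Longrightarrow> f \<in> X"
    and X_add: "\<And>f g. f \<in> X \<Longrightarrow> g \<in> X \<Longrightarrow> (\<lambda>x. f x + g x) \<in> X"
    and C_zero: "((\<lambda>_. 0), 0) \<in> C"
    and C_add: "\<And>f g c d. (f, c) \<in> C \<Longrightarrow> (g, d) \<in> C \<Longrightarrow> ((\<lambda>x. f x + g x), c + d) \<in> C"
    and C_scale: "\<And>f c t. (f, c) \<in> C \<Longrightarrow> 0 < t \<Longrightarrow> ((\<lambda>x. t * f x), t * c) \<in> C"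
    and C_onto: "\<And>f. f \<in> X \<Longrightarrow> \<exists>c. (f, c) \<in> C"
    and C_nonneg: "\<And>c. ((\<lambda>_. 0), c) \<in> C \<Longrightarrow> 0 \<le> c"
  obtains \<psi> where "\<And>f g. f \<in> X \<Longrightarrow> g \<in> X \<Longrightarrow> \<psi> (\<lambda>x. f x + g x) = \<psi> f + \<psi> g"
    and "\<And>f t. f \<in> X \<Longrightarrow> \<psi> (\<lambda>x. t * f x) = t * \<psi> f"
    and "\<And>f c. (f, c) \<in> C \<Longrightarrow> \<psi> f \<le> c"
proof -
  \<comment> \<open>A pair \<open>(f, c)\<close> is read as the demand that the functional be at
    most \<open>c\<close> at \<open>f\<close>. \<open>Z\<close> collects the cones of demands that
    extend \<open>C\<close> and stay consistent, that is, never demand a negative value at the zero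
    function. Zorn's lemma is applied to these sets of demands and not to partial
    functionals.\<close>
  define Z where "Z = {D. C \<subseteq> D \<and> (\<forall>f c. (f, c) \<in> D \<longrightarrow> f \<in> X) \<and>
     (\<forall>f g c d. (f, c) \<in> D \<longrightarrow> (g, d) \<in> D \<longrightarrow> ((\<lambda>x. f x + g x), c + d) \<in> D) \<and>
     (\<forall>f c t. (f, c) \<in> D \<longrightarrow> 0 < t \<longrightarrow> ((\<lambda>x. t * f x), t * c) \<in> D) \<and>
     (\<forall>c. ((\<lambda>_. 0), c) \<in> D \<longrightarrow> 0 \<le> c)}"
  have "C \<in> Z"
    unfolding Z_def using C_X C_add C_scale C_nonneg by auto
  have "\<exists>D\<in>Z. \<forall>E\<in>Z. D \<subseteq> E \<longrightarrow> E = D"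
  proof (rule subset_Zorn_nonempty)
    show "Z \<noteq> {}" using \<open>C \<in> Z\<close> by auto
  next
    fix Y assume Y: "Y \<noteq> {}" "subset.chain Z Y"
    have Y1: "D \<in> Z" if "D \<in> Y" for D
      using Y that by (auto simp: subset.chain_def)
    have Y2: "D \<subseteq> E \<or> E \<subseteq> D" if "D \<in> Y" "E \<in> Y" for D E
      using Y that by (auto simp: subset.chain_def)
    have Y3: "C \<subseteq> D" "\<And>f c. (f, c) \<in> D \<Longrightarrow> f \<in> X"
      "\<And>f g c d. (f, c) \<in> D \<Longrightarrow> (g, d) \<in> D \<Longrightarrow> ((\<lambda>x. f x + g x), c + d) \<in> D"
      "\<And>f c t. (f, c) \<in> D \<Longrightarrow> 0 < t \<Longrightarrow> ((\<lambda>x. t * f x), t * c) \<in> D"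
      "\<And>c. ((\<lambda>_. 0), c) \<in> D \<Longrightarrow> 0 \<le> c" if "D \<in> Y" for D
      using Y1[OF that] unfolding Z_def by blast+
    show "\<Union>Y \<in> Z"
      unfolding Z_def
    proof (intro CollectI conjI allI impI)
      show "C \<subseteq> \<Union>Y" using Y(1) Y3(1) by blast
    next
      fix f c assume "(f, c) \<in> \<Union>Y"
      then show "f \<in> X" using Y3(2) by blast
    next
      fix f g c d assume "(f, c) \<in> \<Union>Y" "(g, d) \<in> \<Union>Y"
      then obtain D E where DE: "D \<in> Y" "E \<in> Y" "(f, c) \<in> D" "(g, d) \<in> E" by auto
      then obtain F where "F \<in> Y" "(f, c) \<in> F" "(g, d) \<in> F"
        using Y2[of D E] by auto
      then show "((\<lambda>x. f x + g x), c + d) \<in> \<Union>Y"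
        using Y3(3) by blast
    next
      fix f c and t :: real assume "(f, c) \<in> \<Union>Y" "0 < t"
      then show "((\<lambda>x. t * f x), t * c) \<in> \<Union>Y"
        using Y3(4) by blast
    next
      fix c assume "((\<lambda>_. 0), c) \<in> \<Union>Y"
      then show "0 \<le> c" using Y3(5) by blast
    qed
  qed
  then obtain D where D: "D \<in> Z" and max: "\<And>E. E \<in> Z \<Longrightarrow> D \<subseteq> E \<Longrightarrow> E = D" by blast
  have D_C: "C \<subseteq> D" and D_X: "\<And>f c. (f, c) \<in> D \<Longrightarrow> f \<in> X"
    and D_add: "\<And>f g c d. (f, c) \<in> D \<Longrightarrow> (g, d) \<in> D \<Longrightarrow> ((\<lambda>x. f x + g x), c + d) \<in> D"
    and D_scale: "\<And>f c t. (f, c) \<in> D \<Longrightarrow> 0 < t \<Longrightarrow> ((\<lambda>x. t * f x), t * c) \<in> D"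
    and D_nonneg: "\<And>c. ((\<lambda>_. 0), c) \<in> D \<Longrightarrow> 0 \<le> c"
    using D unfolding Z_def by blast+
  have X_neg: "(\<lambda>x. - f x) \<in> X" if "f \<in> X" for f
    using X_scale[OF that, of "-1"] by simp
  \<comment> \<open>The sharpest demand at \<open>f\<close>. It is finite: \<open>C_onto\<close>
    makes the set nonempty, and adding a demand at \<open>- f\<close> to a demand at
    \<open>f\<close> bounds it below by consistency.\<close>
  define p where "p f = Inf {c. (f, c) \<in> D}" for f
  have ne: "{c. (f, c) \<in> D} \<noteq> {}" if "f \<in> X" for f
    using C_onto[OF that] D_C by auto
  have bdd: "bdd_below {c. (f, c) \<in> D}" if f: "f \<in> X" for f
  proof -
    obtain d where d: "((\<lambda>x. - f x), d) \<in> D" using ne[OF X_neg[OF f]] by auto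
    have "- d \<le> c" if "(f, c) \<in> D" for c
      using D_nonneg[of "c + d"] D_add[OF that d] by simp
    then show ?thesis by (intro bdd_belowI[of _ "- d"]) auto
  qed
  have p_le: "p f \<le> c" if "(f, c) \<in> D" for f c
    unfolding p_def using that bdd[OF D_X[OF that]] by (intro cInf_lower) auto
  \<comment> \<open>The demand of at least \<open>p f\<close> at \<open>f\<close> keeps the cone
    consistent because \<open>p f\<close> is an infimum, so a maximal cone contains it already.
    Applied to \<open>f\<close> and to \<open>- f\<close>, this turns inequalities into
    equalities.\<close>
  have neg_mem: "((\<lambda>x. - f x), - p f) \<in> D" if f: "f \<in> X" for f
  proof -
    define E where "E = {((\<lambda>x. g x + t * - f x), c - t * p f) | g c t. (g, c) \<in> D \<and> 0 \<le> t}"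
    have E_I: "((\<lambda>x. g x + t * - f x), c - t * p f) \<in> E" if "(g, c) \<in> D" "0 \<le> t" for g c t
      unfolding E_def using that by blast
    have "E \<in> Z"
      unfolding Z_def
    proof (intro CollectI conjI allI impI)
      show "C \<subseteq> E" 
      proof (clarsimp)
        fix g c assume "(g, c) \<in> C"
        then show "(g, c) \<in> E" using E_I[of g c 0] D_C by auto
      qed
    next
      fix g c assume "(g, c) \<in> E"
      then obtain g' c' t where *: "g = (\<lambda>x. g' x + t * - f x)" "(g', c') \<in> D"
        unfolding E_def by blast
      show "g \<in> X"
        unfolding *(1) using D_X[OF *(2)] X_scale[OF X_neg[OF f]] by (rule X_add)
    next
      fix g h c d assume "(g, c) \<in> E" "(h, d) \<in> E"
      then obtain g' c' t h' d' s where *: "g = (\<lambda>x. g' x + t * - f x)" "c = c' - t * p f"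
        "h = (\<lambda>x. h' x + s * - f x)" "d = d' - s * p f" "(g', c') \<in> D" "(h', d') \<in> D"
        "0 \<le> t" "0 \<le> s" unfolding E_def by blast
      show "((\<lambda>x. g x + h x), c + d) \<in> E"
        using E_I[OF D_add[OF *(5,6)], of "t + s"] *(7,8) by (simp add: *(1-4) algebra_simps)
    next
      fix g c and s :: real assume "(g, c) \<in> E" "0 < s"
      then obtain g' c' t where *: "g = (\<lambda>x. g' x + t * - f x)" "c = c' - t * p f"
        "(g', c') \<in> D" "0 \<le> t" unfolding E_def by blast
      show "((\<lambda>x. s * g x), s * c) \<in> E"
        using E_I[OF D_scale[OF *(3) \<open>0 < s\<close>], of "s * t"] *(4) \<open>0 < s\<close>
          by (simp add: *(1,2) algebra_simps)
    next
      fix c assume "((\<lambda>_. 0), c) \<in> E"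
      then obtain g' c' t where *: "(\<lambda>_. 0) = (\<lambda>x. g' x + t * - f x)" "c = c' - t * p f"
        "(g', c') \<in> D" "0 \<le> t" unfolding E_def by blast
      have g': "g' = (\<lambda>x. t * f x)"
      proof
        fix x
        show "g' x = t * f x" using fun_cong[OF *(1), of x] by simp
      qed
      show "0 \<le> c"
      proof (cases "t = 0")
        case True
        then show ?thesis using D_nonneg *(2,3) g' by simp
      next
        case False
        then have t: "t > 0" using *(4) by simp
        have "(f, c' / t) \<in> D"
          using D_scale[OF *(3), of "1 / t"] t by (simp add: g')
        then have "p f \<le> c' / t" by (rule p_le)
        then show ?thesis using t *(2) by (simp add: field_simps)
      qed
    qed
    moreover have "D \<subseteq> E"
    proof (clarsimp)
      fix g c assume "(g, c) \<in> D"
      then show "(g, c) \<in> E" using E_I[of g c 0] by auto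
    qed
    ultimately have "E = D" by (rule max)
    have "((\<lambda>_. 0), 0) \<in> D" using C_zero D_C by auto
    from E_I[OF this, of 1] show ?thesis using \<open>E = D\<close> by simp
  qed
  \<comment> \<open>Demands with opposite bounds at \<open>f\<close> and \<open>- f\<close> pin the
    value; additivity and homogeneity below are both read off from such pairs.\<close>
  have uniq: "p f = a" if "(f, a) \<in> D" "((\<lambda>x. - f x), - a) \<in> D" for f a
  proof (rule antisym)
    show "p f \<le> a" using p_le that by blast
    have fX: "f \<in> X" using D_X that by blast
    have "- a + c \<ge> 0" if "(f, c) \<in> D" for c
      using D_nonneg[of "- a + c"] D_add[OF \<open>((\<lambda>x. - f x), - a) \<in> D\<close> that] by simp
    then show "a \<le> p f"
      unfolding p_def using ne[OF fX] by (intro cInf_greatest) force+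
  qed
  have mem: "(f, p f) \<in> D" if f: "f \<in> X" for f
  proof -
    have 1: "(f, - p (\<lambda>x. - f x)) \<in> D" using neg_mem[OF X_neg[OF f]] by simp
    have "- p (\<lambda>x. - f x) \<le> p f" 
    proof -
      have "0 \<le> c + p (\<lambda>x. - f x)" if "(f, c) \<in> D" for c
      proof -
        have "0 \<le> c + d" if "((\<lambda>x. - f x), d) \<in> D" for d
          using D_nonneg[of "c + d"] D_add[OF \<open>(f, c) \<in> D\<close> that] by simp
        then have "- c \<le> p (\<lambda>x. - f x)"
          unfolding p_def using ne[OF X_neg[OF f]] by (intro cInf_greatest) force+
        then show ?thesis by simp
      qed
      then show ?thesis unfolding p_def[of f] using ne[OF f] by (intro cInf_greatest) force+
    qed
    moreover have "p f \<le> - p (\<lambda>x. - f x)" using p_le[OF 1] .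
    ultimately show ?thesis using 1 by simp
  qed
  show ?thesis
  proof (rule that[of p])
    fix f g assume "f \<in> X" "g \<in> X"
    then show "p (\<lambda>x. f x + g x) = p f + p g"
      using D_add[OF mem mem] D_add[OF neg_mem neg_mem] by (intro uniq) auto
  next
    fix f and t :: real assume f: "f \<in> X"
    consider "t > 0" | "t = 0" | "t < 0" by linarith
    then show "p (\<lambda>x. t * f x) = t * p f"
    proof cases
      case 1
      then show ?thesis
        using D_scale[OF mem[OF f], of t] D_scale[OF neg_mem[OF f], of t] by (intro uniq) auto
    next
      case 2
      then show ?thesis using C_zero D_C by (intro uniq) auto
    next
      case 3
      then show ?thesis
        using D_scale[OF mem[OF f], of "-t"] D_scale[OF neg_mem[OF f], of "-t"] by (intro uniq) auto
    qed
  next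
    fix f c assume "(f, c) \<in> C"
    then show "p f \<le> c" using p_le D_C by blast
  qed
qed

text \<open>The measure comes from Caratheodory's construction: an open set receives the supremum of
  \<open>\<psi>\<close> over functions between 0 and 1 that vanish on the rest of \<open>K\<close>,
  an arbitrary set the infimum over its open supersets. The functional takes functions on the whole
  type that are continuous on \<open>K\<close>; by positivity it ignores their values off
  \<open>K\<close>.\<close>

lemma riesz_compact:
  fixes K :: "'b::metric_space set" and \<psi> :: "('b \<Rightarrow> real) \<Rightarrow> real"
  assumes K: "compact K"
    and add: "\<And>f g. continuous_on K f \<Longrightarrow> continuous_on K g \<Longrightarrow> \<psi> (\<lambda>x. f x + g x) = \<psi> f + \<psi> g"
    and scale: "\<And>f t. continuous_on K f \<Longrightarrow> \<psi> (\<lambda>x. t * f x) = t * \<psi> f"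
    and pos: "\<And>f. continuous_on K f \<Longrightarrow> (\<And>x. x \<in> K \<Longrightarrow> 0 \<le> f x) \<Longrightarrow> 0 \<le> \<psi> f"
  obtains M where "sets M = sets (restrict_space borel K)" "finite_measure M"
    "\<And>f. continuous_on K f \<Longrightarrow> integral\<^sup>L M f = \<psi> f"
proof -
  have diff: "\<psi> (\<lambda>x. f x - g x) = \<psi> f - \<psi> g" if "continuous_on K f" "continuous_on K g" for f g
    using add[of f "\<lambda>x. -1 * g x"] scale[of g "-1"] that by (auto intro!: continuous_intros)
  have mono: "\<psi> f \<le> \<psi> g"
    if "continuous_on K f" "continuous_on K g" "\<And>x. x \<in> K \<Longrightarrow> f x \<le> g x" for f g
    using pos[of "\<lambda>x. g x - f x"] diff[of g f] that by (auto intro!: continuous_intros)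
  have zero: "\<psi> (\<lambda>_. 0) = 0"
    using scale[of "\<lambda>_. 0" 0] by simp
  define c1 where "c1 = \<psi> (\<lambda>_. 1)"
  have c1: "0 \<le> c1" unfolding c1_def by (rule pos) auto
  have const: "\<psi> (\<lambda>_. t) = t * c1" for t
    using scale[of "\<lambda>_. 1" t] by (simp add: c1_def)
  have sum: "\<psi> (\<lambda>x. \<Sum>i\<in>I. g i x) = (\<Sum>i\<in>I. \<psi> (g i))"
    if "finite I" "\<And>i. i \<in> I \<Longrightarrow> continuous_on K (g i)" for I :: "'i set" and g
    using that
  proof (induction I rule: finite_induct)
    case empty
    then show ?case by (simp add: zero)
  next
    case (insert i I)
    then show ?case
      using add[of "g i" "\<lambda>x. \<Sum>i\<in>I. g i x"] by (simp add: continuous_on_sum)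
  qed
  \<comment> \<open>Functions need only vanish on \<open>K\<close> outside \<open>U\<close>, instead
    of having compact support inside \<open>U\<close>. Compactness is regained by passing to the
    positive part of \<open>f - \<delta>\<close>, at a cost of at most
    \<open>\<delta> * c1\<close>.\<close>
  define adm where "adm U = {f :: 'b \<Rightarrow> real. continuous_on K f \<and> (\<forall>x\<in>K. 0 \<le> f x \<and> f x \<le> 1) \<and>
    (\<forall>x\<in>K. x \<notin> U \<longrightarrow> f x = 0)}"
    for U :: "'b set"
  define \<rho> where "\<rho> U = (SUP f\<in>adm U. ennreal (\<psi> f))" for U
  have adm0: "(\<lambda>_. 0) \<in> adm U" for U by (simp add: adm_def)
  have adm_le: "ennreal (\<psi> f) \<le> \<rho> U" if "f \<in> adm U" for f U
    unfolding \<rho>_def using that by (rule SUP_upper)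
  have rho_mono: "\<rho> U \<le> \<rho> V" if "U \<subseteq> V" for U V
    unfolding \<rho>_def using that by (intro SUP_subset_mono) (auto simp: adm_def)
  have rho_c1: "\<rho> U \<le> ennreal c1" for U
    unfolding \<rho>_def c1_def by (intro SUP_least ennreal_leI mono) (auto simp: adm_def)
  have cut: "\<psi> f - \<delta> * c1 \<le> \<psi> (\<lambda>x. max (f x - \<delta>) 0)" if "continuous_on K f" for f \<delta>
  proof -
    have "\<psi> (\<lambda>x. f x - \<delta>) \<le> \<psi> (\<lambda>x. max (f x - \<delta>) 0)"
      using that by (intro mono continuous_intros) auto
    then show ?thesis using diff[of f "\<lambda>_. \<delta>"] const[of \<delta>] that by auto
  qed
  have super_compact: "compact {x\<in>K. \<delta> \<le> f x}" "compact {x\<in>K. f x \<le> \<delta>}"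
    if "continuous_on K f" for f and \<delta> :: real
  proof -
    have "closedin (top_of_set K) {x\<in>K. \<delta> \<le> f x}" "closedin (top_of_set K) {x\<in>K. f x \<le> \<delta>}"
      using continuous_closedin_preimage[OF that, of "{\<delta>..}"]
        continuous_closedin_preimage[OF that, of "{..\<delta>}"]
      by (auto simp: vimage_def Int_def conj_commute)
    then show "compact {x\<in>K. \<delta> \<le> f x}" "compact {x\<in>K. f x \<le> \<delta>}"
      using closedin_compact[OF K] by auto
  qed
  have rho_UN: "\<rho> (\<Union>i. U i) \<le> (suminf (\<lambda>i. \<rho> (U i)))" if U: "\<And>i. open (U i)" for U :: "nat \<Rightarrow> 'b set"
    unfolding \<rho>_def[of "\<Union>i. U i"]
  proof (rule SUP_least, rule ennreal_le_epsilon)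
    fix f :: "'b \<Rightarrow> real" and e :: real
    assume f: "f \<in> adm (\<Union>i. U i)" and e: "0 < e"
    \<comment> \<open>The summand \<open>1\<close> covers a functional with
      \<open>c1 = 0\<close>.\<close>
    define \<delta> where "\<delta> = e / (c1 + 1)"
    have \<delta>: "\<delta> > 0" "\<delta> * c1 \<le> e" using e c1 by (auto simp: \<delta>_def field_simps)
    define L where "L = {x\<in>K. \<delta> \<le> f x}"
    have fc: "continuous_on K f" using f by (simp add: adm_def)
    have "compact L" unfolding L_def using super_compact fc by blast
    moreover have "L \<subseteq> (\<Union>i\<in>UNIV. U i)"
      using f \<delta> by (auto simp: L_def adm_def)
    ultimately obtain I where I: "finite I" "L \<subseteq> (\<Union>i\<in>I. U i)"
      using U compactE_image[of L UNIV U] by auto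
    \<comment> \<open>The distance to the empty set is \<open>0\<close> by convention, hence the
      separate value for \<open>U i = UNIV\<close>.\<close>
    define d where "d i x = (if U i = UNIV then 1 else infdist x (- U i))" for i x
    have d_cont: "continuous_on S (d i)" for i S
    proof (cases "U i = UNIV")
      case True then show ?thesis by (simp add: d_def[abs_def])
    next
      case False then show ?thesis 
        by (simp add: d_def[abs_def] continuous_on_infdist continuous_on_id)
    qed
    have d_pos: "0 < d i x" if "x \<in> U i" for i x
    proof (cases "U i = UNIV")
      case False
      have "infdist x (- U i) \<noteq> 0"
        using in_closed_iff_infdist_zero[of "- U i" x] False U[of i] that by (auto simp: closed_Compl)
      then show ?thesis using infdist_nonneg[of x "- U i"] False by (simp add: d_def)
    qed (simp add: d_def)
    have d_zero: "d i x = 0" if "x \<notin> U i" for i x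
      using that by (auto simp: d_def intro: infdist_zero)
    have d_nonneg: "0 \<le> d i x" for i x
      using d_pos[of x i] d_zero[of x i] by (cases "x \<in> U i") auto
    obtain \<eta> where \<eta>: "\<eta> > 0" "\<And>x. x \<in> L \<Longrightarrow> \<eta> \<le> (\<Sum>i\<in>I. d i x)"
    proof (cases "L = {}")
      case True
      then show ?thesis using that[of 1] by auto
    next
      case False
      have "continuous_on L (\<lambda>x. \<Sum>i\<in>I. d i x)" by (intro continuous_on_sum d_cont)
      then obtain y where y: "y \<in> L" "\<And>x. x \<in> L \<Longrightarrow> (\<Sum>i\<in>I. d i y) \<le> (\<Sum>i\<in>I. d i x)"
        using continuous_attains_inf[OF \<open>compact L\<close> False, of "\<lambda>x. \<Sum>i\<in>I. d i x"] by auto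
      obtain i where "i \<in> I" "y \<in> U i" using I y by auto
      then have "0 < (\<Sum>i\<in>I. d i y)" using I(1) d_nonneg d_pos by (intro sum_pos2[of I i]) auto
      then show ?thesis using that y by blast
    qed
    \<comment> \<open>On \<open>L\<close> the functions \<open>g i\<close> only have to add up to at
      least \<open>1\<close>. Dividing by the positive lower bound \<open>\<eta>\<close> of the
      summed distances achieves this, and the cap at \<open>1\<close> keeps each of them
      admissible.\<close>
    define g where "g i x = min 1 (d i x / \<eta>)" for i x
    have g_adm: "g i \<in> adm (U i)" for i
      unfolding adm_def g_def using \<eta>(1) d_zero d_nonneg
      by (auto intro!: continuous_intros d_cont)
    have g_nonneg: "0 \<le> g i x" for i x unfolding g_def using d_nonneg \<eta>(1) by simp
    have g_L: "1 \<le> (\<Sum>i\<in>I. g i x)" if x: "x \<in> L" for x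
    proof (cases "\<exists>i\<in>I. g i x = 1")
      case True
      then obtain i where i: "i \<in> I" "g i x = 1" by auto
      have "g i x \<le> (\<Sum>i\<in>I. g i x)" using i g_nonneg I(1) by (intro member_le_sum) auto
      then show ?thesis using i by simp
    next
      case False
      then have "g i x = d i x / \<eta>" if "i \<in> I" for i using that unfolding g_def by (auto simp: min_def)
      then have "(\<Sum>i\<in>I. g i x) = (\<Sum>i\<in>I. d i x) / \<eta>" by (simp add: sum_divide_distrib)
      then show ?thesis using \<eta>(1) \<eta>(2)[OF x] by simp
    qed
    have "\<psi> f - \<delta> * c1 \<le> \<psi> (\<lambda>x. max (f x - \<delta>) 0)" by (rule cut[OF fc])
    also have "\<dots> \<le> \<psi> (\<lambda>x. \<Sum>i\<in>I. g i x)"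
    proof (rule mono)
      show "continuous_on K (\<lambda>x. max (f x - \<delta>) 0)" using fc by (intro continuous_intros)
      show "continuous_on K (\<lambda>x. \<Sum>i\<in>I. g i x)"
        using g_adm by (intro continuous_on_sum) (auto simp: adm_def)
      fix x assume x: "x \<in> K"
      show "max (f x - \<delta>) 0 \<le> (\<Sum>i\<in>I. g i x)"
      proof (cases "x \<in> L")
        case True
        have "f x \<le> 1" using f x by (auto simp: adm_def)
        then show ?thesis using g_L[OF True] \<delta> by auto
      next
        case False
        then show ?thesis using x sum_nonneg[of I "\<lambda>i. g i x"] g_nonneg by (auto simp: L_def max_def)
      qed
    qed
    also have "\<dots> = (\<Sum>i\<in>I. \<psi> (g i))"
      using g_adm by (intro sum[OF I(1)]) (auto simp: adm_def)
    finally have "\<psi> f \<le> (\<Sum>i\<in>I. \<psi> (g i)) + e" using \<delta> by linarith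
    have g_pos: "0 \<le> \<psi> (g i)" for i using g_adm[of i] by (intro pos) (auto simp: adm_def)
    have "ennreal (\<psi> f) \<le> ennreal ((\<Sum>i\<in>I. \<psi> (g i)) + e)" by (rule ennreal_leI) fact
    also have "\<dots> = (\<Sum>i\<in>I. ennreal (\<psi> (g i))) + ennreal e"
      using g_pos e by (subst ennreal_plus) (auto simp: sum_nonneg sum_ennreal)
    also have "(\<Sum>i\<in>I. ennreal (\<psi> (g i))) \<le> (\<Sum>i\<in>I. \<rho> (U i))"
      by (intro sum_mono adm_le g_adm)
    also have "\<dots> \<le> (suminf (\<lambda>i. \<rho> (U i)))" by (rule sum_le_suminf) (auto simp: I)
    finally show "ennreal (\<psi> f) \<le> (suminf (\<lambda>i. \<rho> (U i))) + ennreal e" by (simp add: add_mono)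
  qed
  define \<mu> where "\<mu> A = (INF U\<in>{U. open U \<and> A \<subseteq> U}. \<rho> U)" for A
  have mu_le: "\<mu> A \<le> \<rho> U" if "open U" "A \<subseteq> U" for A U
    unfolding \<mu>_def using that by (intro INF_lower) auto
  have mu_open: "\<mu> U = \<rho> U" if "open U" for U
  proof (rule antisym)
    show "\<mu> U \<le> \<rho> U" using mu_le[OF that] by simp
    show "\<rho> U \<le> \<mu> U" unfolding \<mu>_def by (intro INF_greatest rho_mono) auto
  qed
  have mu_c1: "\<mu> A \<le> ennreal c1" for A
    using mu_le[of UNIV A] rho_c1[of UNIV] by (auto intro: order.trans)
  have mu_fin: "\<mu> A < \<infinity>" for A
    using mu_c1[of A] by (simp add: le_less_trans)
  have rho_empty: "\<rho> U = 0" if "U \<inter> K = {}" for U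
  proof -
    have "ennreal (\<psi> f) \<le> 0" if "f \<in> adm U" for f
    proof -
      have "\<psi> f \<le> \<psi> (\<lambda>_. 0)" using that \<open>U \<inter> K = {}\<close> by (intro mono) (auto simp: adm_def)
      then show ?thesis by (simp add: zero ennreal_neg)
    qed
    then have "\<rho> U \<le> 0" unfolding \<rho>_def by (intro SUP_least) auto
    then show ?thesis by simp
  qed
  have mu_mono: "\<mu> A \<le> \<mu> B" if "A \<subseteq> B" for A B
    unfolding \<mu>_def using that by (intro INF_superset_mono) auto
  have mu_UN: "\<mu> (\<Union>i. A i) \<le> (suminf (\<lambda>i. \<mu> (A i)))" for A :: "nat \<Rightarrow> 'b set"
  proof (rule ennreal_le_epsilon)
    fix e :: real assume e: "0 < e"
    have "\<exists>U. open U \<and> A i \<subseteq> U \<and> \<rho> U \<le> \<mu> (A i) + ennreal (e * (1/2) ^ Suc i)" for i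
    proof -
      have "\<mu> (A i) < \<mu> (A i) + ennreal (e * (1/2) ^ Suc i)"
        using mu_fin[of "A i"] e by (simp add: ennreal_add_left_cancel_less)
      then obtain U where "open U" "A i \<subseteq> U" "\<rho> U < \<mu> (A i) + ennreal (e * (1/2) ^ Suc i)"
        unfolding \<mu>_def[of "A i"] by (auto simp: INF_less_iff)
      then show ?thesis by (auto intro: less_imp_le)
    qed
    then obtain U where U: "\<And>i. open (U i)" "\<And>i. A i \<subseteq> U i"
      "\<And>i. \<rho> (U i) \<le> \<mu> (A i) + ennreal (e * (1/2) ^ Suc i)" by metis
    have "\<mu> (\<Union>i. A i) \<le> \<rho> (\<Union>i. U i)" using U by (intro mu_le) auto
    also have "\<dots> \<le> (suminf (\<lambda>i. \<rho> (U i)))" using U by (intro rho_UN)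
    also have "\<dots> \<le> (suminf (\<lambda>i. \<mu> (A i) + ennreal (e * (1/2) ^ Suc i)))" by (intro suminf_le U) auto
    also have "\<dots> = (suminf (\<lambda>i. \<mu> (A i))) + (suminf (\<lambda>i. ennreal (e * (1/2) ^ Suc i)))"
      by (intro suminf_add[symmetric]) auto
    also have "(suminf (\<lambda>i. ennreal (e * (1/2) ^ Suc i))) = ennreal (e * 1)"
      using e by (intro suminf_ennreal_eq sums_mult power_half_series) auto
    also have "\<dots> = ennreal e" by simp
    finally show "\<mu> (\<Union>i. A i) \<le> (suminf (\<lambda>i. \<mu> (A i))) + ennreal e" .
  qed
  have mu_empty: "\<mu> {} = 0" using mu_open[of "{}"] rho_empty[of "{}"] by simp
  have oms: "outer_measure_space (Pow UNIV) \<mu>"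
    unfolding outer_measure_space_def positive_def increasing_def countably_subadditive_def
    using mu_empty mu_mono mu_UN by auto
  have mu_Un: "\<mu> (A \<union> B) \<le> \<mu> A + \<mu> B" for A B
  proof -
    have "(\<Union>i::nat. if i = 0 then A else if i = 1 then B else {}) = A \<union> B"
      by (auto split: if_splits)
    moreover have "(suminf (\<lambda>i::nat. \<mu> (if i = 0 then A else if i = 1 then B else {}))) =
        (\<Sum>i\<in>{0, 1::nat}. \<mu> (if i = 0 then A else if i = 1 then B else {}))"
      by (intro suminf_finite) (auto simp: mu_empty)
    ultimately show ?thesis
      using mu_UN[of "\<lambda>i. if i = 0 then A else if i = 1 then B else {}"] by simp
  qed
  \<comment> \<open>Caratheodory's condition for an open \<open>U\<close>, tested on an open
    \<open>V\<close>. A function cut at height \<open>\<delta>\<close> and one vanishing off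
    \<open>W\<close>, where \<open>f < \<delta>\<close> on \<open>K\<close>, are never both nonzero,
    so their sum is still admissible for \<open>V\<close>.\<close>
  have split_open: "\<mu> (V \<inter> U) + \<mu> (V - U) \<le> \<rho> V" if U: "open U" and V: "open V" for U V
  proof -
    have 1: "\<mu> (V - U) + ennreal (\<psi> f) \<le> \<rho> V" if f: "f \<in> adm (V \<inter> U)" for f
    proof (rule ennreal_le_epsilon)
      fix e :: real assume e: "0 < e"
      define \<delta> where "\<delta> = e / (c1 + 1)"
      have \<delta>: "\<delta> > 0" "\<delta> * c1 \<le> e" using e c1 by (auto simp: \<delta>_def field_simps)
      have fc: "continuous_on K f" using f by (simp add: adm_def)
      define W where "W = V - {x\<in>K. \<delta> \<le> f x}"
      have "open W" unfolding W_def using V super_compact(1)[OF fc, of \<delta>] compact_imp_closed by blast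
      have "V - U \<subseteq> W" using f \<delta> by (auto simp: W_def adm_def)
      define f' where "f' x = max (f x - \<delta>) 0" for x
      have f'_c: "continuous_on K f'" unfolding f'_def using fc by (intro continuous_intros)
      have f'_pos: "0 \<le> \<psi> f'" using f'_c by (intro pos) (auto simp: f'_def)
      have 2: "ennreal (\<psi> f') + ennreal (\<psi> g) \<le> \<rho> V" if g: "g \<in> adm W" for g
      proof -
        have "(\<lambda>x. f' x + g x) \<in> adm V"
        proof -
          have "continuous_on K (\<lambda>x. f' x + g x)"
            using f'_c g by (intro continuous_intros) (auto simp: adm_def)
          moreover have "0 \<le> f' x + g x \<and> f' x + g x \<le> 1 \<and> (x \<notin> V \<longrightarrow> f' x + g x = 0)" 
            if x: "x \<in> K" for x
          proof -
            have gx: "0 \<le> g x" "g x \<le> 1" "x \<notin> W \<Longrightarrow> g x = 0" using g x by (auto simp: adm_def)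
            have fx: "f x \<le> 1" "x \<notin> V \<Longrightarrow> f x = 0" using f x by (auto simp: adm_def)
            show ?thesis using gx fx \<delta> x by (cases "\<delta> \<le> f x") (auto simp: f'_def W_def)
          qed
          ultimately show ?thesis by (auto simp: adm_def)
        qed
        then have "ennreal (\<psi> (\<lambda>x. f' x + g x)) \<le> \<rho> V" by (rule adm_le)
        moreover have "\<psi> (\<lambda>x. f' x + g x) = \<psi> f' + \<psi> g"
          using f'_c g by (intro add) (auto simp: adm_def)
        moreover have "0 \<le> \<psi> g" using g by (intro pos) (auto simp: adm_def)
        ultimately show ?thesis using f'_pos by (simp add: ennreal_plus)
      qed
      have 3: "ennreal (\<psi> f') + \<rho> W \<le> \<rho> V"
        unfolding \<rho>_def[of W] using adm0 2
        by (subst ennreal_SUP_add_right) (auto intro!: SUP_least)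
      have "\<psi> f \<le> \<psi> f' + e" using cut[OF fc, of \<delta>] \<delta> unfolding f'_def[abs_def] by linarith
      then have "ennreal (\<psi> f) \<le> ennreal (\<psi> f') + ennreal e"
        using f'_pos e by (simp add: ennreal_plus[symmetric] ennreal_leI del: ennreal_plus)
      moreover have "\<mu> (V - U) \<le> \<rho> W" by (rule mu_le) fact+
      ultimately have "\<mu> (V - U) + ennreal (\<psi> f) \<le> \<rho> W + (ennreal (\<psi> f') + ennreal e)"
        by (intro add_mono)
      also have "\<dots> = (ennreal (\<psi> f') + \<rho> W) + ennreal e" by (simp add: ac_simps)
      also have "\<dots> \<le> \<rho> V + ennreal e" using 3 by (rule add_right_mono)
      finally show "\<mu> (V - U) + ennreal (\<psi> f) \<le> \<rho> V + ennreal e" .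
    qed
    have "\<mu> (V - U) + \<rho> (V \<inter> U) \<le> \<rho> V"
      unfolding \<rho>_def[of "V \<inter> U"] using adm0 1
      by (subst ennreal_SUP_add_right) (auto intro!: SUP_least)
    then show ?thesis using mu_open[of "V \<inter> U"] U V by (simp add: open_Int add.commute)
  qed
  have open_L: "U \<in> lambda_system UNIV (Pow UNIV) \<mu>" if U: "open U" for U
    unfolding lambda_system_def
  proof (intro CollectI conjI ballI)
    fix A
    show "\<mu> (U \<inter> A) + \<mu> ((UNIV - U) \<inter> A) = \<mu> A"
    proof (rule antisym)
      show "\<mu> A \<le> \<mu> (U \<inter> A) + \<mu> ((UNIV - U) \<inter> A)"
        using mu_Un[of "U \<inter> A" "(UNIV - U) \<inter> A"] by (simp add: Int_Un_distrib2[symmetric])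
      show "\<mu> (U \<inter> A) + \<mu> ((UNIV - U) \<inter> A) \<le> \<mu> A"
        unfolding \<mu>_def[of A]
      proof (rule INF_greatest)
        fix V assume V: "V \<in> {V. open V \<and> A \<subseteq> V}"
        have "\<mu> (U \<inter> A) + \<mu> ((UNIV - U) \<inter> A) \<le> \<mu> (V \<inter> U) + \<mu> (V - U)"
          using V by (intro add_mono mu_mono) auto
        also have "\<dots> \<le> \<rho> V" using split_open U V by auto
        finally show "\<mu> (U \<inter> A) + \<mu> ((UNIV - U) \<inter> A) \<le> \<rho> V" .
      qed
    qed
  qed simp
  define L where "L = lambda_system UNIV (Pow UNIV) \<mu>"
  have open_L: "U \<in> L" if "open U" for U
    unfolding L_def using that by (rule open_L)
  interpret P: sigma_algebra "UNIV :: 'b set" "Pow UNIV" by (rule sigma_algebra_Pow)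
  have msL: "measure_space UNIV L \<mu>"
    unfolding L_def by (rule P.caratheodory_lemma[OF oms])
  then have saL: "sigma_algebra UNIV L" by (simp add: measure_space_def)
  have borel_L: "sets borel \<subseteq> L"
    unfolding borel_def using open_L
    by (subst sets_measure_of) (auto intro!: sigma_algebra.sigma_sets_subset[OF saL])
  define M0 where "M0 = measure_of UNIV (sets borel) \<mu>"
  have sets_M0: "sets M0 = sets borel" unfolding M0_def
    by (metis sets.sets_measure_of_eq space_borel)
  have space_M0: "space M0 = UNIV" using sets_eq_imp_space_eq[OF sets_M0] by simp
  have emeasure_M0: "emeasure M0 A = \<mu> A" if "A \<in> sets borel" for A
    unfolding M0_def
  proof (rule emeasure_measure_of_sigma)
    show "sigma_algebra (UNIV :: 'b set) (sets borel)"
      using sets.sigma_algebra_axioms[of "borel :: 'b measure"] by simp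
    show "positive (sets borel) \<mu>" by (simp add: positive_def mu_empty)
    show "countably_additive (sets borel) \<mu>"
      using msL borel_L unfolding measure_space_def countably_additive_def by (meson subset_iff subset_trans)
    show "A \<in> sets borel" by fact
  qed
  have Kb: "K \<in> sets borel" using K by (simp add: borel_closed compact_imp_closed)
  define M where "M = restrict_space M0 K"
  have sets_M: "sets M = sets (restrict_space borel K)"
    unfolding M_def by (simp add: sets_restrict_space sets_M0)
  have space_M: "space M = K" unfolding M_def by (simp add: space_restrict_space space_M0)
  have em: "emeasure M (U \<inter> K) = \<rho> U" if U: "open U" for U
  proof -
    have "emeasure M (U \<inter> K) = emeasure M0 (U \<inter> K)"
      unfolding M_def by (rule emeasure_restrict_space) (auto simp: space_M0 sets_M0 Kb)
    also have "\<dots> = \<mu> (U \<inter> K)" using U Kb by (intro emeasure_M0) auto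
    also have "\<dots> = \<rho> U"
    proof (rule antisym)
      show "\<mu> (U \<inter> K) \<le> \<rho> U" using mu_le[OF U] by auto
      have "\<mu> U \<le> \<mu> (U \<inter> K) + \<mu> (- K)"
        using mu_Un[of "U \<inter> K" "-K"] mu_mono[of U "U \<inter> K \<union> - K"] by (auto intro: order.trans)
      moreover have "\<mu> (- K) = 0"
        using mu_open[of "- K"] rho_empty[of "- K"] compact_imp_closed[OF K] by auto
      ultimately show "\<rho> U \<le> \<mu> (U \<inter> K)" using mu_open[OF U] by simp
    qed
    finally show ?thesis .
  qed
  have emK: "emeasure M K = ennreal c1"
  proof -
    have "(\<lambda>_. 1) \<in> adm UNIV" by (simp add: adm_def)
    then have "\<rho> UNIV = ennreal c1" using adm_le[of "\<lambda>_. 1" UNIV] rho_c1[of UNIV] by (simp add: c1_def)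
    then show ?thesis using em[of UNIV] by simp
  qed
  interpret M: finite_measure M by (rule finite_measureI) (simp add: space_M emK)
  have mK: "measure M K = c1" using emK c1 by (simp add: measure_def)
  have meas: "f \<in> borel_measurable M" if "continuous_on K f" for f :: "'b \<Rightarrow> real"
    using borel_measurable_continuous_on_restrict[OF that] measurable_cong_sets[OF sets_M refl] by blast
  have integ: "integrable M f" if fc: "continuous_on K f" for f :: "'b \<Rightarrow> real"
  proof -
    have "compact (f ` K)" using fc K by (rule compact_continuous_image)
    then obtain B where "\<And>x. x \<in> K \<Longrightarrow> norm (f x) \<le> B"
      by (meson bounded_iff compact_imp_bounded imageI)
    then show ?thesis by (intro M.integrable_const_bound[of _ B]) (auto simp: space_M meas fc)
  qed
  \<comment> \<open>Layer cake: \<open>f\<close> is cut into \<open>N\<close> horizontal slices of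
    height \<open>1 / N\<close>. A slice times \<open>N\<close> is admissible for the superlevel set
    \<open>U j\<close>, and the resulting step function exceeds \<open>f\<close> by at most
    \<open>1 / N\<close>.\<close>
  have le: "\<psi> f \<le> integral\<^sup>L M f" if fc: "continuous_on K f" and f01: "\<And>x. x \<in> K \<Longrightarrow> 0 \<le> f x \<and> f x \<le> 1" for f
  proof -
    have N: "\<psi> f \<le> integral\<^sup>L M f + c1 / real N" if N: "N > 0" for N :: nat
    proof -
      define fj where "fj j x = min (max (f x - real j / N) 0) (1 / N)" for j x
      define U where "U j = - {x\<in>K. f x \<le> real j / N}" for j :: nat
      have fjc: "continuous_on K (fj j)" for j unfolding fj_def using fc by (intro continuous_intros)
      have Uo: "open (U j)" for j unfolding U_def using super_compact(2)[OF fc] compact_imp_closed by auto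
      have fsum: "(\<Sum>j<n. min (max (t - real j / N) 0) (1 / N)) = min t (n / N)" if "t \<ge> 0" for n and t :: real
      proof (induction n)
        case 0 then show ?case using that by simp
      next
        case (Suc n)
        have Suc_n: "real (Suc n) / N = n / N + 1 / N" by (simp add: add_divide_distrib)
        have "min t a + min (max (t - a) 0) b = min t (a + b)" if "0 \<le> t" "0 < b" for a b t :: real
          using that by (auto simp: min_def max_def)
        from this[OF \<open>0 \<le> t\<close>, of "1 / N" "n / N"] N show ?case
          unfolding sum.lessThan_Suc Suc.IH Suc_n by simp
      qed
      have "\<psi> f \<le> \<psi> (\<lambda>x. \<Sum>j<N. fj j x)"
      proof (rule mono[OF fc])
        show "continuous_on K (\<lambda>x. \<Sum>j<N. fj j x)" by (intro continuous_on_sum fjc)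
        fix x assume "x \<in> K"
        then show "f x \<le> (\<Sum>j<N. fj j x)" unfolding fj_def using fsum[of "f x" N] f01[of x] N by simp
      qed
      also have "\<dots> = (\<Sum>j<N. \<psi> (fj j))" by (rule sum) (auto simp: fjc)
      also have "\<dots> \<le> (\<Sum>j<N. measure M (U j \<inter> K) / N)"
      proof (rule sum_mono)
        fix j assume "j \<in> {..<N}"
        have "(\<lambda>x. real N * fj j x) \<in> adm (U j)"
          unfolding adm_def using fjc N by (auto simp: fj_def U_def min_def max_def field_simps intro!: continuous_intros fjc fc)
        then have "ennreal (\<psi> (\<lambda>x. real N * fj j x)) \<le> emeasure M (U j \<inter> K)"
          using adm_le em Uo by simp
        moreover have "\<psi> (\<lambda>x. real N * fj j x) = N * \<psi> (fj j)" using fjc by (rule scale)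
        ultimately have "N * \<psi> (fj j) \<le> measure M (U j \<inter> K)"
          by (simp add: M.emeasure_eq_measure)
        then show "\<psi> (fj j) \<le> measure M (U j \<inter> K) / N" using N by (simp add: field_simps)
      qed
      also have "\<dots> = (\<Sum>j<N. integral\<^sup>L M (\<lambda>x. indicator (U j \<inter> K) x / N))"
        by (simp add: space_M Int_absorb2 Int_commute)
      also have "\<dots> = integral\<^sup>L M (\<lambda>x. \<Sum>j<N. indicator (U j \<inter> K) x / N)"
      proof (rule Bochner_Integration.integral_sum[symmetric])
        fix j
        have "U j \<inter> K \<in> sets M" using Uo[of j] by (auto simp: sets_M sets_restrict_space)
        then show "integrable M (\<lambda>x. indicator (U j \<inter> K) x / real N)"
          by (intro integrable_divide integrable_real_indicator) (auto simp: M.emeasure_finite less_top[symmetric])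
      qed
      also have "\<dots> \<le> integral\<^sup>L M (\<lambda>x. f x + 1 / N)"
      proof (rule integral_mono)
        have "U j \<inter> K \<in> sets M" for j using Uo[of j] by (auto simp: sets_M sets_restrict_space)
        then show "integrable M (\<lambda>x. \<Sum>j<N. indicator (U j \<inter> K) x / real N)"
          by (intro Bochner_Integration.integrable_sum integrable_divide integrable_real_indicator)
            (auto simp: M.emeasure_finite less_top[symmetric])
        show "integrable M (\<lambda>x. f x + 1 / real N)" using integ[OF fc] by simp
        fix x assume "x \<in> space M"
        then have x: "x \<in> K" by (simp add: space_M)
        have "(\<Sum>j<N. indicator (U j \<inter> K) x :: real) = card {j\<in>{..<N}. real j < N * f x}"
          using x N by (simp add: U_def indicator_def sum.If_cases field_simps not_le Int_def)
        also have "\<dots> \<le> card {..<nat \<lceil>N * f x\<rceil>}"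
          using f01[OF x] by (intro of_nat_mono card_mono) (auto, linarith)
        also have "\<dots> \<le> N * f x + 1"
        proof -
          have "0 \<le> N * f x" using f01[OF x] by simp
          then show ?thesis by simp
        qed
        finally show "(\<Sum>j<N. indicator (U j \<inter> K) x / real N) \<le> f x + 1 / real N"
          using N by (simp add: sum_divide_distrib[symmetric] field_simps)
      qed
      also have "\<dots> = integral\<^sup>L M f + c1 / N" using integ[OF fc] by (simp add: space_M mK)
      finally show ?thesis .
    qed
    have "(\<lambda>N. integral\<^sup>L M f + c1 / real (Suc N)) \<longlonglongrightarrow> integral\<^sup>L M f + 0"
      by (intro tendsto_intros LIMSEQ_Suc[OF lim_const_over_n])
    moreover have "\<psi> f \<le> integral\<^sup>L M f + c1 / real (Suc n)" for n using N[of "Suc n"] by simp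
    ultimately show ?thesis by (intro LIMSEQ_le_const[of _ "integral\<^sup>L M f"]) auto
  qed
  \<comment> \<open>The reverse inequality is the same one for \<open>1 - f\<close>, since both
    sides agree on constants.\<close>
  have eq01: "integral\<^sup>L M f = \<psi> f" if fc: "continuous_on K f" and f01: "\<And>x. x \<in> K \<Longrightarrow> 0 \<le> f x \<and> f x \<le> 1" for f
  proof -
    have "\<psi> (\<lambda>x. 1 - f x) \<le> integral\<^sup>L M (\<lambda>x. 1 - f x)"
      using fc f01 by (intro le) (auto intro!: continuous_intros)
    then have "c1 - \<psi> f \<le> c1 - integral\<^sup>L M f"
      using diff[of "\<lambda>_. 1" f] fc integ[OF fc] by (simp add: c1_def[symmetric] space_M mK)
    then show ?thesis using le[OF fc f01] by simp
  qed
  show ?thesis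
  proof (rule that[OF sets_M])
    show "finite_measure M" by (rule M.finite_measure_axioms)
    fix f :: "'b \<Rightarrow> real" assume fc: "continuous_on K f"
    have "compact (f ` K)" using fc K by (rule compact_continuous_image)
    then obtain B where B: "B > 0" "\<And>x. x \<in> K \<Longrightarrow> \<bar>f x\<bar> \<le> B"
      by (metis bounded_pos compact_imp_bounded imageI real_norm_def)
    define g where "g x = (f x + B) / (2 * B)" for x
    have gc: "continuous_on K g" unfolding g_def using fc B by (intro continuous_intros) auto
    have g: "integral\<^sup>L M g = \<psi> g"
    proof (rule eq01[OF gc])
      fix x assume "x \<in> K"
      then show "0 \<le> g x \<and> g x \<le> 1" using B(2)[of x] B(1) by (auto simp: g_def field_simps)
    qed
    have f: "f = (\<lambda>x. 2 * B * g x - B)" using B by (auto simp: g_def fun_eq_iff)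
    have "\<psi> f = 2 * B * \<psi> g - B * c1"
      unfolding f using diff[of "\<lambda>x. 2 * B * g x" "\<lambda>_. B"] scale[OF gc, of "2 * B"] const[of B] gc
      by (simp add: continuous_on_mult_left)
    moreover have "integral\<^sup>L M f = 2 * B * integral\<^sup>L M g - B * c1"
      unfolding f using integ[OF gc] by (simp add: space_M mK)
    ultimately show "integral\<^sup>L M f = \<psi> f" using g by simp
  qed
qed


text \<open>Positivity of the functional is built into the cone: by \<open>C_mono\<close> the demand
  \<open>0\<close> at the zero function passes down to every nonpositive function. The demand at the
  constant \<open>1\<close> lets the cone reach every continuous function, as these are bounded on
  the compact \<open>K\<close>. In applications the substantial hypothesis is consistency at the
  zero function.\<close>

lemma cone_measure:
  fixes K :: "'b::metric_space set" and C :: "(('b \<Rightarrow> real) \<times> real) set"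
  assumes K: "compact K"
    and C_cont: "\<And>f c. (f, c) \<in> C \<Longrightarrow> continuous_on K f"
    and C_zero: "((\<lambda>_. 0), 0) \<in> C"
    and C_one: "((\<lambda>_. 1), c1) \<in> C"
    and C_add: "\<And>f g c d. (f, c) \<in> C \<Longrightarrow> (g, d) \<in> C \<Longrightarrow> ((\<lambda>x. f x + g x), c + d) \<in> C"
    and C_scale: "\<And>f c t. (f, c) \<in> C \<Longrightarrow> 0 < t \<Longrightarrow> ((\<lambda>x. t * f x), t * c) \<in> C"
    and C_mono: "\<And>f g c. (f, c) \<in> C \<Longrightarrow> continuous_on K g \<Longrightarrow> (\<And>x. x \<in> K \<Longrightarrow> g x \<le> f x) \<Longrightarrow> (g, c) \<in> C"
    and C_nonneg: "\<And>c. ((\<lambda>_. 0), c) \<in> C \<Longrightarrow> 0 \<le> c"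
  obtains M where "sets M = sets (restrict_space borel K)" "finite_measure M"
    "\<And>f c. (f, c) \<in> C \<Longrightarrow> integral\<^sup>L M f \<le> c"
proof -
  have onto: "\<exists>c. (f, c) \<in> C" if f: "f \<in> {f. continuous_on K f}" for f
  proof -
    have fc: "continuous_on K f" using f by simp
    have "compact (f ` K)" using fc K by (rule compact_continuous_image)
    then obtain B where B: "B > 0" "\<And>x. x \<in> K \<Longrightarrow> \<bar>f x\<bar> \<le> B"
      by (metis bounded_pos compact_imp_bounded imageI real_norm_def)
    have "((\<lambda>x. B * 1), B * c1) \<in> C" using C_scale[OF C_one B(1)] .
    then have "(f, B * c1) \<in> C" by (rule C_mono[OF _ fc]) (use B(2) in \<open>auto simp: abs_le_iff\<close>)
    then show ?thesis by auto
  qed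
  have sc: "(\<lambda>x. t * f x) \<in> {f. continuous_on K f}" if "f \<in> {f. continuous_on K f}"
    for f :: "'b \<Rightarrow> real" and t using that by (simp add: continuous_on_mult_left)
  have ad: "(\<lambda>x. f x + g x) \<in> {f. continuous_on K f}"
    if "f \<in> {f. continuous_on K f}" "g \<in> {f. continuous_on K f}" for f g :: "'b \<Rightarrow> real"
    using that by (simp add: continuous_on_add)
  have cx: "f \<in> {f. continuous_on K f}" if "(f, c) \<in> C" for f c using C_cont that by auto
  have "\<exists>\<psi>. (\<forall>f g. continuous_on K f \<longrightarrow> continuous_on K g \<longrightarrow> \<psi> (\<lambda>x. f x + g x) = \<psi> f + \<psi> g) \<and>
      (\<forall>f t. continuous_on K f \<longrightarrow> \<psi> (\<lambda>x. t * f x) = t * \<psi> f) \<and> (\<forall>f c. (f, c) \<in> C \<longrightarrow> \<psi> f \<le> c)"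
  proof (rule cone_linear_functional[of "{f. continuous_on K f}" C], erule sc, erule cx, erule (1) ad,
        rule C_zero, erule (1) C_add, erule (1) C_scale, erule onto, erule C_nonneg)
    fix \<psi>
    assume "\<And>f g. f \<in> {f. continuous_on K f} \<Longrightarrow> g \<in> {f. continuous_on K f} \<Longrightarrow> \<psi> (\<lambda>x. f x + g x) = \<psi> f + \<psi> g"
      "\<And>f t. f \<in> {f. continuous_on K f} \<Longrightarrow> \<psi> (\<lambda>x. t * f x) = t * \<psi> f"
      "\<And>f c. (f, c) \<in> C \<Longrightarrow> \<psi> f \<le> c"
    then show ?thesis by (intro exI[of _ \<psi>]) simp
  qed
  then obtain \<psi> where "(\<forall>f g. continuous_on K f \<longrightarrow> continuous_on K g \<longrightarrow> \<psi> (\<lambda>x. f x + g x) = \<psi> f + \<psi> g) \<and>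
      (\<forall>f t. continuous_on K f \<longrightarrow> \<psi> (\<lambda>x. t * f x) = t * \<psi> f) \<and> (\<forall>f c. (f, c) \<in> C \<longrightarrow> \<psi> f \<le> c)"
    by (rule exE)
  then have
    \<psi>: "\<And>f g. continuous_on K f \<Longrightarrow> continuous_on K g \<Longrightarrow> \<psi> (\<lambda>x. f x + g x) = \<psi> f + \<psi> g"
    "\<And>f t. continuous_on K f \<Longrightarrow> \<psi> (\<lambda>x. t * f x) = t * \<psi> f"
    "\<And>f c. (f, c) \<in> C \<Longrightarrow> \<psi> f \<le> c"
    by blast+
  have pos: "0 \<le> \<psi> f" if "continuous_on K f" "\<And>x. x \<in> K \<Longrightarrow> 0 \<le> f x" for f :: "'b \<Rightarrow> real"
  proof -
    have "((\<lambda>x. -1 * f x), 0) \<in> C"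
      by (rule C_mono[OF C_zero]) (use that in \<open>simp_all add: continuous_on_minus\<close>)
    then have "\<psi> (\<lambda>x. -1 * f x) \<le> 0" by (rule \<psi>(3))
    then show ?thesis using \<psi>(2)[of f "-1"] that by simp
  qed
  show ?thesis
  proof (rule riesz_compact[of K \<psi>])
    show "compact K" by (rule K)
    show "\<psi> (\<lambda>x. f x + g x) = \<psi> f + \<psi> g" if "continuous_on K f" "continuous_on K g" for f g
      using that by (rule \<psi>(1))
    show "\<psi> (\<lambda>x. t * f x) = t * \<psi> f" if "continuous_on K f" for f t
      using that by (rule \<psi>(2))
    show "0 \<le> \<psi> f" if "continuous_on K f" "\<And>x. x \<in> K \<Longrightarrow> 0 \<le> f x" for f
      using that by (rule pos)
    fix M assume M: "sets M = sets (restrict_space borel K)" "finite_measure M"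
      "\<And>f. continuous_on K f \<Longrightarrow> integral\<^sup>L M f = \<psi> f"
    have "integral\<^sup>L M f \<le> c" if "(f, c) \<in> C" for f c
      using M(3)[OF C_cont[OF that]] \<psi>(3)[OF that] by simp
    then show ?thesis by (rule that[OF M(1,2)])
  qed
qed

section \<open>Densities of complex measures\<close>

lemma set_integral_ennreal:
  fixes k :: "'b \<Rightarrow> real"
  assumes "integrable L k" "A \<in> sets L" "\<And>x. 0 \<le> k x"
  shows "(\<integral>\<^sup>+x. ennreal (k x) * indicator A x \<partial>L) = ennreal (LINT x:A|L. k x)"
proof -
  have i: "integrable L (\<lambda>x. indicat_real A x *\<^sub>R k x)"
    by (rule integrable_mult_indicator[OF assms(2,1)])
  have "(\<integral>\<^sup>+x. ennreal (k x) * indicator A x \<partial>L) = (\<integral>\<^sup>+x. ennreal (indicat_real A x *\<^sub>R k x) \<partial>L)"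
    by (intro nn_integral_cong) (auto simp: indicator_def)
  also have "\<dots> = ennreal (LINT x:A|L. k x)"
    unfolding set_lebesgue_integral_def using assms
    by (intro nn_integral_eq_integral[OF i]) (auto simp: indicator_def)
  finally show ?thesis .
qed

text \<open>The supremum in the Jordan decomposition is attained at the part of \<open>A\<close>
  where \<open>k\<close> is positive.\<close>

lemma positive_variation_density:
  fixes k :: "'b \<Rightarrow> real"
  assumes sets: "sets L = sets M" and k: "integrable L k"
    and \<nu>: "\<And>A. A \<in> sets M \<Longrightarrow> \<nu> A = (LINT x:A|L. k x)"
  shows "positive_variation M \<nu> = density L (\<lambda>x. ennreal (max 0 (k x)))"
proof -
  have sp: "space L = space M" using sets by (rule sets_eq_imp_space_eq)
  have km: "k \<in> borel_measurable L" using k by auto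
  have k': "integrable L (\<lambda>x. max 0 (k x))" using k by auto
  have si: "set_integrable L B k" if "B \<in> sets L" for B
    unfolding set_integrable_def using integrable_mult_indicator[OF that k] .
  have si': "set_integrable L B (\<lambda>x. max 0 (k x))" if "B \<in> sets L" for B
    unfolding set_integrable_def using integrable_mult_indicator[OF that k'] .
  have eq: "(SUP B\<in>{B \<in> sets M. B \<subseteq> A}. ennreal (\<nu> B)) =
      emeasure (density L (\<lambda>x. ennreal (max 0 (k x)))) A" if A: "A \<in> sets M" for A
  proof -
    have "(\<lambda>x. ennreal (max 0 (k x))) \<in> borel_measurable L" using km by measurable
    then have em: "emeasure (density L (\<lambda>x. ennreal (max 0 (k x)))) A = ennreal (LINT x:A|L. max 0 (k x))"
      using A set_integral_ennreal[OF k', of A] by (simp add: sets emeasure_density)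
    have "(LINT x:B|L. k x) \<le> (LINT x:A|L. max 0 (k x))" if B: "B \<in> sets M" "B \<subseteq> A" for B
    proof -
      have "(LINT x:B|L. k x) \<le> (LINT x:B|L. max 0 (k x))"
        using si si' B by (intro set_integral_mono) (auto simp: sets)
      also have "\<dots> \<le> (LINT x:A|L. max 0 (k x))"
        unfolding set_lebesgue_integral_def
        using si' A B by (intro integral_mono) (auto simp: sets set_integrable_def indicator_def)
      finally show ?thesis .
    qed
    moreover have "\<exists>B\<in>sets M. B \<subseteq> A \<and> (LINT x:B|L. k x) = (LINT x:A|L. max 0 (k x))"
    proof (intro bexI[of _ "A \<inter> {x\<in>space L. 0 < k x}"] conjI)
      show "A \<inter> {x\<in>space L. 0 < k x} \<in> sets M" using A km by (auto simp: sets[symmetric])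
      show "(LINT x:A \<inter> {x\<in>space L. 0 < k x}|L. k x) = (LINT x:A|L. max 0 (k x))"
        unfolding set_lebesgue_integral_def
        by (intro Bochner_Integration.integral_cong) (auto simp: indicator_def)
    qed auto
    ultimately show ?thesis unfolding em using \<nu>
      by (intro antisym SUP_least) (auto intro!: ennreal_leI SUP_upper2)
  qed
  have "positive_variation M \<nu> =
      measure_of (space M) (sets M) (emeasure (density L (\<lambda>x. ennreal (max 0 (k x)))))"
    unfolding positive_variation_def
    by (rule measure_of_eq) (auto simp: sets.space_closed sets.sigma_sets_eq eq)
  also have "\<dots> = density L (\<lambda>x. ennreal (max 0 (k x)))"
    using measure_of_of_measure[of "density L (\<lambda>x. ennreal (max 0 (k x)))"] by (simp add: sets sp)
  finally show ?thesis .
qed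

lemma signed_integral_density:
  fixes k :: "'b \<Rightarrow> real" and u :: "'b \<Rightarrow> complex"
  assumes sets: "sets L = sets M" and k: "integrable L k"
    and \<nu>: "\<And>A. A \<in> sets M \<Longrightarrow> \<nu> A = (LINT x:A|L. k x)"
    and u: "u \<in> borel_measurable L" and ku: "integrable L (\<lambda>x. k x *\<^sub>R u x)"
  shows "signed_integral M \<nu> u = (LINT x|L. k x *\<^sub>R u x)"
proof -
  have km[measurable]: "k \<in> borel_measurable L" using k by auto
  have 1: "positive_variation M \<nu> = density L (\<lambda>x. ennreal (max 0 (k x)))"
    by (rule positive_variation_density[OF sets k \<nu>])
  have 2: "positive_variation M (\<lambda>A. - \<nu> A) = density L (\<lambda>x. ennreal (max 0 (- k x)))"
    by (rule positive_variation_density[OF sets]) (use k \<nu> in \<open>auto simp: set_lebesgue_integral_def\<close>)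
  have i1: "integrable L (\<lambda>x. max 0 (k x) *\<^sub>R u x)" "integrable L (\<lambda>x. max 0 (- k x) *\<^sub>R u x)"
    using u by (auto intro!: Bochner_Integration.integrable_bound[OF ku] AE_I2 mult_right_mono)
  have "signed_integral M \<nu> u = (LINT x|L. max 0 (k x) *\<^sub>R u x) - (LINT x|L. max 0 (- k x) *\<^sub>R u x)"
    unfolding signed_integral_def 1 2 using u by (subst (1 2) integral_density) auto
  also have "\<dots> = (LINT x|L. max 0 (k x) *\<^sub>R u x - max 0 (- k x) *\<^sub>R u x)"
    using i1 by simp
  also have "\<dots> = (LINT x|L. k x *\<^sub>R u x)"
    by (intro Bochner_Integration.integral_cong) (auto simp: max_def)
  finally show ?thesis .
qed

text \<open>Bridge from the definition through Jordan decompositions to an ordinary integral. Later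
  computations with complex measures go through densities by means of it.\<close>

lemma complex_measure_integral_density:
  fixes \<kappa> u :: "'b \<Rightarrow> complex"
  assumes sets: "sets L = sets M" and \<kappa>: "integrable L \<kappa>"
    and \<mu>: "\<And>A. A \<in> sets M \<Longrightarrow> \<mu> A = (LINT x:A|L. \<kappa> x)"
    and u: "u \<in> borel_measurable L" and bdd: "\<And>x. x \<in> space L \<Longrightarrow> cmod (u x) \<le> B"
  shows "complex_measure_integral M \<mu> u = (LINT x|L. \<kappa> x * u x)"
proof -
  have int: "integrable L (\<lambda>x. k x *\<^sub>R u x)" if k: "integrable L k" for k :: "'b \<Rightarrow> real"
  proof (rule Bochner_Integration.integrable_bound[of _ "\<lambda>x. B * k x"])
    show "integrable L (\<lambda>x. B * k x)" using k by simp
    show "(\<lambda>x. k x *\<^sub>R u x) \<in> borel_measurable L" using k u by auto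
    show "AE x in L. norm (k x *\<^sub>R u x) \<le> norm (B * k x)"
    proof (rule AE_I2)
      fix x assume "x \<in> space L"
      have "cmod (u x) \<le> \<bar>B\<bar>" using bdd[OF \<open>x \<in> space L\<close>] by simp
      then show "norm (k x *\<^sub>R u x) \<le> norm (B * k x)"
        using mult_right_mono[of "cmod (u x)" "\<bar>B\<bar>" "\<bar>k x\<bar>"]
        by (simp add: abs_mult mult.commute)
    qed
  qed
  have si: "integrable L (\<lambda>x. indicat_real A x *\<^sub>R \<kappa> x)" if "A \<in> sets M" for A
    using \<kappa> that by (simp add: sets[symmetric] integrable_mult_indicator)
  have r: "signed_integral M (\<lambda>A. Re (\<mu> A)) u = (LINT x|L. Re (\<kappa> x) *\<^sub>R u x)"
    using \<kappa> si by (intro signed_integral_density sets u int)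
      (auto simp: \<mu> set_lebesgue_integral_def integral_Re[symmetric])
  have i: "signed_integral M (\<lambda>A. Im (\<mu> A)) u = (LINT x|L. Im (\<kappa> x) *\<^sub>R u x)"
    using \<kappa> si by (intro signed_integral_density sets u int)
      (auto simp: \<mu> set_lebesgue_integral_def integral_Im[symmetric])
  have "complex_measure_integral M \<mu> u =
      (LINT x|L. Re (\<kappa> x) *\<^sub>R u x) + (LINT x|L. \<i> * (Im (\<kappa> x) *\<^sub>R u x))"
    unfolding complex_measure_integral_def r i
    by (simp only: integral_mult_right_zero)
  also have "\<dots> = (LINT x|L. Re (\<kappa> x) *\<^sub>R u x + \<i> * (Im (\<kappa> x) *\<^sub>R u x))"
    by (intro Bochner_Integration.integral_add[symmetric] int integrable_Re integrable_Im
        integrable_mult_right \<kappa>)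
  also have "\<dots> = (LINT x|L. \<kappa> x * u x)"
    by (intro Bochner_Integration.integral_cong)
      (auto simp: complex_eq_iff algebra_simps)
  finally show ?thesis .
qed

section \<open>Radon-Nikodym derivatives of finite and of signed measures\<close>

lemma finite_Radon_Nikodym_real:
  assumes "finite_measure P" "finite_measure N" "sets N = sets P" "absolutely_continuous P N"
  obtains k :: "'b \<Rightarrow> real" where "integrable P k" "\<And>x. 0 \<le> k x"
    "N = density P (\<lambda>x. ennreal (k x))" "\<And>A. A \<in> sets P \<Longrightarrow> measure N A = (LINT x:A|P. k x)"
proof -
  interpret P: finite_measure P by fact
  interpret N: finite_measure N by fact
  obtain f where f: "f \<in> borel_measurable P" "density P f = N"
    using P.Radon_Nikodym_finite_measure[OF assms(2-4)] by auto
  have fin: "(\<integral>\<^sup>+x. f x \<partial>P) \<noteq> \<infinity>"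
  proof -
    have "(\<integral>\<^sup>+x. f x \<partial>P) = (\<integral>\<^sup>+x. f x * indicator (space P) x \<partial>P)"
      by (intro nn_integral_cong) auto
    also have "\<dots> = emeasure N (space P)"
      using f by (auto simp: emeasure_density)
    finally show ?thesis by (simp add: N.emeasure_finite)
  qed
  define k where "k x = enn2real (f x)" for x
  have k_m: "k \<in> borel_measurable P" unfolding k_def using f(1) by measurable
  have ae: "AE x in P. f x = ennreal (k x)"
    using nn_integral_noteq_infinite[OF f(1) fin] by (auto simp: k_def less_top)
  have N: "N = density P (\<lambda>x. ennreal (k x))"
    unfolding f(2)[symmetric] using f(1) k_m ae by (intro density_cong) auto
  have k_i: "integrable P k"
  proof (rule integrableI_nonneg)
    have "(\<integral>\<^sup>+x. ennreal (k x) \<partial>P) = (\<integral>\<^sup>+x. f x \<partial>P)"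
      using ae by (intro nn_integral_cong_AE) auto
    then show "(\<integral>\<^sup>+x. ennreal (k x) \<partial>P) < \<infinity>" using fin by (simp add: less_top)
  qed (use k_m in \<open>auto simp: k_def\<close>)
  have "measure N A = (LINT x:A|P. k x)" if A: "A \<in> sets P" for A
  proof -
    have "emeasure N A = (\<integral>\<^sup>+x. ennreal (k x) * indicator A x \<partial>P)"
      unfolding N using k_m A by (intro emeasure_density) auto
    also have "\<dots> = ennreal (LINT x:A|P. k x)"
      by (rule set_integral_ennreal[OF k_i A]) (simp add: k_def)
    finally show ?thesis
      by (simp add: N.emeasure_eq_measure set_lebesgue_integral_def k_def integral_nonneg_AE)
  qed
  moreover have "0 \<le> k x" for x by (simp add: k_def)
  ultimately show ?thesis using that[OF k_i _ N] by blast
qed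

lemma ennreal_sums_le:
  fixes f :: "nat \<Rightarrow> real"
  assumes "f sums s"
  shows "ennreal s \<le> (suminf (\<lambda>i. ennreal (f i)))"
proof (rule LIMSEQ_le_const2)
  show "(\<lambda>n. ennreal (\<Sum>i<n. f i)) \<longlonglongrightarrow> ennreal s"
    using assms by (intro tendsto_ennrealI) (simp add: sums_def)
  have "ennreal (\<Sum>i<n. f i) \<le> (\<Sum>i<n. ennreal (f i))" for n
  proof (induction n)
    case (Suc n)
    have "ennreal (a + b) \<le> ennreal a + ennreal b" for a b :: real
    proof (cases "a \<ge> 0 \<and> b \<ge> 0")
      case False
      then have "a + b \<le> a \<or> a + b \<le> b" by auto
      then show ?thesis using ennreal_leI[of "a+b" a] ennreal_leI[of "a+b" b]
        by (metis add.commute add_increasing2 zero_le)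
    qed simp
    from this[of "\<Sum>i<n. f i" "f n"] Suc show ?case
      by (simp only: sum.lessThan_Suc) (meson add_right_mono order_trans)
  qed simp
  then have "ennreal (\<Sum>i<n. f i) \<le> (suminf (\<lambda>i. ennreal (f i)))" for n
    using sum_le_suminf[of "\<lambda>i. ennreal (f i)" "{..<n}"] by (auto intro: order.trans)
  then show "\<exists>N. \<forall>n\<ge>N. ennreal (\<Sum>i<n. f i) \<le> (suminf (\<lambda>i. ennreal (f i)))" by auto
qed

text \<open>Countable additivity already bounds a real-valued set function. Its positive and
  negative variations are then finite measures absolutely continuous with respect to
  \<open>P\<close>, and the density is the difference of their Radon-Nikodym derivatives.\<close>

lemma signed_Radon_Nikodym:
  fixes \<nu> :: "'b set \<Rightarrow> real"
  assumes P: "finite_measure P"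
    and ca: "\<And>A :: nat \<Rightarrow> 'b set. range A \<subseteq> sets P \<Longrightarrow> disjoint_family A \<Longrightarrow> (\<lambda>i. \<nu> (A i)) sums \<nu> (\<Union>i. A i)"
    and ac: "\<And>A. A \<in> null_sets P \<Longrightarrow> \<nu> A = 0"
  obtains k :: "'b \<Rightarrow> real" where "integrable P k" "\<And>A. A \<in> sets P \<Longrightarrow> \<nu> A = (LINT x:A|P. k x)"
proof -
  interpret P: finite_measure P by fact
  have empty: "\<nu> {} = 0" by (rule ac) simp
  have add: "\<nu> (A \<union> B) = \<nu> A + \<nu> B" if "A \<in> sets P" "B \<in> sets P" "A \<inter> B = {}" for A B
  proof -
    define C where "C i = (if i = 0 then A else if i = 1 then B else {})" for i :: nat
    have "(\<lambda>i. \<nu> (C i)) sums \<nu> (\<Union>i. C i)"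
      using that by (intro ca) (auto simp: C_def disjoint_family_on_def)
    moreover have "(\<Union>i. C i) = A \<union> B" by (auto simp: C_def split: if_splits)
    moreover have "(\<lambda>i. \<nu> (C i)) sums (\<Sum>i\<in>{0, 1}. \<nu> (C i))"
      by (intro sums_finite) (auto simp: C_def empty)
    ultimately have "\<nu> (A \<union> B) = (\<Sum>i\<in>{0, 1::nat}. \<nu> (C i))" using sums_unique2 by metis
    then show ?thesis by (simp add: C_def)
  qed
  have diff: "\<nu> (A - B) = \<nu> A - \<nu> B" if "A \<in> sets P" "B \<in> sets P" "B \<subseteq> A" for A B
  proof -
    have "A - B \<union> B = A" "(A - B) \<inter> B = {}" using that by auto
    then show ?thesis using add[of "A - B" B] that by auto
  qed
  have "\<exists>b. \<forall>A\<in>sets P. \<bar>\<nu> A\<bar> \<le> b"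
  proof (rule ccontr)
    assume unb: "\<nexists>b. \<forall>A\<in>sets P. \<bar>\<nu> A\<bar> \<le> b"
    \<comment> \<open>A bad set has measurable subsets of arbitrarily large absolute value. Given a
      subset \<open>C\<close> of a bad \<open>A\<close> with value beyond
      \<open>1 + \<bar>\<nu> A\<bar>\<close>, one of \<open>C\<close> and \<open>A - C\<close> is
      bad again, and the discarded piece has absolute value above \<open>1\<close> in either case.
      The discarded pieces are disjoint, so their values would have to tend to 0.\<close>
    define bad where "bad A \<longleftrightarrow> A \<in> sets P \<and> (\<forall>b. \<exists>C\<in>sets P. C \<subseteq> A \<and> b < \<bar>\<nu> C\<bar>)" for A
    have "bad (space P)"
    proof -
      have "\<exists>C\<in>sets P. C \<subseteq> space P \<and> b < \<bar>\<nu> C\<bar>" for b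
        using unb sets.sets_into_space by (meson not_le)
      then show ?thesis by (simp add: bad_def)
    qed
    moreover have "\<exists>A'. bad A' \<and> A' \<subseteq> A \<and> 1 < \<bar>\<nu> (A - A')\<bar>" if A: "bad A" for A
    proof -
      obtain C where C: "C \<in> sets P" "C \<subseteq> A" "1 + \<bar>\<nu> A\<bar> < \<bar>\<nu> C\<bar>"
        using A unfolding bad_def by meson
      have As: "A \<in> sets P" using A by (simp add: bad_def)
      show ?thesis
      proof (cases "bad C")
        case True
        then show ?thesis using C diff[OF As C(1,2)] by (intro exI[of _ C]) auto
      next
        case False
        then obtain b where b: "\<And>D. D \<in> sets P \<Longrightarrow> D \<subseteq> C \<Longrightarrow> \<bar>\<nu> D\<bar> \<le> b"
          using C(1) unfolding bad_def by (meson not_le)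
        have "\<exists>D\<in>sets P. D \<subseteq> A - C \<and> b' < \<bar>\<nu> D\<bar>" for b'
        proof -
          obtain D where D: "D \<in> sets P" "D \<subseteq> A" "b' + b < \<bar>\<nu> D\<bar>"
            using A unfolding bad_def by meson
          have "\<nu> D = \<nu> (D - C) + \<nu> (D \<inter> C)"
          proof -
            have "D - C \<union> D \<inter> C = D" "(D - C) \<inter> (D \<inter> C) = {}" by auto
            then show ?thesis using add[of "D - C" "D \<inter> C"] D C by auto
          qed
          moreover have "\<bar>\<nu> (D \<inter> C)\<bar> \<le> b" using D C by (intro b) auto
          ultimately have "b' < \<bar>\<nu> (D - C)\<bar>" using D(3) by linarith
          then show ?thesis using D C by (intro bexI[of _ "D - C"]) auto
        qed
        then have "bad (A - C)" using As C by (auto simp: bad_def)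
        moreover have "A - (A - C) = C" using C by auto
        ultimately show ?thesis using C by (intro exI[of _ "A - C"]) auto
      qed
    qed
    ultimately have "\<exists>A. \<forall>n::nat. bad (A n) \<and> (A (Suc n) \<subseteq> A n \<and> 1 < \<bar>\<nu> (A n - A (Suc n))\<bar>)"
      by (intro dependent_nat_choice) auto
    then obtain A where A: "\<And>n::nat. bad (A n)" "\<And>n. A (Suc n) \<subseteq> A n \<and> 1 < \<bar>\<nu> (A n - A (Suc n))\<bar>"
      by auto
    define D where "D n = A n - A (Suc n)" for n
    have dec: "A m \<subseteq> A n" if "n \<le> m" for n m
      using A(2) that by (meson lift_Suc_antimono_le)
    have "disjoint_family D"
      unfolding disjoint_family_on_def
    proof (intro ballI impI)
      fix m n :: nat assume "m \<noteq> n"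
      then show "D m \<inter> D n = {}"
      proof (cases "m < n")
        case True
        then have "A n \<subseteq> A (Suc m)" by (intro dec) auto
        then show ?thesis by (auto simp: D_def)
      next
        case False
        then have "A m \<subseteq> A (Suc n)" using \<open>m \<noteq> n\<close> by (intro dec) auto
        then show ?thesis by (auto simp: D_def)
      qed
    qed
    moreover have "range D \<subseteq> sets P" using A(1) by (auto simp: D_def bad_def)
    ultimately have "summable (\<lambda>i. \<nu> (D i))" using ca sums_summable by blast
    then have "(\<lambda>i. \<nu> (D i)) \<longlonglongrightarrow> 0" by (rule summable_LIMSEQ_zero)
    then have "\<forall>\<^sub>F i in sequentially. \<bar>\<nu> (D i)\<bar> < 1"
      using tendstoD[of "\<lambda>i. \<nu> (D i)" 0 sequentially 1] by (simp add: dist_real_def)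
    then obtain i where "\<bar>\<nu> (D i)\<bar> < 1" by (auto simp: eventually_sequentially)
    then show False using A(2)[of i] by (simp add: D_def)
  qed
  then obtain b where b: "\<And>A. A \<in> sets P \<Longrightarrow> \<bar>\<nu> A\<bar> \<le> b" by auto
  \<comment> \<open>Stated for an arbitrary set function because it serves both \<open>\<nu>\<close>
    and \<open>- \<nu>\<close>.\<close>
  have main: "\<exists>k. integrable P k \<and> (\<forall>A\<in>sets P. (SUP B\<in>{B \<in> sets P. B \<subseteq> A}. ennreal (\<nu> B)) = ennreal (LINT x:A|P. k x)
      \<and> 0 \<le> (LINT x:A|P. k x))"
    if empty: "\<nu> {} = 0" and bound: "\<And>A. A \<in> sets P \<Longrightarrow> \<bar>\<nu> A\<bar> \<le> b"
      and add: "\<And>A B. A \<in> sets P \<Longrightarrow> B \<in> sets P \<Longrightarrow> A \<inter> B = {} \<Longrightarrow> \<nu> (A \<union> B) = \<nu> A + \<nu> B"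
      and ca: "\<And>A :: nat \<Rightarrow> 'b set. range A \<subseteq> sets P \<Longrightarrow> disjoint_family A \<Longrightarrow> (\<lambda>i. \<nu> (A i)) sums \<nu> (\<Union>i. A i)"
      and ac: "\<And>A. A \<in> null_sets P \<Longrightarrow> \<nu> A = 0" for \<nu> :: "'b set \<Rightarrow> real"
  proof -
    define N where "N A = (SUP B\<in>{B \<in> sets P. B \<subseteq> A}. ennreal (\<nu> B))" for A
    have N_up: "ennreal (\<nu> B) \<le> N A" if "B \<in> sets P" "B \<subseteq> A" for A B
      unfolding N_def using that by (intro SUP_upper) auto
    have N_empty: "N {} = 0" unfolding N_def by (intro antisym SUP_least) (auto simp: empty)
    have super: "N A + N B \<le> N (A \<union> B)" if AB: "A \<in> sets P" "B \<in> sets P" "A \<inter> B = {}" for A B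
    proof -
      have 1: "ennreal (\<nu> C) + ennreal (\<nu> D) \<le> N (A \<union> B)"
        if "C \<in> sets P" "D \<in> sets P" "C \<subseteq> A" "D \<subseteq> B" for C D
      proof (cases "0 \<le> \<nu> C \<and> 0 \<le> \<nu> D")
        case True
        have "ennreal (\<nu> C) + ennreal (\<nu> D) = ennreal (\<nu> (C \<union> D))"
        proof -
          have "C \<inter> D = {}" using that AB by auto
          then have "\<nu> (C \<union> D) = \<nu> C + \<nu> D" using add that by blast
          then show ?thesis using True by simp
        qed
        then show ?thesis using N_up[of "C \<union> D" "A \<union> B"] that by auto
      next
        case False
        have "C \<subseteq> A \<union> B" "D \<subseteq> A \<union> B" using that by auto
        then have "ennreal (\<nu> C) \<le> N (A \<union> B)" "ennreal (\<nu> D) \<le> N (A \<union> B)"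
          using N_up that by blast+
        then show ?thesis using False by (auto simp: ennreal_neg)
      qed
      have 2: "N A + ennreal (\<nu> D) \<le> N (A \<union> B)" if "D \<in> sets P" "D \<subseteq> B" for D
        unfolding N_def[of A] using 1 that
        by (subst ennreal_SUP_add_left[symmetric]) (auto intro!: SUP_least)
      show ?thesis
        unfolding N_def[of B] using 2
        by (subst ennreal_SUP_add_right) (auto intro!: SUP_least)
    qed
    have N_ca: "countably_additive (sets P) N"
      unfolding countably_additive_def
    proof (intro allI impI antisym)
      fix A :: "nat \<Rightarrow> 'b set"
      assume A: "range A \<subseteq> sets P" "disjoint_family A" "(\<Union>i. A i) \<in> sets P"
      have fin: "(\<Sum>i<n. N (A i)) \<le> N (\<Union>i<n. A i)" for n
      proof (induction n)
        case (Suc n)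
        have "N (\<Union>i<n. A i) + N (A n) \<le> N ((\<Union>i<n. A i) \<union> A n)"
        proof (rule super)
          show "(\<Union>i<n. A i) \<in> sets P" "A n \<in> sets P" using A(1) by auto
          have "A i \<inter> A n = {}" if "i < n" for i
            using disjoint_family_onD[OF A(2), of i n] that by auto
          then show "(\<Union>i<n. A i) \<inter> A n = {}" by auto
        qed
        moreover have "(\<Union>i<n. A i) \<union> A n = (\<Union>i<Suc n. A i)" by (auto simp: lessThan_Suc)
        ultimately show ?case
          unfolding sum.lessThan_Suc using order_trans[OF add_right_mono[OF Suc, of "N (A n)"]] by simp
      qed (simp add: N_empty)
      have "N (\<Union>i<n. A i) \<le> N (\<Union>i. A i)" for n
        unfolding N_def by (intro SUP_subset_mono) auto
      then show "(suminf (\<lambda>i. N (A i))) \<le> N (\<Union>i. A i)"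
        using fin by (intro suminf_le_const) (auto intro: order.trans)
      show "N (\<Union>i. A i) \<le> (suminf (\<lambda>i. N (A i)))"
        unfolding N_def[of "\<Union>i. A i"]
      proof (rule SUP_least, clarsimp)
        fix B assume B: "B \<in> sets P" "B \<subseteq> (\<Union>i. A i)"
        have "(\<lambda>i. \<nu> (B \<inter> A i)) sums \<nu> (\<Union>i. B \<inter> A i)"
        proof (rule ca)
          show "range (\<lambda>i. B \<inter> A i) \<subseteq> sets P" using B A(1) by auto
          show "disjoint_family (\<lambda>i. B \<inter> A i)"
            using A(2) by (rule disjoint_family_on_bisimulation) auto
        qed
        moreover have "(\<Union>i. B \<inter> A i) = B" using B by auto
        ultimately have "ennreal (\<nu> B) \<le> (suminf (\<lambda>i. ennreal (\<nu> (B \<inter> A i))))" using ennreal_sums_le by metis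
        also have "\<dots> \<le> (suminf (\<lambda>i. N (A i)))" using B A(1) by (intro suminf_le N_up) auto
        finally show "ennreal (\<nu> B) \<le> (suminf (\<lambda>i. N (A i)))" .
      qed
    qed
    define Q where "Q = measure_of (space P) (sets P) N"
    have sets_Q: "sets Q = sets P" and space_Q: "space Q = space P" unfolding Q_def
      by (simp_all add: sets.sets_measure_of_eq sets.space_measure_of_eq)
    have em: "emeasure Q A = N A" if "A \<in> sets P" for A
      unfolding Q_def using that N_ca N_empty
      by (intro emeasure_measure_of_sigma sets.sigma_algebra_axioms) (auto simp: positive_def)
    have N_b: "N A \<le> ennreal b" for A
      unfolding N_def using bound by (intro SUP_least ennreal_leI) (auto simp: abs_le_iff)
    have Q: "finite_measure Q"
      using N_b[of "space P"] by (intro finite_measureI) (auto simp: space_Q em top_unique)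
    have "absolutely_continuous P Q"
      unfolding absolutely_continuous_def
    proof
      fix A assume A: "A \<in> null_sets P"
      have "\<nu> B = 0" if "B \<in> sets P" "B \<subseteq> A" for B
        using A that by (intro ac) (rule null_sets_subset)
      then have "N A \<le> 0" unfolding N_def by (intro SUP_least) auto
      then show "A \<in> null_sets Q" using A by (auto simp: null_sets_def sets_Q em)
    qed
    then obtain k where k: "integrable P k" "\<And>x. 0 \<le> k x" "\<And>A. A \<in> sets P \<Longrightarrow> measure Q A = (LINT x:A|P. k x)"
      using finite_Radon_Nikodym_real[OF P Q sets_Q] by metis
    have "N A = ennreal (LINT x:A|P. k x) \<and> 0 \<le> (LINT x:A|P. k x)" if A: "A \<in> sets P" for A
      using em[OF A] k(3)[OF A] finite_measure.emeasure_eq_measure[OF Q, of A] measure_nonneg[of Q A] by simp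
    then show ?thesis using k(1) unfolding N_def by blast
  qed
  obtain k where k': "integrable P k \<and> (\<forall>A\<in>sets P. (SUP B\<in>{B \<in> sets P. B \<subseteq> A}. ennreal (\<nu> B)) =
      ennreal (LINT x:A|P. k x) \<and> 0 \<le> (LINT x:A|P. k x))"
    using main[OF empty b add ca ac] by (rule exE)
  then have k: "integrable P k"
    "\<And>A. A \<in> sets P \<Longrightarrow> (SUP B\<in>{B \<in> sets P. B \<subseteq> A}. ennreal (\<nu> B)) = ennreal (LINT x:A|P. k x)"
    "\<And>A. A \<in> sets P \<Longrightarrow> 0 \<le> (LINT x:A|P. k x)" by blast+
  have "\<exists>l. integrable P l \<and> (\<forall>A\<in>sets P. (SUP B\<in>{B \<in> sets P. B \<subseteq> A}. ennreal (- \<nu> B)) =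
      ennreal (LINT x:A|P. l x) \<and> 0 \<le> (LINT x:A|P. l x))"
  proof (rule main)
    show "(\<lambda>i. - \<nu> (A i)) sums - \<nu> (\<Union>i. A i)"
      if "range A \<subseteq> sets P" "disjoint_family A" for A :: "nat \<Rightarrow> 'b set"
      using ca[OF that] by (rule sums_minus)
    show "\<bar>- \<nu> A\<bar> \<le> b" if "A \<in> sets P" for A using b[OF that] by simp
    show "- \<nu> (A \<union> B) = - \<nu> A + - \<nu> B" if "A \<in> sets P" "B \<in> sets P" "A \<inter> B = {}" for A B
      using add[OF that] by simp
    show "- \<nu> A = 0" if "A \<in> null_sets P" for A using ac[OF that] by simp
  qed (simp add: empty)
  then obtain l where l: "integrable P l"
    "\<And>A. A \<in> sets P \<Longrightarrow> (SUP B\<in>{B \<in> sets P. B \<subseteq> A}. ennreal (- \<nu> B)) = ennreal (LINT x:A|P. l x)"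
    "\<And>A. A \<in> sets P \<Longrightarrow> 0 \<le> (LINT x:A|P. l x)" by blast
  have le: "\<nu> B \<le> (LINT x:A|P. k x)" "- \<nu> B \<le> (LINT x:A|P. l x)" if "A \<in> sets P" "B \<in> sets P" "B \<subseteq> A" for A B
  proof -
    have "ennreal (\<nu> B) \<le> ennreal (LINT x:A|P. k x)" "ennreal (- \<nu> B) \<le> ennreal (LINT x:A|P. l x)"
      unfolding k(2)[OF that(1), symmetric] l(2)[OF that(1), symmetric]
      using that by (auto intro!: SUP_upper)
    then show "\<nu> B \<le> (LINT x:A|P. k x)" "- \<nu> B \<le> (LINT x:A|P. l x)"
      using k(3) l(3) that(1) by (auto simp: ennreal_le_iff)
  qed
  \<comment> \<open>For \<open>B \<subseteq> A\<close> the value \<open>\<nu> B\<close> is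
    \<open>\<nu> A - \<nu> (A - B)\<close>, and \<open>- \<nu> (A - B)\<close> is at most the
    negative variation of \<open>A\<close>. Suprema over \<open>B\<close>, here and in the mirrored
    estimate, give the Jordan identity.\<close>
  have upper: "(LINT x:A|P. k x) \<le> \<nu> A + (LINT x:A|P. l x)" "(LINT x:A|P. l x) \<le> - \<nu> A + (LINT x:A|P. k x)"
    if A: "A \<in> sets P" for A
  proof -
    have "\<nu> B \<le> \<nu> A + (LINT x:A|P. l x)" "- \<nu> B \<le> - \<nu> A + (LINT x:A|P. k x)" if B: "B \<in> sets P" "B \<subseteq> A" for B
      using le[OF A, of "A - B"] diff[OF A B] A B by auto
    then have "ennreal (LINT x:A|P. k x) \<le> ennreal (\<nu> A + (LINT x:A|P. l x))"
      "ennreal (LINT x:A|P. l x) \<le> ennreal (- \<nu> A + (LINT x:A|P. k x))"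
      unfolding k(2)[OF A, symmetric] l(2)[OF A, symmetric] by (auto intro!: SUP_least ennreal_leI)
    then show "(LINT x:A|P. k x) \<le> \<nu> A + (LINT x:A|P. l x)" "(LINT x:A|P. l x) \<le> - \<nu> A + (LINT x:A|P. k x)"
      using le[OF A A] by (auto simp: ennreal_le_iff)
  qed
  show ?thesis
  proof (rule that[of "\<lambda>x. k x - l x"])
    show "integrable P (\<lambda>x. k x - l x)" using k(1) l(1) by simp
    fix A assume A: "A \<in> sets P"
    have "(LINT x:A|P. k x - l x) = (LINT x:A|P. k x) - (LINT x:A|P. l x)"
      using integrable_mult_indicator[OF A k(1)] integrable_mult_indicator[OF A l(1)]
      by (intro set_integral_diff) (auto simp: set_integrable_def)
    then show "\<nu> A = (LINT x:A|P. k x - l x)" using upper[OF A] by simp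
  qed
qed

section \<open>Trigonometric averages of polynomials\<close>

definition monom_fun :: "('n::finite \<Rightarrow>\<^sub>0 nat) \<Rightarrow> complex^'n \<Rightarrow> complex" where
  "monom_fun \<alpha> z = (\<Prod>i\<in>UNIV. z $ i ^ Poly_Mapping.lookup \<alpha> i)"

text \<open>\<open>A\<close> only has to contain the support. Keeping the coefficient function apart
  lets a multiplier act on \<open>c\<close> with \<open>A\<close> unchanged.\<close>

definition pol :: "('n::finite \<Rightarrow>\<^sub>0 nat) set \<Rightarrow> (('n \<Rightarrow>\<^sub>0 nat) \<Rightarrow> complex) \<Rightarrow> complex^'n \<Rightarrow> complex" where
  "pol A c z = (\<Sum>\<alpha>\<in>A. c \<alpha> * monom_fun \<alpha> z)"

definition rot :: "'n::finite \<Rightarrow> complex \<Rightarrow> complex^'n \<Rightarrow> complex^'n" where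
  "rot i w z = (\<chi> k. if k = i then w * z $ k else z $ k)"

definition upd :: "complex^'n \<Rightarrow> 'n::finite \<Rightarrow> complex \<Rightarrow> complex^'n" where
  "upd z i w = (\<chi> k. if k = i then w else z $ k)"

lemma eval_poly_eq_pol: "eval_poly p = pol (Poly_Mapping.keys p) (Poly_Mapping.lookup p)"
  by (auto simp: eval_poly_def pol_def monom_fun_def)

lemma monom_fun_zero [simp]: "monom_fun 0 z = 1"
  by (simp add: monom_fun_def)

lemma monom_fun_add: "monom_fun (\<alpha> + \<beta>) z = monom_fun \<alpha> z * monom_fun \<beta> z"
  by (simp add: monom_fun_def lookup_add power_add prod.distrib)

lemma monom_fun_single: "monom_fun (Poly_Mapping.single i k) z = z $ i ^ k"
  by (simp add: monom_fun_def lookup_single when_def prod.delta power_0 if_distrib[of "\<lambda>k. _ ^ k"] cong: if_cong)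

lemma norm_monom_fun_torus: "z \<in> torus \<Longrightarrow> cmod (monom_fun \<alpha> z) = 1"
  by (simp add: monom_fun_def torus_def prod_norm[symmetric] norm_power)

lemma monom_fun_rot: "monom_fun \<alpha> (rot i w z) = w ^ Poly_Mapping.lookup \<alpha> i * monom_fun \<alpha> z"
proof -
  have "monom_fun \<alpha> (rot i w z) = (\<Prod>k\<in>UNIV. (if k = i then w ^ Poly_Mapping.lookup \<alpha> k else 1) * z $ k ^ Poly_Mapping.lookup \<alpha> k)"
    unfolding monom_fun_def rot_def by (intro prod.cong) (auto simp: power_mult_distrib)
  also have "\<dots> = w ^ Poly_Mapping.lookup \<alpha> i * monom_fun \<alpha> z"
    by (simp add: prod.distrib monom_fun_def prod.delta)
  finally show ?thesis .
qed

lemma rot_torus: "z \<in> torus \<Longrightarrow> cmod w = 1 \<Longrightarrow> rot i w z \<in> torus"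
  by (auto simp: torus_def rot_def norm_mult)

lemma pol_empty [simp]: "pol {} c z = 0"
  by (simp add: pol_def)

lemma pol_restrict:
  assumes "finite A" "A' \<subseteq> A" "\<And>\<alpha>. \<alpha> \<in> A - A' \<Longrightarrow> c \<alpha> = 0"
  shows "pol A c z = pol A' c z"
  unfolding pol_def using assms by (intro sum.mono_neutral_right) auto

text \<open>Both exponents lie in one period of length \<open>M\<close>, so the ratio of the
  geometric series is \<open>1\<close> only if they agree. Such finite sums take the place of
  integrals over the circle.\<close>

lemma root_of_unity_sum:
  assumes "a < M" "b < M"
  shows "(\<Sum>s<M. cis (2 * pi * real s / real M) ^ a * cnj (cis (2 * pi * real s / real M)) ^ b) = (if a = b then of_nat M else 0)"
proof -
  define w where "w = cis (2 * pi * (real a - real b) / M)"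
  have M: "M > 0" using assms by simp
  have *: "cis (2 * pi * real s / real M) ^ a * cnj (cis (2 * pi * real s / real M)) ^ b = w ^ s" for s :: nat
  proof -
    have "real a * (2 * pi * real s / real M) + real b * - (2 * pi * real s / real M) =
        real s * (2 * pi * (real a - real b) / real M)"
      using M by (simp add: field_simps)
    then show ?thesis unfolding w_def by (simp only: cis_cnj Complex.DeMoivre cis_mult)
  qed
  show ?thesis
  proof (cases "a = b")
    case True
    then show ?thesis unfolding * by (simp add: w_def)
  next
    case False
    have "w \<noteq> 1"
    proof
      assume "w = 1"
      then have "cos (2 * pi * (real a - real b) / M) = 1"
        by (simp add: w_def complex_eq_iff)
      then obtain n :: int where "2 * pi * (real a - real b) / M = real_of_int n * 2 * pi"
        using cos_one_2pi_int by auto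
      then have "2 * pi * ((real a - real b) / M) = 2 * pi * real_of_int n" by (simp add: mult_ac)
      then have "(real a - real b) / M = real_of_int n" by (subst (asm) mult_left_cancel) auto
      then have "real a - real b = real_of_int n * M"
        using M by (simp add: divide_eq_eq)
      then have "real_of_int (int a - int b) = real_of_int (n * int M)" by simp
      then have eq: "int a - int b = n * int M" by linarith
      then have "n \<noteq> 0" using False by auto
      then have "int M \<le> \<bar>n * int M\<bar>" using mult_right_mono[of 1 "\<bar>n\<bar>" "int M"] by (simp add: abs_mult)
      also have "\<dots> < int M" unfolding eq[symmetric] using assms by linarith
      finally show False by simp
    qed
    moreover have "w ^ M = 1"
    proof -
      have "w ^ M = cis (real M * (2 * pi * (real a - real b) / M))" unfolding w_def by (rule Complex.DeMoivre)
      also have "real M * (2 * pi * (real a - real b) / M) = 2 * pi * (of_int (int a - int b))" using M by simp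
      also have "cis \<dots> = 1" by (rule cis_multiple_2pi) auto
      finally show ?thesis .
    qed
    ultimately show ?thesis unfolding * using False by (simp add: geometric_sum)
  qed
qed

lemma pol_rot_average:
  "(\<Sum>s<M. \<kappa> s * pol A c (rot i (w s) z)) = pol A (\<lambda>\<alpha>. (\<Sum>s<M. \<kappa> s * w s ^ Poly_Mapping.lookup \<alpha> i) * c \<alpha>) z"
proof -
  have "(\<Sum>s<M. \<kappa> s * pol A c (rot i (w s) z)) =
      (\<Sum>s<M. \<Sum>\<alpha>\<in>A. (\<kappa> s * w s ^ Poly_Mapping.lookup \<alpha> i) * c \<alpha> * monom_fun \<alpha> z)"
    by (simp add: pol_def monom_fun_rot sum_distrib_left mult_ac)
  also have "\<dots> = (\<Sum>\<alpha>\<in>A. \<Sum>s<M. (\<kappa> s * w s ^ Poly_Mapping.lookup \<alpha> i) * c \<alpha> * monom_fun \<alpha> z)"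
    by (rule sum.swap)
  also have "\<dots> = pol A (\<lambda>\<alpha>. (\<Sum>s<M. \<kappa> s * w s ^ Poly_Mapping.lookup \<alpha> i) * c \<alpha>) z"
    by (simp add: pol_def sum_distrib_right)
  finally show ?thesis .
qed

text \<open>A multiplier that is a combination of characters of the variable \<open>i\<close> with
  nonnegative weights of sum at most \<open>1\<close> acts as a weighted mean of rotations, and
  rotations preserve the torus. The formula for the multiplier is asked only for the degrees that
  occur in \<open>A\<close>.\<close>

lemma pol_multiplier_bound:
  fixes v :: "nat \<Rightarrow> complex"
  assumes A: "finite A" and B: "\<And>z. z \<in> torus \<Longrightarrow> cmod (pol A c z) \<le> B"
    and w: "\<And>s. cmod (w s) = 1" and \<kappa>: "\<And>s. 0 \<le> \<kappa> s" "(\<Sum>s<M. \<kappa> s) \<le> (1::real)"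
    and v: "\<And>\<alpha>. \<alpha> \<in> A \<Longrightarrow> (\<Sum>s<M. \<kappa> s * w s ^ Poly_Mapping.lookup \<alpha> i) = v (Poly_Mapping.lookup \<alpha> i)"
    and z: "z \<in> torus"
  shows "cmod (pol A (\<lambda>\<alpha>. v (Poly_Mapping.lookup \<alpha> i) * c \<alpha>) z) \<le> B"
proof -
  have B0: "0 \<le> B" using B[OF z] norm_ge_zero order_trans by blast
  have "pol A (\<lambda>\<alpha>. v (Poly_Mapping.lookup \<alpha> i) * c \<alpha>) z = (\<Sum>s<M. complex_of_real (\<kappa> s) * pol A c (rot i (w s) z))"
    unfolding pol_rot_average unfolding pol_def by (intro sum.cong refl) (simp add: v)
  also have "cmod \<dots> \<le> (\<Sum>s<M. \<kappa> s * B)"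
    by (intro sum_norm_le) (auto simp: norm_mult \<kappa>(1) intro!: mult_left_mono B rot_torus z w)
  also have "\<dots> \<le> B" using \<kappa>(2) B0 by (simp add: sum_distrib_right[symmetric] mult_left_le_one_le sum_nonneg \<kappa>)
  finally show ?thesis .
qed

lemma exists_degree_bound:
  fixes A :: "('n::finite \<Rightarrow>\<^sub>0 nat) set"
  assumes "finite A"
  obtains N where "\<And>\<alpha> i. \<alpha> \<in> A \<Longrightarrow> Poly_Mapping.lookup \<alpha> i < N"
proof -
  have "finite ((\<lambda>(\<alpha>, i). Poly_Mapping.lookup \<alpha> i) ` (A \<times> UNIV))" using assms by simp
  then obtain N where "\<And>x. x \<in> (\<lambda>(\<alpha>, i). Poly_Mapping.lookup \<alpha> i) ` (A \<times> UNIV) \<Longrightarrow> x < N"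
    using finite_nat_set_iff_bounded by metis
  then show ?thesis using that by (metis (no_types, lifting) SigmaI UNIV_I case_prod_conv image_eqI)
qed

text \<open>The part of a polynomial free of the variable \<open>i\<close> is its mean over rotations of that variable.\<close>

lemma pol_free_part_bound:
  assumes A: "finite A" and B: "\<And>z. z \<in> torus \<Longrightarrow> cmod (pol A c z) \<le> B" and z: "z \<in> torus"
  shows "cmod (pol {\<alpha>\<in>A. Poly_Mapping.lookup \<alpha> i = 0} c z) \<le> B"
proof -
  obtain N where N: "\<And>\<alpha> i. \<alpha> \<in> A \<Longrightarrow> Poly_Mapping.lookup \<alpha> i < N" using exists_degree_bound[OF A] by metis
  \<comment> \<open>The mean over the \<open>M\<close>-th roots of unity kills every degree that is
    not a multiple of \<open>M\<close>. \<open>M\<close> exceeds all degrees, so only degree 0 is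
    left, and it is positive even for empty \<open>A\<close>.\<close>
  define M where "M = Suc N"
  have "cmod (pol A (\<lambda>\<alpha>. (\<lambda>k. if k = 0 then 1 else 0) (Poly_Mapping.lookup \<alpha> i) * c \<alpha>) z) \<le> B"
  proof (rule pol_multiplier_bound[OF A B])
    show "cmod (cis (2 * pi * real s / real M)) = 1" for s by simp
    show "0 \<le> 1 / real M" for s :: nat by simp
    show "(\<Sum>s<M. 1 / real M) \<le> 1" by (simp add: M_def)
    show "(\<Sum>s<M. complex_of_real (1 / real M) * cis (2 * pi * real s / real M) ^ Poly_Mapping.lookup \<alpha> i) =
        (if Poly_Mapping.lookup \<alpha> i = 0 then 1 else 0)" if "\<alpha> \<in> A" for \<alpha>
    proof -
      have M: "Poly_Mapping.lookup \<alpha> i < M" "0 < M" using N[OF that, of i] by (auto simp: M_def)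
      show ?thesis
        using root_of_unity_sum[OF M] M(2) by (simp add: sum_divide_distrib[symmetric])
    qed
  qed (use z in auto)
  also have "pol A (\<lambda>\<alpha>. (\<lambda>k. if k = 0 then 1 else 0) (Poly_Mapping.lookup \<alpha> i) * c \<alpha>) z = pol {\<alpha>\<in>A. Poly_Mapping.lookup \<alpha> i = 0} c z"
    unfolding pol_def using A by (simp add: sum.inter_filter) (intro sum.cong; simp)
  finally show ?thesis .
qed

section \<open>Fejer and de la Vallee-Poussin multipliers in one variable\<close>

definition fejer :: "nat \<Rightarrow> nat \<Rightarrow> real" where
  "fejer m k = (if k < m then 1 - k / m else 0)"

text \<open>The Fejer kernel is a squared modulus, hence nonnegative. Sampled at sufficiently many
  roots of unity it supplies the weights of a mean of rotations.\<close>

lemma pol_fejer_bound: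
  fixes c :: "('n::finite \<Rightarrow>\<^sub>0 nat) \<Rightarrow> complex"
  assumes A: "finite A" and m: "0 < m" and B: "\<And>z. z \<in> torus \<Longrightarrow> cmod (pol A c z) \<le> B" and z: "z \<in> torus"
  shows "cmod (pol A (\<lambda>\<alpha>. complex_of_real (fejer m (Poly_Mapping.lookup \<alpha> i)) * c \<alpha>) z) \<le> B"
proof -
  obtain N where N: "\<And>\<alpha> i. \<alpha> \<in> A \<Longrightarrow> Poly_Mapping.lookup \<alpha> i < N" using exists_degree_bound[OF A] by metis
  \<comment> \<open>The exponents of \<open>w s\<close> that occur range up to
    \<open>m + N - 2\<close>; with \<open>m + N\<close> nodes none of them aliases.\<close>
  define M where "M = m + N"
  define w where "w s = cis (2 * pi * real s / real M)" for s :: nat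
  define F where "F s = (cmod (\<Sum>a<m. w s ^ a))\<^sup>2 / (m * M)" for s
  have M: "0 < M" using m by (simp add: M_def)
  have F: "complex_of_real (F s) = (\<Sum>a<m. \<Sum>b<m. w s ^ a * cnj (w s) ^ b) / (m * M)" for s
  proof -
    have "complex_of_real ((cmod (\<Sum>a<m. w s ^ a))\<^sup>2) = (\<Sum>a<m. w s ^ a) * (\<Sum>b<m. cnj (w s) ^ b)"
      by (simp only: complex_norm_square cnj_sum complex_cnj_power)
    then show ?thesis unfolding F_def by (simp add: sum_product)
  qed
  have key: "(\<Sum>s<M. complex_of_real (F s) * w s ^ k) = fejer m k" if k: "k < N" for k
  proof -
    have "(\<Sum>s<M. complex_of_real (F s) * w s ^ k) =
        (\<Sum>s<M. \<Sum>a<m. \<Sum>b<m. w s ^ (a + k) * cnj (w s) ^ b) / (m * M)"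
      unfolding F times_divide_eq_left sum_divide_distrib[symmetric]
      by (simp only: sum_distrib_right sum_distrib_left power_add mult_ac)
    also have "(\<Sum>s<M. \<Sum>a<m. \<Sum>b<m. w s ^ (a + k) * cnj (w s) ^ b) =
        (\<Sum>a<m. \<Sum>b<m. \<Sum>s<M. w s ^ (a + k) * cnj (w s) ^ b)"
      by (subst sum.swap, subst sum.swap[of _ "{..<M}"], rule refl)
    also have "\<dots> = (\<Sum>a<m. \<Sum>b<m. if a + k = b then of_nat M else 0)"
      using k unfolding w_def by (intro sum.cong refl root_of_unity_sum) (auto simp: M_def)
    also have "\<dots> = (\<Sum>a<m. if a + k < m then of_nat M else 0)"
      by (intro sum.cong refl) (simp add: sum.delta')
    also have "\<dots> = of_nat M * of_nat (m - k)"
    proof -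
      have "{a\<in>{..<m}. a + k < m} = {..<m - k}" by auto
      then show ?thesis by (subst sum.inter_filter[symmetric]) simp_all
    qed
    also have "of_nat M * of_nat (m - k) / of_nat (m * M) = complex_of_real (fejer m k)"
      using m M by (simp add: fejer_def of_nat_diff field_simps)
    finally show ?thesis by simp
  qed
  show ?thesis
  proof (rule pol_multiplier_bound[OF A B, where v = "\<lambda>k. complex_of_real (fejer m k)" and \<kappa> = F])
    show "cmod (w s) = 1" for s by (simp add: w_def)
    show "0 \<le> F s" for s by (simp add: F_def)
    show "(\<Sum>s<M. F s) \<le> 1"
    \<comment> \<open>The total weight is \<open>key\<close> at degree 0, which is accessible only
      if 0 lies below the degree bound \<open>N\<close>.\<close>
    proof (cases "N = 0")
      case True
      have "complex_of_real (\<Sum>s<M. F s) = (\<Sum>s<M. \<Sum>a<m. \<Sum>b<m. w s ^ a * cnj (w s) ^ b) / (m * M)"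
        by (simp add: F sum_divide_distrib)
      also have "(\<Sum>s<M. \<Sum>a<m. \<Sum>b<m. w s ^ a * cnj (w s) ^ b) =
          (\<Sum>a<m. \<Sum>b<m. \<Sum>s<M. w s ^ a * cnj (w s) ^ b)"
        by (subst sum.swap, subst sum.swap[of _ "{..<M}"], rule refl)
      also have "\<dots> = (\<Sum>a<m. \<Sum>b<m. if a = b then of_nat M else 0)"
        unfolding w_def by (intro sum.cong refl root_of_unity_sum) (auto simp: M_def)
      also have "\<dots> = of_nat (m * M)" by (simp add: sum.delta')
      also have "of_nat (m * M) / of_nat (m * M) = complex_of_real 1" using m M by simp
      finally show ?thesis using of_real_eq_iff by (metis order_refl)
    next
      case False
      then have "complex_of_real (\<Sum>s<M. F s) = complex_of_real 1"
        using key[of 0] m by (simp add: fejer_def)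
      then show ?thesis using of_real_eq_iff by (metis order_refl)
    qed
    show "(\<Sum>s<M. complex_of_real (F s) * w s ^ Poly_Mapping.lookup \<alpha> i) = complex_of_real (fejer m (Poly_Mapping.lookup \<alpha> i))"
      if "\<alpha> \<in> A" for \<alpha> using key N that by blast
  qed (use z in auto)
qed

text \<open>A trapezoid: constantly \<open>1\<close> up to \<open>m\<close> and \<open>0\<close>
  from \<open>2 * m\<close> on. As a combination of two Fejer multipliers with weights
  \<open>2\<close> and \<open>-1\<close> it costs a factor of \<open>3\<close> in the sup norm,
  whatever \<open>m\<close> is.\<close>

definition vallee_poussin :: "nat \<Rightarrow> nat \<Rightarrow> real" where
  "vallee_poussin m k = 2 * fejer (2 * m) k - fejer m k"

lemma vallee_poussin_eq_1: "k \<le> m \<Longrightarrow> 0 < m \<Longrightarrow> vallee_poussin m k = 1"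
  by (auto simp: vallee_poussin_def fejer_def field_simps)

lemma vallee_poussin_eq_0: "2 * m \<le> k \<Longrightarrow> vallee_poussin m k = 0"
  by (auto simp: vallee_poussin_def fejer_def)

lemma vallee_poussin_bounds: "0 \<le> vallee_poussin m k" "vallee_poussin m k \<le> 1"
  by (auto simp: vallee_poussin_def fejer_def field_simps)

lemma pol_vallee_poussin_bound:
  fixes c :: "('n::finite \<Rightarrow>\<^sub>0 nat) \<Rightarrow> complex"
  assumes A: "finite A" and m: "0 < m" and B: "\<And>z. z \<in> torus \<Longrightarrow> cmod (pol A c z) \<le> B" and z: "z \<in> torus"
  shows "cmod (pol A (\<lambda>\<alpha>. complex_of_real (vallee_poussin m (Poly_Mapping.lookup \<alpha> i)) * c \<alpha>) z) \<le> 3 * B"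
proof -
  have "pol A (\<lambda>\<alpha>. complex_of_real (vallee_poussin m (Poly_Mapping.lookup \<alpha> i)) * c \<alpha>) z =
      2 * pol A (\<lambda>\<alpha>. complex_of_real (fejer (2 * m) (Poly_Mapping.lookup \<alpha> i)) * c \<alpha>) z - pol A (\<lambda>\<alpha>. complex_of_real (fejer m (Poly_Mapping.lookup \<alpha> i)) * c \<alpha>) z"
    by (simp add: pol_def vallee_poussin_def sum_distrib_left sum_subtractf[symmetric] algebra_simps)
  also have "cmod \<dots> \<le> cmod (2 * pol A (\<lambda>\<alpha>. complex_of_real (fejer (2 * m) (Poly_Mapping.lookup \<alpha> i)) * c \<alpha>) z) + cmod (pol A (\<lambda>\<alpha>. complex_of_real (fejer m (Poly_Mapping.lookup \<alpha> i)) * c \<alpha>) z)"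
    by (rule norm_triangle_ineq4)
  also have "\<dots> \<le> 2 * B + B"
    using pol_fejer_bound[OF A _ B z, of "2 * m" i] pol_fejer_bound[OF A m B z, of i] m
    by (intro add_mono) (auto simp: norm_mult)
  finally show ?thesis by simp
qed

section \<open>Coefficients and the value at 0 as averages over grids of roots of unity\<close>

lemma pol_coeff_average:
  fixes A :: "('n::finite \<Rightarrow>\<^sub>0 nat) set"
  assumes A: "finite A" and M: "\<And>\<alpha> i. \<alpha> \<in> A \<Longrightarrow> Poly_Mapping.lookup \<alpha> i < M" and \<beta>: "\<And>i. Poly_Mapping.lookup \<beta> i < M"
  shows "(\<Sum>s\<in>UNIV \<rightarrow>\<^sub>E {..<M}. pol A c (\<chi> i. cis (2 * pi * real (s i) / M)) *
      cnj (monom_fun \<beta> (\<chi> i. cis (2 * pi * real (s i) / M)))) = (if \<beta> \<in> A then c \<beta> else 0) * of_nat M ^ CARD('n)"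
proof -
  define e :: "nat \<Rightarrow> complex" where "e t = cis (2 * pi * real t / M)" for t
  have *: "(\<Sum>s\<in>UNIV \<rightarrow>\<^sub>E {..<M}. monom_fun \<alpha> (\<chi> i. e (s i)) * cnj (monom_fun \<beta> (\<chi> i. e (s i)))) =
      (if \<alpha> = \<beta> then of_nat M ^ CARD('n) else 0)" if \<alpha>: "\<alpha> \<in> A" for \<alpha>
  proof -
    have "(\<Sum>s\<in>UNIV \<rightarrow>\<^sub>E {..<M}. monom_fun \<alpha> (\<chi> i. e (s i)) * cnj (monom_fun \<beta> (\<chi> i. e (s i)))) =
        (\<Sum>s\<in>UNIV \<rightarrow>\<^sub>E {..<M}. \<Prod>i\<in>UNIV. e (s i) ^ Poly_Mapping.lookup \<alpha> i * cnj (e (s i)) ^ Poly_Mapping.lookup \<beta> i)"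
      by (simp add: monom_fun_def prod.distrib cnj_prod)
    also have "\<dots> = (\<Prod>i\<in>(UNIV::'n set). \<Sum>t<M. e t ^ Poly_Mapping.lookup \<alpha> i * cnj (e t) ^ Poly_Mapping.lookup \<beta> i)"
      by (rule prod_sum_PiE[symmetric]) auto
    also have "\<dots> = (\<Prod>i\<in>(UNIV::'n set). if Poly_Mapping.lookup \<alpha> i = Poly_Mapping.lookup \<beta> i then of_nat M else 0)"
      unfolding e_def by (intro prod.cong refl root_of_unity_sum M \<alpha> \<beta>)
    also have "\<dots> = (if \<alpha> = \<beta> then of_nat M ^ CARD('n) else 0)"
    proof (cases "\<alpha> = \<beta>")
      case False
      then obtain i where "Poly_Mapping.lookup \<alpha> i \<noteq> Poly_Mapping.lookup \<beta> i" by (metis poly_mapping_eqI)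
      then show ?thesis using False by auto
    qed simp
    finally show ?thesis .
  qed
  have "(\<Sum>s\<in>UNIV \<rightarrow>\<^sub>E {..<M}. pol A c (\<chi> i. e (s i)) * cnj (monom_fun \<beta> (\<chi> i. e (s i)))) =
      (\<Sum>s\<in>UNIV \<rightarrow>\<^sub>E {..<M}. \<Sum>\<alpha>\<in>A. c \<alpha> * (monom_fun \<alpha> (\<chi> i. e (s i)) * cnj (monom_fun \<beta> (\<chi> i. e (s i)))))"
    by (simp add: pol_def sum_distrib_right sum_distrib_left mult_ac)
  also have "\<dots> = (\<Sum>\<alpha>\<in>A. c \<alpha> * (\<Sum>s\<in>UNIV \<rightarrow>\<^sub>E {..<M}. monom_fun \<alpha> (\<chi> i. e (s i)) * cnj (monom_fun \<beta> (\<chi> i. e (s i)))))"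
    by (simp only: sum_distrib_left) (rule sum.swap)
  also have "\<dots> = (\<Sum>\<alpha>\<in>A. if \<alpha> = \<beta> then c \<beta> * of_nat M ^ CARD('n) else 0)"
    by (intro sum.cong refl) (simp add: *)
  also have "\<dots> = (if \<beta> \<in> A then c \<beta> else 0) * of_nat M ^ CARD('n)"
    using A by simp
  finally show ?thesis by (simp add: e_def)
qed

lemma pol_at_zero:
  assumes "finite A"
  shows "pol A c (0 :: complex^'n::finite) = (if 0 \<in> A then c 0 else 0)"
proof -
  have "monom_fun \<alpha> 0 = (if \<alpha> = 0 then 1 else 0)" for \<alpha> :: "'n \<Rightarrow>\<^sub>0 nat"
  proof (cases "\<alpha> = 0")
    case False
    then obtain i where "Poly_Mapping.lookup \<alpha> i \<noteq> 0" by (metis lookup_zero poly_mapping_eqI)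
    then have "monom_fun \<alpha> 0 = 0" unfolding monom_fun_def by (intro prod_zero) (auto intro!: bexI[of _ i])
    then show ?thesis using False by simp
  qed simp
  then have "pol A c 0 = (\<Sum>\<alpha>\<in>A. if \<alpha> = 0 then c 0 else 0)"
    unfolding pol_def by (intro sum.cong) auto
  then show ?thesis using assms by simp
qed

lemma pol_at_zero_bound:
  assumes A: "finite A" and B: "\<And>z. z \<in> torus \<Longrightarrow> cmod (pol A c z) \<le> B"
  shows "cmod (pol A c (0 :: complex^'n::finite)) \<le> B"
proof -
  obtain M where M: "\<And>\<alpha> i. \<alpha> \<in> A \<Longrightarrow> Poly_Mapping.lookup \<alpha> i < M" using exists_degree_bound[OF A] by metis
  define N where "N = Suc M"
  have N: "\<And>\<alpha> i. \<alpha> \<in> A \<Longrightarrow> Poly_Mapping.lookup \<alpha> i < N" using M by (auto simp: N_def less_Suc_eq)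
  define e :: "('n \<Rightarrow> nat) \<Rightarrow> complex^'n" where "e s = (\<chi> i. cis (2 * pi * real (s i) / N))" for s
  have "(\<Sum>s\<in>UNIV \<rightarrow>\<^sub>E {..<N}. pol A c (e s)) = pol A c 0 * of_nat N ^ CARD('n)"
    using pol_coeff_average[of A N 0 c] A N by (simp add: pol_at_zero e_def N_def)
  moreover have "cmod (\<Sum>s\<in>UNIV \<rightarrow>\<^sub>E {..<N}. pol A c (e s)) \<le> of_nat (card ((UNIV :: 'n set) \<rightarrow>\<^sub>E {..<N})) * B"
    by (intro sum_norm_bound B) (auto simp: e_def torus_def)
  ultimately have "cmod (pol A c 0) * real N ^ CARD('n) \<le> real N ^ CARD('n) * B"
    by (simp add: norm_mult norm_power card_PiE)
  then show ?thesis by (simp add: N_def)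
qed

text \<open>For \<open>\<beta> \<noteq> 0\<close> the conjugate of the polynomial contributes
  nothing to the coefficient at \<open>\<beta>\<close>, so \<open>c \<beta>\<close> is an average of
  twice the real part times a unimodular factor. A real \<open>x \<ge> - \<eta>\<close> satisfies
  \<open>\<bar>2 * x\<bar> \<le> 2 * x + 4 * \<eta>\<close>, and the average of the real part is its
  value at 0.\<close>

lemma pol_coeff_bound:
  assumes A: "finite A" and re: "\<And>z. z \<in> torus \<Longrightarrow> - \<eta> \<le> Re (pol A c z)" and \<beta>: "\<beta> \<in> A"
    and \<eta>: "0 \<le> \<eta>"
  shows "cmod (c \<beta>) \<le> 2 * cmod (pol A c (0 :: complex^'n::finite)) + 4 * \<eta>"
proof (cases "\<beta> = 0")
  case True
  then show ?thesis using A \<beta> \<eta> by (simp add: pol_at_zero)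
next
  case False
  obtain M where M: "\<And>\<alpha> i. \<alpha> \<in> A \<Longrightarrow> Poly_Mapping.lookup \<alpha> i < M" using exists_degree_bound[OF A] by metis
  \<comment> \<open>Products with \<open>monom_fun \<beta>\<close> double the range of degrees; they
    must not alias to degree 0.\<close>
  define N where "N = Suc (2 * M)"
  have N: "Poly_Mapping.lookup \<alpha> i < N" if "\<alpha> \<in> A" for \<alpha> i using M[OF that, of i] by (simp add: N_def)
  define e :: "('n \<Rightarrow> nat) \<Rightarrow> complex^'n" where "e s = (\<chi> i. cis (2 * pi * real (s i) / N))" for s
  define S where "S = ((UNIV :: 'n set) \<rightarrow>\<^sub>E {..<N})"
  have S: "finite S" "card S = N ^ CARD('n)" unfolding S_def by (auto simp: finite_PiE card_PiE)
  have eT: "e s \<in> torus" for s by (simp add: e_def torus_def)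
  have 1: "(\<Sum>s\<in>S. pol A c (e s) * cnj (monom_fun \<beta> (e s))) = c \<beta> * of_nat N ^ CARD('n)"
    using pol_coeff_average[of A N \<beta> c] A N \<beta> by (simp add: e_def S_def)
  have 2: "(\<Sum>s\<in>S. cnj (pol A c (e s)) * cnj (monom_fun \<beta> (e s))) = 0"
  proof -
    have "(\<Sum>s\<in>S. pol A c (e s) * monom_fun \<beta> (e s)) = (\<Sum>s\<in>S. pol ((\<lambda>\<alpha>. \<alpha> + \<beta>) ` A) (\<lambda>\<alpha>. c (\<alpha> - \<beta>)) (e s))"
      unfolding pol_def by (subst sum.reindex) (auto simp: monom_fun_add sum_distrib_right sum_distrib_left mult_ac inj_on_def)
    also have "\<dots> = 0"
    proof -
      have "\<And>\<alpha> i. \<alpha> \<in> (\<lambda>\<alpha>. \<alpha> + \<beta>) ` A \<Longrightarrow> Poly_Mapping.lookup \<alpha> i < N"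
      proof (clarsimp simp: lookup_add N_def)
        fix \<alpha> i assume "\<alpha> \<in> A"
        then show "Poly_Mapping.lookup \<alpha> i + Poly_Mapping.lookup \<beta> i < Suc (2 * M)"
          using M[of \<alpha> i] M[OF \<beta>, of i] by linarith
      qed
      moreover have "0 \<notin> (\<lambda>\<alpha>. \<alpha> + \<beta>) ` A"
      proof
        assume "0 \<in> (\<lambda>\<alpha>. \<alpha> + \<beta>) ` A"
        then obtain \<alpha> where "\<alpha> + \<beta> = 0" by auto
        then have "Poly_Mapping.lookup \<beta> i = 0" for i by (metis add_is_0 lookup_add lookup_zero)
        then show False using False by (metis lookup_zero poly_mapping_eqI)
      qed
      ultimately show ?thesis
        using pol_coeff_average[of "(\<lambda>\<alpha>. \<alpha> + \<beta>) ` A" N 0] A by (simp add: e_def S_def N_def)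
    qed
    finally have "cnj (\<Sum>s\<in>S. pol A c (e s) * monom_fun \<beta> (e s)) = 0" by simp
    then show ?thesis by simp
  qed
  have 3: "(\<Sum>s\<in>S. pol A c (e s)) = pol A c 0 * of_nat N ^ CARD('n)"
    using pol_coeff_average[of A N 0 c] A N by (simp add: pol_at_zero e_def N_def S_def)
  have "c \<beta> * of_nat N ^ CARD('n) = (\<Sum>s\<in>S. (pol A c (e s) + cnj (pol A c (e s))) * cnj (monom_fun \<beta> (e s)))"
    using 1 2 by (simp add: distrib_right sum.distrib)
  also have "cmod \<dots> \<le> (\<Sum>s\<in>S. 2 * Re (pol A c (e s)) + 4 * \<eta>)"
  proof (rule sum_norm_le)
    fix s assume "s \<in> S"
    have "cmod ((pol A c (e s) + cnj (pol A c (e s))) * cnj (monom_fun \<beta> (e s))) = \<bar>2 * Re (pol A c (e s))\<bar>"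
      using norm_monom_fun_torus[OF eT] by (simp add: norm_mult complex_add_cnj)
    also have "\<dots> \<le> 2 * Re (pol A c (e s)) + 4 * \<eta>" using re[OF eT, of s] \<eta> by linarith
    finally show "cmod ((pol A c (e s) + cnj (pol A c (e s))) * cnj (monom_fun \<beta> (e s))) \<le> 2 * Re (pol A c (e s)) + 4 * \<eta>" .
  qed
  also have "\<dots> = 2 * Re (\<Sum>s\<in>S. pol A c (e s)) + card S * (4 * \<eta>)"
    by (simp add: sum.distrib sum_distrib_left)
  also have "\<dots> = (2 * Re (pol A c 0) + 4 * \<eta>) * real N ^ CARD('n)"
    unfolding 3 S(2) by (simp add: algebra_simps flip: of_nat_power)
  also have "\<dots> \<le> (2 * cmod (pol A c 0) + 4 * \<eta>) * real N ^ CARD('n)"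
    using complex_Re_le_cmod[of "pol A c 0"] by (intro mult_right_mono) auto
  finally have "cmod (c \<beta>) * real N ^ CARD('n) \<le> (2 * cmod (pol A c 0) + 4 * \<eta>) * real N ^ CARD('n)"
    by (simp add: norm_mult norm_power)
  then show ?thesis by (simp add: N_def)
qed

section \<open>The polydisc algebra\<close>

text \<open>Functions instead of formal polynomials: closure under sums and shifts becomes a
  statement about values. \<open>is_pol_iff\<close> is the link to \<open>eval_poly\<close>.\<close>

definition is_pol :: "(complex^'n::finite \<Rightarrow> complex) \<Rightarrow> bool" where
  "is_pol f \<longleftrightarrow> (\<exists>A c. finite A \<and> f = pol A c)"

lemma is_pol_pol: "finite A \<Longrightarrow> is_pol (pol A c)"
  by (auto simp: is_pol_def)

lemma is_pol_const: "is_pol (\<lambda>_. a)"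
  unfolding is_pol_def by (rule exI[of _ "{0}"], rule exI[of _ "\<lambda>_. a"]) (auto simp: pol_def fun_eq_iff)

lemma is_pol_add:
  assumes "is_pol f" "is_pol g"
  shows "is_pol (\<lambda>z. f z + g z)"
proof -
  obtain A c where f: "finite A" "f = pol A c" using assms by (auto simp: is_pol_def)
  obtain A' c' where g: "finite A'" "g = pol A' c'" using assms by (auto simp: is_pol_def)
  define d where "d \<alpha> = (if \<alpha> \<in> A then c \<alpha> else 0)" for \<alpha>
  define d' where "d' \<alpha> = (if \<alpha> \<in> A' then c' \<alpha> else 0)" for \<alpha>
  have "f z = pol (A \<union> A') d z" for z
    unfolding f(2) pol_def using f(1) g(1) by (intro sum.mono_neutral_cong_left) (auto simp: d_def)
  moreover have "g z = pol (A \<union> A') d' z" for z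
    unfolding g(2) pol_def using f(1) g(1) by (intro sum.mono_neutral_cong_left) (auto simp: d'_def)
  ultimately have "(\<lambda>z. f z + g z) = pol (A \<union> A') (\<lambda>\<alpha>. d \<alpha> + d' \<alpha>)"
    by (simp add: fun_eq_iff pol_def sum.distrib algebra_simps)
  then show ?thesis using is_pol_pol[of "A \<union> A'"] f(1) g(1) by simp
qed

lemma is_pol_sum: "finite I \<Longrightarrow> (\<And>i. i \<in> I \<Longrightarrow> is_pol (f i)) \<Longrightarrow> is_pol (\<lambda>z. \<Sum>i\<in>I. f i z)"
  by (induction I rule: finite_induct) (auto intro: is_pol_add is_pol_const)

lemma pol_shift: "pol ((\<lambda>\<alpha>. \<alpha> + \<beta>) ` A) (\<lambda>\<alpha>. c (\<alpha> - \<beta>)) z = pol A c z * monom_fun \<beta> z"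
  unfolding pol_def by (subst sum.reindex) (auto simp: monom_fun_add sum_distrib_right sum_distrib_left mult_ac inj_on_def)

lemma is_pol_mult_monom:
  assumes "is_pol f"
  shows "is_pol (\<lambda>z. f z * monom_fun \<beta> z)"
proof -
  obtain A c where A: "finite A" "f = pol A c" using assms by (auto simp: is_pol_def)
  have "(\<lambda>z. f z * monom_fun \<beta> z) = pol ((\<lambda>\<alpha>. \<alpha> + \<beta>) ` A) (\<lambda>\<alpha>. c (\<alpha> - \<beta>))"
    by (simp add: A(2) pol_shift fun_eq_iff)
  then show ?thesis using is_pol_pol[of "(\<lambda>\<alpha>. \<alpha> + \<beta>) ` A"] A(1) by simp
qed

lemma is_pol_power_mult: "is_pol f \<Longrightarrow> is_pol (\<lambda>z. f z * z $ i ^ k)"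
  using is_pol_mult_monom[of f "Poly_Mapping.single i k"] by (simp add: monom_fun_single)

lemma pol_eq_eval_poly:
  assumes "finite A"
  shows "pol A c = eval_poly (\<Sum>\<alpha>\<in>A. Poly_Mapping.single \<alpha> (c \<alpha>))"
proof -
  define p where "p = (\<Sum>\<alpha>\<in>A. Poly_Mapping.single \<alpha> (c \<alpha>))"
  have p: "Poly_Mapping.lookup p \<alpha> = (if \<alpha> \<in> A then c \<alpha> else 0)" for \<alpha>
    unfolding p_def using assms by (simp add: lookup_sum lookup_single when_def)
  then have "Poly_Mapping.keys p \<subseteq> A" by (auto simp: in_keys_iff split: if_splits)
  then have "pol A (Poly_Mapping.lookup p) z = pol (Poly_Mapping.keys p) (Poly_Mapping.lookup p) z" for z
    using assms by (intro pol_restrict) (auto simp: in_keys_iff)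
  moreover have "pol A (Poly_Mapping.lookup p) z = pol A c z" for z
    unfolding pol_def by (intro sum.cong) (auto simp: p)
  ultimately show ?thesis by (simp add: fun_eq_iff eval_poly_eq_pol p_def)
qed

lemma is_pol_iff: "is_pol f \<longleftrightarrow> (\<exists>p. f = eval_poly p)"
proof
  assume "is_pol f"
  then show "\<exists>p. f = eval_poly p" using pol_eq_eval_poly by (auto simp: is_pol_def)
next
  assume "\<exists>p. f = eval_poly p"
  then show "is_pol f" by (auto simp: eval_poly_eq_pol intro: is_pol_pol)
qed

section \<open>The closed polydisc, the torus and closure properties of the algebra\<close>

lemma closure_polydisc: "closure (polydisc :: (complex^'n::finite) set) = {z. \<forall>i. cmod (z $ i) \<le> 1}"
proof (rule antisym)
  have "closed {z :: complex^'n. \<forall>i. cmod (z $ i) \<le> 1}"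
    by (intro closed_Collect_all closed_Collect_le continuous_intros)
  then show "closure polydisc \<subseteq> {z :: complex^'n. \<forall>i. cmod (z $ i) \<le> 1}"
    by (intro closure_minimal) (auto simp: polydisc_def less_imp_le)
  show "{z :: complex^'n. \<forall>i. cmod (z $ i) \<le> 1} \<subseteq> closure polydisc"
  proof
    fix z :: "complex^'n" assume z: "z \<in> {z. \<forall>i. cmod (z $ i) \<le> 1}"
    show "z \<in> closure polydisc"
      unfolding closure_approachable
    proof (intro allI impI)
      fix e :: real assume e: "0 < e"
      \<comment> \<open>Shrinking by the factor \<open>1 - t\<close> moves \<open>z\<close> by
        \<open>t * norm z\<close>. The divisor is \<open>norm z + 1\<close> because \<open>z\<close>
        may be 0.\<close>
      define t where "t = min (1 / 2) (e / (norm z + 1) / 2)"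
      have n: "0 < norm z + 1" using norm_ge_zero[of z] by linarith
      have t: "0 < t" "t < 1" "t * (norm z + 1) < e"
      proof -
        show "0 < t" using e n by (simp add: t_def)
        have "t \<le> 1 / 2" unfolding t_def by (rule min.cobounded1)
        then show "t < 1" by simp
        have "t \<le> e / (norm z + 1) / 2" unfolding t_def by (rule min.cobounded2)
        then have "t * (norm z + 1) \<le> e / (norm z + 1) / 2 * (norm z + 1)"
          using n by (intro mult_right_mono) auto
        also have "\<dots> = e / 2"
        proof -
          have "e / m / 2 * m = e / 2" if "0 < m" for m :: real using that by simp
          then show ?thesis using n .
        qed
        finally show "t * (norm z + 1) < e" using e by simp
      qed
      have "(1 - t) *\<^sub>R z \<in> polydisc"
        unfolding polydisc_def
      proof (clarify)
        fix i
        have "cmod (((1 - t) *\<^sub>R z) $ i) = (1 - t) * cmod (z $ i)" using t by simp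
        also have "\<dots> \<le> (1 - t) * 1" using t z by (intro mult_left_mono) auto
        also have "\<dots> < 1" using t by simp
        finally show "cmod (((1 - t) *\<^sub>R z) $ i) < 1" .
      qed
      moreover have "dist ((1 - t) *\<^sub>R z) z < e"
      proof -
        have "(1 - t) *\<^sub>R z - z = - (t *\<^sub>R z)" by (simp add: algebra_simps)
        then have "dist ((1 - t) *\<^sub>R z) z = t * norm z" using t by (simp add: dist_norm)
        also have "\<dots> \<le> t * (norm z + 1)" using t by (intro mult_left_mono) auto
        finally show ?thesis using t by simp
      qed
      ultimately show "\<exists>y\<in>polydisc. dist y z < e" by blast
    qed
  qed
qed

lemma norm_le_card:
  fixes z :: "complex^'n::finite"
  assumes "\<And>i. cmod (z $ i) \<le> 1"
  shows "norm z \<le> CARD('n)"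
proof -
  have "norm z \<le> (\<Sum>i\<in>UNIV. cmod (z $ i))" unfolding norm_vec_def by (rule L2_set_le_sum) simp
  also have "\<dots> \<le> (\<Sum>i\<in>(UNIV :: 'n set). 1)" using assms by (intro sum_mono)
  finally show ?thesis by simp
qed

lemma compact_closure_polydisc: "compact (closure (polydisc :: (complex^'n::finite) set))"
proof -
  have "bounded (closure (polydisc :: (complex^'n::finite) set))"
    unfolding bounded_iff closure_polydisc using norm_le_card by blast
  then show ?thesis by (simp add: compact_eq_bounded_closed)
qed

lemma torus_subset_closure: "torus \<subseteq> closure (polydisc :: (complex^'n::finite) set)"
  by (auto simp: closure_polydisc torus_def)

lemma compact_torus: "compact (torus :: (complex^'n::finite) set)"
proof -
  have "closed (torus :: (complex^'n) set)"
    unfolding torus_def by (intro closed_Collect_all closed_Collect_eq continuous_intros)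
  moreover have "bounded (torus :: (complex^'n::finite) set)"
    by (rule bounded_subset[OF compact_imp_bounded[OF compact_closure_polydisc] torus_subset_closure])
  ultimately show ?thesis by (simp add: compact_eq_bounded_closed)
qed

lemma torus_nonempty: "(torus :: (complex^'n::finite) set) \<noteq> {}"
proof -
  have "(\<chi> i. 1) \<in> (torus :: (complex^'n) set)" by (simp add: torus_def)
  then show ?thesis by blast
qed

lemma zero_in_polydisc: "0 \<in> (polydisc :: (complex^'n::finite) set)"
  by (simp add: polydisc_def)

lemma polydisc_algebra_const: "(\<lambda>_. a) \<in> polydisc_algebra"
  by (auto simp: polydisc_algebra_def holomorphic_at_def intro!: exI[of _ "\<lambda>_. 0"] derivative_eq_intros)

lemma polydisc_algebra_nth: "(\<lambda>z :: complex^'n::finite. z $ i) \<in> polydisc_algebra"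
proof -
  have "((\<lambda>z. z $ i) has_derivative (\<lambda>v. v $ i)) (at z)" for z :: "complex^'n"
    by (rule bounded_linear_imp_has_derivative) (rule bounded_linear_vec_nth)
  then show ?thesis
    by (auto simp: polydisc_algebra_def holomorphic_at_def intro!: exI[of _ "\<lambda>v. v $ i"] continuous_intros)
qed

lemma polydisc_algebra_add:
  assumes "u \<in> polydisc_algebra" "v \<in> polydisc_algebra"
  shows "(\<lambda>z. u z + v z) \<in> polydisc_algebra"
proof -
  have "holomorphic_at (\<lambda>z. u z + v z) z" if z: "z \<in> polydisc" for z
  proof -
    obtain D where D: "(u has_derivative D) (at z)" "\<And>c v. D (c *s v) = c * D v"
      using assms(1) z by (auto simp: polydisc_algebra_def holomorphic_at_def)
    obtain E where E: "(v has_derivative E) (at z)" "\<And>c v. E (c *s v) = c * E v"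
      using assms(2) z by (auto simp: polydisc_algebra_def holomorphic_at_def)
    show ?thesis
      unfolding holomorphic_at_def using has_derivative_add[OF D(1) E(1)] D(2) E(2)
      by (intro exI[of _ "\<lambda>h. D h + E h"]) (simp add: distrib_left)
  qed
  then show ?thesis using assms by (auto simp: polydisc_algebra_def intro: continuous_on_add)
qed

lemma polydisc_algebra_mult:
  assumes "u \<in> polydisc_algebra" "v \<in> polydisc_algebra"
  shows "(\<lambda>z. u z * v z) \<in> polydisc_algebra"
proof -
  have "holomorphic_at (\<lambda>z. u z * v z) z" if z: "z \<in> polydisc" for z
  proof -
    obtain D where D: "(u has_derivative D) (at z)" "\<And>c v. D (c *s v) = c * D v"
      using assms(1) z by (auto simp: polydisc_algebra_def holomorphic_at_def)
    obtain E where E: "(v has_derivative E) (at z)" "\<And>c v. E (c *s v) = c * E v"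
      using assms(2) z by (auto simp: polydisc_algebra_def holomorphic_at_def)
    show ?thesis
      unfolding holomorphic_at_def using has_derivative_mult[OF D(1) E(1)] D(2) E(2)
      by (intro exI[of _ "\<lambda>h. u z * E h + D h * v z"]) (simp add: algebra_simps)
  qed
  then show ?thesis using assms by (auto simp: polydisc_algebra_def intro: continuous_on_mult)
qed

lemma polydisc_algebra_exp:
  assumes "u \<in> polydisc_algebra"
  shows "(\<lambda>z. exp (u z)) \<in> polydisc_algebra"
proof -
  have "holomorphic_at (\<lambda>z. exp (u z)) z" if z: "z \<in> polydisc" for z
  proof -
    obtain D where D: "(u has_derivative D) (at z)" "\<And>c v. D (c *s v) = c * D v"
      using assms(1) z by (auto simp: polydisc_algebra_def holomorphic_at_def)
    have "(exp has_derivative (\<lambda>h. exp (u z) * h)) (at (u z))"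
      using DERIV_exp[of "u z"] by (simp add: has_field_derivative_def)
    from has_derivative_compose[OF D(1) this]
    show ?thesis
      unfolding holomorphic_at_def using D(2)
      by (intro exI[of _ "\<lambda>h. exp (u z) * D h"]) simp
  qed
  then show ?thesis using assms by (auto simp: polydisc_algebra_def intro: continuous_on_exp)
qed

lemma polydisc_algebra_cmult: "u \<in> polydisc_algebra \<Longrightarrow> (\<lambda>z. a * u z) \<in> polydisc_algebra"
  by (rule polydisc_algebra_mult[OF polydisc_algebra_const])

lemma polydisc_algebra_diff:
  assumes "u \<in> polydisc_algebra" "v \<in> polydisc_algebra"
  shows "(\<lambda>z. u z - v z) \<in> polydisc_algebra"
  using polydisc_algebra_add[OF assms(1) polydisc_algebra_cmult[OF assms(2), of "-1"]] by simp

lemma polydisc_algebra_power: "u \<in> polydisc_algebra \<Longrightarrow> (\<lambda>z. u z ^ k) \<in> polydisc_algebra"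
  by (induction k) (auto intro: polydisc_algebra_const polydisc_algebra_mult)

lemma polydisc_algebra_sum:
  "finite I \<Longrightarrow> (\<And>i. i \<in> I \<Longrightarrow> f i \<in> polydisc_algebra) \<Longrightarrow> (\<lambda>z. \<Sum>i\<in>I. f i z) \<in> polydisc_algebra"
  by (induction I rule: finite_induct) (auto intro: polydisc_algebra_const polydisc_algebra_add)

lemma polydisc_algebra_prod:
  "finite I \<Longrightarrow> (\<And>i. i \<in> I \<Longrightarrow> f i \<in> polydisc_algebra) \<Longrightarrow> (\<lambda>z. \<Prod>i\<in>I. f i z) \<in> polydisc_algebra"
  by (induction I rule: finite_induct) (auto intro: polydisc_algebra_const polydisc_algebra_mult)

lemma polydisc_algebra_monom: "monom_fun \<alpha> \<in> polydisc_algebra"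
  unfolding monom_fun_def[abs_def]
  by (intro polydisc_algebra_prod polydisc_algebra_power polydisc_algebra_nth) auto

lemma polydisc_algebra_pol: "is_pol f \<Longrightarrow> f \<in> polydisc_algebra"
  by (auto simp: is_pol_def pol_def[abs_def]
      intro!: polydisc_algebra_sum polydisc_algebra_cmult polydisc_algebra_monom)

lemma polydisc_algebra_continuous: "u \<in> polydisc_algebra \<Longrightarrow> continuous_on torus u"
  by (auto simp: polydisc_algebra_def intro: continuous_on_subset[OF _ torus_subset_closure])

lemma continuous_torus_bounded:
  fixes u :: "complex^'n::finite \<Rightarrow> complex"
  assumes "continuous_on torus u"
  shows "bdd_above ((\<lambda>z. cmod (u z)) ` torus)"
  using compact_continuous_image[OF continuous_on_norm[OF assms] compact_torus]
  by (intro bounded_imp_bdd_above compact_imp_bounded)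

lemma sup_norm_upper:
  "continuous_on torus u \<Longrightarrow> z \<in> torus \<Longrightarrow> cmod (u z) \<le> sup_norm u"
  unfolding sup_norm_def by (intro cSUP_upper continuous_torus_bounded)

lemma sup_norm_least: "(\<And>z. z \<in> torus \<Longrightarrow> cmod (u z) \<le> B) \<Longrightarrow> sup_norm u \<le> B"
  unfolding sup_norm_def by (intro cSUP_least torus_nonempty)

lemma sup_norm_nonneg:
  fixes u :: "complex^'n::finite \<Rightarrow> complex"
  assumes "continuous_on torus u"
  shows "0 \<le> sup_norm u"
proof -
  obtain z :: "complex^'n" where "z \<in> torus" using torus_nonempty by blast
  from order_trans[OF norm_ge_zero sup_norm_upper[OF assms this]] show ?thesis .
qed

section \<open>Uniform approximation by polynomials on the closed polydisc\<close>

lemma bounded_linear_vector_smult: "bounded_linear (\<lambda>w. w *s (v :: complex^'n::finite))"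
  unfolding linear_conv_bounded_linear[symmetric]
  by (rule linearI) (auto simp: vec_eq_iff algebra_simps)

text \<open>Dilation by \<open>r < 1\<close> leaves room in every coordinate: by the chain rule the
  slices are holomorphic on a disc of radius \<open>1 / r > 1\<close>, and this margin is what makes
  Taylor coefficients decay geometrically.\<close>

lemma slice_holomorphic:
  fixes u :: "complex^'n::finite \<Rightarrow> complex"
  assumes u: "u \<in> polydisc_algebra" and r: "0 < r" "r < 1" and z: "z \<in> closure polydisc"
  shows "(\<lambda>w. u (complex_of_real r *s upd z i w)) holomorphic_on ball 0 (1 / r)"
    and "w \<in> ball 0 (1 / r) \<Longrightarrow> complex_of_real r *s upd z i w \<in> polydisc"
proof -
  have mem: "complex_of_real r *s upd z i w \<in> polydisc" if "w \<in> ball 0 (1 / r)" for w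
    unfolding polydisc_def
  proof (clarify)
    fix k
    have "cmod (z $ k) \<le> 1" using z by (simp add: closure_polydisc)
    then have "r * cmod (z $ k) \<le> r * 1" using r by (intro mult_left_mono) auto
    also have "\<dots> < 1" using r by simp
    finally have "r * cmod (z $ k) < 1" .
    moreover have "r * cmod w < 1" using that r by (simp add: field_simps)
    ultimately show "cmod ((complex_of_real r *s upd z i w) $ k) < 1"
      using r(1) by (cases "k = i") (simp_all add: upd_def norm_mult)
  qed
  show "w \<in> ball 0 (1 / r) \<Longrightarrow> complex_of_real r *s upd z i w \<in> polydisc" by (rule mem)
  show "(\<lambda>w. u (complex_of_real r *s upd z i w)) holomorphic_on ball 0 (1 / r)"
    unfolding holomorphic_on_def
  proof
    fix w :: complex assume w: "w \<in> ball 0 (1 / r)"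
    obtain D where D: "(u has_derivative D) (at (complex_of_real r *s upd z i w))" "\<And>c v. D (c *s v) = c * D v"
      using u mem[OF w] unfolding polydisc_algebra_def holomorphic_at_def by blast
    have eq: "(\<lambda>h. complex_of_real r *s upd z i h) =
        (\<lambda>h. complex_of_real r *s upd z i 0 + h *s (complex_of_real r *s axis i 1))"
      by (rule ext) (simp add: vec_eq_iff upd_def axis_def)
    have "((\<lambda>h. complex_of_real r *s upd z i 0 + h *s (complex_of_real r *s axis i 1)) has_derivative
        (\<lambda>h. 0 + h *s (complex_of_real r *s axis i 1))) (at w)"
      by (rule has_derivative_add[OF has_derivative_const
          bounded_linear_imp_has_derivative[OF bounded_linear_vector_smult]])
    then have "((\<lambda>h. complex_of_real r *s upd z i h) has_derivative (\<lambda>h. h *s (complex_of_real r *s axis i 1))) (at w)"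
      unfolding eq by simp
    from has_derivative_compose[OF this D(1)]
    have "((\<lambda>w. u (complex_of_real r *s upd z i w)) has_derivative (\<lambda>h. D (complex_of_real r *s axis i 1) * h)) (at w)"
      by (simp add: D(2) mult_ac)
    then have "((\<lambda>w. u (complex_of_real r *s upd z i w)) has_field_derivative D (complex_of_real r *s axis i 1)) (at w)"
      by (simp add: has_field_derivative_def)
    then show "(\<lambda>w. u (complex_of_real r *s upd z i w)) field_differentiable at w within ball 0 (1 / r)"
      using field_differentiable_at_within field_differentiable_def by blast
  qed
qed

text \<open>Interpolation at roots of unity replaces the Taylor coefficients, which would require the
  regularity of parameter integrals.\<close>

lemma root_interpolation:
  assumes R: "1 < R" and \<epsilon>: "0 < \<epsilon>" and B: "0 \<le> B"
  shows "\<exists>M>0. \<forall>h. h holomorphic_on ball 0 R \<longrightarrow> (\<forall>w\<in>ball 0 R. cmod (h w) \<le> B) \<longrightarrow>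
    (\<forall>w. cmod w \<le> 1 \<longrightarrow> cmod (h w - (\<Sum>k<M. w ^ k * ((\<Sum>s<M. h (cis (2 * pi * real s / real M)) *
        cnj (cis (2 * pi * real s / real M)) ^ k) / of_nat M))) \<le> \<epsilon>)"
proof -
  \<comment> \<open>Any radius strictly between \<open>1\<close> and \<open>R\<close> would do.
    Cauchy's estimate on this circle makes the bound \<open>\<tau> M\<close> of the Taylor tail
    decay geometrically, fast enough to beat the factor \<open>M\<close> coming from
    \<open>M\<close> perturbed coefficients.\<close>
  define \<rho> where "\<rho> = (1 + R) / 2"
  have \<rho>: "1 < \<rho>" "\<rho> < R" using R by (auto simp: \<rho>_def)
  define \<tau> where "\<tau> M = B * (1 / \<rho>) ^ M / (1 - 1 / \<rho>)" for M
  have "(\<lambda>M. (\<tau> M + real M * \<tau> M)) \<longlonglongrightarrow> B / (1 - 1 / \<rho>) * 0 + B / (1 - 1 / \<rho>) * 0"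
  proof -
    have "(\<lambda>M. (1 / \<rho>) ^ M) \<longlonglongrightarrow> 0" using \<rho> by (intro LIMSEQ_power_zero) auto
    moreover have "norm (1 / \<rho>) < 1" using \<rho> by simp
    then have "(\<lambda>M. real M * (1 / \<rho>) ^ M) \<longlonglongrightarrow> 0" by (rule powser_times_n_limit_0)
    ultimately have "(\<lambda>M. B / (1 - 1 / \<rho>) * (1 / \<rho>) ^ M + B / (1 - 1 / \<rho>) * (real M * (1 / \<rho>) ^ M))
        \<longlonglongrightarrow> B / (1 - 1 / \<rho>) * 0 + B / (1 - 1 / \<rho>) * 0" by (intro tendsto_add tendsto_mult tendsto_const)
    then show ?thesis by (simp add: \<tau>_def mult_ac)
  qed
  then have "\<forall>\<^sub>F M in sequentially. \<tau> M + real M * \<tau> M < \<epsilon>"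
    using \<epsilon> by (intro order_tendstoD) auto
  then obtain N where N: "\<And>M. N \<le> M \<Longrightarrow> \<tau> M + real M * \<tau> M < \<epsilon>" by (auto simp: eventually_sequentially)
  define M where "M = Suc N"
  have M: "M > 0" "\<tau> M + real M * \<tau> M < \<epsilon>" using N[of M] by (auto simp only: M_def)
  have "cmod (h w - (\<Sum>k<M. w ^ k * ((\<Sum>s<M. h (cis (2 * pi * real s / real M)) *
        cnj (cis (2 * pi * real s / real M)) ^ k) / of_nat M))) \<le> \<epsilon>"
    if h: "h holomorphic_on ball 0 R" "\<And>w. w \<in> ball 0 R \<Longrightarrow> cmod (h w) \<le> B" and w: "cmod w \<le> 1" for h w
  proof -
    define c where "c l = (deriv ^^ l) h 0 / fact l" for l
    define e where "e s = cis (2 * pi * real s / real M)" for s :: nat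
    define t where "t w = h w - (\<Sum>l<M. c l * w ^ l)" for w
    have c: "cmod (c l) \<le> B * (1 / \<rho>) ^ l" for l
    proof -
      have "cmod ((deriv ^^ l) h 0) \<le> fact l * B / \<rho> ^ l"
      proof (rule Cauchy_inequality)
        show "h holomorphic_on ball 0 \<rho>" using h(1) \<rho> by (auto intro: holomorphic_on_subset)
        show "continuous_on (cball 0 \<rho>) h"
          using \<rho> by (intro holomorphic_on_imp_continuous_on holomorphic_on_subset[OF h(1)]) auto
        show "cmod (h x) \<le> B" if "cmod (0 - x) = \<rho>" for x using that \<rho> by (intro h(2)) auto
      qed (use \<rho> in auto)
      then show ?thesis by (simp add: c_def norm_divide field_simps)
    qed
    have t: "cmod (t w) \<le> \<tau> M" if w: "cmod w \<le> 1" for w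
    proof -
      have sm: "(\<lambda>l. c l * w ^ l) sums h w"
        using holomorphic_power_series[OF h(1), of w] w R by (simp add: c_def)
      then have "(\<lambda>l. c (l + M) * w ^ (l + M)) sums t w"
        using sums_iff_shift[of "\<lambda>l. c l * w ^ l" M "t w"] by (simp add: t_def)
      moreover have g: "(\<lambda>l. B * (1 / \<rho>) ^ M * (1 / \<rho>) ^ l) sums \<tau> M"
        using sums_mult[OF geometric_sums[of "1 / \<rho>"], of "B * (1 / \<rho>) ^ M"] \<rho> by (simp add: \<tau>_def)
      moreover have "cmod (c (l + M) * w ^ (l + M)) \<le> B * (1 / \<rho>) ^ M * (1 / \<rho>) ^ l" for l
      proof -
        have "cmod (c (l + M)) * cmod w ^ (l + M) \<le> (B * (1 / \<rho>) ^ (l + M)) * 1"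
          using c[of "l + M"] w B \<rho> by (intro mult_mono power_le_one) auto
        then show ?thesis by (simp add: norm_mult norm_power power_add mult_ac)
      qed
      ultimately show ?thesis using norm_suminf_le[of "\<lambda>l. c (l + M) * w ^ (l + M)" "\<lambda>l. B * (1 / \<rho>) ^ M * (1 / \<rho>) ^ l"]
        by (simp add: sums_iff)
    qed
    \<comment> \<open>Degrees below \<open>M\<close> are reproduced exactly, so an interpolated
      coefficient is off only by an average of the tail \<open>t\<close>.\<close>
    have interp: "(\<Sum>s<M. h (e s) * cnj (e s) ^ k) / of_nat M =
        c k + (\<Sum>s<M. t (e s) * cnj (e s) ^ k) / of_nat M" if k: "k < M" for k
    proof -
      have "(\<Sum>s<M. (\<Sum>l<M. c l * e s ^ l) * cnj (e s) ^ k) = (\<Sum>s<M. \<Sum>l<M. c l * (e s ^ l * cnj (e s) ^ k))"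
        by (simp add: sum_distrib_right sum_distrib_left mult_ac)
      also have "\<dots> = (\<Sum>l<M. c l * (\<Sum>s<M. e s ^ l * cnj (e s) ^ k))"
        by (simp only: sum_distrib_left) (rule sum.swap)
      also have "\<dots> = (\<Sum>l<M. if l = k then c k * of_nat M else 0)"
        using k unfolding e_def by (intro sum.cong refl) (subst root_of_unity_sum, auto)
      also have "\<dots> = c k * of_nat M" using k by simp
      finally have "(\<Sum>s<M. (\<Sum>l<M. c l * e s ^ l) * cnj (e s) ^ k) = c k * of_nat M" .
      moreover have "(\<Sum>s<M. h (e s) * cnj (e s) ^ k) =
          (\<Sum>s<M. (\<Sum>l<M. c l * e s ^ l) * cnj (e s) ^ k) + (\<Sum>s<M. t (e s) * cnj (e s) ^ k)"
        unfolding sum.distrib[symmetric] by (intro sum.cong refl) (simp add: t_def algebra_simps)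
      ultimately show ?thesis using M(1) by (simp add: add_divide_distrib)
    qed
    have "h w - (\<Sum>k<M. w ^ k * ((\<Sum>s<M. h (e s) * cnj (e s) ^ k) / of_nat M)) =
        t w - (\<Sum>k<M. w ^ k * ((\<Sum>s<M. t (e s) * cnj (e s) ^ k) / of_nat M))"
      by (simp add: interp distrib_left sum.distrib t_def mult.commute)
    also have "cmod \<dots> \<le> cmod (t w) + cmod (\<Sum>k<M. w ^ k * ((\<Sum>s<M. t (e s) * cnj (e s) ^ k) / of_nat M))"
      by (rule norm_triangle_ineq4)
    also have "\<dots> \<le> \<tau> M + (\<Sum>k<M. \<tau> M)"
    proof (intro add_mono t w sum_norm_le)
      fix k
      have "cmod (\<Sum>s<M. t (e s) * cnj (e s) ^ k) \<le> (\<Sum>s<M. \<tau> M)"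
        by (intro sum_norm_le) (auto simp: norm_mult norm_power e_def intro!: t)
      then have "cmod (\<Sum>s<M. t (e s) * cnj (e s) ^ k) / M \<le> \<tau> M" using M(1) by (simp add: field_simps)
      moreover have "cmod w ^ k \<le> 1" using w by (simp add: power_le_one)
      ultimately have "cmod w ^ k * (cmod (\<Sum>s<M. t (e s) * cnj (e s) ^ k) / M) \<le> 1 * \<tau> M"
        by (intro mult_mono) auto
      then show "cmod (w ^ k * ((\<Sum>s<M. t (e s) * cnj (e s) ^ k) / of_nat M)) \<le> \<tau> M"
        by (simp add: norm_mult norm_power norm_divide)
    qed
    also have "\<dots> \<le> \<epsilon>" using M(2) by simp
    finally show ?thesis by (simp add: e_def)
  qed
  then show ?thesis using M(1) by blast
qed

text \<open>\<open>R\<close> and \<open>B\<close> are common to all base points and coordinates.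
  This uniformity survives when one variable is frozen at a unimodular value, as the elimination of
  variables does.\<close>

definition holomorphic_slices :: "real \<Rightarrow> real \<Rightarrow> (complex^'n::finite \<Rightarrow> complex) \<Rightarrow> bool" where
  "holomorphic_slices R B u \<longleftrightarrow> (\<forall>z\<in>closure polydisc. \<forall>i. (\<lambda>w. u (upd z i w)) holomorphic_on ball 0 R \<and>
     (\<forall>w\<in>ball 0 R. cmod (u (upd z i w)) \<le> B))"

lemma upd_closure: "z \<in> closure polydisc \<Longrightarrow> cmod w \<le> 1 \<Longrightarrow> upd z i w \<in> closure polydisc"
  by (auto simp: closure_polydisc upd_def)

lemma upd_upd: "upd (upd z i w) i w' = upd z i w'" "i \<noteq> l \<Longrightarrow> upd (upd z l w) i w' = upd (upd z i w') l w"
  by (auto simp: upd_def vec_eq_iff)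

lemma upd_same: "upd z i (z $ i) = z"
  by (auto simp: upd_def vec_eq_iff)

text \<open>The variables on which \<open>u\<close> depends are eliminated one at a time.
  Interpolation in \<open>z $ i\<close> leaves coefficients that depend on the other variables only;
  being averages of frozen copies of \<open>u\<close>, they obey the same bounds and are
  approximated by induction.\<close>

lemma holomorphic_slices_approx:
  fixes u :: "complex^'n::finite \<Rightarrow> complex"
  assumes "finite S" and R: "1 < R" and B: "0 \<le> B"
    and "holomorphic_slices R B u" and "\<And>z z'. (\<And>i. i \<in> S \<Longrightarrow> z $ i = z' $ i) \<Longrightarrow> u z = u z'" and "0 < \<epsilon>"
  shows "\<exists>f. is_pol f \<and> (\<forall>z\<in>closure polydisc. cmod (u z - f z) \<le> \<epsilon>)"
  using assms(1,4-)
proof (induction S arbitrary: u \<epsilon> rule: finite_induct)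
  case empty
  have "cmod (u z - u 0) \<le> \<epsilon>" for z
  proof -
    have "u z = u 0" by (rule empty.prems(2)) simp
    then show ?thesis using empty.prems(3) by simp
  qed
  then show ?case by (intro exI[of _ "\<lambda>_. u 0"] conjI ballI is_pol_const)
next
  case (insert i S)
  have hs: "(\<lambda>w. u (upd z l w)) holomorphic_on ball 0 R" "w \<in> ball 0 R \<Longrightarrow> cmod (u (upd z l w)) \<le> B"
    if "z \<in> closure polydisc" for z l w
    using insert.prems(1) that by (auto simp: holomorphic_slices_def)
  obtain M where M: "0 < M" and interp: "\<And>h w. h holomorphic_on ball 0 R \<Longrightarrow> (\<forall>w\<in>ball 0 R. cmod (h w) \<le> B) \<Longrightarrow>
      cmod w \<le> 1 \<Longrightarrow> cmod (h w - (\<Sum>k<M. w ^ k * ((\<Sum>s<M. h (cis (2 * pi * real s / real M)) *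
        cnj (cis (2 * pi * real s / real M)) ^ k) / of_nat M))) \<le> \<epsilon> / 2"
    using root_interpolation[OF R half_gt_zero[OF insert.prems(3)] B] by blast
  define e where "e s = cis (2 * pi * real s / real M)" for s :: nat
  define a where "a k z = (\<Sum>s<M. u (upd z i (e s)) * cnj (e s) ^ k) / of_nat M" for k z
  have e: "cmod (e s) = 1" for s by (simp add: e_def)
  \<comment> \<open>Half of the tolerance goes to the interpolation in \<open>z $ i\<close>; the
    other half is shared by the \<open>M\<close> coefficients.\<close>
  have "\<exists>f. is_pol f \<and> (\<forall>z\<in>closure polydisc. cmod (a k z - f z) \<le> \<epsilon> / (2 * M))" for k
  proof (rule insert.IH)
    show "holomorphic_slices R B (a k)"
      unfolding holomorphic_slices_def
    proof (intro ballI allI conjI)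
      fix z :: "complex^'n" and l assume z: "z \<in> closure polydisc"
      have sl: "(\<lambda>w. u (upd (upd z l w) i (e s))) holomorphic_on ball 0 R" 
        "w \<in> ball 0 R \<Longrightarrow> cmod (u (upd (upd z l w) i (e s))) \<le> B" for s w
      proof -
        have z': "upd z i (e s) \<in> closure polydisc" using z e by (intro upd_closure) auto
        show "(\<lambda>w. u (upd (upd z l w) i (e s))) holomorphic_on ball 0 R"
          using hs(1)[OF z', of l] by (cases "i = l") (auto simp: upd_upd)
        show "cmod (u (upd (upd z l w) i (e s))) \<le> B" if "w \<in> ball 0 R"
          using hs(2)[OF z' that, of l] hs(2)[OF z, of "e s" i] e R by (cases "i = l") (auto simp: upd_upd)
      qed
      show "(\<lambda>w. a k (upd z l w)) holomorphic_on ball 0 R"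
        unfolding a_def using sl(1) M by (intro holomorphic_intros) auto
      fix w :: complex assume w: "w \<in> ball 0 R"
      have "cmod (\<Sum>s<M. u (upd (upd z l w) i (e s)) * cnj (e s) ^ k) \<le> (\<Sum>s<M. B)"
        using sl(2)[OF w] e by (intro sum_norm_le) (auto simp: norm_mult norm_power)
      then show "cmod (a k (upd z l w)) \<le> B"
        unfolding a_def using M by (simp add: norm_divide field_simps)
    qed
    show "a k z = a k z'" if "\<And>i. i \<in> S \<Longrightarrow> z $ i = z' $ i" for z z' :: "complex^'n"
    proof -
      have "u (upd z i w) = u (upd z' i w)" for w
        using that by (intro insert.prems(2)) (auto simp: upd_def)
      then show ?thesis by (simp add: a_def)
    qed
    show "0 < \<epsilon> / (2 * M)" using insert.prems(3) M by simp
  qed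
  then obtain f where f: "\<And>k. is_pol (f k)" "\<And>k z. z \<in> closure polydisc \<Longrightarrow> cmod (a k z - f k z) \<le> \<epsilon> / (2 * M)"
    by metis
  define g where "g z = (\<Sum>k<M. f k z * z $ i ^ k)" for z
  have "is_pol g" unfolding g_def by (intro is_pol_sum is_pol_power_mult f(1)) auto
  moreover have "cmod (u z - g z) \<le> \<epsilon>" if z: "z \<in> closure polydisc" for z
  proof -
    have zi: "cmod (z $ i) \<le> 1" using z by (simp add: closure_polydisc)
    have "cmod (u (upd z i (z $ i)) - (\<Sum>k<M. (z $ i) ^ k * a k z)) \<le> \<epsilon> / 2"
      using interp[of "\<lambda>w. u (upd z i w)" "z $ i"] hs[OF z] zi by (simp add: a_def e_def)
    then have 1: "cmod (u z - (\<Sum>k<M. (z $ i) ^ k * a k z)) \<le> \<epsilon> / 2" by (simp add: upd_same)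
    have "(\<Sum>k<M. (z $ i) ^ k * a k z) - g z = (\<Sum>k<M. (z $ i) ^ k * (a k z - f k z))"
      by (simp add: g_def sum_subtractf[symmetric] algebra_simps)
    also have "cmod \<dots> \<le> (\<Sum>k<M. \<epsilon> / (2 * M))"
    proof (rule sum_norm_le)
      fix k
      have "cmod (z $ i) ^ k * cmod (a k z - f k z) \<le> 1 * (\<epsilon> / (2 * M))"
        using zi f(2)[OF z] by (intro mult_mono power_le_one) auto
      then show "cmod ((z $ i) ^ k * (a k z - f k z)) \<le> \<epsilon> / (2 * M)" by (simp add: norm_mult norm_power)
    qed
    also have "\<dots> = \<epsilon> / 2" using M by simp
    finally have 2: "cmod ((\<Sum>k<M. (z $ i) ^ k * a k z) - g z) \<le> \<epsilon> / 2" .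
    have "cmod (u z - g z) \<le> cmod (u z - (\<Sum>k<M. (z $ i) ^ k * a k z)) + cmod ((\<Sum>k<M. (z $ i) ^ k * a k z) - g z)"
      using norm_triangle_ineq[of "u z - (\<Sum>k<M. (z $ i) ^ k * a k z)" "(\<Sum>k<M. (z $ i) ^ k * a k z) - g z"]
      by simp
    then show ?thesis using 1 2 by simp
  qed
  ultimately show ?case by blast
qed

text \<open>The dilates of \<open>u\<close> are uniformly close to \<open>u\<close> by uniform
  continuity, and they extend holomorphically beyond the closed polydisc in every variable.\<close>

lemma polydisc_algebra_approx:
  fixes u :: "complex^'n::finite \<Rightarrow> complex"
  assumes u: "u \<in> polydisc_algebra" and \<epsilon>: "0 < \<epsilon>"
  obtains f where "is_pol f" "\<And>z. z \<in> closure polydisc \<Longrightarrow> cmod (u z - f z) \<le> \<epsilon>"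
proof -
  have uc: "continuous_on (closure polydisc) u" using u by (simp add: polydisc_algebra_def)
  have "uniformly_continuous_on (closure polydisc) u"
    using compact_uniformly_continuous[OF uc compact_closure_polydisc] .
  then obtain d where d: "0 < d" "\<And>z z'. z \<in> closure polydisc \<Longrightarrow> z' \<in> closure polydisc \<Longrightarrow> dist z' z < d \<Longrightarrow> dist (u z') (u z) < \<epsilon> / 2"
    unfolding uniformly_continuous_on_def using half_gt_zero[OF \<epsilon>] by metis
  obtain B where B: "\<And>z. z \<in> closure polydisc \<Longrightarrow> cmod (u z) \<le> B"
    using compact_imp_bounded[OF compact_continuous_image[OF uc compact_closure_polydisc]]
    unfolding bounded_iff by (metis imageI)
  have B0: "0 \<le> B" using B[of 0] zero_in_polydisc closure_subset norm_ge_zero order_trans by blast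
  \<comment> \<open>Points of the closed polydisc have norm at most \<open>CARD('n)\<close>, so the
    dilation moves them by less than \<open>d\<close>. The cap \<open>1 / 2\<close> keeps
    \<open>r\<close> positive.\<close>
  define t where "t = min (1 / 2) (d / (2 * CARD('n)))"
  define r where "r = 1 - t"
  have t: "0 < t" "t \<le> 1 / 2" "t * CARD('n) < d"
    using d(1) by (auto simp: t_def min_def field_simps)
  have r: "0 < r" "r < 1" using t by (auto simp: r_def)
  define v where "v z = u (complex_of_real r *s z)" for z
  have "holomorphic_slices (1 / r) B v"
    unfolding holomorphic_slices_def v_def
    using slice_holomorphic[OF u r] B closure_subset by blast
  have "\<exists>f. is_pol f \<and> (\<forall>z\<in>closure polydisc. cmod (v z - f z) \<le> \<epsilon> / 2)"
  proof (rule holomorphic_slices_approx[of UNIV "1 / r" B])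
    show "1 < 1 / r" using r by simp
    show "holomorphic_slices (1 / r) B v" by fact
    show "v z = v z'" if "\<And>i. i \<in> UNIV \<Longrightarrow> z $ i = z' $ i" for z z' :: "complex^'n"
    proof -
      have "z = z'" using that by (simp add: vec_eq_iff)
      then show ?thesis by simp
    qed
  qed (use B0 \<epsilon> in auto)
  then obtain f where f: "is_pol f" "\<And>z. z \<in> closure polydisc \<Longrightarrow> cmod (v z - f z) \<le> \<epsilon> / 2"
    by blast
  have "cmod (u z - f z) \<le> \<epsilon>" if z: "z \<in> closure polydisc" for z
  proof -
    have rz: "complex_of_real r *s z \<in> closure polydisc"
      using z r by (auto simp: closure_polydisc norm_mult intro: mult_le_one)
    have "z - complex_of_real r *s z = t *\<^sub>R z"
      unfolding r_def by (simp add: vec_eq_iff scaleR_conv_of_real[where 'a = complex] algebra_simps)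
    then have "dist z (complex_of_real r *s z) = t * norm z" using t by (simp add: dist_norm)
    also have "\<dots> \<le> t * CARD('n)" using t z by (intro mult_left_mono norm_le_card) (auto simp: closure_polydisc)
    finally have "dist (u z) (v z) < \<epsilon> / 2" unfolding v_def using t by (intro d(2) rz z) auto
    then have "cmod (u z - v z) < \<epsilon> / 2" by (simp add: dist_norm)
    moreover have "cmod (u z - f z) \<le> cmod (u z - v z) + cmod (v z - f z)"
      using norm_triangle_ineq[of "u z - v z" "v z - f z"] by simp
    ultimately show ?thesis using f(2)[OF z] by simp
  qed
  then show ?thesis using that f(1) by blast
qed

section \<open>Maximum principle at 0\<close>

lemma polydisc_algebra_zero_bound:
  fixes u :: "complex^'n::finite \<Rightarrow> complex"
  assumes u: "u \<in> polydisc_algebra" and B: "\<And>z. z \<in> torus \<Longrightarrow> cmod (u z) \<le> B"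
  shows "cmod (u 0) \<le> B"
proof (rule field_le_epsilon)
  fix e :: real assume e: "0 < e"
  obtain f where f: "is_pol f" "\<And>z. z \<in> closure polydisc \<Longrightarrow> cmod (u z - f z) \<le> e / 2"
    using polydisc_algebra_approx[OF u half_gt_zero[OF e]] by blast
  obtain A c where A: "finite A" "f = pol A c" using f(1) by (auto simp: is_pol_def)
  have "cmod (f z) \<le> B + e / 2" if "z \<in> torus" for z
    using f(2)[of z] B[OF that] torus_subset_closure that norm_triangle_ineq3[of "u z" "f z"] by force
  then have "cmod (f 0) \<le> B + e / 2" unfolding A(2) by (rule pol_at_zero_bound[OF A(1)])
  moreover have "cmod (u 0 - f 0) \<le> e / 2" using f(2)[of 0] zero_in_polydisc closure_subset by blast
  ultimately show "cmod (u 0) \<le> B + e" using norm_triangle_sub[of "u 0" "f 0"] by simp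
qed

text \<open>The function \<open>exp (- u)\<close> has modulus at most \<open>1\<close> on the torus,
  hence at 0.\<close>

lemma polydisc_algebra_Re_nonneg:
  fixes u :: "complex^'n::finite \<Rightarrow> complex"
  assumes u: "u \<in> polydisc_algebra" and re: "\<And>z. z \<in> torus \<Longrightarrow> 0 \<le> Re (u z)"
  shows "0 \<le> Re (u 0)"
proof -
  have "(\<lambda>z. exp (-1 * u z)) \<in> polydisc_algebra"
    by (intro polydisc_algebra_exp polydisc_algebra_cmult u)
  then have "cmod (exp (-1 * u 0)) \<le> 1"
    by (rule polydisc_algebra_zero_bound) (use re in simp)
  then show ?thesis by simp
qed

section \<open>The natural representation\<close>

lemma scaleC_zero_left: "0 *\<^sub>C (x :: 'a::complex_normed_vector) = 0"
  using scaleC_of_real[of 0 x] by simp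

lemma scaleC_sum_right: "c *\<^sub>C (\<Sum>i\<in>I. f i :: 'a::complex_normed_vector) = (\<Sum>i\<in>I. c *\<^sub>C f i)"
  using bounded_linear.linear[OF bounded_linear_scaleC[of c]] by (rule linear_sum)

lemma op_poly_superset:
  assumes "finite A" "Poly_Mapping.keys p \<subseteq> A"
  shows "op_poly T p = (\<Sum>\<alpha>\<in>A. Poly_Mapping.lookup p \<alpha> *\<^sub>C op_monomial T \<alpha>)"
  unfolding op_poly_def using assms
  by (intro sum.mono_neutral_left) (auto simp: in_keys_iff scaleC_zero_left)

lemma op_poly_add: "op_poly T (p + q) = op_poly T p + op_poly T q"
proof -
  define A where "A = Poly_Mapping.keys p \<union> Poly_Mapping.keys q"
  have A: "finite A" "Poly_Mapping.keys p \<subseteq> A" "Poly_Mapping.keys q \<subseteq> A" "Poly_Mapping.keys (p + q) \<subseteq> A"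
    unfolding A_def using keys_add[of p q] by auto
  show ?thesis
    unfolding op_poly_superset[OF A(1,2)] op_poly_superset[OF A(1,3)] op_poly_superset[OF A(1,4)]
    by (simp add: lookup_add scaleC_add_left sum.distrib)
qed

lemma eval_poly_add: "eval_poly (p + q) z = eval_poly p z + eval_poly q z"
proof -
  define A where "A = Poly_Mapping.keys p \<union> Poly_Mapping.keys q"
  have A: "finite A" "Poly_Mapping.keys p \<subseteq> A" "Poly_Mapping.keys q \<subseteq> A" "Poly_Mapping.keys (p + q) \<subseteq> A"
    unfolding A_def using keys_add[of p q] by auto
  have *: "eval_poly r z = pol A (Poly_Mapping.lookup r) z" if "Poly_Mapping.keys r \<subseteq> A" for r
    unfolding eval_poly_eq_pol using that A(1) by (intro pol_restrict[symmetric]) (auto simp: in_keys_iff)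
  show ?thesis
    unfolding *[OF A(2)] *[OF A(3)] *[OF A(4)] by (simp add: pol_def lookup_add distrib_right sum.distrib)
qed

lemma op_poly_sum_single:
  assumes "finite A"
  shows "op_poly T (\<Sum>\<alpha>\<in>A. Poly_Mapping.single (\<alpha> :: 'n::finite \<Rightarrow>\<^sub>0 nat) (c \<alpha>)) = (\<Sum>\<alpha>\<in>A. c \<alpha> *\<^sub>C op_monomial T \<alpha>)"
proof -
  define p where "p = (\<Sum>\<alpha>\<in>A. Poly_Mapping.single \<alpha> (c \<alpha>))"
  have p: "Poly_Mapping.lookup p \<alpha> = (if \<alpha> \<in> A then c \<alpha> else 0)" for \<alpha>
    unfolding p_def using assms by (simp add: lookup_sum lookup_single when_def)
  then have "Poly_Mapping.keys p \<subseteq> A" by (auto simp: in_keys_iff split: if_splits)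
  then show ?thesis using op_poly_superset[OF assms, of p T] by (simp add: p p_def[symmetric])
qed

lemma exists_poly_scale:
  obtains q where "\<And>z. eval_poly q z = a * eval_poly p z" "\<And>T. op_poly T q = a *\<^sub>C op_poly T p"
proof -
  define q where "q = (\<Sum>\<alpha>\<in>Poly_Mapping.keys p. Poly_Mapping.single \<alpha> (a * Poly_Mapping.lookup p \<alpha>))"
  have "eval_poly q z = a * eval_poly p z" for z
    unfolding q_def
    by (subst pol_eq_eval_poly[symmetric]) (auto simp: eval_poly_eq_pol pol_def sum_distrib_left mult_ac)
  moreover have "op_poly T q = a *\<^sub>C op_poly T p" for T
    unfolding q_def by (subst op_poly_sum_single) (auto simp: op_poly_def scaleC_sum_right scaleC_scaleC)
  ultimately show ?thesis using that by blast
qed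

section \<open>Powers and monomials of commuting operators\<close>

lemma blinfun_compose_assoc: "(f o\<^sub>L g) o\<^sub>L h = f o\<^sub>L (g o\<^sub>L h)"
  by (rule blinfun_eqI) simp

lemma blinfun_compose_id [simp]: "id_blinfun o\<^sub>L f = f" "f o\<^sub>L id_blinfun = f"
  by (rule blinfun_eqI, simp)+

lemma op_power_commute:
  assumes "R o\<^sub>L S = S o\<^sub>L R"
  shows "R o\<^sub>L op_power S k = op_power S k o\<^sub>L R"
proof (induction k)
  case 0
  show ?case by (simp add: op_power_def)
next
  case (Suc k)
  have "R o\<^sub>L (S o\<^sub>L op_power S k) = (S o\<^sub>L op_power S k) o\<^sub>L R"
    by (metis Suc assms blinfun_compose_assoc)
  then show ?case by (simp add: op_power_def)
qed

lemma op_power_add: "op_power S (a + b) = op_power S a o\<^sub>L op_power S b"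
  by (induction a) (auto simp: op_power_def blinfun_compose_assoc)

text \<open>With commuting factors the \<open>fold\<close> may take the index \<open>j\<close> last.
  There the exponents add, and the new power is then moved past the remaining factors.\<close>

lemma op_monomial_shift:
  fixes T :: "'n::finite \<Rightarrow> 'a::complex_normed_vector \<Rightarrow>\<^sub>L 'a"
  assumes "commuting_tuple T"
  shows "op_monomial T (\<alpha> + Poly_Mapping.single j m) = op_monomial T \<alpha> o\<^sub>L op_power (T j) m"
proof -
  have comm: "op_power (T i) a o\<^sub>L op_power (T k) b = op_power (T k) b o\<^sub>L op_power (T i) a" for i k a b
    using assms by (intro op_power_commute op_power_commute[symmetric]) (simp add: commuting_tuple_def)
  define f where "f \<alpha> i S = op_power (T i) (Poly_Mapping.lookup \<alpha> i) o\<^sub>L S" for \<alpha> i and S :: "'a \<Rightarrow>\<^sub>L 'a"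
  have cfc: "comp_fun_commute_on UNIV (f \<alpha>)" for \<alpha>
  proof (rule comp_fun_commute_on.intro)
    fix i k
    show "f \<alpha> i \<circ> f \<alpha> k = f \<alpha> k \<circ> f \<alpha> i"
    proof
      fix S
      show "(f \<alpha> i \<circ> f \<alpha> k) S = (f \<alpha> k \<circ> f \<alpha> i) S"
        unfolding f_def comp_def blinfun_compose_assoc[symmetric] by (simp only: comm)
    qed
  qed
  have ins: "Finite_Set.fold (f \<alpha>) id_blinfun (insert i A) = f \<alpha> i (Finite_Set.fold (f \<alpha>) id_blinfun A)"
    if "finite A" "i \<notin> A" for \<alpha> i A
    using comp_fun_commute_on.fold_insert[OF cfc _ that] by simp
  have op_c: "op_power (T j) m o\<^sub>L Finite_Set.fold (f \<alpha>) id_blinfun A = Finite_Set.fold (f \<alpha>) id_blinfun A o\<^sub>L op_power (T j) m"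
    if "finite A" for A \<alpha>
    using that
  proof (induction A rule: finite_induct)
    case empty
    show ?case by simp
  next
    case (insert i A)
    have "op_power (T j) m o\<^sub>L (op_power (T i) k o\<^sub>L X) = (op_power (T i) k o\<^sub>L X) o\<^sub>L op_power (T j) m"
      if "op_power (T j) m o\<^sub>L X = X o\<^sub>L op_power (T j) m" for k X
    proof -
      have "op_power (T j) m o\<^sub>L (op_power (T i) k o\<^sub>L X) = op_power (T i) k o\<^sub>L (op_power (T j) m o\<^sub>L X)"
        unfolding blinfun_compose_assoc[symmetric] comm[of j m i k] ..
      then show ?thesis unfolding that by (simp only: blinfun_compose_assoc)
    qed
    then show ?case unfolding ins[OF insert.hyps] f_def[of \<alpha> i] using insert.IH by blast
  qed
  have off: "Finite_Set.fold (f (\<alpha> + Poly_Mapping.single j m)) id_blinfun A = Finite_Set.fold (f \<alpha>) id_blinfun A"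
    if "finite A" "j \<notin> A" for A
    using that
  proof (induction A rule: finite_induct)
    case empty
    show ?case by simp
  next
    case (insert i A)
    then have "i \<noteq> j" "j \<notin> A" by auto
    then show ?case unfolding ins[OF insert.hyps] insert.IH[OF \<open>j \<notin> A\<close>]
      by (simp add: f_def lookup_add lookup_single)
  qed
  define R where "R = Finite_Set.fold (f \<alpha>) id_blinfun (UNIV - {j})"
  have U: "insert j (UNIV - {j}) = (UNIV :: 'n set)" by auto
  have 1: "op_monomial T \<alpha> = op_power (T j) (Poly_Mapping.lookup \<alpha> j) o\<^sub>L R"
    using ins[of "UNIV - {j}" j \<alpha>] unfolding U by (simp add: op_monomial_def R_def f_def[abs_def])
  have "op_monomial T (\<alpha> + Poly_Mapping.single j m) =
      op_power (T j) (Poly_Mapping.lookup (\<alpha> + Poly_Mapping.single j m) j) o\<^sub>L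
        Finite_Set.fold (f (\<alpha> + Poly_Mapping.single j m)) id_blinfun (UNIV - {j})"
    using ins[of "UNIV - {j}" j "\<alpha> + Poly_Mapping.single j m"] unfolding U
    by (simp add: op_monomial_def f_def[abs_def])
  also have "\<dots> = op_power (T j) (Poly_Mapping.lookup \<alpha> j) o\<^sub>L (op_power (T j) m o\<^sub>L R)"
    unfolding R_def using off[of "UNIV - {j}"]
    by (simp add: lookup_add lookup_single op_power_add blinfun_compose_assoc)
  also have "op_power (T j) m o\<^sub>L R = R o\<^sub>L op_power (T j) m"
    unfolding R_def by (rule op_c) simp
  finally show ?thesis unfolding 1 by (simp add: blinfun_compose_assoc)
qed

lemma blinfun_compose_sum_left: "(\<Sum>i\<in>I. f i) o\<^sub>L g = (\<Sum>i\<in>I. f i o\<^sub>L g)"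
  using bounded_bilinear.sum_left[OF bounded_bilinear_blinfun_compose] .

text \<open>The product of \<open>p\<close> with a power of a coordinate enters only through its
  values and its operator, the two aspects that \<open>natural_rep_shift\<close> compares.\<close>

lemma exists_poly_shift:
  fixes T :: "'n::finite \<Rightarrow> 'a::complex_normed_vector \<Rightarrow>\<^sub>L 'a"
  assumes "commuting_tuple T"
  obtains q where "\<And>z. eval_poly q z = eval_poly p z * z $ j ^ m" "op_poly T q = op_poly T p o\<^sub>L op_power (T j) m"
proof -
  define e where "e = Poly_Mapping.single j m"
  define A where "A = (\<lambda>\<alpha>. \<alpha> + e) ` Poly_Mapping.keys p"
  define c where "c \<alpha> = Poly_Mapping.lookup p (\<alpha> - e)" for \<alpha>
  define q where "q = (\<Sum>\<alpha>\<in>A. Poly_Mapping.single \<alpha> (c \<alpha>))"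
  have A: "finite A" by (simp add: A_def)
  have "eval_poly q z = eval_poly p z * z $ j ^ m" for z
    unfolding q_def pol_eq_eval_poly[OF A, symmetric] unfolding A_def c_def pol_shift eval_poly_eq_pol
    by (simp add: e_def monom_fun_single)
  moreover have "op_poly T q = op_poly T p o\<^sub>L op_power (T j) m"
  proof -
    have sc: "(a *\<^sub>C X) o\<^sub>L Y = a *\<^sub>C (X o\<^sub>L Y)" for a and X Y :: "'a \<Rightarrow>\<^sub>L 'a"
      by (rule blinfun_eqI) (simp add: scaleC_blinfun.rep_eq)
    have "op_poly T q = (\<Sum>\<alpha>\<in>A. c \<alpha> *\<^sub>C op_monomial T \<alpha>)"
      unfolding q_def by (rule op_poly_sum_single[OF A])
    also have "\<dots> = (\<Sum>\<alpha>\<in>Poly_Mapping.keys p. Poly_Mapping.lookup p \<alpha> *\<^sub>C op_monomial T (\<alpha> + e))"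
      unfolding A_def by (subst sum.reindex) (auto simp: c_def inj_on_def)
    also have "\<dots> = op_poly T p o\<^sub>L op_power (T j) m"
      unfolding op_poly_def blinfun_compose_sum_left e_def op_monomial_shift[OF assms] sc ..
    finally show ?thesis .
  qed
  ultimately show ?thesis using that by blast
qed

section \<open>Existence and algebraic properties of the natural representation\<close>

lemma eval_poly_continuous: "continuous_on S (eval_poly p)"
  unfolding eval_poly_def by (intro continuous_intros)

locale poly_bounded_tuple =
  fixes T :: "'n::finite \<Rightarrow> 'a::{complex_normed_vector, banach} \<Rightarrow>\<^sub>L 'a" and C :: real
  assumes commuting: "commuting_tuple T"
    and C_pos: "0 < C" and C_bound: "norm (op_poly T p) \<le> C * sup_norm (eval_poly p)"
begin

lemma op_poly_dist:
  assumes "\<And>z. z \<in> torus \<Longrightarrow> cmod (eval_poly p z - eval_poly q z) \<le> d"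
  shows "norm (op_poly T p - op_poly T q) \<le> C * d"
proof -
  obtain q' where q': "\<And>z. eval_poly q' z = -1 * eval_poly q z" "op_poly T q' = (-1) *\<^sub>C op_poly T q"
    using exists_poly_scale[of "-1" q] by metis
  have "(-1) *\<^sub>C X = - X" for X :: "'a \<Rightarrow>\<^sub>L 'a"
    using scaleC_of_real[of "-1" X] by simp
  then have "op_poly T p - op_poly T q = op_poly T (p + q')"
    by (simp add: op_poly_add q'(2))
  also have "norm \<dots> \<le> C * sup_norm (eval_poly (p + q'))" by (rule C_bound)
  also have "sup_norm (eval_poly (p + q')) \<le> d"
    using assms by (intro sup_norm_least) (simp add: eval_poly_add q'(1))
  finally show ?thesis using C_pos by simp
qed

text \<open>This contains the existence of the limit that defines \<open>natural_rep\<close>. The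
  operators of a sequence of approximating polynomials are Cauchy, and their limit \<open>L\<close>
  lies within \<open>C * g p\<close> of the operator of every polynomial \<open>p\<close>; that
  estimate is convergence along the filter.\<close>

lemma natural_rep_dist:
  assumes u: "u \<in> polydisc_algebra" and d: "\<And>z. z \<in> torus \<Longrightarrow> cmod (eval_poly p z - u z) \<le> d"
  shows "norm (op_poly T p - natural_rep T u) \<le> C * d"
proof -
  have uc: "continuous_on torus u" using u by (rule polydisc_algebra_continuous)
  define g where "g p = sup_norm (\<lambda>z. eval_poly p z - u z)" for p
  have g_c: "continuous_on torus (\<lambda>z. eval_poly p z - u z)" for p
    by (intro continuous_on_diff eval_poly_continuous uc)
  have g_up: "cmod (eval_poly p z - u z) \<le> g p" if "z \<in> torus" for p z
    unfolding g_def using sup_norm_upper[OF g_c that] .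
  have g_nonneg: "0 \<le> g p" for p unfolding g_def by (rule sup_norm_nonneg[OF g_c])
  have ex: "\<exists>p. g p \<le> e" if e: "0 < e" for e
  proof -
    obtain f where f: "is_pol f" "\<And>z. z \<in> closure polydisc \<Longrightarrow> cmod (u z - f z) \<le> e"
      using polydisc_algebra_approx[OF u e] by blast
    obtain p where p: "f = eval_poly p" using f(1) is_pol_iff by blast
    have "g p \<le> e"
      unfolding g_def
    proof (rule sup_norm_least)
      fix z :: "complex^'n" assume "z \<in> torus"
      then show "cmod (eval_poly p z - u z) \<le> e"
        using f(2)[of z] torus_subset_closure by (auto simp: p norm_minus_commute)
    qed
    then show ?thesis by blast
  qed
  then have "\<exists>p. g p \<le> 1 / real (Suc k)" for k by simp
  then obtain P where P: "\<And>k. g (P k) \<le> 1 / real (Suc k)" by metis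
  have dist: "norm (op_poly T p - op_poly T q) \<le> C * (g p + g q)" for p q
  proof (rule op_poly_dist)
    fix z :: "complex^'n" assume z: "z \<in> torus"
    have "eval_poly p z - eval_poly q z = (eval_poly p z - u z) - (eval_poly q z - u z)" by simp
    also have "cmod \<dots> \<le> cmod (eval_poly p z - u z) + cmod (eval_poly q z - u z)" by (rule norm_triangle_ineq4)
    finally show "cmod (eval_poly p z - eval_poly q z) \<le> g p + g q"
      using g_up[OF z, of p] g_up[OF z, of q] by linarith
  qed
  have lim0: "(\<lambda>k. g (P k)) \<longlonglongrightarrow> 0"
    by (rule tendsto_sandwich[of "\<lambda>_. 0" _ _ "\<lambda>k. 1 / real (Suc k)"])
      (use P g_nonneg in \<open>auto intro!: always_eventually LIMSEQ_Suc[OF lim_const_over_n] tendsto_const simp del: of_nat_Suc\<close>)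
  have "Cauchy (\<lambda>k. op_poly T (P k))"
  proof (rule metric_CauchyI)
    fix e :: real assume e: "0 < e"
    have "\<forall>\<^sub>F k in sequentially. g (P k) < e / (2 * C)"
      using lim0 e C_pos by (intro order_tendstoD) auto
    then obtain K where K: "\<And>k. K \<le> k \<Longrightarrow> g (P k) < e / (2 * C)" by (auto simp: eventually_sequentially)
    have "dist (op_poly T (P k)) (op_poly T (P l)) < e" if "K \<le> k" "K \<le> l" for k l
    proof -
      have "norm (op_poly T (P k) - op_poly T (P l)) \<le> C * (g (P k) + g (P l))" by (rule dist)
      also have "\<dots> < C * (e / (2 * C) + e / (2 * C))"
        using C_pos K[OF that(1)] K[OF that(2)] by (intro mult_strict_left_mono add_strict_mono)
      also have "\<dots> = e" using C_pos by (simp add: field_simps)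
      finally show ?thesis by (simp add: dist_norm)
    qed
    then show "\<exists>K. \<forall>k\<ge>K. \<forall>l\<ge>K. dist (op_poly T (P k)) (op_poly T (P l)) < e" by blast
  qed
  then obtain L where L: "(\<lambda>k. op_poly T (P k)) \<longlonglongrightarrow> L"
    using Cauchy_convergent convergent_def by blast
  have Ld: "norm (op_poly T p - L) \<le> C * g p" for p
  proof -
    have "(\<lambda>k. norm (op_poly T p - op_poly T (P k))) \<longlonglongrightarrow> norm (op_poly T p - L)"
      by (intro tendsto_intros L)
    moreover have "(\<lambda>k. C * (g p + g (P k))) \<longlonglongrightarrow> C * (g p + 0)"
      by (intro tendsto_intros lim0)
    ultimately have "norm (op_poly T p - L) \<le> C * (g p + 0)"
      using dist by (intro LIMSEQ_le) auto
    then show ?thesis by simp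
  qed
  have "natural_rep T u = L"
    unfolding natural_rep_def g_def[symmetric]
  proof (rule tendsto_Lim)
    \<comment> \<open>Density of the polynomials makes the filter proper, so that the limit along it
      is unique.\<close>
    have "\<exists>p. Q (g p)" if "eventually Q (nhds 0)" for Q
    proof -
      obtain d where d: "0 < d" "\<And>x. dist x 0 < d \<Longrightarrow> Q x"
        using \<open>eventually Q (nhds 0)\<close> unfolding eventually_nhds_metric by blast
      obtain p where "g p \<le> d / 2" using ex[of "d / 2"] d by auto
      then have "Q (g p)" using d g_nonneg[of p] by (intro d(2)) (simp add: dist_real_def)
      then show ?thesis by blast
    qed
    then show "filtercomap g (nhds 0) \<noteq> bot" by (rule filtercomap_neq_bot)
    show "(op_poly T \<longlongrightarrow> L) (filtercomap g (nhds 0))"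
    proof (rule tendstoI)
      fix e :: real assume e: "0 < e"
      have "eventually (\<lambda>x. x < e / C) (nhds (0::real))"
        using e C_pos by (intro eventually_nhds_in_open[of "{..<e / C}" 0, simplified]) auto
      moreover have "dist (op_poly T p) L < e" if "g p < e / C" for p
      proof -
        have "C * g p < e" using that C_pos by (simp add: field_simps)
        then show ?thesis using Ld[of p] by (simp add: dist_norm)
      qed
      ultimately show "\<forall>\<^sub>F p in filtercomap g (nhds 0). dist (op_poly T p) L < e"
        unfolding eventually_filtercomap by blast
    qed
  qed
  then have "norm (op_poly T p - natural_rep T u) \<le> C * g p" using Ld by simp
  also have "\<dots> \<le> C * d" unfolding g_def using d C_pos by (intro mult_left_mono sup_norm_least) auto
  finally show ?thesis .
qed

lemma natural_rep_eval_poly: "natural_rep T (eval_poly p) = op_poly T p"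
proof -
  have "eval_poly p \<in> polydisc_algebra" using polydisc_algebra_pol is_pol_iff by blast
  then have "norm (op_poly T p - natural_rep T (eval_poly p)) \<le> C * 0"
    by (rule natural_rep_dist) simp
  then show ?thesis by simp
qed

lemma approx_poly:
  assumes u: "u \<in> polydisc_algebra" and e: "0 < e"
  obtains p where "\<And>z. z \<in> torus \<Longrightarrow> cmod (eval_poly p z - u z) \<le> e" "norm (op_poly T p - natural_rep T u) \<le> C * e"
proof -
  obtain f where f: "is_pol f" "\<And>z. z \<in> closure polydisc \<Longrightarrow> cmod (u z - f z) \<le> e"
    using polydisc_algebra_approx[OF u e] by blast
  obtain p where p: "f = eval_poly p" using f(1) is_pol_iff by blast
  have "cmod (eval_poly p z - u z) \<le> e" if "z \<in> torus" for z
    using f(2)[of z] torus_subset_closure that by (auto simp: p norm_minus_commute)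
  then show ?thesis using that natural_rep_dist[OF u] by blast
qed

lemma natural_rep_bound:
  assumes u: "u \<in> polydisc_algebra" and B: "\<And>z. z \<in> torus \<Longrightarrow> cmod (u z) \<le> B"
  shows "norm (natural_rep T u) \<le> C * B"
proof -
  have "norm (op_poly T 0 - natural_rep T u) \<le> C * B"
    by (rule natural_rep_dist[OF u]) (use B in \<open>simp add: eval_poly_def\<close>)
  then show ?thesis by (simp add: op_poly_def)
qed

lemma natural_rep_add:
  assumes u: "u \<in> polydisc_algebra" and v: "v \<in> polydisc_algebra"
  shows "natural_rep T (\<lambda>z. u z + v z) = natural_rep T u + natural_rep T v"
proof -
  have "norm (natural_rep T (\<lambda>z. u z + v z) - (natural_rep T u + natural_rep T v)) \<le> 0"
  proof (rule field_le_epsilon)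
    fix e :: real assume e: "0 < e"
    define d where "d = e / (4 * C)"
    have d: "0 < d" "4 * (C * d) = e" using e C_pos by (auto simp: d_def)
    obtain p where p: "\<And>z. z \<in> torus \<Longrightarrow> cmod (eval_poly p z - u z) \<le> d" "norm (op_poly T p - natural_rep T u) \<le> C * d"
      using approx_poly[OF u d(1)] by blast
    obtain q where q: "\<And>z. z \<in> torus \<Longrightarrow> cmod (eval_poly q z - v z) \<le> d" "norm (op_poly T q - natural_rep T v) \<le> C * d"
      using approx_poly[OF v d(1)] by blast
    have "norm (op_poly T (p + q) - natural_rep T (\<lambda>z. u z + v z)) \<le> C * (d + d)"
    proof (rule natural_rep_dist[OF polydisc_algebra_add[OF u v]])
      fix z :: "complex^'n" assume z: "z \<in> torus"
      have "cmod ((eval_poly p z - u z) + (eval_poly q z - v z)) \<le> d + d"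
        by (intro norm_triangle_mono p q z)
      then show "cmod (eval_poly (p + q) z - (u z + v z)) \<le> d + d" by (simp add: eval_poly_add algebra_simps)
    qed
    then have 1: "norm (op_poly T p + op_poly T q - natural_rep T (\<lambda>z. u z + v z)) \<le> 2 * (C * d)"
      by (simp add: op_poly_add algebra_simps)
    have "natural_rep T (\<lambda>z. u z + v z) - (natural_rep T u + natural_rep T v) =
        (op_poly T p - natural_rep T u) + (op_poly T q - natural_rep T v)
        - (op_poly T p + op_poly T q - natural_rep T (\<lambda>z. u z + v z))" by simp
    also have "norm \<dots> \<le> norm ((op_poly T p - natural_rep T u) + (op_poly T q - natural_rep T v))
        + norm (op_poly T p + op_poly T q - natural_rep T (\<lambda>z. u z + v z))" by (rule norm_triangle_ineq4)
    also have "\<dots> \<le> (C * d + C * d) + 2 * (C * d)"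
      by (intro add_mono norm_triangle_mono p q 1)
    finally show "norm (natural_rep T (\<lambda>z. u z + v z) - (natural_rep T u + natural_rep T v)) \<le> 0 + e"
      using d by simp
  qed
  then show ?thesis by simp
qed

lemma natural_rep_scale:
  assumes u: "u \<in> polydisc_algebra"
  shows "natural_rep T (\<lambda>z. a * u z) = a *\<^sub>C natural_rep T u"
proof -
  have "norm (natural_rep T (\<lambda>z. a * u z) - a *\<^sub>C natural_rep T u) \<le> 0"
  proof (rule field_le_epsilon)
    fix e :: real assume e: "0 < e"
    define d where "d = e / (2 * C * (cmod a + 1))"
    have a1: "0 < cmod a + 1" using norm_ge_zero[of a] by linarith
    have d: "0 < d" "2 * (C * ((cmod a + 1) * d)) = e" using e C_pos a1 by (auto simp: d_def)
    obtain p where p: "\<And>z. z \<in> torus \<Longrightarrow> cmod (eval_poly p z - u z) \<le> d" "norm (op_poly T p - natural_rep T u) \<le> C * d"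
      using approx_poly[OF u d(1)] by blast
    obtain q where q: "\<And>z. eval_poly q z = a * eval_poly p z" "op_poly T q = a *\<^sub>C op_poly T p"
      using exists_poly_scale[of a p] by metis
    have 1: "norm (op_poly T q - natural_rep T (\<lambda>z. a * u z)) \<le> C * (cmod a * d)"
    proof (rule natural_rep_dist[OF polydisc_algebra_cmult[OF u]])
      fix z :: "complex^'n" assume z: "z \<in> torus"
      have "eval_poly q z - a * u z = a * (eval_poly p z - u z)" by (simp add: q algebra_simps)
      then show "cmod (eval_poly q z - a * u z) \<le> cmod a * d"
        using p(1)[OF z] by (simp add: norm_mult mult_left_mono)
    qed
    have sd: "a *\<^sub>C X - a *\<^sub>C Y = a *\<^sub>C (X - Y)" for X Y :: "'a \<Rightarrow>\<^sub>L 'a"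
      by (rule blinfun_eqI) (simp add: scaleC_blinfun.rep_eq blinfun.diff_left linear_diff[OF bounded_linear.linear[OF bounded_linear_scaleC]])
    have "natural_rep T (\<lambda>z. a * u z) - a *\<^sub>C natural_rep T u =
        a *\<^sub>C (op_poly T p - natural_rep T u) - (op_poly T q - natural_rep T (\<lambda>z. a * u z))"
      by (simp add: q(2) sd[symmetric])
    also have "norm \<dots> \<le> norm (a *\<^sub>C (op_poly T p - natural_rep T u)) + norm (op_poly T q - natural_rep T (\<lambda>z. a * u z))"
      by (rule norm_triangle_ineq4)
    also have "\<dots> \<le> cmod a * (C * d) + C * (cmod a * d)"
      unfolding norm_scaleC by (intro add_mono mult_left_mono p 1) auto
    also have "\<dots> \<le> 2 * (C * ((cmod a + 1) * d))" using C_pos d(1) by (simp add: algebra_simps)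
    finally show "norm (natural_rep T (\<lambda>z. a * u z) - a *\<^sub>C natural_rep T u) \<le> 0 + e"
      using d by simp
  qed
  then show ?thesis by simp
qed

text \<open>The part of multiplicativity that Apostol's condition involves. Polynomials satisfy it,
  and on the torus multiplication by a power of a coordinate does not change the quality of an
  approximation.\<close>

lemma natural_rep_shift:
  assumes u: "u \<in> polydisc_algebra"
  shows "natural_rep T (\<lambda>z. u z * z $ j ^ m) = natural_rep T u o\<^sub>L op_power (T j) m"
proof -
  define S where "S = op_power (T j) m"
  define v where "v z = u z * z $ j ^ m" for z
  have v: "v \<in> polydisc_algebra"
    unfolding v_def[abs_def] by (intro polydisc_algebra_mult u polydisc_algebra_power polydisc_algebra_nth)
  have "norm (natural_rep T v - (natural_rep T u o\<^sub>L S)) \<le> 0"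
  proof (rule field_le_epsilon)
    fix e :: real assume e: "0 < e"
    define d where "d = e / (C * (1 + norm S))"
    have s1: "0 < 1 + norm S" using norm_ge_zero[of S] by linarith
    have d: "0 < d" "C * d * (1 + norm S) = e" using e C_pos s1 by (auto simp: d_def)
    obtain p where p: "\<And>z. z \<in> torus \<Longrightarrow> cmod (eval_poly p z - u z) \<le> d" "norm (op_poly T p - natural_rep T u) \<le> C * d"
      using approx_poly[OF u d(1)] by blast
    obtain q where q: "\<And>z. eval_poly q z = eval_poly p z * z $ j ^ m" "op_poly T q = op_poly T p o\<^sub>L S"
      using exists_poly_shift[OF commuting, of p j m] unfolding S_def by metis
    have 1: "norm (op_poly T q - natural_rep T v) \<le> C * d"
    proof (rule natural_rep_dist[OF v])
      fix z :: "complex^'n" assume z: "z \<in> torus"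
      have "eval_poly q z - v z = (eval_poly p z - u z) * z $ j ^ m" by (simp add: q v_def algebra_simps)
      then show "cmod (eval_poly q z - v z) \<le> d"
        using p(1)[OF z] z by (simp add: norm_mult norm_power torus_def)
    qed
    have "natural_rep T v - (natural_rep T u o\<^sub>L S) =
        ((op_poly T p - natural_rep T u) o\<^sub>L S) - (op_poly T q - natural_rep T v)"
      by (rule blinfun_eqI) (simp add: q(2) blinfun.diff_left)
    also have "norm \<dots> \<le> norm ((op_poly T p - natural_rep T u) o\<^sub>L S) + norm (op_poly T q - natural_rep T v)"
      by (rule norm_triangle_ineq4)
    also have "\<dots> \<le> C * d * norm S + C * d"
      using p(2) by (intro add_mono 1 order_trans[OF norm_blinfun_compose] mult_right_mono) auto
    also have "\<dots> = e" using d(2) by (simp add: algebra_simps)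
    finally show "norm (natural_rep T v - (natural_rep T u o\<^sub>L S)) \<le> 0 + e" by simp
  qed
  then show ?thesis by (simp add: v_def[abs_def] S_def)
qed

end

section \<open>Apostol's condition for densities\<close>

text \<open>Subtraction of exponents is truncated at 0; the lower bound on the degree in
  \<open>i\<close> makes it exact, hence injective on \<open>A\<close>.\<close>

lemma pol_divide:
  assumes A: "finite A" and m: "\<And>\<alpha>. \<alpha> \<in> A \<Longrightarrow> m \<le> Poly_Mapping.lookup \<alpha> i"
  shows "pol A c z = z $ i ^ m * pol ((\<lambda>\<alpha>. \<alpha> - Poly_Mapping.single i m) ` A) (\<lambda>\<alpha>. c (\<alpha> + Poly_Mapping.single i m)) z"
proof -
  define e where "e = Poly_Mapping.single i m"
  have shift_back: "\<alpha> - e + e = \<alpha>" if "\<alpha> \<in> A" for \<alpha>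
    using m[OF that] by (intro poly_mapping_eqI) (auto simp: lookup_add lookup_minus e_def lookup_single when_def)
  have "inj_on (\<lambda>\<alpha>. \<alpha> - e) A"
    by (rule inj_on_inverseI[of _ "\<lambda>\<alpha>. \<alpha> + e"]) (rule shift_back)
  then have "pol ((\<lambda>\<alpha>. \<alpha> - e) ` A) (\<lambda>\<alpha>. c (\<alpha> + e)) z = (\<Sum>\<alpha>\<in>A. c \<alpha> * monom_fun (\<alpha> - e) z)"
    unfolding pol_def by (simp add: sum.reindex shift_back)
  moreover have "c \<alpha> * monom_fun \<alpha> z = z $ i ^ m * (c \<alpha> * monom_fun (\<alpha> - e) z)" if "\<alpha> \<in> A" for \<alpha>
    using monom_fun_add[of "\<alpha> - e" e z] shift_back[OF that] by (simp add: e_def monom_fun_single)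
  then have "pol A c z = (\<Sum>\<alpha>\<in>A. z $ i ^ m * (c \<alpha> * monom_fun (\<alpha> - e) z))"
    unfolding pol_def by (intro sum.cong) auto
  ultimately show ?thesis by (simp add: e_def sum_distrib_left)
qed

section \<open>Polynomials in a subset of the variables\<close>

definition pol_in :: "'n::finite set \<Rightarrow> (complex^'n \<Rightarrow> complex) \<Rightarrow> bool" where
  "pol_in S f \<longleftrightarrow> (\<exists>A c. finite A \<and> (\<forall>\<alpha>\<in>A. \<forall>i. i \<notin> S \<longrightarrow> Poly_Mapping.lookup \<alpha> i = 0) \<and> f = pol A c)"

lemma pol_in_is_pol: "pol_in S f \<Longrightarrow> is_pol f"
  by (auto simp: pol_in_def is_pol_def)

lemma is_pol_pol_in: "is_pol f \<Longrightarrow> pol_in UNIV f"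
  by (auto simp: pol_in_def is_pol_def)

lemma pol_in_cmult: 
  assumes "pol_in S f"
  shows "pol_in S (\<lambda>z. a * f z)"
proof -
  obtain A c where A: "finite A" "\<forall>\<alpha>\<in>A. \<forall>i. i \<notin> S \<longrightarrow> Poly_Mapping.lookup \<alpha> i = 0" "f = pol A c"
    using assms by (auto simp: pol_in_def)
  have "(\<lambda>z. a * f z) = pol A (\<lambda>\<alpha>. a * c \<alpha>)"
    by (simp add: A(3) pol_def sum_distrib_left mult_ac fun_eq_iff)
  then show ?thesis unfolding pol_in_def using A(1,2) by blast
qed

lemma pol_in_add:
  assumes "pol_in S f" "pol_in S g"
  shows "pol_in S (\<lambda>z. f z + g z)"
proof -
  obtain A c where f: "finite A" "\<forall>\<alpha>\<in>A. \<forall>i. i \<notin> S \<longrightarrow> Poly_Mapping.lookup \<alpha> i = 0" "f = pol A c"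
    using assms(1) by (auto simp: pol_in_def)
  obtain A' c' where g: "finite A'" "\<forall>\<alpha>\<in>A'. \<forall>i. i \<notin> S \<longrightarrow> Poly_Mapping.lookup \<alpha> i = 0" "g = pol A' c'"
    using assms(2) by (auto simp: pol_in_def)
  define d where "d \<alpha> = (if \<alpha> \<in> A then c \<alpha> else 0)" for \<alpha>
  define d' where "d' \<alpha> = (if \<alpha> \<in> A' then c' \<alpha> else 0)" for \<alpha>
  have "f z = pol (A \<union> A') d z" for z
    unfolding f(3) pol_def using f(1) g(1) by (intro sum.mono_neutral_cong_left) (auto simp: d_def)
  moreover have "g z = pol (A \<union> A') d' z" for z
    unfolding g(3) pol_def using f(1) g(1) by (intro sum.mono_neutral_cong_left) (auto simp: d'_def)
  ultimately have "(\<lambda>z. f z + g z) = pol (A \<union> A') (\<lambda>\<alpha>. d \<alpha> + d' \<alpha>)"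
    by (simp add: fun_eq_iff pol_def sum.distrib algebra_simps)
  moreover have "finite (A \<union> A')" "\<forall>\<alpha>\<in>A \<union> A'. \<forall>i. i \<notin> S \<longrightarrow> Poly_Mapping.lookup \<alpha> i = 0"
    using f g by auto
  ultimately show ?thesis unfolding pol_in_def by blast
qed

lemma pol_in_power_mult:
  assumes "pol_in S f" "j \<in> S"
  shows "pol_in S (\<lambda>z. z $ j ^ m * f z)"
proof -
  obtain A c where A: "finite A" "\<forall>\<alpha>\<in>A. \<forall>i. i \<notin> S \<longrightarrow> Poly_Mapping.lookup \<alpha> i = 0" "f = pol A c"
    using assms(1) by (auto simp: pol_in_def)
  define e where "e = Poly_Mapping.single j m"
  have "(\<lambda>z. z $ j ^ m * f z) = pol ((\<lambda>\<alpha>. \<alpha> + e) ` A) (\<lambda>\<alpha>. c (\<alpha> - e))"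
    by (simp add: fun_eq_iff pol_shift A(3) e_def monom_fun_single)
  moreover have "\<forall>\<alpha>\<in>(\<lambda>\<alpha>. \<alpha> + e) ` A. \<forall>i. i \<notin> S \<longrightarrow> Poly_Mapping.lookup \<alpha> i = 0"
    using A(2) assms(2) by (auto simp: e_def lookup_add lookup_single when_def)
  moreover have "finite ((\<lambda>\<alpha>. \<alpha> + e) ` A)" using A(1) by simp
  ultimately show ?thesis unfolding pol_in_def by blast
qed

text \<open>Subtracting the part free of \<open>z $ i\<close> at most doubles the bound, and
  division by a unimodular coordinate keeps moduli on the torus.\<close>

lemma pol_in_split:
  fixes f :: "complex^'n::finite \<Rightarrow> complex"
  assumes f: "pol_in S f" and B: "\<And>z. z \<in> torus \<Longrightarrow> cmod (f z) \<le> B" and i: "i \<in> S"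
  obtains f0 q :: "complex^'n \<Rightarrow> complex" where "pol_in (S - {i}) f0" "pol_in S q" "\<And>z :: complex^'n. f z = f0 z + z $ i * q z"
    "\<And>z. z \<in> torus \<Longrightarrow> cmod (f0 z) \<le> B" "\<And>z. z \<in> torus \<Longrightarrow> cmod (q z) \<le> 2 * B"
proof -
  obtain A c where A: "finite A" "\<forall>\<alpha>\<in>A. \<forall>i. i \<notin> S \<longrightarrow> Poly_Mapping.lookup \<alpha> i = 0" "f = pol A c"
    using f by (auto simp: pol_in_def)
  define A0 where "A0 = {\<alpha>\<in>A. Poly_Mapping.lookup \<alpha> i = 0}"
  define A1 where "A1 = {\<alpha>\<in>A. Poly_Mapping.lookup \<alpha> i \<noteq> 0}"
  define e where "e = Poly_Mapping.single i (1::nat)"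
  define q where "q = pol ((\<lambda>\<alpha>. \<alpha> - e) ` A1) (\<lambda>\<alpha>. c (\<alpha> + e))"
  have "A = A0 \<union> A1" "A0 \<inter> A1 = {}" "finite A0" "finite A1" using A(1) by (auto simp: A0_def A1_def)
  then have "pol A c z = pol A0 c z + pol A1 c z" for z
    unfolding pol_def by (simp add: sum.union_disjoint)
  moreover have "pol A1 c z = z $ i ^ 1 * q z" for z
    unfolding q_def e_def by (rule pol_divide) (auto simp: A1_def A(1))
  ultimately have fz: "f z = pol A0 c z + z $ i * q z" for z by (simp add: A(3))
  have B0: "cmod (pol A0 c z) \<le> B" if "z \<in> torus" for z
    unfolding A0_def by (rule pol_free_part_bound[OF A(1) _ that]) (use B in \<open>simp add: A(3)\<close>)
  have Bq: "cmod (q z) \<le> 2 * B" if z: "z \<in> torus" for z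
  proof -
    have "cmod (q z) = cmod (f z - pol A0 c z)"
      using z by (simp add: fz norm_mult torus_def)
    also have "\<dots> \<le> cmod (f z) + cmod (pol A0 c z)" by (rule norm_triangle_ineq4)
    finally show ?thesis using B[OF z] B0[OF z] by simp
  qed
  have p0: "pol_in (S - {i}) (pol A0 c)"
    unfolding pol_in_def using A(1,2) by (intro exI[of _ A0] exI[of _ c]) (auto simp: A0_def)
  have "pol_in S q"
    unfolding pol_in_def q_def
    by (rule exI[of _ "(\<lambda>\<alpha>. \<alpha> - e) ` A1"], rule exI[of _ "\<lambda>\<alpha>. c (\<alpha> + e)"])
      (use A(1,2) i in \<open>auto simp: A1_def lookup_minus\<close>)
  then show ?thesis using that[OF p0 _ fz B0 Bq] by blast
qed

section \<open>Measurability and integrability on the torus, and the asymptotic orthogonality of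
  shifted balls\<close>

lemma space_torus_borel: "sets M = sets torus_borel \<Longrightarrow> space M = torus"
  using sets_eq_imp_space_eq[of M torus_borel] by (simp add: torus_borel_def space_restrict_space)

lemma torus_measurable:
  assumes "sets M = sets torus_borel" "continuous_on torus f"
  shows "f \<in> borel_measurable M"
  using borel_measurable_continuous_on_restrict[OF assms(2)] measurable_cong_sets[OF assms(1) refl]
  unfolding torus_borel_def by blast

lemma torus_integrable:
  fixes f :: "complex^'n::finite \<Rightarrow> complex"
  assumes "sets M = sets torus_borel" "finite_measure M" "continuous_on torus f"
  shows "integrable M f"
proof -
  interpret finite_measure M by fact
  show ?thesis
    using sup_norm_upper[OF assms(3)] torus_measurable[OF assms(1,3)]
    by (intro integrable_const_bound[of _ "sup_norm f"]) (auto simp: space_torus_borel[OF assms(1)])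
qed

lemma pol_in_continuous: "pol_in S f \<Longrightarrow> continuous_on torus f"
  by (intro polydisc_algebra_continuous polydisc_algebra_pol pol_in_is_pol)

lemma monom_continuous: "continuous_on torus (monom_fun \<alpha>)"
  by (rule polydisc_algebra_continuous[OF polydisc_algebra_monom])

text \<open>If \<open>h\<close> were not asymptotically orthogonal to the balls of \<open>z\<^sub>j\<^sup>m\<close>-multiples, sums of almost
  orthogonal elements of these balls would violate the Cauchy-Schwarz inequality.\<close>

lemma shifted_balls_weakly_null:
  fixes \<nu> :: "(complex^'n::finite) measure"
  assumes \<nu>: "prob_space \<nu>" "sets \<nu> = sets torus_borel" and j: "j \<in> S"
    and Q: "\<And>F \<epsilon>. pol_in S F \<Longrightarrow> 0 < \<epsilon> \<Longrightarrow> \<exists>m0. \<forall>m\<ge>m0. \<forall>p. pol_in S p \<longrightarrow>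
      (\<forall>z\<in>torus. cmod (p z) \<le> 1) \<longrightarrow> cmod (LINT z|\<nu>. z $ j ^ m * p z * cnj (F z)) \<le> \<epsilon>"
    and h: "h \<in> borel_measurable \<nu>" "\<And>z. z \<in> torus \<Longrightarrow> cmod (h z) \<le> H" and \<epsilon>: "0 < \<epsilon>"
  shows "\<exists>m0. \<forall>m\<ge>m0. \<forall>p. pol_in S p \<longrightarrow>
      (\<forall>z\<in>torus. cmod (p z) \<le> 1) \<longrightarrow> cmod (LINT z|\<nu>. z $ j ^ m * p z * h z) \<le> \<epsilon>"
proof (rule ccontr)
  assume "\<not> ?thesis"
  then have neg: "\<exists>m\<ge>m0. \<exists>p. pol_in S p \<and> (\<forall>z\<in>torus. cmod (p z) \<le> 1) \<and>
      \<epsilon> < cmod (LINT z|\<nu>. z $ j ^ m * p z * h z)" for m0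
    by (meson not_le)
  interpret prob_space \<nu> by fact
  have fin: "finite_measure \<nu>" by unfold_locales
  have sp: "space \<nu> = torus" by (rule space_torus_borel[OF \<nu>(2)])
  have H0: "0 \<le> H" using h(2) torus_nonempty norm_ge_zero order_trans by blast
  have int_c: "integrable \<nu> f" if "continuous_on torus f" for f :: "complex^'n \<Rightarrow> complex"
    using torus_integrable[OF \<nu>(2) fin that] .
  have int_h: "integrable \<nu> (\<lambda>z. f z * h z)" if "continuous_on torus f" for f
  proof (rule integrable_const_bound[of _ "sup_norm f * H"])
    show "AE z in \<nu>. norm (f z * h z) \<le> sup_norm f * H"
      using h(2) sup_norm_upper[OF that] H0 sup_norm_nonneg[OF that]
      by (intro AE_I2) (auto simp: sp norm_mult intro!: mult_mono)
    show "(\<lambda>z. f z * h z) \<in> borel_measurable \<nu>" using torus_measurable[OF \<nu>(2) that] h(1) by measurable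
  qed
  \<comment> \<open>Each added function gains at least \<open>\<epsilon>\<close> in correlation with
    \<open>h\<close> and adds at most \<open>2\<close> to the squared norm: at most \<open>1\<close>
    for its own square and at most \<open>1\<close> for twice the cross term, which \<open>Q\<close>
    keeps below \<open>1 / 2\<close>.\<close>
  have step: "\<exists>F. pol_in S F \<and> real N * \<epsilon> \<le> Re (LINT z|\<nu>. F z * h z) \<and> (LINT z|\<nu>. (cmod (F z))\<^sup>2) \<le> 2 * real N" for N
  proof (induction N)
    case 0
    have "pol_in S (\<lambda>_. 0)"
      unfolding pol_in_def by (intro exI[of _ "{}"]) (auto simp: fun_eq_iff)
    then show ?case by (intro exI[of _ "\<lambda>_. 0"]) auto
  next
    case (Suc N)
    then obtain F where F: "pol_in S F" "real N * \<epsilon> \<le> Re (LINT z|\<nu>. F z * h z)" "(LINT z|\<nu>. (cmod (F z))\<^sup>2) \<le> 2 * real N"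
      by blast
    obtain m0 where m0: "\<And>m p. m0 \<le> m \<Longrightarrow> pol_in S p \<Longrightarrow> (\<forall>z\<in>torus. cmod (p z) \<le> 1) \<Longrightarrow>
        cmod (LINT z|\<nu>. z $ j ^ m * p z * cnj (F z)) \<le> 1 / 2"
      using Q[OF F(1), of "1 / 2"] by auto
    obtain m p where p: "m0 \<le> m" "pol_in S p" "\<forall>z\<in>torus. cmod (p z) \<le> 1"
      "\<epsilon> < cmod (LINT z|\<nu>. z $ j ^ m * p z * h z)" using neg by blast
    define I where "I = (LINT z|\<nu>. z $ j ^ m * p z * h z)"
    have I0: "I \<noteq> 0" using p(4) \<epsilon> by (auto simp: I_def)
    \<comment> \<open>A unimodular factor that turns the correlation into a positive real number, so
      that the gains add up.\<close>
    define \<theta> where "\<theta> = cnj I / cmod I"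
    have \<theta>: "cmod \<theta> = 1" "\<theta> * I = cmod I"
      using I0 by (auto simp: \<theta>_def norm_divide complex_norm_square[symmetric] mult.commute power2_eq_square)
    define f where "f z = z $ j ^ m * (\<theta> * p z)" for z
    have f: "pol_in S f" unfolding f_def[abs_def] using p(2) j by (intro pol_in_power_mult pol_in_cmult)
    have fb: "cmod (f z) \<le> 1" if "z \<in> torus" for z
      using p(3) that \<theta> by (simp add: f_def norm_mult norm_power torus_def)
    have fc: "continuous_on torus f" and Fc: "continuous_on torus F" using f F(1) pol_in_continuous by auto
    have "Re (LINT z|\<nu>. (F z + f z) * h z) = Re (LINT z|\<nu>. F z * h z) + Re (LINT z|\<nu>. f z * h z)"
      using int_h[OF Fc] int_h[OF fc] by (simp add: distrib_right)
    also have "(LINT z|\<nu>. f z * h z) = (LINT z|\<nu>. \<theta> * (z $ j ^ m * p z * h z))"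
      by (simp add: f_def mult_ac)
    also have "\<dots> = \<theta> * I" unfolding I_def by simp
    finally have "Re (LINT z|\<nu>. (F z + f z) * h z) = Re (LINT z|\<nu>. F z * h z) + cmod I"
      unfolding \<theta>(2) by simp
    moreover have "real (Suc N) * \<epsilon> = real N * \<epsilon> + \<epsilon>" by (simp add: algebra_simps)
    ultimately have 1: "real (Suc N) * \<epsilon> \<le> Re (LINT z|\<nu>. (F z + f z) * h z)"
      using F(2) p(4) unfolding I_def by linarith
    have "(LINT z|\<nu>. f z * cnj (F z)) = (LINT z|\<nu>. \<theta> * (z $ j ^ m * p z * cnj (F z)))"
      by (simp add: f_def mult_ac)
    also have "cmod \<dots> \<le> 1 / 2"
      using m0[OF p(1-3)] \<theta>(1) by (simp add: norm_mult)
    finally have cross: "cmod (LINT z|\<nu>. f z * cnj (F z)) \<le> 1 / 2" .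
    define r where "r z = Re (f z * cnj (F z))" for z
    have sq: "(cmod (F z + f z))\<^sup>2 = (cmod (F z))\<^sup>2 + 2 * r z + (cmod (f z))\<^sup>2" for z
      unfolding cmod_power2 r_def by (simp add: power2_eq_square algebra_simps)
    have i1: "integrable \<nu> (\<lambda>z. (cmod (F z))\<^sup>2)" "integrable \<nu> (\<lambda>z. (cmod (f z))\<^sup>2)"
      using integrable_norm[OF int_c, of "\<lambda>z. F z * F z"] integrable_norm[OF int_c, of "\<lambda>z. f z * f z"] fc Fc
      by (simp_all add: norm_mult power2_eq_square continuous_on_mult)
    have i2: "integrable \<nu> (\<lambda>z. f z * cnj (F z))" using fc Fc by (intro int_c continuous_intros)
    have "(LINT z|\<nu>. (cmod (F z + f z))\<^sup>2) =
        (LINT z|\<nu>. (cmod (F z))\<^sup>2) + 2 * Re (LINT z|\<nu>. f z * cnj (F z)) + (LINT z|\<nu>. (cmod (f z))\<^sup>2)"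
    proof -
      have "integrable \<nu> r" "(LINT z|\<nu>. r z) = Re (LINT z|\<nu>. f z * cnj (F z))"
        unfolding r_def using integrable_Re[OF i2] integral_Re[OF i2] by auto
      then show ?thesis unfolding sq using i1 by simp
    qed
    also have "\<dots> \<le> 2 * real N + 2 * (1 / 2) + 1"
    proof (intro add_mono F(3) mult_left_mono)
      show "Re (LINT z|\<nu>. f z * cnj (F z)) \<le> 1 / 2"
        using cross complex_Re_le_cmod order_trans by blast
      have "(LINT z|\<nu>. (cmod (f z))\<^sup>2) \<le> (LINT z|\<nu>. 1)"
        using i1(2) fb by (intro integral_mono) (auto simp: sp power_le_one)
      then show "(LINT z|\<nu>. (cmod (f z))\<^sup>2) \<le> 1" by (simp add: prob_space)
    qed simp
    finally have 2: "(LINT z|\<nu>. (cmod (F z + f z))\<^sup>2) \<le> 2 * real (Suc N)" by simp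
    show ?case using 1 2 pol_in_add[OF F(1) f] by (intro exI[of _ "\<lambda>z. F z + f z"]) auto
  qed
  \<comment> \<open>Cauchy-Schwarz is used in the form
    \<open>2 * cmod (F z) \<le> s + (cmod (F z))^2 / s\<close>. For this \<open>s\<close> the term
    that grows with \<open>N\<close> is \<open>N * \<epsilon> / 4\<close> and is absorbed on the
    left.\<close>
  define s where "s = 4 * (H + 1) / \<epsilon>"
  have s: "0 < s" using H0 \<epsilon> by (simp add: s_def)
  have "real N * \<epsilon> \<le> (H + 1) * s" for N
  proof -
    obtain F where F: "pol_in S F" "real N * \<epsilon> \<le> Re (LINT z|\<nu>. F z * h z)" "(LINT z|\<nu>. (cmod (F z))\<^sup>2) \<le> 2 * real N"
      using step by blast
    have Fc: "continuous_on torus F" using F(1) pol_in_continuous by auto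
    have i1: "integrable \<nu> (\<lambda>z. (cmod (F z))\<^sup>2)"
      using integrable_norm[OF int_c, of "\<lambda>z. F z * F z"] Fc
      by (simp add: norm_mult power2_eq_square continuous_on_mult)
    have "Re (LINT z|\<nu>. F z * h z) \<le> (LINT z|\<nu>. cmod (F z * h z))"
      using complex_Re_le_cmod integral_norm_bound order_trans by blast
    also have "\<dots> \<le> (LINT z|\<nu>. (H + 1) / 2 * (s + (cmod (F z))\<^sup>2 / s))"
    proof (rule integral_mono)
      show "integrable \<nu> (\<lambda>z. cmod (F z * h z))" using int_h[OF Fc] by (rule integrable_norm)
      show "integrable \<nu> (\<lambda>z. (H + 1) / 2 * (s + (cmod (F z))\<^sup>2 / s))" using i1 by simp
      fix z assume z: "z \<in> space \<nu>"
      have "0 \<le> (s - cmod (F z))\<^sup>2 / s" using s by simp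
      also have "\<dots> = s + (cmod (F z))\<^sup>2 / s - 2 * cmod (F z)"
        using s by (simp add: power2_eq_square field_simps)
      finally have "cmod (F z) \<le> (s + (cmod (F z))\<^sup>2 / s) / 2" by simp
      moreover have "cmod (h z) \<le> H + 1" using h(2)[of z] z by (simp add: sp)
      ultimately have "cmod (F z) * cmod (h z) \<le> (s + (cmod (F z))\<^sup>2 / s) / 2 * (H + 1)"
        using H0 s by (intro mult_mono) auto
      then show "cmod (F z * h z) \<le> (H + 1) / 2 * (s + (cmod (F z))\<^sup>2 / s)"
        by (simp add: norm_mult mult.commute)
    qed
    also have "\<dots> = (H + 1) / 2 * (s + (LINT z|\<nu>. (cmod (F z))\<^sup>2) / s)"
      using i1 by (simp add: prob_space)
    also have "\<dots> \<le> (H + 1) / 2 * (s + 2 * real N / s)"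
      using H0 s F(3) by (intro mult_left_mono add_left_mono divide_right_mono) auto
    also have "\<dots> = (H + 1) * s / 2 + real N * ((H + 1) / s)" using s by (simp add: field_simps)
    also have "(H + 1) / s = \<epsilon> / 4"
    proof -
      have "K / (4 * K / \<epsilon>) = \<epsilon> / 4" if "0 < K" for K
        using that \<epsilon> by (simp add: field_simps)
      moreover have "0 < H + 1" using H0 by simp
      ultimately show ?thesis unfolding s_def by blast
    qed
    finally have "real N * \<epsilon> \<le> (H + 1) * s / 2 + real N * (\<epsilon> / 4)" using F(2) by simp
    moreover have "0 \<le> real N * \<epsilon>" using \<epsilon> by simp
    ultimately show ?thesis by linarith
  qed
  then have "real N \<le> (H + 1) * s / \<epsilon>" for N using \<epsilon> by (simp add: field_simps)
  then show False using reals_Archimedean2 not_le by blast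
qed

text \<open>Only elements of the algebra have known integrals, so the conjugate of
  \<open>monom_fun \<beta>\<close> has to be cancelled. A pure power of \<open>z $ j\<close> is
  absorbed by \<open>z $ j ^ m\<close>, which leaves an element that vanishes at 0. Another
  conjugate variable \<open>z $ i\<close> cancels against the part of \<open>p\<close> divisible by
  \<open>z $ i\<close>; the part of \<open>p\<close> free of \<open>z $ i\<close> is the case
  \<open>P\<close> of fewer variables.\<close>

lemma shifted_balls_monomial:
  fixes \<nu> :: "(complex^'n::finite) measure"
  assumes \<nu>: "representing_measure 0 \<nu>" and j: "j \<in> S"
    and P: "\<And>i h H \<epsilon>. i \<in> S - {j} \<Longrightarrow> h \<in> borel_measurable \<nu> \<Longrightarrow> (\<And>z. z \<in> torus \<Longrightarrow> cmod (h z) \<le> H) \<Longrightarrow> 0 < \<epsilon> \<Longrightarrow>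
      \<exists>m0. \<forall>m\<ge>m0. \<forall>p. pol_in (S - {i}) p \<longrightarrow>
      (\<forall>z\<in>torus. cmod (p z) \<le> 1) \<longrightarrow> cmod (LINT z|\<nu>. z $ j ^ m * p z * h z) \<le> \<epsilon>"
    and \<beta>: "\<And>i. i \<notin> S \<Longrightarrow> Poly_Mapping.lookup \<beta> i = 0" and \<epsilon>: "0 < \<epsilon>"
  shows "\<exists>m0. \<forall>m\<ge>m0. \<forall>p. pol_in S p \<longrightarrow>
      (\<forall>z\<in>torus. cmod (p z) \<le> 1) \<longrightarrow> cmod (LINT z|\<nu>. z $ j ^ m * p z * cnj (monom_fun \<beta> z)) \<le> \<epsilon>"
  using \<beta> \<epsilon>
proof (induction "\<Sum>i\<in>UNIV - {j}. Poly_Mapping.lookup \<beta> i" arbitrary: \<beta> \<epsilon>)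
  case 0
  have sets: "sets \<nu> = sets torus_borel" and rep: "\<And>u. u \<in> polydisc_algebra \<Longrightarrow> u 0 = (LINT w|\<nu>. u w)"
    using \<nu> by (auto simp: representing_measure_def)
  have sp: "space \<nu> = torus" by (rule space_torus_borel[OF sets])
  define b where "b = Poly_Mapping.lookup \<beta> j"
  have "\<beta> = Poly_Mapping.single j b"
    using 0(1) by (intro poly_mapping_eqI) (auto simp: b_def lookup_single when_def)
  then have mb: "monom_fun \<beta> z = z $ j ^ b" for z by (simp add: monom_fun_single)
  \<comment> \<open>Beyond \<open>b\<close> a positive power of \<open>z $ j\<close> survives the
    cancellation, and it vanishes at 0.\<close>
  have "(LINT z|\<nu>. z $ j ^ m * p z * cnj (monom_fun \<beta> z)) = 0" if m: "Suc b \<le> m" and p: "pol_in S p" for m p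
  proof -
    have "(LINT z|\<nu>. z $ j ^ m * p z * cnj (monom_fun \<beta> z)) = (LINT z|\<nu>. z $ j ^ (m - b) * p z)"
    proof (rule Bochner_Integration.integral_cong[OF refl])
      fix z assume "z \<in> space \<nu>"
      then have "z $ j * cnj (z $ j) = 1" by (simp add: sp torus_def complex_norm_square[symmetric])
      then have "z $ j ^ b * cnj (z $ j) ^ b = 1" by (metis power_mult_distrib power_one)
      moreover have "z $ j ^ m = z $ j ^ (m - b) * z $ j ^ b" using m by (simp flip: power_add)
      ultimately show "z $ j ^ m * p z * cnj (monom_fun \<beta> z) = z $ j ^ (m - b) * p z"
        by (simp add: mb mult_ac)
    qed
    also have "\<dots> = 0 ^ (m - b) * p 0"
      using rep[of "\<lambda>z. z $ j ^ (m - b) * p z"] p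
      by (simp add: polydisc_algebra_mult polydisc_algebra_power polydisc_algebra_nth polydisc_algebra_pol pol_in_is_pol)
    also have "\<dots> = 0" using m by simp
    finally show ?thesis .
  qed
  then show ?case using 0(3) by (intro exI[of _ "Suc b"]) auto
next
  case (Suc k)
  have sets: "sets \<nu> = sets torus_borel" and fin: "finite_measure \<nu>"
    using \<nu> by (auto simp: representing_measure_def intro: prob_space.finite_measure)
  have sp: "space \<nu> = torus" by (rule space_torus_borel[OF sets])
  obtain i where i: "i \<noteq> j" "Poly_Mapping.lookup \<beta> i \<noteq> 0"
  proof -
    have "(\<Sum>i\<in>UNIV - {j}. Poly_Mapping.lookup \<beta> i) \<noteq> 0" using Suc.hyps(2) by linarith
    then show ?thesis using that by (metis (no_types, lifting) Diff_iff insertI1 sum.neutral)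
  qed
  have iS: "i \<in> S" using Suc.prems(1)[of i] i(2) by (cases "i \<in> S") auto
  define e where "e = Poly_Mapping.single i (1::nat)"
  define \<beta>' where "\<beta>' = \<beta> - e"
  have \<beta>: "\<beta> = \<beta>' + e"
    using i by (intro poly_mapping_eqI) (auto simp: \<beta>'_def lookup_add lookup_minus e_def lookup_single when_def)
  have mb: "monom_fun \<beta> z = monom_fun \<beta>' z * z $ i" for z
    unfolding \<beta> monom_fun_add by (simp add: e_def monom_fun_single)
  have "(\<Sum>i\<in>UNIV - {j}. Poly_Mapping.lookup \<beta> i) = (\<Sum>i\<in>UNIV - {j}. Poly_Mapping.lookup \<beta>' i) + (\<Sum>k\<in>UNIV - {j}. if k = i then 1 else 0)"
    unfolding \<beta> by (simp add: lookup_add sum.distrib e_def lookup_single when_def eq_commute)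
  also have "(\<Sum>k\<in>UNIV - {j}. if k = i then 1 else 0) = (1::nat)" using i by simp
  finally have k: "k = (\<Sum>i\<in>UNIV - {j}. Poly_Mapping.lookup \<beta>' i)" using Suc.hyps(2) by simp
  have "\<exists>m0. \<forall>m\<ge>m0. \<forall>p. pol_in S p \<longrightarrow>
      (\<forall>z\<in>torus. cmod (p z) \<le> 1) \<longrightarrow> cmod (LINT z|\<nu>. z $ j ^ m * p z * cnj (monom_fun \<beta>' z)) \<le> \<epsilon> / 4"
    using Suc.prems by (intro Suc.hyps(1)[OF k]) (auto simp: \<beta>'_def lookup_minus)
  then obtain m1 where m1: "\<And>m p. m1 \<le> m \<Longrightarrow> pol_in S p \<Longrightarrow> (\<forall>z\<in>torus. cmod (p z) \<le> 1) \<Longrightarrow>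
      cmod (LINT z|\<nu>. z $ j ^ m * p z * cnj (monom_fun \<beta>' z)) \<le> \<epsilon> / 4" by blast
  have hc: "continuous_on torus (\<lambda>z. cnj (monom_fun \<gamma> z))" for \<gamma> :: "'n \<Rightarrow>\<^sub>0 nat"
    by (intro continuous_intros monom_continuous)
  have "\<exists>m0. \<forall>m\<ge>m0. \<forall>p. pol_in (S - {i}) p \<longrightarrow>
      (\<forall>z\<in>torus. cmod (p z) \<le> 1) \<longrightarrow> cmod (LINT z|\<nu>. z $ j ^ m * p z * cnj (monom_fun \<beta> z)) \<le> \<epsilon> / 2"
    by (rule P[where H = 1]) (use i iS Suc.prems(2) torus_measurable[OF sets hc] in \<open>auto simp: norm_monom_fun_torus\<close>)
  then obtain m2 where m2: "\<And>m p. m2 \<le> m \<Longrightarrow> pol_in (S - {i}) p \<Longrightarrow> (\<forall>z\<in>torus. cmod (p z) \<le> 1) \<Longrightarrow>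
      cmod (LINT z|\<nu>. z $ j ^ m * p z * cnj (monom_fun \<beta> z)) \<le> \<epsilon> / 2" by blast
  have "cmod (LINT z|\<nu>. z $ j ^ m * p z * cnj (monom_fun \<beta> z)) \<le> \<epsilon>"
    if m: "max m1 m2 \<le> m" and p: "pol_in S p" "\<forall>z\<in>torus. cmod (p z) \<le> 1" for m p
  proof -
    obtain p0 q where s: "pol_in (S - {i}) p0" "pol_in S q" "\<And>z. p z = p0 z + z $ i * q z"
      "\<And>z. z \<in> torus \<Longrightarrow> cmod (p0 z) \<le> 1" "\<And>z. z \<in> torus \<Longrightarrow> cmod (q z) \<le> 2 * 1"
      using pol_in_split[OF p(1) _ iS, of 1] p(2) by auto
    \<comment> \<open>The quotient \<open>q\<close> is bounded by \<open>2\<close>. Halving returns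
      it to the unit ball; the factor \<open>2\<close> is met by the tolerance
      \<open>\<epsilon> / 4\<close>.\<close>
    define q' where "q' z = (1 / 2) * q z" for z
    have q': "pol_in S q'" "\<forall>z\<in>torus. cmod (q' z) \<le> 1"
      using s(2,5) by (auto simp: q'_def[abs_def] norm_mult intro: pol_in_cmult[of S q "1/2", simplified])
    have c: "continuous_on torus (\<lambda>z. z $ j ^ m * p0 z * cnj (monom_fun \<beta> z))"
      "continuous_on torus (\<lambda>z. z $ j ^ m * q' z * cnj (monom_fun \<beta>' z))"
      using pol_in_continuous[OF s(1)] pol_in_continuous[OF q'(1)] hc
      by (auto intro!: continuous_intros monom_continuous)
    have "(LINT z|\<nu>. z $ j ^ m * p z * cnj (monom_fun \<beta> z)) =
        (LINT z|\<nu>. z $ j ^ m * p0 z * cnj (monom_fun \<beta> z) + 2 * (z $ j ^ m * q' z * cnj (monom_fun \<beta>' z)))"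
    proof (rule Bochner_Integration.integral_cong[OF refl])
      fix z assume "z \<in> space \<nu>"
      then have 1: "z $ i * cnj (z $ i) = 1" by (simp add: sp torus_def complex_norm_square[symmetric])
      have "z $ j ^ m * (z $ i * q z) * cnj (monom_fun \<beta> z) = z $ j ^ m * q z * cnj (monom_fun \<beta>' z) * (z $ i * cnj (z $ i))"
        by (simp add: mb mult_ac)
      then show "z $ j ^ m * p z * cnj (monom_fun \<beta> z) =
          z $ j ^ m * p0 z * cnj (monom_fun \<beta> z) + 2 * (z $ j ^ m * q' z * cnj (monom_fun \<beta>' z))"
        unfolding 1 by (simp add: s(3) q'_def algebra_simps)
    qed
    also have "\<dots> = (LINT z|\<nu>. z $ j ^ m * p0 z * cnj (monom_fun \<beta> z)) + 2 * (LINT z|\<nu>. z $ j ^ m * q' z * cnj (monom_fun \<beta>' z))"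
      using torus_integrable[OF sets fin c(1)] torus_integrable[OF sets fin c(2)] by simp
    also have "cmod \<dots> \<le> \<epsilon> / 2 + 2 * (\<epsilon> / 4)"
      using m2[of m p0] m1[of m q'] m s q' by (intro norm_triangle_mono) (auto simp: norm_mult)
    finally show ?thesis by simp
  qed
  then show ?case by blast
qed

lemma shifted_balls_polynomial:
  fixes \<nu> :: "(complex^'n::finite) measure"
  assumes \<nu>: "finite_measure \<nu>" "sets \<nu> = sets torus_borel"
    and mon: "\<And>\<beta> \<epsilon>. (\<And>i. i \<notin> S \<Longrightarrow> Poly_Mapping.lookup \<beta> i = 0) \<Longrightarrow> 0 < \<epsilon> \<Longrightarrow> \<exists>m0. \<forall>m\<ge>m0. \<forall>p. pol_in S p \<longrightarrow>
      (\<forall>z\<in>torus. cmod (p z) \<le> 1) \<longrightarrow> cmod (LINT z|\<nu>. z $ j ^ m * p z * cnj (monom_fun \<beta> z)) \<le> \<epsilon>"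
    and F: "pol_in S F" and \<epsilon>: "0 < \<epsilon>"
  shows "\<exists>m0. \<forall>m\<ge>m0. \<forall>p. pol_in S p \<longrightarrow>
      (\<forall>z\<in>torus. cmod (p z) \<le> 1) \<longrightarrow> cmod (LINT z|\<nu>. z $ j ^ m * p z * cnj (F z)) \<le> \<epsilon>"
proof -
  obtain A c where A: "finite A" "\<forall>\<alpha>\<in>A. \<forall>i. i \<notin> S \<longrightarrow> Poly_Mapping.lookup \<alpha> i = 0" "F = pol A c"
    using F by (auto simp: pol_in_def)
  \<comment> \<open>The summand \<open>1\<close> keeps the divisor positive when all coefficients
    vanish.\<close>
  define K where "K = (\<Sum>\<alpha>\<in>A. cmod (c \<alpha>)) + 1"
  have K: "0 < K" unfolding K_def by (intro add_nonneg_pos sum_nonneg) auto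
  have "\<forall>\<alpha>\<in>A. \<exists>m0. \<forall>m\<ge>m0. \<forall>p. pol_in S p \<longrightarrow> (\<forall>z\<in>torus. cmod (p z) \<le> 1) \<longrightarrow>
      cmod (LINT z|\<nu>. z $ j ^ m * p z * cnj (monom_fun \<alpha> z)) \<le> \<epsilon> / K"
  proof
    fix \<alpha> assume "\<alpha> \<in> A"
    then show "\<exists>m0. \<forall>m\<ge>m0. \<forall>p. pol_in S p \<longrightarrow> (\<forall>z\<in>torus. cmod (p z) \<le> 1) \<longrightarrow>
        cmod (LINT z|\<nu>. z $ j ^ m * p z * cnj (monom_fun \<alpha> z)) \<le> \<epsilon> / K"
      using A(2) \<epsilon> K by (intro mon) auto
  qed
  then have "\<exists>M. \<forall>\<alpha>\<in>A. \<forall>m\<ge>M \<alpha>. \<forall>p. pol_in S p \<longrightarrow> (\<forall>z\<in>torus. cmod (p z) \<le> 1) \<longrightarrow>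
      cmod (LINT z|\<nu>. z $ j ^ m * p z * cnj (monom_fun \<alpha> z)) \<le> \<epsilon> / K"
    by (rule bchoice)
  then obtain M where M: "\<forall>\<alpha>\<in>A. \<forall>m\<ge>M \<alpha>. \<forall>p. pol_in S p \<longrightarrow> (\<forall>z\<in>torus. cmod (p z) \<le> 1) \<longrightarrow>
      cmod (LINT z|\<nu>. z $ j ^ m * p z * cnj (monom_fun \<alpha> z)) \<le> \<epsilon> / K"
    by (rule exE)
  have "cmod (LINT z|\<nu>. z $ j ^ m * p z * cnj (F z)) \<le> \<epsilon>"
    if m: "(\<Sum>\<alpha>\<in>A. M \<alpha>) \<le> m" and p: "pol_in S p" "\<forall>z\<in>torus. cmod (p z) \<le> 1" for m p
  proof -
    have i: "integrable \<nu> (\<lambda>z. cnj (c \<alpha>) * (z $ j ^ m * p z * cnj (monom_fun \<alpha> z)))" for \<alpha>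
      using pol_in_continuous[OF p(1)]
      by (intro integrable_mult_right torus_integrable[OF \<nu>(2,1)] continuous_intros monom_continuous)
    have "(LINT z|\<nu>. z $ j ^ m * p z * cnj (F z)) =
        (LINT z|\<nu>. (\<Sum>\<alpha>\<in>A. cnj (c \<alpha>) * (z $ j ^ m * p z * cnj (monom_fun \<alpha> z))))"
      by (simp add: A(3) pol_def sum_distrib_left mult_ac)
    also have "\<dots> = (\<Sum>\<alpha>\<in>A. cnj (c \<alpha>) * (LINT z|\<nu>. z $ j ^ m * p z * cnj (monom_fun \<alpha> z)))"
      using i by (subst Bochner_Integration.integral_sum) auto
    also have "cmod \<dots> \<le> (\<Sum>\<alpha>\<in>A. cmod (c \<alpha>) * (\<epsilon> / K))"
    proof (rule sum_norm_le)
      fix \<alpha> assume \<alpha>: "\<alpha> \<in> A"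
      have "M \<alpha> \<le> (\<Sum>\<alpha>\<in>A. M \<alpha>)" using \<alpha> A(1) by (intro member_le_sum) auto
      then show "cmod (cnj (c \<alpha>) * (LINT z|\<nu>. z $ j ^ m * p z * cnj (monom_fun \<alpha> z))) \<le> cmod (c \<alpha>) * (\<epsilon> / K)"
        using M[rule_format, OF \<alpha> _ p(1) p(2)[rule_format], of m] m
        unfolding norm_mult complex_mod_cnj by (intro mult_left_mono) auto
    qed
    also have "\<dots> = (K - 1) * (\<epsilon> / K)" unfolding sum_distrib_right[symmetric] by (simp add: K_def)
    also have "\<dots> \<le> K * (\<epsilon> / K)" using K \<epsilon> by (intro mult_right_mono) auto
    also have "\<dots> = \<epsilon>" using K by simp
    finally show ?thesis .
  qed
  then show ?thesis by blast
qed

text \<open>Induction on the number of variables in \<open>S\<close>: bounded densities for smaller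
  sets give conjugate monomials for \<open>S\<close>, hence conjugate polynomials, hence all bounded
  densities for \<open>S\<close> by the selection of almost orthogonal functions. For
  \<open>S = {j}\<close> there is no smaller set to refer to, and the cancellation of powers of
  \<open>z $ j\<close> does everything.\<close>

lemma shifted_balls_bounded:
  fixes \<nu> :: "(complex^'n::finite) measure"
  assumes \<nu>: "representing_measure 0 \<nu>" and "j \<in> S"
    and "h \<in> borel_measurable \<nu>" "\<And>z. z \<in> torus \<Longrightarrow> cmod (h z) \<le> H" and "0 < \<epsilon>"
  shows "\<exists>m0. \<forall>m\<ge>m0. \<forall>p. pol_in S p \<longrightarrow>
      (\<forall>z\<in>torus. cmod (p z) \<le> 1) \<longrightarrow> cmod (LINT z|\<nu>. z $ j ^ m * p z * h z) \<le> \<epsilon>"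
  using assms(2-)
proof (induction "card S" arbitrary: S h H \<epsilon> rule: less_induct)
  case less
  have \<nu>': "prob_space \<nu>" "sets \<nu> = sets torus_borel" "finite_measure \<nu>"
    using \<nu> by (auto simp: representing_measure_def intro: prob_space.finite_measure)
  show ?case
  proof (rule shifted_balls_weakly_null[OF \<nu>'(1,2) less.prems(1) _ less.prems(2,3,4)])
    fix F :: "complex^'n \<Rightarrow> complex" and e :: real
    assume F: "pol_in S F" "0 < e"
    show "\<exists>m0. \<forall>m\<ge>m0. \<forall>p. pol_in S p \<longrightarrow>
      (\<forall>z\<in>torus. cmod (p z) \<le> 1) \<longrightarrow> cmod (LINT z|\<nu>. z $ j ^ m * p z * cnj (F z)) \<le> e"
    proof (rule shifted_balls_polynomial[OF \<nu>'(3,2) _ F])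
      fix \<beta> :: "'n \<Rightarrow>\<^sub>0 nat" and d :: real
      assume \<beta>: "\<And>i. i \<notin> S \<Longrightarrow> Poly_Mapping.lookup \<beta> i = 0" and d: "0 < d"
      show "\<exists>m0. \<forall>m\<ge>m0. \<forall>p. pol_in S p \<longrightarrow>
        (\<forall>z\<in>torus. cmod (p z) \<le> 1) \<longrightarrow> cmod (LINT z|\<nu>. z $ j ^ m * p z * cnj (monom_fun \<beta> z)) \<le> d"
      proof (rule shifted_balls_monomial[OF \<nu> less.prems(1) _ \<beta> d])
        fix i h H and \<epsilon> :: real
        assume i: "i \<in> S - {j}" and h: "h \<in> borel_measurable \<nu>" "\<And>z. z \<in> torus \<Longrightarrow> cmod (h z) \<le> H" "0 < \<epsilon>"
        have "card (S - {i}) < card S" using i by (intro card_Diff1_less) auto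
        moreover have "j \<in> S - {i}" using i less.prems(1) by auto
        ultimately show "\<exists>m0. \<forall>m\<ge>m0. \<forall>p. pol_in (S - {i}) p \<longrightarrow>
          (\<forall>z\<in>torus. cmod (p z) \<le> 1) \<longrightarrow> cmod (LINT z|\<nu>. z $ j ^ m * p z * h z) \<le> \<epsilon>"
          using h by (intro less.hyps) auto
      qed
    qed
  qed
qed

text \<open>Truncations approximate \<open>h\<close> in mean, and the test functions are bounded by
  \<open>1\<close> on the torus, so the error of a truncation is uniform in \<open>m\<close> and
  \<open>p\<close>.\<close>

lemma shifted_balls_integrable:
  fixes \<nu> :: "(complex^'n::finite) measure"
  assumes \<nu>: "representing_measure 0 \<nu>" and h: "integrable \<nu> h" and \<epsilon>: "0 < \<epsilon>"
  shows "\<exists>m0. \<forall>m\<ge>m0. \<forall>p. is_pol p \<longrightarrow>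
      (\<forall>z\<in>torus. cmod (p z) \<le> 1) \<longrightarrow> cmod (LINT z|\<nu>. z $ j ^ m * p z * h z) \<le> \<epsilon>"
proof -
  have \<nu>': "prob_space \<nu>" "sets \<nu> = sets torus_borel" "finite_measure \<nu>"
    using \<nu> by (auto simp: representing_measure_def intro: prob_space.finite_measure)
  have sp: "space \<nu> = torus" by (rule space_torus_borel[OF \<nu>'(2)])
  have hm[measurable]: "h \<in> borel_measurable \<nu>" using h by auto
  define g where "g k z = (if cmod (h z) \<le> real k then h z else 0)" for k z
  have gm: "g k \<in> borel_measurable \<nu>" for k unfolding g_def by measurable
  have "(\<lambda>k. LINT z|\<nu>. cmod (h z - g k z)) \<longlonglongrightarrow> (LINT z|\<nu>. 0)"
  proof (rule integral_dominated_convergence[where w = "\<lambda>z. cmod (h z)"])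
    show "AE z in \<nu>. (\<lambda>k. cmod (h z - g k z)) \<longlonglongrightarrow> 0"
    proof (rule AE_I2)
      fix z
      obtain K :: nat where "cmod (h z) \<le> real K" using real_arch_simple by blast
      then have "\<forall>\<^sub>F k in sequentially. cmod (h z - g k z) = 0"
        unfolding eventually_sequentially g_def by (intro exI[of _ K]) (auto intro: order_trans)
      then show "(\<lambda>k. cmod (h z - g k z)) \<longlonglongrightarrow> 0" by (rule tendsto_eventually)
    qed
  qed (use gm h in \<open>auto simp: g_def\<close>)
  then have "\<forall>\<^sub>F k in sequentially. (LINT z|\<nu>. cmod (h z - g k z)) < \<epsilon> / 2"
    using \<epsilon> by (intro order_tendstoD) auto
  then obtain k where k: "(LINT z|\<nu>. cmod (h z - g k z)) < \<epsilon> / 2" by (auto simp: eventually_sequentially)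
  have gi: "integrable \<nu> (g k)"
    using gm by (intro finite_measure.integrable_const_bound[OF \<nu>'(3), of _ "real k"]) (auto simp: g_def)
  have gb: "cmod (g k z) \<le> real k" for z by (simp add: g_def)
  obtain m0 where m0: "\<And>m p. m0 \<le> m \<Longrightarrow> pol_in UNIV p \<Longrightarrow> (\<forall>z\<in>torus. cmod (p z) \<le> 1) \<Longrightarrow>
      cmod (LINT z|\<nu>. z $ j ^ m * p z * g k z) \<le> \<epsilon> / 2"
    using shifted_balls_bounded[OF \<nu> UNIV_I gm gb half_gt_zero[OF \<epsilon>]] by blast
  have "cmod (LINT z|\<nu>. z $ j ^ m * p z * h z) \<le> \<epsilon>"
    if m: "m0 \<le> m" and p: "is_pol p" "\<forall>z\<in>torus. cmod (p z) \<le> 1" for m p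
  proof -
    have pm: "p \<in> borel_measurable \<nu>"
      using torus_measurable[OF \<nu>'(2) polydisc_algebra_continuous[OF polydisc_algebra_pol[OF p(1)]]] .
    have zm: "(\<lambda>z. z $ j ^ m) \<in> borel_measurable \<nu>"
      by (rule torus_measurable[OF \<nu>'(2)]) (intro continuous_intros)
    have b: "cmod (z $ j ^ m * p z * w) \<le> cmod w" if "z \<in> torus" for z w
      using p(2) that by (simp add: norm_mult norm_power torus_def mult_left_le_one_le)
    have i1: "integrable \<nu> (\<lambda>z. z $ j ^ m * p z * f z)" if f: "integrable \<nu> f" for f
    proof (rule Bochner_Integration.integrable_bound[OF f])
      have "f \<in> borel_measurable \<nu>" using f by auto
      then show "(\<lambda>z. z $ j ^ m * p z * f z) \<in> borel_measurable \<nu>" using pm zm by measurable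
      show "AE z in \<nu>. cmod (z $ j ^ m * p z * f z) \<le> cmod (f z)" using b by (intro AE_I2) (simp add: sp)
    qed
    have hg: "integrable \<nu> (\<lambda>z. h z - g k z)" using h gi by simp
    have "(LINT z|\<nu>. z $ j ^ m * p z * h z) = (LINT z|\<nu>. z $ j ^ m * p z * (h z - g k z)) + (LINT z|\<nu>. z $ j ^ m * p z * g k z)"
      using i1[OF hg] i1[OF gi] by (simp flip: Bochner_Integration.integral_add add: algebra_simps)
    also have "cmod \<dots> \<le> \<epsilon> / 2 + \<epsilon> / 2"
    proof (rule norm_triangle_mono)
      have "cmod (LINT z|\<nu>. z $ j ^ m * p z * (h z - g k z)) \<le> (LINT z|\<nu>. cmod (z $ j ^ m * p z * (h z - g k z)))"
        by (rule integral_norm_bound)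
      also have "\<dots> \<le> (LINT z|\<nu>. cmod (h z - g k z))"
        using i1[OF hg] hg b by (intro integral_mono integrable_norm) (auto simp: sp)
      finally show "cmod (LINT z|\<nu>. z $ j ^ m * p z * (h z - g k z)) \<le> \<epsilon> / 2" using k by simp
      show "cmod (LINT z|\<nu>. z $ j ^ m * p z * g k z) \<le> \<epsilon> / 2"
        using m0[OF m is_pol_pol_in[OF p(1)] p(2)] .
    qed
    finally show ?thesis by simp
  qed
  then show ?thesis by blast
qed

text \<open>Null sets of the representing measure are null for \<open>\<eta>\<close>, so the real
  and imaginary parts have densities by the signed Radon-Nikodym theorem.\<close>

lemma M0_density:
  fixes \<eta> :: "(complex^'n::finite) set \<Rightarrow> complex"
  assumes "\<eta> \<in> M\<^sub>0"
  obtains \<nu> \<kappa> where "representing_measure 0 \<nu>" "integrable \<nu> \<kappa>"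
    "\<And>u. continuous_on torus u \<Longrightarrow> complex_measure_integral torus_borel \<eta> u = (LINT z|\<nu>. \<kappa> z * u z)"
proof -
  obtain \<nu> where \<nu>: "representing_measure 0 \<nu>" "\<forall>A\<in>null_sets \<nu>. \<eta> A = 0" and \<eta>: "complex_measure torus_borel \<eta>"
    using assms unfolding M\<^sub>0_def torus_measures_def by blast
  have \<nu>': "sets \<nu> = sets torus_borel" "finite_measure \<nu>"
    using \<nu>(1) by (auto simp: representing_measure_def intro: prob_space.finite_measure)
  have ca: "(\<lambda>i. \<eta> (A i)) sums \<eta> (\<Union>i. A i)" if "range A \<subseteq> sets \<nu>" "disjoint_family A" for A :: "nat \<Rightarrow> (complex^'n) set"
    using \<eta> that unfolding complex_measure_def \<nu>'(1) by blast
  obtain k where k: "integrable \<nu> k" "\<And>A. A \<in> sets \<nu> \<Longrightarrow> Re (\<eta> A) = (LINT x:A|\<nu>. k x)"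
    using signed_Radon_Nikodym[OF \<nu>'(2), of "\<lambda>A. Re (\<eta> A)"] sums_Re[OF ca] \<nu>(2) by auto
  obtain l where l: "integrable \<nu> l" "\<And>A. A \<in> sets \<nu> \<Longrightarrow> Im (\<eta> A) = (LINT x:A|\<nu>. l x)"
    using signed_Radon_Nikodym[OF \<nu>'(2), of "\<lambda>A. Im (\<eta> A)"] sums_Im[OF ca] \<nu>(2) by auto
  define \<kappa> where "\<kappa> z = Complex (k z) (l z)" for z
  have \<kappa>i: "integrable \<nu> \<kappa>"
    using k(1) l(1) unfolding \<kappa>_def Complex_eq by auto
  have "\<eta> A = (LINT x:A|\<nu>. \<kappa> x)" if "A \<in> sets torus_borel" for A
  proof -
    have A: "A \<in> sets \<nu>" using that \<nu>'(1) by simp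
    have i: "integrable \<nu> (\<lambda>x. indicat_real A x *\<^sub>R \<kappa> x)" using integrable_mult_indicator[OF A \<kappa>i] .
    show ?thesis
      using k(2)[OF A] l(2)[OF A] integral_Re[OF i] integral_Im[OF i]
      by (simp add: complex_eq_iff set_lebesgue_integral_def \<kappa>_def)
  qed
  then have "complex_measure_integral torus_borel \<eta> u = (LINT z|\<nu>. \<kappa> z * u z)" if "continuous_on torus u" for u
    using sup_norm_upper[OF that] torus_measurable[OF \<nu>'(1) that]
    by (intro complex_measure_integral_density[OF \<nu>'(1) \<kappa>i]) (auto simp: space_torus_borel[OF \<nu>'(1)])
  then show ?thesis using that \<nu>(1) \<kappa>i by blast
qed

section \<open>Splitting off the singular part\<close>

text \<open>The algebra is closed under multiplication by \<open>- \<i>\<close>, so the identity for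
  real parts carries the imaginary parts along. Real parts are what cones of inequalities
  deliver.\<close>

lemma representing_measureI:
  fixes \<nu> :: "(complex^'n::finite) measure"
  assumes \<nu>: "prob_space \<nu>" "sets \<nu> = sets torus_borel"
    and re: "\<And>u. u \<in> polydisc_algebra \<Longrightarrow> (LINT w|\<nu>. Re (u w)) = Re (u 0)"
  shows "representing_measure 0 \<nu>"
  unfolding representing_measure_def
proof (intro conjI ballI)
  fix u :: "complex^'n \<Rightarrow> complex" assume u: "u \<in> polydisc_algebra"
  have i: "integrable \<nu> u"
    using \<nu> u by (intro torus_integrable polydisc_algebra_continuous) (auto simp: prob_space.finite_measure)
  have "(\<lambda>z. - \<i> * u z) \<in> polydisc_algebra" using u by (rule polydisc_algebra_cmult)
  from re[OF this] have "(LINT w|\<nu>. Im (u w)) = Im (u 0)" by simp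
  then show "u 0 = (LINT w|\<nu>. u w)"
    using re[OF u] integral_Re[OF i] integral_Im[OF i] by (simp add: complex_eq_iff)
qed (use \<nu> in auto)

lemma representing_measureD:
  assumes "representing_measure 0 \<nu>"
  shows "prob_space \<nu>" "sets \<nu> = sets torus_borel" "finite_measure \<nu>" "space \<nu> = torus"
    "u \<in> polydisc_algebra \<Longrightarrow> (LINT w|\<nu>. u w) = u 0" "u \<in> polydisc_algebra \<Longrightarrow> (LINT w|\<nu>. Re (u w)) = Re (u 0)"
proof -
  show \<nu>: "prob_space \<nu>" "sets \<nu> = sets torus_borel" using assms by (auto simp: representing_measure_def)
  then show fin: "finite_measure \<nu>" by (simp add: prob_space.finite_measure)
  show "space \<nu> = torus" by (rule space_torus_borel[OF \<nu>(2)])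
  show eq: "(LINT w|\<nu>. u w) = u 0" if "u \<in> polydisc_algebra" for u
    using assms that by (simp add: representing_measure_def)
  show "(LINT w|\<nu>. Re (u w)) = Re (u 0)" if u: "u \<in> polydisc_algebra"
    using eq[OF u] integral_Re[OF torus_integrable[OF \<nu>(2) fin polydisc_algebra_continuous[OF u]]] by simp
qed

lemma sets_torus_borel_iff: "A \<in> sets (torus_borel :: (complex^'n::finite) measure) \<longleftrightarrow> A \<in> sets borel \<and> A \<subseteq> torus"
  unfolding torus_borel_def
  by (rule sets_restrict_space_iff[THEN trans]) (auto simp: compact_torus compact_imp_closed borel_closed)

lemma space_torus_borel_eq: "space torus_borel = torus"
  by (simp add: torus_borel_def space_restrict_space)

lemma finite_measure_density_indicator:
  "finite_measure M \<Longrightarrow> S \<in> sets M \<Longrightarrow> finite_measure (density M (indicator S))"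
  using finite_measure.emeasure_finite[of M "S \<inter> space M"]
  by (intro finite_measureI) (simp add: emeasure_restricted)

text \<open>Approximating indicators from below by continuous functions gives the inequality on open
  sets; outer regularity of \<open>\<theta>\<close> extends it to Borel sets.\<close>

lemma emeasure_le_of_integral_le:
  fixes \<psi> \<theta> :: "(complex^'n::finite) measure"
  assumes \<psi>: "finite_measure \<psi>" "sets \<psi> = sets torus_borel"
    and \<theta>: "finite_measure \<theta>" "sets \<theta> = sets torus_borel"
    and le: "\<And>g :: complex^'n \<Rightarrow> real. continuous_on torus g \<Longrightarrow> (\<And>z. z \<in> torus \<Longrightarrow> 0 \<le> g z) \<Longrightarrow> (LINT z|\<psi>. g z) \<le> (LINT z|\<theta>. g z)"
    and A: "A \<in> sets torus_borel"
  shows "emeasure \<psi> A \<le> emeasure \<theta> A"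
proof -
  have Ut: "U \<inter> torus \<in> sets torus_borel" if "open U" for U :: "(complex^'n) set"
    using that by (auto simp: sets_torus_borel_iff compact_torus compact_imp_closed)
  have open_le: "emeasure \<psi> (U \<inter> torus) \<le> emeasure \<theta> (U \<inter> torus)" if U: "open U" for U
  proof -
    define d where "d x = (if U = UNIV then 1 else infdist x (- U))" for x
    have d_cont: "continuous_on S d" for S
      by (cases "U = UNIV") (simp_all add: d_def[abs_def] continuous_on_infdist continuous_on_id)
    have d_pos: "0 < d x" if "x \<in> U" for x
    proof (cases "U = UNIV")
      case False
      have "infdist x (- U) \<noteq> 0"
        using in_closed_iff_infdist_zero[of "- U" x] False U that by (auto simp: closed_Compl)
      then show ?thesis using infdist_nonneg[of x "- U"] False by (simp add: d_def)
    qed (simp add: d_def)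
    have d_zero: "d x = 0" if "x \<notin> U" for x
      using that by (auto simp: d_def intro: infdist_zero)
    have d_nonneg: "0 \<le> d x" for x
      using d_pos[of x] d_zero[of x] by (cases "x \<in> U") auto
    define h where "h k x = min 1 (real k * d x)" for k x
    have h_c: "continuous_on torus (h k)" for k
      unfolding h_def by (intro continuous_intros d_cont)
    have h_01: "0 \<le> h k x" "h k x \<le> 1" for k x using d_nonneg by (auto simp: h_def)
    have h_lim: "(\<lambda>k. h k x) \<longlonglongrightarrow> indicator (U \<inter> torus) x" if x: "x \<in> torus" for x
    proof (cases "x \<in> U")
      case True
      obtain K :: nat where K: "1 / d x \<le> real K" using real_arch_simple by blast
      have "h k x = 1" if "K \<le> k" for k
      proof -
        have "1 / d x \<le> real k" using K that by (meson of_nat_mono order_trans)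
        then have "1 \<le> real k * d x" using d_pos[OF True] by (simp add: field_simps)
        then show ?thesis by (simp add: h_def)
      qed
      then have "\<forall>\<^sub>F k in sequentially. h k x = indicator (U \<inter> torus) x"
        using True x unfolding eventually_sequentially by auto
      then show ?thesis by (rule tendsto_eventually)
    next
      case False
      then show ?thesis by (simp add: h_def d_zero)
    qed
    have lim: "(\<lambda>k. LINT z|M. h k z) \<longlonglongrightarrow> measure M (U \<inter> torus)"
      if M: "finite_measure M" "sets M = sets torus_borel" for M
    proof -
      interpret finite_measure M by fact
      have sp: "space M = torus" by (rule space_torus_borel[OF M(2)])
      have UM: "U \<inter> torus \<in> sets M" using Ut[OF U] M(2) by simp
      have "(\<lambda>k. LINT z|M. h k z) \<longlonglongrightarrow> (LINT z|M. indicator (U \<inter> torus) z)"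
      proof (rule integral_dominated_convergence[where w = "\<lambda>_. 1"])
        show "h k \<in> borel_measurable M" for k by (rule torus_measurable[OF M(2) h_c])
        show "AE x in M. (\<lambda>k. h k x) \<longlonglongrightarrow> indicator (U \<inter> torus) x"
          using h_lim by (intro AE_I2) (simp add: sp)
        show "AE x in M. norm (h k x) \<le> 1" for k using h_01 by (intro AE_I2) auto
      qed (use UM in auto)
      then show ?thesis using UM by simp
    qed
    have "measure \<psi> (U \<inter> torus) \<le> measure \<theta> (U \<inter> torus)"
      using lim[OF \<psi>] lim[OF \<theta>] le[OF h_c] h_01 by (intro LIMSEQ_le) auto
    then show ?thesis
      using finite_measure.emeasure_eq_measure[OF \<psi>(1)] finite_measure.emeasure_eq_measure[OF \<theta>(1)]
      by (simp add: ennreal_leI)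
  qed
  \<comment> \<open>\<open>\<theta>\<close> is regarded as a Borel measure on the whole space, where
    the open supersets of \<open>A\<close> live.\<close>
  define L where "L = distr \<theta> borel (\<lambda>z. z)"
  have id: "(\<lambda>z. z) \<in> measurable \<theta> borel"
  proof (rule measurableI)
    fix B :: "(complex^'n) set" assume "B \<in> sets borel"
    then have "B \<inter> torus \<in> sets torus_borel"
      by (auto simp: sets_torus_borel_iff compact_torus compact_imp_closed)
    then show "(\<lambda>z. z) -` B \<inter> space \<theta> \<in> sets \<theta>" using \<theta>(2) by (simp add: space_torus_borel[OF \<theta>(2)])
  qed auto
  have eL: "emeasure L B = emeasure \<theta> (B \<inter> torus)" if "B \<in> sets borel" for B
    unfolding L_def using emeasure_distr[OF id that] by (simp add: space_torus_borel[OF \<theta>(2)])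
  have AB: "A \<in> sets borel" "A \<subseteq> torus" using A by (auto simp: sets_torus_borel_iff)
  have "emeasure L A = (INF U\<in>{U. A \<subseteq> U \<and> open U}. emeasure L U)"
  proof (rule outer_regular)
    show "sets L = sets borel" by (simp add: L_def)
    show "emeasure L (space L) \<noteq> \<infinity>"
      using finite_measure.emeasure_finite[OF \<theta>(1)] eL[of UNIV] by (simp add: L_def)
  qed (use AB in auto)
  moreover have "emeasure \<psi> A \<le> emeasure L U" if "A \<subseteq> U" "open U" for U
  proof -
    have "emeasure \<psi> A \<le> emeasure \<psi> (U \<inter> torus)"
      using that AB Ut[OF that(2)] \<psi>(2) by (intro emeasure_mono) auto
    also have "\<dots> \<le> emeasure \<theta> (U \<inter> torus)" by (rule open_le[OF that(2)])
    also have "\<dots> = emeasure L U" using that by (simp add: eL)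
    finally show ?thesis .
  qed
  ultimately have "emeasure \<psi> A \<le> emeasure L A" by (auto intro!: INF_greatest)
  also have "\<dots> = emeasure \<theta> A" using eL[OF AB(1)] AB(2) by (simp add: Int_absorb2)
  finally show ?thesis .
qed

text \<open>One cone on two copies of the torus produces the dominated measure \<open>\<psi>\<close> and the representing
  measure at once: the functional restricted to the second copy is \<open>\<psi>\<close>, its sum over both copies
  is \<open>\<nu>\<close>.\<close>

lemma dominated_representing_measure:
  fixes \<theta> :: "(complex^'n::finite) measure"
  assumes \<theta>: "finite_measure \<theta>" "sets \<theta> = sets torus_borel" and \<epsilon>: "0 \<le> \<epsilon>"
    and sep: "\<And>u g. u \<in> polydisc_algebra \<Longrightarrow> continuous_on torus g \<Longrightarrow> (\<And>z. z \<in> torus \<Longrightarrow> 0 \<le> Re (u z)) \<Longrightarrow>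
      (\<And>z. z \<in> torus \<Longrightarrow> 0 \<le> g z) \<Longrightarrow> (\<And>z. z \<in> torus \<Longrightarrow> 1 \<le> Re (u z) + g z) \<Longrightarrow> \<epsilon> \<le> Re (u 0) + (LINT z|\<theta>. g z)"
  obtains \<nu> \<psi> where "representing_measure 0 \<nu>" "finite_measure \<psi>" "sets \<psi> = sets torus_borel"
    "\<And>A. A \<in> sets torus_borel \<Longrightarrow> emeasure \<psi> A \<le> emeasure \<nu> A"
    "\<And>A. A \<in> sets torus_borel \<Longrightarrow> emeasure \<psi> A \<le> emeasure \<theta> A" "\<epsilon> \<le> measure \<psi> torus"
proof -
  define K where "K = (torus :: (complex^'n) set) \<times> {0, 1 :: complex}"
  have K: "compact K" unfolding K_def by (intro compact_Times compact_torus) auto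
  \<comment> \<open>The second coordinate flags the copy of the torus. The term \<open>u\<close>
    makes the sum over both copies represent 0, the term \<open>g\<close> keeps the measure on the
    copy flagged \<open>1\<close> below \<open>\<theta>\<close>, and \<open>t\<close> demands that
    this measure have mass at least \<open>\<epsilon>\<close>.\<close>
  define C where "C = {(f, c) | f c. continuous_on K f \<and> (\<exists>u g t. u \<in> polydisc_algebra \<and> continuous_on torus g \<and>
     (\<forall>z\<in>torus. 0 \<le> g z) \<and> 0 \<le> t \<and> (\<forall>x\<in>K. f x \<le> Re (u (fst x)) + Re (snd x) * (g (fst x) - t)) \<and>
     c = Re (u 0) + (LINT z|\<theta>. g z) - t * \<epsilon>)}"
  have C_I: "(f, Re (u 0) + (LINT z|\<theta>. g z) - t * \<epsilon>) \<in> C"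
    if "continuous_on K f" "u \<in> polydisc_algebra" "continuous_on torus g" "\<And>z. z \<in> torus \<Longrightarrow> 0 \<le> g z"
      "0 \<le> t" "\<And>x. x \<in> K \<Longrightarrow> f x \<le> Re (u (fst x)) + Re (snd x) * (g (fst x) - t)" for f u g t
    unfolding C_def using that by blast
  have C_E: "\<exists>u g t. continuous_on K f \<and> u \<in> polydisc_algebra \<and> continuous_on torus g \<and>
     (\<forall>z\<in>torus. 0 \<le> g z) \<and> 0 \<le> t \<and> (\<forall>x\<in>K. f x \<le> Re (u (fst x)) + Re (snd x) * (g (fst x) - t)) \<and>
     c = Re (u 0) + (LINT z|\<theta>. g z) - t * \<epsilon>" if "(f, c) \<in> C" for f c
    using that unfolding C_def by blast
  have int: "integrable \<theta> g" if "continuous_on torus g" for g :: "complex^'n \<Rightarrow> real"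
  proof -
    have "integrable \<theta> (\<lambda>z. complex_of_real (g z))"
      using that by (intro torus_integrable[OF \<theta>(2,1)] continuous_intros)
    from integrable_Re[OF this] show ?thesis by simp
  qed
  have contf: "continuous_on K (\<lambda>x. Re (u (fst x)))" if "continuous_on torus u" for u :: "complex^'n \<Rightarrow> complex"
    using that by (intro continuous_intros continuous_on_compose2[OF that, of K fst]) (auto simp: K_def)
  have contg: "continuous_on K (\<lambda>x. Re (snd x) * g (fst x))" if "continuous_on torus g" for g :: "complex^'n \<Rightarrow> real"
    using that by (intro continuous_intros continuous_on_compose2[OF that, of K fst]) (auto simp: K_def)
  obtain M where M: "sets M = sets (restrict_space borel K)" "finite_measure M"
    "\<And>f c. (f, c) \<in> C \<Longrightarrow> integral\<^sup>L M f \<le> c"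
  proof (rule cone_measure[OF K])
    show "continuous_on K f" if "(f, c) \<in> C" for f c using C_E[OF that] by blast
    show "((\<lambda>_. 0), 0) \<in> C"
      using C_I[of "\<lambda>_. 0" "\<lambda>_. 0" "\<lambda>_. 0" 0] by (simp add: polydisc_algebra_const)
    show "((\<lambda>_. 1), 1) \<in> C"
      using C_I[of "\<lambda>_. 1" "\<lambda>_. 1" "\<lambda>_. 0" 0] by (simp add: polydisc_algebra_const)
    show "((\<lambda>x. f x + g x), c + d) \<in> C" if fc: "(f, c) \<in> C" and gd: "(g, d) \<in> C" for f g c d
    proof -
      obtain u h t where 1: "continuous_on K f" "u \<in> polydisc_algebra" "continuous_on torus h"
        "\<forall>z\<in>torus. 0 \<le> h z" "0 \<le> t" "\<forall>x\<in>K. f x \<le> Re (u (fst x)) + Re (snd x) * (h (fst x) - t)"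
        "c = Re (u 0) + (LINT z|\<theta>. h z) - t * \<epsilon>" using C_E[OF fc] by blast
      obtain u' h' t' where 2: "continuous_on K g" "u' \<in> polydisc_algebra" "continuous_on torus h'"
        "\<forall>z\<in>torus. 0 \<le> h' z" "0 \<le> t'" "\<forall>x\<in>K. g x \<le> Re (u' (fst x)) + Re (snd x) * (h' (fst x) - t')"
        "d = Re (u' 0) + (LINT z|\<theta>. h' z) - t' * \<epsilon>" using C_E[OF gd] by blast
      have "((\<lambda>x. f x + g x), Re (u 0 + u' 0) + (LINT z|\<theta>. h z + h' z) - (t + t') * \<epsilon>) \<in> C"
      proof (rule C_I)
        show "continuous_on K (\<lambda>x. f x + g x)" using 1(1) 2(1) by (rule continuous_on_add)
        show "(\<lambda>z. u z + u' z) \<in> polydisc_algebra" using 1(2) 2(2) by (rule polydisc_algebra_add)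
        show "continuous_on torus (\<lambda>z. h z + h' z)" using 1(3) 2(3) by (rule continuous_on_add)
        show "0 \<le> h z + h' z" if "z \<in> torus" for z using 1(4) 2(4) that by simp
        show "0 \<le> t + t'" using 1(5) 2(5) by simp
        show "f x + g x \<le> Re (u (fst x) + u' (fst x)) + Re (snd x) * (h (fst x) + h' (fst x) - (t + t'))"
          if "x \<in> K" for x using bspec[OF 1(6) that] bspec[OF 2(6) that] by (simp add: algebra_simps)
      qed
      moreover have "Re (u 0 + u' 0) + (LINT z|\<theta>. h z + h' z) - (t + t') * \<epsilon> = c + d"
        unfolding 1(7) 2(7) using int[OF 1(3)] int[OF 2(3)] by (simp add: algebra_simps)
      ultimately show ?thesis by simp
    qed
    show "((\<lambda>x. s * f x), s * c) \<in> C" if fc: "(f, c) \<in> C" and s: "0 < s" for f c s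
    proof -
      obtain u h t where 1: "continuous_on K f" "u \<in> polydisc_algebra" "continuous_on torus h"
        "\<forall>z\<in>torus. 0 \<le> h z" "0 \<le> t" "\<forall>x\<in>K. f x \<le> Re (u (fst x)) + Re (snd x) * (h (fst x) - t)"
        "c = Re (u 0) + (LINT z|\<theta>. h z) - t * \<epsilon>" using C_E[OF fc] by blast
      have "((\<lambda>x. s * f x), Re (complex_of_real s * u 0) + (LINT z|\<theta>. s * h z) - (s * t) * \<epsilon>) \<in> C"
      proof (rule C_I)
        show "continuous_on K (\<lambda>x. s * f x)" using 1(1) by (rule continuous_on_mult_left)
        show "(\<lambda>z. complex_of_real s * u z) \<in> polydisc_algebra" using 1(2) by (rule polydisc_algebra_cmult)
        show "continuous_on torus (\<lambda>z. s * h z)" using 1(3) by (rule continuous_on_mult_left)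
        show "0 \<le> s * h z" if "z \<in> torus" for z using 1(4) that s by simp
        show "0 \<le> s * t" using 1(5) s by simp
        show "s * f x \<le> Re (complex_of_real s * u (fst x)) + Re (snd x) * (s * h (fst x) - s * t)"
          if "x \<in> K" for x
          using mult_left_mono[OF bspec[OF 1(6) that], of s] s by (simp add: algebra_simps)
      qed
      moreover have "Re (complex_of_real s * u 0) + (LINT z|\<theta>. s * h z) - (s * t) * \<epsilon> = s * c"
        unfolding 1(7) by (simp add: algebra_simps)
      ultimately show ?thesis by simp
    qed
    show "(g, c) \<in> C" if fc: "(f, c) \<in> C" and g: "continuous_on K g" "\<And>x. x \<in> K \<Longrightarrow> g x \<le> f x" for f g c
    proof -
      obtain u h t where 1: "continuous_on K f" "u \<in> polydisc_algebra" "continuous_on torus h"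
        "\<forall>z\<in>torus. 0 \<le> h z" "0 \<le> t" "\<forall>x\<in>K. f x \<le> Re (u (fst x)) + Re (snd x) * (h (fst x) - t)"
        "c = Re (u 0) + (LINT z|\<theta>. h z) - t * \<epsilon>" using C_E[OF fc] by blast
      show ?thesis
        unfolding 1(7)
      proof (intro C_I 1(2,3,5) g(1))
        show "0 \<le> h z" if "z \<in> torus" for z using 1(4) that by simp
        show "g x \<le> Re (u (fst x)) + Re (snd x) * (h (fst x) - t)" if "x \<in> K" for x
          using g(2)[OF that] bspec[OF 1(6) that] by linarith
      qed
    qed
    \<comment> \<open>The copy flagged \<open>0\<close> gives \<open>Re (u z) \<ge> 0\<close>, the
      copy flagged \<open>1\<close> gives \<open>Re (u z) + h z \<ge> t\<close>. After division by a
      positive \<open>t\<close> this is the situation of \<open>sep\<close>; for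
      \<open>t = 0\<close> nonnegativity at 0 is enough.\<close>
    show "0 \<le> c" if C0: "((\<lambda>_. 0), c) \<in> C" for c
    proof -
      obtain u h t where 1: "u \<in> polydisc_algebra" "continuous_on torus h"
        "\<forall>z\<in>torus. 0 \<le> h z" "0 \<le> t" "\<forall>x\<in>K. 0 \<le> Re (u (fst x)) + Re (snd x) * (h (fst x) - t)"
        "c = Re (u 0) + (LINT z|\<theta>. h z) - t * \<epsilon>" using C_E[OF C0] by blast
      have re: "0 \<le> Re (u z)" if "z \<in> torus" for z
        using bspec[OF 1(5), of "(z, 0)"] that by (simp add: K_def)
      have t: "t \<le> Re (u z) + h z" if "z \<in> torus" for z
        using bspec[OF 1(5), of "(z, 1)"] that by (simp add: K_def)
      show ?thesis
      proof (cases "t = 0")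
        case True
        have "0 \<le> (LINT z|\<theta>. h z)" using 1(3) by (intro integral_nonneg_AE AE_I2) (simp add: space_torus_borel[OF \<theta>(2)])
        then show ?thesis using polydisc_algebra_Re_nonneg[OF 1(1) re] True 1(6) by simp
      next
        case False
        then have t0: "0 < t" using 1(4) by simp
        have "\<epsilon> \<le> Re (complex_of_real (1 / t) * u 0) + (LINT z|\<theta>. (1 / t) * h z)"
        proof (rule sep)
          show "(\<lambda>z. complex_of_real (1 / t) * u z) \<in> polydisc_algebra" using 1(1) by (rule polydisc_algebra_cmult)
          show "continuous_on torus (\<lambda>z. 1 / t * h z)" using 1(2) by (rule continuous_on_mult_left)
          show "0 \<le> Re (complex_of_real (1 / t) * u z)" if "z \<in> torus" for z
            using re[OF that] t0 by (simp del: of_real_divide)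
          show "0 \<le> 1 / t * h z" if "z \<in> torus" for z using 1(3) that t0 by simp
          show "1 \<le> Re (complex_of_real (1 / t) * u z) + 1 / t * h z" if "z \<in> torus" for z
            using t[OF that] t0 by (simp add: field_simps del: of_real_divide)
        qed
        then have "\<epsilon> \<le> (Re (u 0) + (LINT z|\<theta>. h z)) / t"
          by (simp add: add_divide_distrib del: of_real_divide)
        then show ?thesis using t0 by (simp add: 1(6) field_simps)
      qed
    qed
    fix M :: "((complex^'n) \<times> complex) measure"
    assume M: "sets M = sets (restrict_space borel K)" "finite_measure M" "\<And>f c. (f, c) \<in> C \<Longrightarrow> integral\<^sup>L M f \<le> c"
    show thesis using M by (rule that)
  qed
  interpret M: finite_measure M by fact
  have spM: "space M = K" using sets_eq_imp_space_eq[OF M(1)] by (simp add: space_restrict_space)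
  have fstM: "fst \<in> measurable M torus_borel"
    unfolding torus_borel_def
  proof (rule measurable_restrict_space2)
    show "fst \<in> space M \<rightarrow> torus" by (auto simp: spM K_def)
    have "fst \<in> measurable (restrict_space borel K) borel"
      by (intro borel_measurable_continuous_on_restrict continuous_intros)
    then show "fst \<in> measurable M borel" using measurable_cong_sets[OF M(1) refl] by blast
  qed
  have sndM: "(\<lambda>x. Re (snd x)) \<in> borel_measurable M"
  proof -
    have "(\<lambda>x. Re (snd x)) \<in> measurable (restrict_space borel K) borel"
      by (intro borel_measurable_continuous_on_restrict continuous_intros)
    then show ?thesis using measurable_cong_sets[OF M(1) refl] by blast
  qed
  define \<nu> where "\<nu> = distr M torus_borel fst"
  define D where "D = {x \<in> space M. Re (snd x) = 1}"
  have D: "D \<in> sets M" unfolding D_def using sndM by measurable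
  define \<psi> where "\<psi> = distr (density M (indicator D)) torus_borel fst"
  have fstM': "fst \<in> measurable (density M (indicator D)) torus_borel" using fstM by simp
  have reK: "Re (snd x) = indicator D x" if "x \<in> space M" for x
    using that by (auto simp: D_def spM K_def indicator_def)
  \<comment> \<open>Demands hold for \<open>u\<close> and for \<open>- u\<close>, which turns the
    inequality into an equality.\<close>
  have eq_u: "(LINT x|M. Re (u (fst x))) = Re (u 0)" if u: "u \<in> polydisc_algebra" for u
  proof (rule antisym)
    have c: "continuous_on torus u" using u by (rule polydisc_algebra_continuous)
    have "((\<lambda>x. Re (u (fst x))), Re (u 0) + (LINT z|\<theta>. 0) - 0 * \<epsilon>) \<in> C"
      using u contf[OF c] by (intro C_I[where g = "\<lambda>_. 0"]) auto
    then show "(LINT x|M. Re (u (fst x))) \<le> Re (u 0)" using M(3) by fastforce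
    have "((\<lambda>x. Re (-1 * u (fst x))), Re (-1 * u 0) + (LINT z|\<theta>. 0) - 0 * \<epsilon>) \<in> C"
      using polydisc_algebra_cmult[OF u, of "-1"] contf[OF c]
      by (intro C_I[where g = "\<lambda>_. 0"]) (auto intro: continuous_on_minus)
    then have "(LINT x|M. Re (-1 * u (fst x))) \<le> Re (-1 * u 0) + (LINT z|\<theta>. 0) - 0 * \<epsilon>" by (rule M(3))
    then show "Re (u 0) \<le> (LINT x|M. Re (u (fst x)))" by simp
  qed
  have rep: "representing_measure 0 \<nu>"
  proof (rule representing_measureI)
    show "sets \<nu> = sets torus_borel" by (simp add: \<nu>_def)
    have "(LINT x|M. (1::real)) = 1" using eq_u[OF polydisc_algebra_const[of 1]] by simp
    then have "emeasure M (space M) = 1" by (simp add: M.emeasure_eq_measure)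
    then have "prob_space M" by (rule prob_spaceI)
    then show "prob_space \<nu>" unfolding \<nu>_def using fstM by (rule prob_space.prob_space_distr)
    fix u :: "complex^'n \<Rightarrow> complex" assume u: "u \<in> polydisc_algebra"
    have "(\<lambda>z. Re (u z)) \<in> borel_measurable torus_borel"
      using torus_measurable[OF refl polydisc_algebra_continuous[OF u]] by measurable
    then have "(LINT w|\<nu>. Re (u w)) = (LINT x|M. Re (u (fst x)))"
      unfolding \<nu>_def by (rule integral_distr[OF fstM])
    then show "(LINT w|\<nu>. Re (u w)) = Re (u 0)" using eq_u[OF u] by simp
  qed
  have fin\<psi>: "finite_measure \<psi>"
    unfolding \<psi>_def using finite_measure_density_indicator[OF M(2) D] fstM'
    by (rule finite_measure.finite_measure_distr)
  have sets\<psi>: "sets \<psi> = sets torus_borel" by (simp add: \<psi>_def)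
  have em\<psi>: "emeasure \<psi> A = emeasure M (D \<inter> (fst -` A \<inter> space M))" if A: "A \<in> sets torus_borel" for A
  proof -
    have "fst -` A \<inter> space M \<in> sets M" using measurable_sets[OF fstM A] .
    then show ?thesis unfolding \<psi>_def using emeasure_distr[OF fstM' A] D by (simp add: emeasure_restricted)
  qed
  have le\<nu>: "emeasure \<psi> A \<le> emeasure \<nu> A" if A: "A \<in> sets torus_borel" for A
    unfolding em\<psi>[OF A] \<nu>_def emeasure_distr[OF fstM A]
    using measurable_sets[OF fstM A] by (intro emeasure_mono) auto
  have int\<psi>: "(LINT z|\<psi>. g z) = (LINT x|M. Re (snd x) * g (fst x))" if g: "continuous_on torus g" for g :: "complex^'n \<Rightarrow> real"
  proof -
    have gm: "g \<in> borel_measurable torus_borel" by (rule torus_measurable[OF refl g])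
    have gM: "(\<lambda>x. g (fst x)) \<in> borel_measurable M" using measurable_compose[OF fstM gm] .
    have "(LINT z|\<psi>. g z) = (LINT x|density M (indicator D). g (fst x))"
      unfolding \<psi>_def using integral_distr[OF fstM' gm] .
    also have "\<dots> = (LINT x|density M (\<lambda>x. ennreal (indicator D x)). g (fst x))"
      by (simp add: ennreal_indicator)
    also have "\<dots> = (LINT x|M. indicat_real D x *\<^sub>R g (fst x))"
      using gM D by (intro integral_density) auto
    also have "\<dots> = (LINT x|M. Re (snd x) * g (fst x))"
      by (intro Bochner_Integration.integral_cong) (auto simp: reK)
    finally show ?thesis .
  qed
  have le\<theta>: "emeasure \<psi> A \<le> emeasure \<theta> A" if A: "A \<in> sets torus_borel" for A
  proof (rule emeasure_le_of_integral_le[OF fin\<psi> sets\<psi> \<theta> _ A])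
    fix g :: "complex^'n \<Rightarrow> real" assume g: "continuous_on torus g" "\<And>z. z \<in> torus \<Longrightarrow> 0 \<le> g z"
    have "((\<lambda>x. Re (snd x) * g (fst x)), Re 0 + (LINT z|\<theta>. g z) - 0 * \<epsilon>) \<in> C"
      using g contg[OF g(1)] by (intro C_I[where u = "\<lambda>_. 0"]) (auto simp: polydisc_algebra_const)
    from M(3)[OF this] show "(LINT z|\<psi>. g z) \<le> (LINT z|\<theta>. g z)" using int\<psi>[OF g(1)] by simp
  qed
  have "\<epsilon> \<le> measure \<psi> torus"
  proof -
    have "((\<lambda>x. Re (snd x) * - 1), Re 0 + (LINT z|\<theta>. 0) - 1 * \<epsilon>) \<in> C"
      using contg[of "\<lambda>_. -1"] by (intro C_I[where u = "\<lambda>_. 0" and g = "\<lambda>_. 0"]) (auto simp: polydisc_algebra_const)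
    from M(3)[OF this] have "\<epsilon> \<le> (LINT z|\<psi>. 1)" using int\<psi>[of "\<lambda>_. 1"] by simp
    then show ?thesis by (simp add: space_torus_borel[OF sets\<psi>])
  qed
  then show ?thesis using that[OF rep fin\<psi> sets\<psi> le\<nu> le\<theta>] by blast
qed

text \<open>For the zero measure and \<open>\<epsilon> = 0\<close> the separation hypothesis reduces
  to nonnegativity of the real part at 0.\<close>

lemma representing_measure_exists: "\<exists>\<nu> :: (complex^'n::finite) measure. representing_measure 0 \<nu>"
proof -
  have 0: "finite_measure (null_measure torus_borel)" by (rule finite_measureI) simp
  show ?thesis
  proof (rule dominated_representing_measure[OF 0, of 0])
    fix u :: "complex^'n \<Rightarrow> complex" and g
    assume "u \<in> polydisc_algebra" "\<And>z. z \<in> torus \<Longrightarrow> 0 \<le> Re (u z)"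
    then show "0 \<le> Re (u 0) + (LINT z|null_measure torus_borel. g z)"
      using polydisc_algebra_Re_nonneg[of u] by simp
  qed auto
qed

text \<open>In a mixture with strictly positive weights, null sets are null for every component. A
  geometric distribution provides such weights on the indices.\<close>

lemma representing_measure_mixture:
  fixes N :: "nat \<Rightarrow> (complex^'n::finite) measure"
  assumes N: "\<And>k. representing_measure 0 (N k)"
  obtains \<nu> where "representing_measure 0 \<nu>" "\<And>A k. A \<in> null_sets \<nu> \<Longrightarrow> A \<in> null_sets (N k)"
proof -
  define P where "P = measure_pmf (geometric_pmf (1 / 2))"
  define \<nu> where "\<nu> = P \<bind> N"
  have set_P: "set_pmf (geometric_pmf (1 / 2)) = UNIV" by (rule set_pmf_geometric) auto
  have ps: "prob_space P" unfolding P_def by (rule measure_pmf.prob_space_axioms)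
  have NK: "N k \<in> space (subprob_algebra torus_borel)" for k
    using representing_measureD(1,2)[OF N[of k]]
    by (simp add: space_subprob_algebra prob_space_imp_subprob_space)
  have Nm: "N \<in> measurable P (subprob_algebra torus_borel)"
    unfolding P_def using NK by (simp add: measurable_def)
  have ne: "space P \<noteq> {}" by (simp add: P_def)
  have sets: "sets \<nu> = sets torus_borel"
    unfolding \<nu>_def using representing_measureD(2)[OF N] ne by (intro sets_bind) auto
  have prob: "prob_space \<nu>"
    unfolding \<nu>_def by (rule prob_space.prob_space_bind[OF ps _ Nm]) (use representing_measureD(1)[OF N] in auto)
  have "representing_measure 0 \<nu>"
  proof (rule representing_measureI[OF prob sets])
    fix u :: "complex^'n \<Rightarrow> complex" assume u: "u \<in> polydisc_algebra"
    have c: "continuous_on torus u" using u by (rule polydisc_algebra_continuous)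
    define B where "B = sup_norm u"
    \<comment> \<open>The integral against a mixture is computed for a nonnegative function, hence
      the shift by the sup norm.\<close>
    define v where "v z = B + Re (u z)" for z
    have v0: "0 \<le> v z" if "z \<in> torus" for z
      using sup_norm_upper[OF c that] abs_Re_le_cmod[of "u z"] unfolding v_def B_def by linarith
    have vm: "v \<in> borel_measurable M" if "sets M = sets torus_borel" for M
      unfolding v_def using torus_measurable[OF that c] by measurable
    have i: "integrable \<rho> u" if "prob_space \<rho>" "sets \<rho> = sets torus_borel" for \<rho>
      using that c by (intro torus_integrable) (auto simp: prob_space.finite_measure)
    have vi: "integrable \<rho> v" "(LINT z|\<rho>. v z) = B + (LINT z|\<rho>. Re (u z))"
      "(\<integral>\<^sup>+z. ennreal (v z) \<partial>\<rho>) = ennreal (LINT z|\<rho>. v z)" if \<rho>: "prob_space \<rho>" "sets \<rho> = sets torus_borel" for \<rho>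
    proof -
      interpret prob_space \<rho> by fact
      have r: "integrable \<rho> (\<lambda>z. Re (u z))" using i[OF \<rho>] by (rule integrable_Re)
      show "integrable \<rho> v" unfolding v_def[abs_def] using r by simp
      show "(LINT z|\<rho>. v z) = B + (LINT z|\<rho>. Re (u z))" unfolding v_def[abs_def] using r by (simp add: prob_space)
      show "(\<integral>\<^sup>+z. ennreal (v z) \<partial>\<rho>) = ennreal (LINT z|\<rho>. v z)"
        using \<open>integrable \<rho> v\<close> v0 by (intro nn_integral_eq_integral AE_I2) (auto simp: space_torus_borel[OF \<rho>(2)])
    qed
    have "(\<integral>\<^sup>+z. ennreal (v z) \<partial>\<nu>) = (\<integral>\<^sup>+k. (\<integral>\<^sup>+z. ennreal (v z) \<partial>N k) \<partial>P)"
      unfolding \<nu>_def using vm[OF refl] by (intro nn_integral_bind[OF _ Nm]) measurable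
    also have "\<dots> = (\<integral>\<^sup>+k. ennreal (B + Re (u 0)) \<partial>P)"
      using vi(2,3)[OF representing_measureD(1,2)[OF N]] representing_measureD(6)[OF N u]
      by (intro nn_integral_cong) simp
    also have "\<dots> = ennreal (B + Re (u 0))"
      using prob_space.emeasure_space_1[OF ps] by simp
    finally have "ennreal (B + (LINT z|\<nu>. Re (u z))) = ennreal (B + Re (u 0))"
      using vi(2,3)[OF prob sets] by simp
    moreover have "0 \<le> B + (LINT z|\<nu>. Re (u z))"
      unfolding vi(2)[OF prob sets, symmetric]
      using v0 by (intro integral_nonneg_AE AE_I2) (simp add: space_torus_borel[OF sets])
    moreover have "0 \<le> B + Re (u 0)"
      using polydisc_algebra_zero_bound[OF u sup_norm_upper[OF c]] abs_Re_le_cmod[of "u 0"] unfolding B_def by linarith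
    ultimately show "(LINT z|\<nu>. Re (u z)) = Re (u 0)" by simp
  qed
  moreover have "A \<in> null_sets (N k)" if A: "A \<in> null_sets \<nu>" for A k
  proof -
    have As: "A \<in> sets torus_borel" using A sets by (auto simp: null_sets_def)
    have "(\<integral>\<^sup>+k. emeasure (N k) A \<partial>P) = 0"
      using A emeasure_bind[OF ne Nm As] by (simp add: \<nu>_def null_sets_def)
    then have "AE k in P. emeasure (N k) A = 0"
      by (subst (asm) nn_integral_0_iff_AE) (auto simp: P_def)
    then have "emeasure (N k) A = 0" unfolding P_def AE_measure_pmf_iff set_P by blast
    then show ?thesis using As representing_measureD(2)[OF N[of k]] by (simp add: null_sets_def)
  qed
  ultimately show ?thesis using that by blast
qed

text \<open>The set \<open>F\<close> carries the part of \<open>\<theta>\<close> that is absolutely continuous with respect to some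
  representing measure; countable mixtures of representing measures make its mass maximal.\<close>

lemma maximal_continuous_part:
  fixes \<theta> :: "(complex^'n::finite) measure"
  assumes \<theta>: "finite_measure \<theta>" "sets \<theta> = sets torus_borel"
  obtains F \<nu> where "F \<in> sets torus_borel" "representing_measure 0 \<nu>"
    "\<And>A. A \<in> null_sets \<nu> \<Longrightarrow> emeasure \<theta> (A \<inter> F) = 0"
    "\<And>G \<rho>. representing_measure 0 \<rho> \<Longrightarrow> G \<in> sets torus_borel \<Longrightarrow> G \<inter> F = {} \<Longrightarrow>
      (\<And>A. A \<in> null_sets \<rho> \<Longrightarrow> emeasure \<theta> (A \<inter> G) = 0) \<Longrightarrow> measure \<theta> G = 0"
proof -
  interpret finite_measure \<theta> by fact
  define good where "good F \<nu> \<longleftrightarrow> F \<in> sets torus_borel \<and> representing_measure 0 \<nu> \<and>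
    (\<forall>A. A \<in> null_sets \<nu> \<longrightarrow> emeasure \<theta> (A \<inter> F) = 0)" for F and \<nu> :: "(complex^'n) measure"
  define S where "S = {measure \<theta> F | F. \<exists>\<nu>. good F \<nu>}"
  obtain \<nu>0 :: "(complex^'n) measure" where "representing_measure 0 \<nu>0" using representing_measure_exists by blast
  then have "good {} \<nu>0" by (simp add: good_def)
  then have ne: "S \<noteq> {}" unfolding S_def by blast
  have bdd: "bdd_above S" unfolding S_def by (rule bdd_aboveI[of _ "measure \<theta> (space \<theta>)"]) (auto intro: bounded_measure)
  have "\<exists>F \<nu>. good F \<nu> \<and> Sup S - 1 / real (Suc k) < measure \<theta> F" for k
  proof -
    have "Sup S - 1 / real (Suc k) < Sup S" by simp
    then obtain s where "s \<in> S" "Sup S - 1 / real (Suc k) < s" using less_cSup_iff[OF ne bdd] by blast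
    then show ?thesis unfolding S_def by blast
  qed
  then obtain F N where FN: "\<And>k. good (F k) (N k)" "\<And>k. Sup S - 1 / real (Suc k) < measure \<theta> (F k)" by metis
  obtain \<nu> where \<nu>: "representing_measure 0 \<nu>" "\<And>A k. A \<in> null_sets \<nu> \<Longrightarrow> A \<in> null_sets (N k)"
    using representing_measure_mixture[of N] FN(1) unfolding good_def by blast
  define E where "E = (\<Union>k. F k)"
  have Fs: "F k \<in> sets torus_borel" for k using FN(1) by (simp add: good_def)
  have Es: "E \<in> sets torus_borel" unfolding E_def using Fs by blast
  have null_E: "emeasure \<theta> (A \<inter> E) = 0" if A: "A \<in> null_sets \<nu>" for A
  proof -
    have As: "A \<in> sets torus_borel" using A representing_measureD(2)[OF \<nu>(1)] by (auto simp: null_sets_def)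
    have "A \<inter> F k \<in> null_sets \<theta>" for k
      using FN(1)[of k] \<nu>(2)[OF A, of k] As Fs[of k] \<theta>(2) by (auto simp: good_def null_sets_def)
    then have "(\<Union>k. A \<inter> F k) \<in> null_sets \<theta>" by (rule null_sets_UN)
    then show ?thesis by (simp add: E_def null_sets_def)
  qed
  have Sup_le: "Sup S \<le> measure \<theta> E"
  proof (rule field_le_epsilon)
    fix e :: real assume "0 < e"
    then obtain k where k: "1 / real (Suc k) < e" using nat_approx_posE by blast
    have "measure \<theta> (F k) \<le> measure \<theta> E" using Fs Es \<theta>(2) by (intro finite_measure_mono) (auto simp: E_def)
    then show "Sup S \<le> measure \<theta> E + e" using FN(2)[of k] k by linarith
  qed
  have "measure \<theta> G = 0" if \<rho>: "representing_measure 0 \<rho>" and G: "G \<in> sets torus_borel" "G \<inter> E = {}"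
    "\<And>A. A \<in> null_sets \<rho> \<Longrightarrow> emeasure \<theta> (A \<inter> G) = 0" for G \<rho>
  proof -
    \<comment> \<open>A mixture of \<open>\<nu>\<close> and \<open>\<rho>\<close> serves for the
      union of \<open>E\<close> and \<open>G\<close>; positive mass of \<open>G\<close> would push
      this union above the supremum.\<close>
    define N' where "N' k = (if k = 0 then \<nu> else \<rho>)" for k :: nat
    have "representing_measure 0 (N' k)" for k using \<nu>(1) \<rho> by (simp add: N'_def)
    then obtain \<sigma> where \<sigma>: "representing_measure 0 \<sigma>" "\<And>A k. A \<in> null_sets \<sigma> \<Longrightarrow> A \<in> null_sets (N' k)"
      using representing_measure_mixture[of N'] by blast
    have \<sigma>_null: "A \<in> null_sets \<nu>" "A \<in> null_sets \<rho>" if "A \<in> null_sets \<sigma>" for A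
      using \<sigma>(2)[OF that, of 0] \<sigma>(2)[OF that, of 1] by (auto simp: N'_def)
    have "good (E \<union> G) \<sigma>"
      unfolding good_def
    proof (intro conjI allI impI)
      fix A assume A: "A \<in> null_sets \<sigma>"
      have As: "A \<in> sets \<theta>" using A representing_measureD(2)[OF \<sigma>(1)] \<theta>(2) by (auto simp: null_sets_def)
      have "A \<inter> E \<in> null_sets \<theta>" "A \<inter> G \<in> null_sets \<theta>"
        using null_E[OF \<sigma>_null(1)[OF A]] G(3)[OF \<sigma>_null(2)[OF A]] G(1) As Es \<theta>(2) by (auto simp: null_sets_def)
      then have "A \<inter> E \<union> A \<inter> G \<in> null_sets \<theta>" by (rule null_sets.Un)
      then show "emeasure \<theta> (A \<inter> (E \<union> G)) = 0" by (simp add: Int_Un_distrib null_sets_def)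
    qed (use Es G \<sigma> in auto)
    then have "measure \<theta> (E \<union> G) \<le> Sup S" by (intro cSup_upper bdd) (auto simp: S_def)
    moreover have "measure \<theta> (E \<union> G) = measure \<theta> E + measure \<theta> G"
      using Es G \<theta>(2) by (intro finite_measure_Union) auto
    ultimately show ?thesis using Sup_le measure_nonneg[of \<theta> G] by linarith
  qed
  then show ?thesis using that[OF Es \<nu>(1)] null_E by blast
qed

text \<open>Otherwise duality would produce a measure \<open>\<psi>\<close> of mass at least
  \<open>\<epsilon>\<close> below both a representing measure and the part of
  \<open>\<theta>\<close> off \<open>F\<close>. Off \<open>F\<close>, on the set where
  \<open>\<psi>\<close> has positive density, \<open>\<theta>\<close> is absolutely continuous with
  respect to that representing measure; so this set has mass 0 by \<open>sing\<close>, and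
  \<open>\<psi>\<close> vanishes.\<close>

lemma singular_part_separation:
  fixes \<theta> :: "(complex^'n::finite) measure"
  assumes \<theta>: "finite_measure \<theta>" "sets \<theta> = sets torus_borel" and F: "F \<in> sets torus_borel"
    and sing: "\<And>G \<rho>. representing_measure 0 \<rho> \<Longrightarrow> G \<in> sets torus_borel \<Longrightarrow> G \<inter> F = {} \<Longrightarrow>
      (\<And>A. A \<in> null_sets \<rho> \<Longrightarrow> emeasure \<theta> (A \<inter> G) = 0) \<Longrightarrow> measure \<theta> G = 0"
    and \<epsilon>: "0 < \<epsilon>"
  obtains u g where "u \<in> polydisc_algebra" "continuous_on torus g" "\<And>z. z \<in> torus \<Longrightarrow> 0 \<le> Re (u z)"
      "\<And>z. z \<in> torus \<Longrightarrow> 0 \<le> g z" "\<And>z. z \<in> torus \<Longrightarrow> 1 \<le> Re (u z) + g z"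
      "Re (u 0) + (LINT z|density \<theta> (indicator (torus - F)). g z) < \<epsilon>"
proof (rule ccontr)
  assume "\<not> thesis"
  note no = this[unfolded not_def, rule_format, OF that]
  define \<theta>s where "\<theta>s = density \<theta> (indicator (torus - F))"
  have Fc: "torus - F \<in> sets \<theta>" using F \<theta>(2) sets.compl_sets[of F torus_borel] by (simp add: space_torus_borel_eq)
  have fin: "finite_measure \<theta>s" unfolding \<theta>s_def by (rule finite_measure_density_indicator[OF \<theta>(1) Fc])
  have sets_s: "sets \<theta>s = sets torus_borel" by (simp add: \<theta>s_def \<theta>(2))
  have sep: "\<epsilon> \<le> Re (u 0) + (LINT z|\<theta>s. g z)"
    if "u \<in> polydisc_algebra" "continuous_on torus g" "\<And>z. z \<in> torus \<Longrightarrow> 0 \<le> Re (u z)"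
      "\<And>z. z \<in> torus \<Longrightarrow> 0 \<le> g z" "\<And>z. z \<in> torus \<Longrightarrow> 1 \<le> Re (u z) + g z" for u g
    using no[of u g] that unfolding \<theta>s_def by (meson not_le)
  show False
  proof (rule dominated_representing_measure[OF fin sets_s less_imp_le[OF \<epsilon>]])
    show "\<epsilon> \<le> Re (u 0) + (LINT z|\<theta>s. g z)"
      if "u \<in> polydisc_algebra" "continuous_on torus g" "\<And>z. z \<in> torus \<Longrightarrow> 0 \<le> Re (u z)"
        "\<And>z. z \<in> torus \<Longrightarrow> 0 \<le> g z" "\<And>z. z \<in> torus \<Longrightarrow> 1 \<le> Re (u z) + g z" for u g
      using that by (rule sep)
    fix \<nu> \<psi> :: "(complex^'n) measure"
    assume \<nu>: "representing_measure 0 \<nu>" and \<psi>: "finite_measure \<psi>" "sets \<psi> = sets torus_borel"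
      "\<And>A. A \<in> sets torus_borel \<Longrightarrow> emeasure \<psi> A \<le> emeasure \<nu> A"
      "\<And>A. A \<in> sets torus_borel \<Longrightarrow> emeasure \<psi> A \<le> emeasure \<theta>s A" "\<epsilon> \<le> measure \<psi> torus"
    have ac: "absolutely_continuous \<theta>s \<psi>"
      unfolding absolutely_continuous_def
    proof
      fix A assume "A \<in> null_sets \<theta>s"
      then show "A \<in> null_sets \<psi>" using \<psi>(4)[of A] \<psi>(2) sets_s by (auto simp: null_sets_def)
    qed
    obtain k where k: "integrable \<theta>s k" "\<And>z. 0 \<le> k z" "\<psi> = density \<theta>s (\<lambda>z. ennreal (k z))"
      "\<And>A. A \<in> sets \<theta>s \<Longrightarrow> measure \<psi> A = (LINT z:A|\<theta>s. k z)"
      using finite_Radon_Nikodym_real[OF fin \<psi>(1) _ ac] \<psi>(2) sets_s by metis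
    have km: "k \<in> borel_measurable \<theta>s" using k(1) by auto
    define G where "G = {z \<in> space \<theta>s. 0 < k z} \<inter> (torus - F)"
    have Gs: "G \<in> sets torus_borel"
    proof -
      have "{z \<in> space \<theta>s. 0 < k z} \<in> sets \<theta>s" using km by measurable
      then show ?thesis unfolding G_def using Fc \<theta>(2) sets_s by auto
    qed
    have "emeasure \<theta> (A \<inter> G) = 0" if A: "A \<in> null_sets \<nu>" for A
    proof -
      have As: "A \<in> sets torus_borel" using A representing_measureD(2)[OF \<nu>] by (auto simp: null_sets_def)
      have "emeasure \<psi> A = 0" using \<psi>(3)[OF As] A by (auto simp: null_sets_def)
      then have "(\<integral>\<^sup>+z. ennreal (k z) * indicator A z \<partial>\<theta>s) = 0"
        unfolding k(3) using km As sets_s by (subst (asm) emeasure_density) auto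
      then have "AE z in \<theta>s. ennreal (k z) * indicator A z = 0"
        using km As sets_s by (subst (asm) nn_integral_0_iff_AE) auto
      then have ae: "AE z in \<theta>s. z \<notin> A \<inter> G"
        by (rule AE_mp) (auto simp: G_def indicator_def)
      have "A \<inter> G \<in> sets \<theta>s" using As Gs sets_s by auto
      then have "emeasure \<theta>s (A \<inter> G) = 0"
        using ae by (subst (asm) AE_iff_measurable[of "A \<inter> G"]) (auto dest: sets.sets_into_space)
      moreover have "emeasure \<theta>s (A \<inter> G) = emeasure \<theta> ((torus - F) \<inter> (A \<inter> G))"
        unfolding \<theta>s_def using Fc As Gs \<theta>(2) by (intro emeasure_restricted) auto
      moreover have "(torus - F) \<inter> (A \<inter> G) = A \<inter> G" by (auto simp: G_def)
      ultimately show ?thesis by simp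
    qed
    then have "measure \<theta> G = 0" by (intro sing[OF \<nu> Gs]) (auto simp: G_def)
    then have "emeasure \<theta> G = 0" using finite_measure.emeasure_eq_measure[OF \<theta>(1)] by simp
    then have "emeasure \<theta>s {z \<in> space \<theta>s. 0 < k z} = 0"
    proof -
      have "{z \<in> space \<theta>s. 0 < k z} \<in> sets \<theta>s" using km by measurable
      then have "emeasure \<theta>s {z \<in> space \<theta>s. 0 < k z} = emeasure \<theta> ((torus - F) \<inter> {z \<in> space \<theta>s. 0 < k z})"
        using Fc \<theta>(2) sets_s unfolding \<theta>s_def by (intro emeasure_restricted) auto
      then show ?thesis using \<open>emeasure \<theta> G = 0\<close> by (simp add: G_def Int_commute)
    qed
    then have "AE z in \<theta>s. k z = 0"
      using km k(2) by (intro AE_I[of _ _ "{z \<in> space \<theta>s. 0 < k z}"]) (auto simp: less_le)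
    then have "(LINT z:torus|\<theta>s. k z) = 0"
      unfolding set_lebesgue_integral_def by (intro integral_eq_zero_AE) auto
    moreover have "measure \<psi> torus = (LINT z:torus|\<theta>s. k z)"
      using k(4)[of torus] sets.top[of \<theta>s] by (simp add: space_torus_borel[OF sets_s])
    ultimately show False using \<psi>(5) \<epsilon> by simp
  qed
qed

text \<open>Off \<open>F\<close>, either \<open>g k\<close> exceeds \<open>1 / 2\<close> or
  \<open>Re (u k z)\<close> is at least \<open>1 / 2\<close> and the exponential is tiny; both parts
  are small in mean. On \<open>F\<close>, a number \<open>H\<close> of modulus at most
  \<open>1\<close> satisfies \<open>(cmod (1 - H))^2 \<le> 2 * Re (1 - H)\<close>, whose integral
  for \<open>\<nu>\<close> is known from the value at 0. A subsequence then converges almost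
  everywhere for \<open>\<nu>\<close>, hence for \<open>\<theta>\<close> on
  \<open>F\<close>.\<close>

lemma continuous_split:
  fixes \<theta> :: "(complex^'n::finite) measure"
  assumes \<theta>: "finite_measure \<theta>" "sets \<theta> = sets torus_borel"
  obtains F \<nu> G where "F \<in> sets torus_borel" "representing_measure 0 \<nu>"
    "\<And>A. A \<in> null_sets \<nu> \<Longrightarrow> emeasure \<theta> (A \<inter> F) = 0"
    "\<And>k::nat. G k \<in> polydisc_algebra" "\<And>k z. z \<in> torus \<Longrightarrow> cmod (G k z) \<le> 1"
    "(\<lambda>k. G k 0) \<longlonglongrightarrow> 1" "(\<lambda>k. LINT z|\<theta>. cmod (indicator F z - G k z)) \<longlonglongrightarrow> 0"
proof -
  interpret finite_measure \<theta> by fact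
  obtain F \<nu> where F: "F \<in> sets torus_borel" and \<nu>: "representing_measure 0 \<nu>"
    and null: "\<And>A. A \<in> null_sets \<nu> \<Longrightarrow> emeasure \<theta> (A \<inter> F) = 0"
    and sing: "\<And>G \<rho>. representing_measure 0 \<rho> \<Longrightarrow> G \<in> sets torus_borel \<Longrightarrow> G \<inter> F = {} \<Longrightarrow>
      (\<And>A. A \<in> null_sets \<rho> \<Longrightarrow> emeasure \<theta> (A \<inter> G) = 0) \<Longrightarrow> measure \<theta> G = 0"
    using maximal_continuous_part[OF \<theta>] by blast
  have sp: "space \<theta> = torus" by (rule space_torus_borel[OF \<theta>(2)])
  have spn: "space \<nu> = torus" by (rule representing_measureD(4)[OF \<nu>])
  have Ft: "F \<subseteq> torus" "F \<in> sets \<theta>" using F \<theta>(2) by (auto simp: sets_torus_borel_iff)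
  have Fc: "torus - F \<in> sets \<theta>" using Ft(2) sets.compl_sets[of F \<theta>] by (simp add: sp)
  define \<theta>s where "\<theta>s = density \<theta> (indicator (torus - F))"
  have fin_s: "finite_measure \<theta>s" unfolding \<theta>s_def by (rule finite_measure_density_indicator[OF \<theta>(1) Fc])
  have sets_s: "sets \<theta>s = sets torus_borel" by (simp add: \<theta>s_def \<theta>(2))
  have sps: "space \<theta>s = torus" by (rule space_torus_borel[OF sets_s])
  \<comment> \<open>The rates balance two needs: \<open>s k\<close> tends to infinity, so the
    exponent is large off \<open>F\<close>, while \<open>s k * q k = (1 / 2) ^ k\<close> tends to 0,
    so the exponent is negligible at 0.\<close>
  define s where "s k = (2 :: real) ^ k" for k :: nat
  define q where "q k = (1 / 4 :: real) ^ k" for k :: nat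
  have s_pos: "0 < s k" and q_pos: "0 < q k" for k by (simp_all add: s_def q_def)
  have sq: "s k * q k = (1 / 2) ^ k" for k by (simp add: s_def q_def flip: power_mult_distrib)
  have "\<exists>u g. u \<in> polydisc_algebra \<and> continuous_on torus g \<and> (\<forall>z\<in>torus. 0 \<le> Re (u z)) \<and>
      (\<forall>z\<in>torus. 0 \<le> g z) \<and> (\<forall>z\<in>torus. 1 \<le> Re (u z) + g z) \<and> Re (u 0) + (LINT z|\<theta>s. g z) < q k" for k :: nat
  proof (rule singular_part_separation[OF \<theta> F _ q_pos])
    show "measure \<theta> G = 0" if "representing_measure 0 \<rho>" "G \<in> sets torus_borel" "G \<inter> F = {}"
      "\<And>A. A \<in> null_sets \<rho> \<Longrightarrow> emeasure \<theta> (A \<inter> G) = 0" for G \<rho> using that by (rule sing)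
    fix u :: "complex^'n \<Rightarrow> complex" and g
    assume *: "u \<in> polydisc_algebra" "continuous_on torus g" "\<And>z. z \<in> torus \<Longrightarrow> 0 \<le> Re (u z)"
      "\<And>z. z \<in> torus \<Longrightarrow> 0 \<le> g z" "\<And>z. z \<in> torus \<Longrightarrow> 1 \<le> Re (u z) + g z"
      "Re (u 0) + (LINT z|density \<theta> (indicator (torus - F)). g z) < q k"
    show ?thesis
      unfolding \<theta>s_def by (intro exI[of _ u] exI[of _ g] conjI ballI *)
  qed
  then obtain u g where ug: "\<And>k::nat. u k \<in> polydisc_algebra" "\<And>k. continuous_on torus (g k)"
    "\<And>k z. z \<in> torus \<Longrightarrow> 0 \<le> Re (u k z)" "\<And>k z. z \<in> torus \<Longrightarrow> 0 \<le> g k z" "\<And>k z. z \<in> torus \<Longrightarrow> 1 \<le> Re (u k z) + g k z"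
    "\<And>k. Re (u k 0) + (LINT z|\<theta>s. g k z) < q k" by metis
  \<comment> \<open>Subtracting the imaginary part at 0 makes \<open>H k 0\<close> real and
    positive; its modulus alone then decides the convergence to \<open>1\<close>.\<close>
  define H where "H k z = exp (- complex_of_real (s k) * (u k z - \<i> * Im (u k 0)))" for k z
  have H_alg: "H k \<in> polydisc_algebra" for k
    unfolding H_def[abs_def]
    by (intro polydisc_algebra_exp polydisc_algebra_cmult polydisc_algebra_diff ug(1) polydisc_algebra_const)
  have H_cont: "continuous_on torus (H k)" for k using H_alg by (rule polydisc_algebra_continuous)
  have H_norm: "cmod (H k z) = exp (- (s k * Re (u k z)))" for k z
  proof -
    have "Re (- complex_of_real (s k) * (u k z - \<i> * Im (u k 0))) = - (s k * Re (u k z))" by simp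
    then show ?thesis unfolding H_def norm_exp_eq_Re by simp
  qed
  have H_le: "cmod (H k z) \<le> 1" if "z \<in> torus" for k z
    unfolding H_norm using ug(3)[OF that, of k] s_pos[of k] by simp
  have g_int: "0 \<le> (LINT z|\<theta>s. g k z)" for k
    using ug(4) by (intro integral_nonneg_AE AE_I2) (simp add: sps)
  have u0: "0 \<le> Re (u k 0)" "Re (u k 0) < q k" "(LINT z|\<theta>s. g k z) < q k" for k
  proof -
    show "0 \<le> Re (u k 0)" by (rule polydisc_algebra_Re_nonneg[OF ug(1,3)])
    then show "Re (u k 0) < q k" "(LINT z|\<theta>s. g k z) < q k"
      using ug(6)[of k] g_int[of k] by linarith+
  qed
  have H0: "H k 0 = complex_of_real (exp (- (s k * Re (u k 0))))" for k
  proof -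
    have "- complex_of_real (s k) * (u k 0 - \<i> * Im (u k 0)) = complex_of_real (- (s k * Re (u k 0)))"
      by (simp add: complex_eq_iff)
    then show ?thesis unfolding H_def by (simp only: exp_of_real)
  qed
  have e0: "(\<lambda>k. s k * Re (u k 0)) \<longlonglongrightarrow> 0"
  proof (rule tendsto_sandwich[of "\<lambda>_. 0" _ _ "\<lambda>k. (1 / 2) ^ k"])
    show "(\<lambda>k. (1 / 2 :: real) ^ k) \<longlonglongrightarrow> 0" by (rule LIMSEQ_power_zero) simp
    show "\<forall>\<^sub>F k in sequentially. s k * Re (u k 0) \<le> (1 / 2) ^ k"
    proof (intro always_eventually allI)
      fix k
      have "s k * Re (u k 0) \<le> s k * q k" using u0(2)[of k] s_pos[of k] by (intro mult_left_mono) auto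
      also have "\<dots> = (1 / 2) ^ k" by (rule sq)
      finally show "s k * Re (u k 0) \<le> (1 / 2) ^ k" .
    qed
  qed (use u0(1) s_pos in \<open>auto intro!: always_eventually simp: less_imp_le\<close>)
  have "(\<lambda>k. exp (- (s k * Re (u k 0)))) \<longlonglongrightarrow> exp (- 0)"
    by (intro tendsto_exp tendsto_minus e0)
  then have exp1: "(\<lambda>k. exp (- (s k * Re (u k 0)))) \<longlonglongrightarrow> 1" by simp
  have H0_lim: "(\<lambda>k. H k 0) \<longlonglongrightarrow> 1"
    unfolding H0 using tendsto_of_real[OF exp1, where 'a = complex] by simp
  have int_c: "integrable M f" if "finite_measure M" "sets M = sets torus_borel" "continuous_on torus f"
    for M and f :: "complex^'n \<Rightarrow> complex" using torus_integrable[OF that(2,1,3)] .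
  have int_r: "integrable M f" if M: "finite_measure M" "sets M = sets torus_borel" "continuous_on torus f"
    for M and f :: "complex^'n \<Rightarrow> real"
  proof -
    have "integrable M (\<lambda>z. complex_of_real (f z))" using M by (intro int_c continuous_intros) auto
    from integrable_Re[OF this] show ?thesis by simp
  qed
  have lim_s: "(\<lambda>k. LINT z|\<theta>s. cmod (H k z)) \<longlonglongrightarrow> 0"
  proof (rule tendsto_sandwich[of "\<lambda>_. 0" _ _ "\<lambda>k. exp (- (s k / 2)) * measure \<theta>s torus + 2 * q k"])
    have "(\<lambda>k. exp (- (s k / 2))) \<longlonglongrightarrow> 0" unfolding s_def by real_asymp
    moreover have "(\<lambda>k. q k) \<longlonglongrightarrow> 0" unfolding q_def by (rule LIMSEQ_power_zero) simp
    ultimately have "(\<lambda>k. exp (- (s k / 2)) * measure \<theta>s torus + 2 * q k) \<longlonglongrightarrow> 0 * measure \<theta>s torus + 2 * 0"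
      by (intro tendsto_add tendsto_mult tendsto_const)
    then show "(\<lambda>k. exp (- (s k / 2)) * measure \<theta>s torus + 2 * q k) \<longlonglongrightarrow> 0" by simp
    show "\<forall>\<^sub>F k in sequentially. (LINT z|\<theta>s. cmod (H k z)) \<le> exp (- (s k / 2)) * measure \<theta>s torus + 2 * q k"
    proof (intro always_eventually allI)
      fix k
      have gi: "integrable \<theta>s (g k)" by (rule int_r[OF fin_s sets_s ug(2)])
      have ci: "integrable \<theta>s (\<lambda>_. exp (- (s k / 2)))" using int_r[OF fin_s sets_s continuous_on_const] .
      have "(LINT z|\<theta>s. cmod (H k z)) \<le> (LINT z|\<theta>s. exp (- (s k / 2)) + 2 * g k z)"
      proof (rule integral_mono)
        show "integrable \<theta>s (\<lambda>z. cmod (H k z))" by (intro integrable_norm int_c fin_s sets_s H_cont)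
        show "integrable \<theta>s (\<lambda>z. exp (- (s k / 2)) + 2 * g k z)" using gi ci by simp
        fix z assume "z \<in> space \<theta>s"
        then have z: "z \<in> torus" by (simp add: sps)
        show "cmod (H k z) \<le> exp (- (s k / 2)) + 2 * g k z"
        proof (cases "g k z \<le> 1 / 2")
          case True
          then have "1 / 2 \<le> Re (u k z)" using ug(5)[OF z, of k] by linarith
          then have "s k * (1 / 2) \<le> s k * Re (u k z)" using s_pos[of k] by (intro mult_left_mono) auto
          then have "cmod (H k z) \<le> exp (- (s k / 2))" unfolding H_norm by simp
          then show ?thesis using ug(4)[OF z, of k] by linarith
        next
          case False
          have "0 \<le> exp (- (s k / 2))" by simp
          then show ?thesis using False H_le[OF z, of k] by linarith
        qed
      qed
      also have "\<dots> = exp (- (s k / 2)) * measure \<theta>s torus + 2 * (LINT z|\<theta>s. g k z)"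
        using gi ci by (simp add: sps mult.commute)
      also have "\<dots> \<le> exp (- (s k / 2)) * measure \<theta>s torus + 2 * q k" using u0(3)[of k] by simp
      finally show "(LINT z|\<theta>s. cmod (H k z)) \<le> exp (- (s k / 2)) * measure \<theta>s torus + 2 * q k" .
    qed
  qed (auto intro!: always_eventually)
  have sq_int: "integrable \<nu> (\<lambda>z. (1 - H k z)\<^sup>2)" for k
    by (intro int_c representing_measureD(2,3)[OF \<nu>] continuous_intros H_cont)
  \<comment> \<open>The square stays complex-valued inside the norm, which is the form in which a
    subsequence converging almost everywhere is extracted from convergence in mean.\<close>
  have lim_n: "(\<lambda>k. LINT z|\<nu>. norm ((1 - H k z)\<^sup>2)) \<longlonglongrightarrow> 0"
  proof (rule tendsto_sandwich[of "\<lambda>_. 0" _ _ "\<lambda>k. 2 * (1 - exp (- (s k * Re (u k 0))))"])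
    have "(\<lambda>k. 2 * (1 - exp (- (s k * Re (u k 0))))) \<longlonglongrightarrow> 2 * (1 - 1)"
      by (intro tendsto_mult tendsto_diff tendsto_const exp1)
    then show "(\<lambda>k. 2 * (1 - exp (- (s k * Re (u k 0))))) \<longlonglongrightarrow> 0" by simp
    show "\<forall>\<^sub>F k in sequentially. (LINT z|\<nu>. norm ((1 - H k z)\<^sup>2)) \<le> 2 * (1 - exp (- (s k * Re (u k 0))))"
    proof (intro always_eventually allI)
      fix k
      have alg: "(\<lambda>z. 2 * (1 - H k z)) \<in> polydisc_algebra"
        by (intro polydisc_algebra_cmult polydisc_algebra_diff polydisc_algebra_const H_alg)
      have "(LINT z|\<nu>. norm ((1 - H k z)\<^sup>2)) \<le> (LINT z|\<nu>. Re (2 * (1 - H k z)))"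
      proof (rule integral_mono)
        show "integrable \<nu> (\<lambda>z. norm ((1 - H k z)\<^sup>2))" using sq_int by (rule integrable_norm)
        show "integrable \<nu> (\<lambda>z. Re (2 * (1 - H k z)))"
          by (intro integrable_Re int_c representing_measureD(2,3)[OF \<nu>] polydisc_algebra_continuous[OF alg])
        fix z assume "z \<in> space \<nu>"
        then have "(cmod (H k z))\<^sup>2 \<le> 1" using H_le[of z k] by (simp add: spn power_le_one)
        then show "norm ((1 - H k z)\<^sup>2) \<le> Re (2 * (1 - H k z))"
          unfolding norm_power cmod_power2 by (simp add: power2_eq_square algebra_simps)
      qed
      also have "\<dots> = Re (2 * (1 - H k 0))" by (rule representing_measureD(6)[OF \<nu> alg])
      also have "\<dots> = 2 * (1 - exp (- (s k * Re (u k 0))))" by (simp add: H0)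
      finally show "(LINT z|\<nu>. norm ((1 - H k z)\<^sup>2)) \<le> 2 * (1 - exp (- (s k * Re (u k 0))))" .
    qed
  qed (auto intro!: always_eventually)
  obtain r where r: "strict_mono r" "AE z in \<nu>. (\<lambda>k. (1 - H (r k) z)\<^sup>2) \<longlonglongrightarrow> 0"
    using tendsto_L1_AE_subseq[OF sq_int lim_n] by blast
  have "AE z in \<theta>. z \<in> F \<longrightarrow> (\<lambda>k. (1 - H (r k) z)\<^sup>2) \<longlonglongrightarrow> 0"
  proof -
    obtain N where N: "{z \<in> space \<nu>. \<not> (\<lambda>k. (1 - H (r k) z)\<^sup>2) \<longlonglongrightarrow> 0} \<subseteq> N" "N \<in> null_sets \<nu>"
      using r(2) unfolding eventually_ae_filter by blast
    have "N \<inter> F \<in> null_sets \<theta>"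
      using null[OF N(2)] N(2) Ft(2) representing_measureD(2)[OF \<nu>] \<theta>(2) by (auto simp: null_sets_def)
    moreover have "{z \<in> space \<theta>. \<not> (z \<in> F \<longrightarrow> (\<lambda>k. (1 - H (r k) z)\<^sup>2) \<longlonglongrightarrow> 0)} \<subseteq> N \<inter> F"
      using N(1) by (auto simp: sp spn)
    ultimately show ?thesis unfolding eventually_ae_filter by blast
  qed
  moreover have sqrt: "(\<lambda>k. cmod (x k)) \<longlonglongrightarrow> 0" if "(\<lambda>k. (x k)\<^sup>2) \<longlonglongrightarrow> 0" for x :: "nat \<Rightarrow> complex"
  proof -
    have "(\<lambda>k. sqrt (norm ((x k)\<^sup>2))) \<longlonglongrightarrow> sqrt (norm (0::complex))"
      by (intro tendsto_real_sqrt tendsto_norm that)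
    then show ?thesis by (simp add: norm_power)
  qed
  ultimately have ae: "AE z in \<theta>. (\<lambda>k. indicat_real F z * cmod (1 - H (r k) z)) \<longlonglongrightarrow> 0"
    by (auto simp: indicator_def)
  have Hm: "H k \<in> borel_measurable \<theta>" for k by (rule torus_measurable[OF \<theta>(2) H_cont])
  have "(\<lambda>k. LINT z|\<theta>. indicat_real F z * cmod (1 - H (r k) z)) \<longlonglongrightarrow> (LINT z|\<theta>. 0)"
  proof (rule integral_dominated_convergence[where w = "\<lambda>_. 2"])
    show "(\<lambda>z. indicat_real F z * cmod (1 - H (r k) z)) \<in> borel_measurable \<theta>" for k
      using Hm[of "r k"] Ft(2) by measurable
    show "AE z in \<theta>. norm (indicat_real F z * cmod (1 - H (r k) z)) \<le> 2" for k
    proof (rule AE_I2)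
      fix z assume "z \<in> space \<theta>"
      then have "cmod (1 - H (r k) z) \<le> 1 + 1"
        using norm_triangle_ineq4[of 1 "H (r k) z"] H_le[of z "r k"] by (simp add: sp)
      then show "norm (indicat_real F z * cmod (1 - H (r k) z)) \<le> 2" by (simp add: indicator_def)
    qed
  qed (use ae in auto)
  moreover have "(\<lambda>k. LINT z|\<theta>. indicat_real (torus - F) z * cmod (H (r k) z)) \<longlonglongrightarrow> 0"
  proof -
    have eq: "(LINT z|\<theta>s. cmod (H k z)) = (LINT z|\<theta>. indicat_real (torus - F) z * cmod (H k z))" for k
    proof -
      have "(LINT z|\<theta>s. cmod (H k z)) = (LINT z|density \<theta> (\<lambda>z. ennreal (indicat_real (torus - F) z)). cmod (H k z))"
        unfolding \<theta>s_def by (simp add: ennreal_indicator)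
      also have "\<dots> = (LINT z|\<theta>. indicat_real (torus - F) z *\<^sub>R cmod (H k z))"
        using Hm[of k] Fc by (intro integral_density) auto
      finally show ?thesis by simp
    qed
    show ?thesis using LIMSEQ_subseq_LIMSEQ[OF lim_s r(1)] by (simp add: o_def eq)
  qed
  ultimately have "(\<lambda>k. (LINT z|\<theta>. indicat_real F z * cmod (1 - H (r k) z)) +
      (LINT z|\<theta>. indicat_real (torus - F) z * cmod (H (r k) z))) \<longlonglongrightarrow> (LINT z|\<theta>. 0) + 0"
    by (intro tendsto_add)
  moreover have "(LINT z|\<theta>. indicat_real F z * cmod (1 - H k z)) + (LINT z|\<theta>. indicat_real (torus - F) z * cmod (H k z)) =
      (LINT z|\<theta>. cmod (indicator F z - H k z))" for k
  proof -
    have "integrable \<theta> (\<lambda>z. indicat_real F z *\<^sub>R cmod (1 - H k z))"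
      by (intro integrable_mult_indicator Ft(2) int_r \<theta> continuous_intros H_cont)
    moreover have "integrable \<theta> (\<lambda>z. indicat_real (torus - F) z *\<^sub>R cmod (H k z))"
      by (intro integrable_mult_indicator Fc int_r \<theta> continuous_intros H_cont)
    ultimately have "(LINT z|\<theta>. indicat_real F z * cmod (1 - H k z)) + (LINT z|\<theta>. indicat_real (torus - F) z * cmod (H k z)) =
        (LINT z|\<theta>. indicat_real F z * cmod (1 - H k z) + indicat_real (torus - F) z * cmod (H k z))" by simp
    also have "\<dots> = (LINT z|\<theta>. cmod (indicator F z - H k z))"
      by (intro Bochner_Integration.integral_cong) (auto simp: sp indicator_def)
    finally show ?thesis .
  qed
  ultimately have "(\<lambda>k. LINT z|\<theta>. cmod (indicator F z - H (r k) z)) \<longlonglongrightarrow> 0" by simp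
  moreover have "(\<lambda>k. H (r k) 0) \<longlonglongrightarrow> 1" using LIMSEQ_subseq_LIMSEQ[OF H0_lim r(1)] by (simp add: o_def)
  ultimately show ?thesis
    using that[OF F \<nu> null, of "\<lambda>k. H (r k)"] H_alg H_le by blast
qed

section \<open>Functionals satisfying Apostol's condition\<close>

text \<open>In \<open>apostol\<close> a single exponent carries the whole limit: a further power of
  \<open>z $ j\<close> maps the unit ball of the algebra into itself, so larger exponents inherit
  the bound.\<close>

locale apostol_functional =
  fixes \<phi> :: "(complex^'n::finite \<Rightarrow> complex) \<Rightarrow> complex" and C :: real
  assumes C_pos: "0 < C"
    and add: "u \<in> polydisc_algebra \<Longrightarrow> v \<in> polydisc_algebra \<Longrightarrow> \<phi> (\<lambda>z. u z + v z) = \<phi> u + \<phi> v"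
    and scale: "u \<in> polydisc_algebra \<Longrightarrow> \<phi> (\<lambda>z. a * u z) = a * \<phi> u"
    and bound: "u \<in> polydisc_algebra \<Longrightarrow> (\<And>z. z \<in> torus \<Longrightarrow> cmod (u z) \<le> B) \<Longrightarrow> cmod (\<phi> u) \<le> C * B"
    and apostol: "0 < \<epsilon> \<Longrightarrow> \<exists>m. \<forall>u\<in>polydisc_algebra. (\<forall>z\<in>torus. cmod (u z) \<le> 1) \<longrightarrow> cmod (\<phi> (\<lambda>z. z $ j ^ m * u z)) \<le> \<epsilon>"
begin

lemma uniform_apostol:
  assumes \<epsilon>: "0 < \<epsilon>"
  obtains m where "0 < m" "\<And>j u B. u \<in> polydisc_algebra \<Longrightarrow> 0 \<le> B \<Longrightarrow> (\<And>z. z \<in> torus \<Longrightarrow> cmod (u z) \<le> B) \<Longrightarrow>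
    cmod (\<phi> (\<lambda>z. z $ j ^ m * u z)) \<le> \<epsilon> * B"
proof -
  obtain M where M: "\<And>j u. u \<in> polydisc_algebra \<Longrightarrow> (\<And>z. z \<in> torus \<Longrightarrow> cmod (u z) \<le> 1) \<Longrightarrow>
      cmod (\<phi> (\<lambda>z. z $ j ^ M j * u z)) \<le> \<epsilon>"
    using apostol[OF \<epsilon>] by metis
  \<comment> \<open>At least every \<open>M j\<close>, and positive because the de la Vallee-Poussin
    multipliers require \<open>m > 0\<close>.\<close>
  define m where "m = Suc (\<Sum>j\<in>UNIV. M j)"
  have "cmod (\<phi> (\<lambda>z. z $ j ^ m * u z)) \<le> \<epsilon> * B"
    if u: "u \<in> polydisc_algebra" and B: "0 \<le> B" "\<And>z. z \<in> torus \<Longrightarrow> cmod (u z) \<le> B" for j u B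
  proof (rule field_le_epsilon)
    fix e :: real assume e: "0 < e"
    \<comment> \<open>\<open>B\<close> may be \<open>0\<close>, so the function is normalised by the
      larger \<open>D\<close>, which costs exactly \<open>e\<close>.\<close>
    define D where "D = B + e / \<epsilon>"
    have D: "0 < D" "B \<le> D" "\<epsilon> * D = \<epsilon> * B + e" using B(1) e \<epsilon> by (auto simp: D_def algebra_simps add_nonneg_pos)
    have Mm: "M j \<le> m"
    proof -
      have "M j \<le> (\<Sum>j\<in>UNIV. M j)" by (rule member_le_sum) auto
      then show ?thesis by (simp add: m_def)
    qed
    define v where "v z = complex_of_real (1 / D) * (z $ j ^ (m - M j) * u z)" for z
    have v: "v \<in> polydisc_algebra"
      unfolding v_def[abs_def] by (intro polydisc_algebra_cmult polydisc_algebra_mult polydisc_algebra_power polydisc_algebra_nth u)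
    have "cmod (v z) \<le> 1" if z: "z \<in> torus" for z
      using B(2)[OF z] D(1,2) z by (simp add: v_def norm_mult norm_power norm_divide torus_def field_simps)
    then have 1: "cmod (\<phi> (\<lambda>z. z $ j ^ M j * v z)) \<le> \<epsilon>" by (intro M v)
    have "(\<lambda>z. z $ j ^ m * u z) = (\<lambda>z. complex_of_real D * (z $ j ^ M j * v z))"
    proof
      fix z :: "complex^'n"
      have "z $ j ^ m = z $ j ^ M j * z $ j ^ (m - M j)" using Mm by (simp flip: power_add)
      then show "z $ j ^ m * u z = complex_of_real D * (z $ j ^ M j * v z)" using D(1) by (simp add: v_def)
    qed
    moreover have "(\<lambda>z. z $ j ^ M j * v z) \<in> polydisc_algebra"
      by (intro polydisc_algebra_mult polydisc_algebra_power polydisc_algebra_nth v)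
    ultimately have "cmod (\<phi> (\<lambda>z. z $ j ^ m * u z)) = D * cmod (\<phi> (\<lambda>z. z $ j ^ M j * v z))"
      using scale D(1) by (simp add: norm_mult)
    also have "\<dots> \<le> D * \<epsilon>" using 1 D(1) by (intro mult_left_mono) auto
    finally show "cmod (\<phi> (\<lambda>z. z $ j ^ m * u z)) \<le> \<epsilon> * B + e" using D(3) by (simp add: mult.commute)
  qed
  then show ?thesis using that[of m] by (simp add: m_def)
qed

text \<open>The multiplier is applied to one variable after the other. It equals \<open>1\<close> up
  to degree \<open>m\<close>, so what it removes in the variable \<open>i\<close> is divisible by
  \<open>z $ i ^ m\<close>. On the torus the quotient is bounded by \<open>1 + 3\<close> times the
  bound reached so far, and \<open>\<phi>\<close> is small on its product with
  \<open>z $ i ^ m\<close>.\<close>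

lemma vallee_poussin_truncation:
  fixes a B :: real and c :: "('n \<Rightarrow>\<^sub>0 nat) \<Rightarrow> complex"
  assumes A: "finite A" and B: "\<And>z. z \<in> torus \<Longrightarrow> cmod (pol A c z) \<le> B"
    and m: "0 < m" "\<And>j u B. u \<in> polydisc_algebra \<Longrightarrow> 0 \<le> B \<Longrightarrow> (\<And>z. z \<in> torus \<Longrightarrow> cmod (u z) \<le> B) \<Longrightarrow>
    cmod (\<phi> (\<lambda>z. z $ j ^ m * u z)) \<le> a * B"
    and u: "u \<in> polydisc_algebra" "\<And>z. z \<in> torus \<Longrightarrow> cmod (u z) \<le> 1" and a: "0 \<le> a"
    and "finite S"
  defines "W \<equiv> \<lambda>S \<alpha>. complex_of_real (\<Prod>i\<in>S. vallee_poussin m (Poly_Mapping.lookup \<alpha> i)) * c \<alpha>"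
  shows "(\<forall>z\<in>torus. cmod (pol A (W S) z) \<le> 3 ^ card S * B) \<and>
    cmod (\<phi> (\<lambda>z. (pol A c z - pol A (W S) z) * u z)) \<le> card S * (4 * 3 ^ card S * B * a)"
  using \<open>finite S\<close>
proof (induction S rule: finite_induct)
  case empty
  have "\<phi> (\<lambda>z. 0) = 0" using scale[OF polydisc_algebra_const[of 0], of 0] by simp
  then show ?case using B by (simp add: W_def)
next
  case (insert i S)
  have B0: "0 \<le> B" using B torus_nonempty norm_ge_zero order_trans by blast
  define B' where "B' = 3 ^ card S * B"
  have B': "0 \<le> B'" using B0 by (simp add: B'_def)
  have WS: "cmod (pol A (W S) z) \<le> B'" if "z \<in> torus" for z
    using insert.IH that by (simp add: B'_def)
  have W_ins: "W (insert i S) = (\<lambda>\<alpha>. complex_of_real (vallee_poussin m (Poly_Mapping.lookup \<alpha> i)) * W S \<alpha>)"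
    using insert.hyps by (simp add: W_def fun_eq_iff)
  have WI: "cmod (pol A (W (insert i S)) z) \<le> 3 * B'" if "z \<in> torus" for z
    unfolding W_ins by (rule pol_vallee_poussin_bound[OF A m(1) WS that])
  \<comment> \<open>Degree exactly \<open>m\<close> may be included: there the multiplier is
    \<open>1\<close> and the difference \<open>d\<close> is \<open>0\<close>.\<close>
  define A1 where "A1 = {\<alpha>\<in>A. m \<le> Poly_Mapping.lookup \<alpha> i}"
  define d where "d \<alpha> = W S \<alpha> - W (insert i S) \<alpha>" for \<alpha>
  define e where "e = Poly_Mapping.single i m"
  define q where "q = pol ((\<lambda>\<alpha>. \<alpha> - e) ` A1) (\<lambda>\<alpha>. d (\<alpha> + e))"
  have A1: "finite A1" using A by (simp add: A1_def)
  have d_eq: "pol A (W S) z - pol A (W (insert i S)) z = z $ i ^ m * q z" for z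
  proof -
    have "pol A (W S) z - pol A (W (insert i S)) z = pol A d z"
      by (simp add: pol_def d_def algebra_simps sum_subtractf)
    also have "\<dots> = pol A1 d z"
    proof (rule pol_restrict[OF A])
      show "d \<alpha> = 0" if "\<alpha> \<in> A - A1" for \<alpha>
      proof -
        have "Poly_Mapping.lookup \<alpha> i \<le> m" using that by (auto simp: A1_def)
        then show ?thesis using m(1) by (simp add: d_def W_ins vallee_poussin_eq_1)
      qed
    qed (simp add: A1_def)
    also have "\<dots> = z $ i ^ m * q z"
      unfolding q_def e_def by (rule pol_divide[OF A1]) (simp add: A1_def)
    finally show ?thesis .
  qed
  have q_alg: "q \<in> polydisc_algebra" unfolding q_def using A1 by (intro polydisc_algebra_pol is_pol_pol) auto
  have q_b: "cmod (q z * u z) \<le> 4 * B'" if z: "z \<in> torus" for z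
  proof -
    have "cmod (q z) = cmod (pol A (W S) z - pol A (W (insert i S)) z)"
      unfolding d_eq using z by (simp add: norm_mult norm_power torus_def)
    also have "\<dots> \<le> cmod (pol A (W S) z) + cmod (pol A (W (insert i S)) z)" by (rule norm_triangle_ineq4)
    also have "\<dots> \<le> 4 * B'" using WS[OF z] WI[OF z] by simp
    finally have "cmod (q z) * cmod (u z) \<le> 4 * B' * 1" using u(2)[OF z] B' by (intro mult_mono) auto
    then show ?thesis by (simp add: norm_mult)
  qed
  have step: "cmod (\<phi> (\<lambda>z. z $ i ^ m * (q z * u z))) \<le> a * (4 * B')"
    using B' q_b by (intro m(2) polydisc_algebra_mult q_alg u(1)) auto
  have alg: "pol A c' \<in> polydisc_algebra" for c' by (intro polydisc_algebra_pol is_pol_pol A)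
  have "(\<lambda>z. (pol A c z - pol A (W (insert i S)) z) * u z) =
      (\<lambda>z. (pol A c z - pol A (W S) z) * u z + z $ i ^ m * (q z * u z))"
  proof
    fix z
    have "pol A (W S) z = pol A (W (insert i S)) z + z $ i ^ m * q z" using d_eq[of z] by (simp add: algebra_simps)
    then show "(pol A c z - pol A (W (insert i S)) z) * u z =
        (pol A c z - pol A (W S) z) * u z + z $ i ^ m * (q z * u z)"
      by (simp add: algebra_simps)
  qed
  then have "\<phi> (\<lambda>z. (pol A c z - pol A (W (insert i S)) z) * u z) =
      \<phi> (\<lambda>z. (pol A c z - pol A (W S) z) * u z) + \<phi> (\<lambda>z. z $ i ^ m * (q z * u z))"
    by (simp only:) (intro add polydisc_algebra_mult polydisc_algebra_diff polydisc_algebra_power polydisc_algebra_nth alg u(1) q_alg)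
  also have "cmod \<dots> \<le> card S * (4 * 3 ^ card S * B * a) + a * (4 * B')"
    using insert.IH step by (intro norm_triangle_mono) auto
  also have "\<dots> \<le> card (insert i S) * (4 * 3 ^ card (insert i S) * B * a)"
  proof -
    define X where "X = 4 * 3 ^ card S * B * a"
    have X: "0 \<le> X" using B0 a by (simp add: X_def)
    have "card S * X + X \<le> real (Suc (card S)) * (3 * X)"
      using X by (simp add: algebra_simps)
    then show ?thesis using insert.hyps by (simp add: X_def B'_def mult_ac)
  qed
  finally have "cmod (\<phi> (\<lambda>z. (pol A c z - pol A (W (insert i S)) z) * u z)) \<le> card (insert i S) * (4 * 3 ^ card (insert i S) * B * a)" .
  moreover have "3 * B' = 3 ^ card (insert i S) * B" using insert.hyps by (simp add: B'_def)
  ultimately show ?case using WI by simp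
qed

lemma card_bounded_exponents:
  fixes A :: "('n \<Rightarrow>\<^sub>0 nat) set"
  assumes "\<And>\<alpha> i. \<alpha> \<in> A \<Longrightarrow> Poly_Mapping.lookup \<alpha> i < N"
  shows "card A \<le> N ^ CARD('n)"
proof -
  have "inj_on Poly_Mapping.lookup A" by (rule inj_onI) (simp add: lookup_inject)
  moreover have "Poly_Mapping.lookup ` A \<subseteq> UNIV \<rightarrow>\<^sub>E {..<N}" using assms by auto
  ultimately have "card A \<le> card ((UNIV :: 'n set) \<rightarrow>\<^sub>E {..<N})"
    by (metis card_inj_on_le finite_PiE finite_class.finite_UNIV finite_lessThan)
  then show ?thesis by (simp add: card_PiE)
qed

text \<open>The real part of \<open>1 - G\<close> is nonnegative on the torus, so the coefficients of \<open>1 - G\<close> are controlled by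
  \<open>1 - G 0\<close>. What de la Vallee-Poussin truncation removes is a sum of multiples of the powers \<open>z\<^sub>j\<^sup>m\<close>,
  on which \<open>\<phi>\<close> is small.\<close>

lemma small_defect:
  assumes \<epsilon>: "0 < \<epsilon>"
  obtains \<delta> where "0 < \<delta>" "\<And>G u. G \<in> polydisc_algebra \<Longrightarrow> (\<And>z. z \<in> torus \<Longrightarrow> cmod (G z) \<le> 1) \<Longrightarrow> cmod (1 - G 0) \<le> \<delta> \<Longrightarrow>
    u \<in> polydisc_algebra \<Longrightarrow> (\<And>z. z \<in> torus \<Longrightarrow> cmod (u z) \<le> 1) \<Longrightarrow> cmod (\<phi> (\<lambda>z. (1 - G z) * u z)) \<le> \<epsilon>"
proof -
  define n where "n = CARD('n)"
  \<comment> \<open>The factor of the truncation estimate for all \<open>n\<close> variables, with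
    bound \<open>3\<close>: on the torus \<open>1 - G\<close> has modulus at most \<open>2\<close>,
    and its polynomial approximation is within \<open>1\<close>. With
    \<open>a = \<epsilon> / 3 / K\<close> the truncation costs a third of
    \<open>\<epsilon>\<close>.\<close>
  define K where "K = real n * (4 * 3 ^ n * 3)"
  have n: "0 < n" by (simp add: n_def)
  have K: "0 < K" using n by (simp add: K_def)
  define a where "a = \<epsilon> / 3 / K"
  have a: "0 < a" using \<epsilon> K by (simp add: a_def)
  obtain m where m: "0 < m" "\<And>j u B. u \<in> polydisc_algebra \<Longrightarrow> 0 \<le> B \<Longrightarrow> (\<And>z. z \<in> torus \<Longrightarrow> cmod (u z) \<le> B) \<Longrightarrow>
    cmod (\<phi> (\<lambda>z. z $ j ^ m * u z)) \<le> a * B"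
    using uniform_apostol[OF a] by blast
  \<comment> \<open>The number of exponent vectors with all entries below \<open>2 * m\<close>,
    hence a bound for the number of terms that survive the truncation.\<close>
  define L where "L = real ((2 * m) ^ n)"
  have "1 \<le> (2 * m) ^ n" using m(1) by (intro one_le_power) simp
  from of_nat_mono[OF this, where 'a = real] have L: "1 \<le> L" by (simp only: L_def of_nat_1)
  define \<delta> where "\<delta> = min 1 (\<epsilon> / (3 * (C * L * 8)))"
  have \<delta>: "0 < \<delta>" "\<delta> \<le> 1" "C * L * (8 * \<delta>) \<le> \<epsilon> / 3"
  proof -
    have p: "0 < 3 * (C * L * 8)" using C_pos L by simp
    show "0 < \<delta>" "\<delta> \<le> 1" using \<epsilon> p by (auto simp: \<delta>_def)
    have "\<delta> \<le> \<epsilon> / (3 * (C * L * 8))" unfolding \<delta>_def by (rule min.cobounded2)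
    then have "\<delta> * (3 * (C * L * 8)) \<le> \<epsilon>" using p by (simp add: pos_le_divide_eq del: mult.assoc)
    then show "C * L * (8 * \<delta>) \<le> \<epsilon> / 3" by (simp add: algebra_simps)
  qed
  have C\<delta>: "C * \<delta> \<le> \<epsilon> / 3"
  proof -
    have "C * \<delta> * 1 \<le> C * \<delta> * (L * 8)" using C_pos \<delta>(1) L by (intro mult_left_mono) auto
    then show ?thesis using \<delta>(3) by (simp add: algebra_simps)
  qed
  have "cmod (\<phi> (\<lambda>z. (1 - G z) * u z)) \<le> \<epsilon>"
    if G: "G \<in> polydisc_algebra" "\<And>z. z \<in> torus \<Longrightarrow> cmod (G z) \<le> 1" "cmod (1 - G 0) \<le> \<delta>"
      and u: "u \<in> polydisc_algebra" "\<And>z. z \<in> torus \<Longrightarrow> cmod (u z) \<le> 1" for G u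
  proof -
    have oneG: "(\<lambda>z. 1 - G z) \<in> polydisc_algebra" by (intro polydisc_algebra_diff polydisc_algebra_const G(1))
    obtain f where f: "is_pol f" "\<And>z. z \<in> closure polydisc \<Longrightarrow> cmod ((1 - G z) - f z) \<le> \<delta>"
      using polydisc_algebra_approx[OF oneG \<delta>(1)] by blast
    obtain A c where A: "finite A" "f = pol A c" using f(1) by (auto simp: is_pol_def)
    have ft: "cmod ((1 - G z) - f z) \<le> \<delta>" if "z \<in> torus" for z using f(2) torus_subset_closure that by blast
    have f_b: "cmod (pol A c z) \<le> 3" if z: "z \<in> torus" for z
    proof -
      have "cmod (f z) \<le> cmod (1 - G z) + cmod ((1 - G z) - f z)"
        using norm_triangle_ineq4[of "1 - G z" "(1 - G z) - f z"] by simp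
      moreover have "cmod (1 - G z) \<le> 1 + 1" using norm_triangle_ineq4[of 1 "G z"] G(2)[OF z] by simp
      ultimately show ?thesis using ft[OF z] \<delta>(2) A(2) by simp
    qed
    have f_re: "- \<delta> \<le> Re (pol A c z)" if z: "z \<in> torus" for z
    proof -
      have "Re (G z) \<le> 1" using complex_Re_le_cmod[of "G z"] G(2)[OF z] by linarith
      moreover have "Re ((1 - G z) - f z) \<le> \<delta>" using complex_Re_le_cmod ft[OF z] order_trans by blast
      ultimately show ?thesis using A(2) by simp
    qed
    have f0: "cmod (pol A c 0) \<le> 2 * \<delta>"
    proof -
      have "cmod ((1 - G 0) - f 0) \<le> \<delta>" using f(2)[of 0] zero_in_polydisc closure_subset by blast
      then show ?thesis using norm_triangle_ineq4[of "1 - G 0" "(1 - G 0) - f 0"] G(3) A(2) by simp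
    qed
    define W where "W = (\<lambda>S \<alpha>. complex_of_real (\<Prod>i\<in>S. vallee_poussin m (Poly_Mapping.lookup \<alpha> i)) * c \<alpha>)"
    have tr: "cmod (\<phi> (\<lambda>z. (pol A c z - pol A (W UNIV) z) * u z)) \<le> n * (4 * 3 ^ n * 3 * a)"
      unfolding W_def n_def
      by (rule conjunct2[OF vallee_poussin_truncation[OF A(1) f_b m u less_imp_le[OF a] finite_class.finite_UNIV]])
    define A2 where "A2 = {\<alpha>\<in>A. \<forall>i. Poly_Mapping.lookup \<alpha> i < 2 * m}"
    have W0: "W UNIV \<alpha> = 0" if \<alpha>: "\<alpha> \<in> A - A2" for \<alpha>
    proof -
      obtain i where "2 * m \<le> Poly_Mapping.lookup \<alpha> i" using \<alpha> by (auto simp: A2_def not_less)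
      then have "vallee_poussin m (Poly_Mapping.lookup \<alpha> i) = 0" by (rule vallee_poussin_eq_0)
      then have "(\<Prod>i\<in>UNIV. vallee_poussin m (Poly_Mapping.lookup \<alpha> i)) = 0" by (intro prod_zero) auto
      then show ?thesis by (simp add: W_def)
    qed
    \<comment> \<open>Here \<open>8 = 2 * 2 + 4\<close>: the approximating polynomial has modulus at
      most \<open>2 * \<delta>\<close> at 0 and real part at least \<open>- \<delta>\<close> on the
      torus. The multipliers lie between \<open>0\<close> and \<open>1\<close> and do not enlarge
      coefficients.\<close>
    have W_le: "cmod (W UNIV \<alpha>) \<le> 8 * \<delta>" if "\<alpha> \<in> A" for \<alpha>
    proof -
      have "\<bar>\<Prod>i\<in>UNIV. vallee_poussin m (Poly_Mapping.lookup \<alpha> i)\<bar> \<le> 1"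
        using vallee_poussin_bounds by (simp add: abs_prod prod_le_1)
      then have "cmod (W UNIV \<alpha>) \<le> 1 * cmod (c \<alpha>)"
        unfolding W_def norm_mult norm_of_real by (intro mult_right_mono) auto
      also have "cmod (c \<alpha>) \<le> 2 * cmod (pol A c 0) + 4 * \<delta>"
        by (rule pol_coeff_bound[OF A(1) f_re that less_imp_le[OF \<delta>(1)]])
      finally show ?thesis using f0 by simp
    qed
    have W_b: "cmod (pol A (W UNIV) z * u z) \<le> L * (8 * \<delta>)" if z: "z \<in> torus" for z
    proof -
      have "pol A (W UNIV) z = pol A2 (W UNIV) z"
        using W0 by (intro pol_restrict A(1)) (auto simp: A2_def)
      also have "cmod \<dots> \<le> (\<Sum>\<alpha>\<in>A2. 8 * \<delta>)"
        unfolding pol_def using W_le norm_monom_fun_torus[OF z] by (intro sum_norm_le) (auto simp: norm_mult A2_def)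
      also have "\<dots> = card A2 * (8 * \<delta>)" by simp
      also have "\<dots> \<le> L * (8 * \<delta>)"
        unfolding L_def n_def using \<delta>(1) by (intro mult_right_mono of_nat_mono card_bounded_exponents) (auto simp: A2_def)
      finally have "cmod (pol A (W UNIV) z) * cmod (u z) \<le> L * (8 * \<delta>) * 1"
        using u(2)[OF z] L \<delta>(1) by (intro mult_mono) auto
      then show ?thesis by (simp add: norm_mult)
    qed
    have alg: "pol A c' \<in> polydisc_algebra" for c' by (intro polydisc_algebra_pol is_pol_pol A(1))
    have 1: "cmod (\<phi> (\<lambda>z. ((1 - G z) - f z) * u z)) \<le> C * \<delta>"
    proof (rule bound)
      show "(\<lambda>z. ((1 - G z) - f z) * u z) \<in> polydisc_algebra"
        unfolding A(2) by (intro polydisc_algebra_mult polydisc_algebra_diff oneG alg u(1))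
      fix z :: "complex^'n" assume z: "z \<in> torus"
      have "cmod ((1 - G z) - f z) * cmod (u z) \<le> \<delta> * 1" using ft[OF z] u(2)[OF z] \<delta>(1) by (intro mult_mono) auto
      then show "cmod (((1 - G z) - f z) * u z) \<le> \<delta>" by (simp add: norm_mult)
    qed
    have 2: "cmod (\<phi> (\<lambda>z. pol A (W UNIV) z * u z)) \<le> C * (L * (8 * \<delta>))"
      by (rule bound[OF _ W_b]) (intro polydisc_algebra_mult alg u(1))
    have "\<phi> (\<lambda>z. (1 - G z) * u z) =
        \<phi> (\<lambda>z. ((1 - G z) - f z) * u z + ((pol A c z - pol A (W UNIV) z) * u z + pol A (W UNIV) z * u z))"
      by (rule arg_cong[of _ _ \<phi>]) (simp add: fun_eq_iff A(2) algebra_simps)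
    also have "\<dots> = \<phi> (\<lambda>z. ((1 - G z) - f z) * u z) +
        (\<phi> (\<lambda>z. (pol A c z - pol A (W UNIV) z) * u z) + \<phi> (\<lambda>z. pol A (W UNIV) z * u z))"
    proof -
      have m1: "(\<lambda>z. ((1 - G z) - f z) * u z) \<in> polydisc_algebra"
        unfolding A(2) by (intro polydisc_algebra_mult polydisc_algebra_diff oneG alg u(1))
      have m2: "(\<lambda>z. (pol A c z - pol A (W UNIV) z) * u z) \<in> polydisc_algebra"
        by (intro polydisc_algebra_mult polydisc_algebra_diff alg u(1))
      have m3: "(\<lambda>z. pol A (W UNIV) z * u z) \<in> polydisc_algebra"
        by (intro polydisc_algebra_mult alg u(1))
      show ?thesis unfolding add[OF m1 polydisc_algebra_add[OF m2 m3]] add[OF m2 m3] ..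
    qed
    also have "cmod \<dots> \<le> C * \<delta> + (n * (4 * 3 ^ n * 3 * a) + C * (L * (8 * \<delta>)))"
      by (intro norm_triangle_mono 1 2 tr)
    also have "n * (4 * 3 ^ n * 3 * a) = \<epsilon> / 3"
    proof -
      have "n * (4 * 3 ^ n * 3 * a) = K * a" by (simp add: K_def)
      then show ?thesis using K by (simp add: a_def)
    qed
    also have "C * \<delta> + (\<epsilon> / 3 + C * (L * (8 * \<delta>))) \<le> \<epsilon>" using C\<delta> \<delta>(3) by (simp add: mult.assoc)
    finally show ?thesis .
  qed
  then show ?thesis using that[OF \<delta>(1)] by blast
qed

end

section \<open>Regularity and push-forwards of complex measures with a density\<close>

lemma density_in_torus_measures:
  fixes \<theta> :: "(complex^'n::finite) measure"
  assumes \<theta>: "sets \<theta> = sets torus_borel" and \<kappa>: "integrable \<theta> \<kappa>"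
  shows "(\<lambda>A. LINT z:A|\<theta>. \<kappa> z) \<in> torus_measures"
proof -
  have si: "set_integrable \<theta> A \<kappa>" if "A \<in> sets \<theta>" for A
    unfolding set_integrable_def by (rule integrable_mult_indicator[OF that \<kappa>])
  have n\<kappa>: "integrable \<theta> (\<lambda>z. cmod (\<kappa> z))" using \<kappa> by (rule integrable_norm)
  have "complex_measure torus_borel (\<lambda>A. LINT z:A|\<theta>. \<kappa> z)"
    unfolding complex_measure_def
  proof (intro allI impI)
    fix A :: "nat \<Rightarrow> (complex^'n) set"
    assume A: "range A \<subseteq> sets torus_borel" "disjoint_family A"
    then have As: "A i \<in> sets \<theta>" for i by (auto simp: \<theta>)
    have "(\<lambda>n. LINT z:(\<Union>i<n. A i)|\<theta>. \<kappa> z) \<longlonglongrightarrow> (LINT z:(\<Union>n. \<Union>i<n. A i)|\<theta>. \<kappa> z)"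
      using As by (intro set_integral_cont_up si monoI UN_mono) auto
    moreover have "(\<Union>n. \<Union>i<n. A i) = (\<Union>i. A i)" by auto
    moreover have "(LINT z:(\<Union>i<n. A i)|\<theta>. \<kappa> z) = (\<Sum>i<n. LINT z:A i|\<theta>. \<kappa> z)" for n
      using As A(2) by (intro set_integral_finite_Union si) (auto simp: disjoint_family_on_def)
    ultimately show "(\<lambda>i. LINT z:A i|\<theta>. \<kappa> z) sums (LINT z:(\<Union>i. A i)|\<theta>. \<kappa> z)"
      by (simp add: sums_def)
  qed
  moreover have "\<exists>K U. compact K \<and> open U \<and> K \<subseteq> A \<and> A \<subseteq> U \<and>
      total_variation torus_borel (\<lambda>A. LINT z:A|\<theta>. \<kappa> z) (U \<inter> torus - K) < e"
    if A: "A \<in> sets torus_borel" and e: "0 < e" for A and e :: ennreal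
  proof -
    \<comment> \<open>A finite measure that dominates the total variation; regularity of the complex
      measure is inherited from it.\<close>
    define D where "D = density \<theta> (\<lambda>z. ennreal (cmod (\<kappa> z)))"
    have sD: "sets D = sets torus_borel" by (simp add: D_def \<theta>)
    have spD: "space D = torus" by (rule space_torus_borel[OF sD])
    have D: "emeasure D A = ennreal (LINT z:A|\<theta>. cmod (\<kappa> z))" if "A \<in> sets torus_borel" for A
      using that \<kappa> set_integral_ennreal[OF n\<kappa>, of A] by (simp add: D_def emeasure_density \<theta>)
    have tv: "total_variation torus_borel (\<lambda>A. LINT z:A|\<theta>. \<kappa> z) A \<le> emeasure D A" for A
      unfolding total_variation_def
    proof (rule SUP_least)
      fix F :: "nat \<Rightarrow> (complex^'n) set"
      assume "F \<in> {F. range F \<subseteq> sets torus_borel \<and> disjoint_family F \<and> (\<Union>i. F i) = A}"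
      then have F: "range F \<subseteq> sets D" "disjoint_family F" "(\<Union>i. F i) = A" by (auto simp: sD)
      then have Fs: "F i \<in> sets torus_borel" for i by (auto simp: sD)
      have "suminf (\<lambda>i. ennreal (cmod (LINT z:F i|\<theta>. \<kappa> z))) \<le> suminf (\<lambda>i. emeasure D (F i))"
      proof (intro suminf_le summableI)
        fix i
        show "ennreal (cmod (LINT z:F i|\<theta>. \<kappa> z)) \<le> emeasure D (F i)"
          unfolding D[OF Fs] using Fs by (intro ennreal_leI set_integral_norm_bound si) (simp add: \<theta>)
      qed
      also have "\<dots> = emeasure D A" using suminf_emeasure[OF F(1,2)] F(3) by simp
      finally show "suminf (\<lambda>i. ennreal (cmod (LINT z:F i|\<theta>. \<kappa> z))) \<le> emeasure D A" .
    qed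
    define B where "B = distr D borel (\<lambda>z. z)"
    have idm: "(\<lambda>z. z) \<in> measurable D borel" by (rule torus_measurable[OF sD continuous_on_id])
    have eB: "emeasure B X = emeasure D (X \<inter> torus)" if "X \<in> sets borel" for X
      using that idm by (simp add: B_def emeasure_distr spD)
    have sB: "sets B = sets borel" by (simp add: B_def)
    have finB: "emeasure B (space B) \<noteq> \<infinity>"
    proof -
      have "torus \<in> sets (torus_borel :: (complex^'n) measure)"
        by (metis sets.top space_torus_borel_eq)
      then show ?thesis using eB[of UNIV] D by (simp add: B_def)
    qed
    interpret B: finite_measure B by (rule finite_measureI[OF finB])
    have A': "A \<in> sets borel" "A \<subseteq> torus" using A by (auto simp: sets_torus_borel_iff)
    \<comment> \<open>\<open>e\<close> may be infinite. A positive real below it is halved between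
      the inner and the outer approximation of \<open>A\<close>.\<close>
    obtain r where r: "0 < r" "ennreal r \<le> e"
    proof (cases e)
      case (real x) then show ?thesis using e that[of x] by (simp add: ennreal_less_zero_iff)
    next
      case top then show ?thesis using that[of 1] by simp
    qed
    define d where "d = ennreal (r / 2)"
    have d: "0 < d" "d + d \<le> e" using r by (auto simp: d_def simp flip: ennreal_plus)
    have "\<exists>K\<in>{K. K \<subseteq> A \<and> compact K}. emeasure B A < emeasure B K + d"
      unfolding d_def using r(1) B.emeasure_finite by (intro SUP_approx_ennreal[OF _ _ inner_regular[OF sB finB]]) (auto simp: A' sB)
    then obtain K where K: "K \<subseteq> A" "compact K" "emeasure B A < emeasure B K + d" by blast
    have "\<exists>U\<in>{U. A \<subseteq> U \<and> open U}. emeasure B U < emeasure B A + d"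
      unfolding d_def using r(1) B.emeasure_finite by (intro INF_approx_ennreal[OF _ outer_regular[OF sB finB]]) (auto simp: A' sB)
    then obtain U where U: "A \<subseteq> U" "open U" "emeasure B U < emeasure B A + d" by blast
    have Ks: "K \<in> sets B" "U \<in> sets B" "A \<in> sets B" using K(2) U(2) A' by (auto simp: sB compact_imp_closed)
    have small: "emeasure B (Y - X) < d" if "X \<in> sets B" "Y \<in> sets B" "X \<subseteq> Y" "emeasure B Y < emeasure B X + d" for X Y
    proof -
      have "emeasure B Y = emeasure B X + emeasure B (Y - X)"
        using plus_emeasure[of X B "Y - X"] that by (simp add: Un_absorb1)
      then show ?thesis using that(4) by (metis add_left_mono not_le)
    qed
    have "U - K = (U - A) \<union> (A - K)" using K(1) U(1) by auto
    then have "emeasure B (U - K) \<le> emeasure B (U - A) + emeasure B (A - K)"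
      using emeasure_subadditive[of "U - A" B "A - K"] Ks by simp
    also have "\<dots> < d + d" using Ks K U by (intro add_strict_mono small) auto
    also have "\<dots> \<le> e" by (rule d(2))
    finally have "emeasure B (U - K) < e" .
    moreover have "U - K \<in> sets borel" using Ks by (auto simp: sB)
    ultimately have "emeasure D (U \<inter> torus - K) < e" using eB[of "U - K"] by (simp add: Diff_Int_distrib2 Int_Diff Int_commute)
    then show ?thesis using K U by (intro exI[of _ K] exI[of _ U] conjI order.strict_trans1[OF tv])
  qed
  ultimately show ?thesis by (simp add: torus_measures_def)
qed

text \<open>The density is a conditional expectation of \<open>\<omega>\<close> given
  \<open>\<pi>\<close>: the weighted measure is absolutely continuous with respect to the unweighted
  one, and this survives the push-forward.\<close>

lemma weighted_pushforward_real:
  fixes \<omega> :: "'b \<Rightarrow> real"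
  assumes \<Lambda>: "finite_measure \<Lambda>" and \<pi>[measurable]: "\<pi> \<in> measurable \<Lambda> N"
    and \<omega>[measurable]: "\<omega> \<in> borel_measurable \<Lambda>" and \<omega>_ge: "\<And>x. 0 \<le> \<omega> x" and \<omega>_le: "\<And>x. x \<in> space \<Lambda> \<Longrightarrow> \<omega> x \<le> 1"
  obtains k where "integrable (distr \<Lambda> N \<pi>) k"
    "\<And>v :: _ \<Rightarrow> complex. v \<in> borel_measurable N \<Longrightarrow> (LINT x|\<Lambda>. \<omega> x *\<^sub>R v (\<pi> x)) = (LINT z|distr \<Lambda> N \<pi>. k z *\<^sub>R v z)"
proof -
  interpret finite_measure \<Lambda> by fact
  define D where "D = density \<Lambda> (\<lambda>x. ennreal (\<omega> x))"
  have \<pi>D[measurable]: "\<pi> \<in> measurable D N" by (simp add: D_def)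
  have "emeasure D (space D) \<le> emeasure \<Lambda> (space \<Lambda>)"
  proof -
    have "emeasure D (space D) = (\<integral>\<^sup>+x. ennreal (\<omega> x) * indicator (space \<Lambda>) x \<partial>\<Lambda>)"
      by (simp add: D_def emeasure_density)
    also have "\<dots> \<le> (\<integral>\<^sup>+x. indicator (space \<Lambda>) x \<partial>\<Lambda>)"
      using \<omega>_le by (intro nn_integral_mono) (auto simp: ennreal_le_1 split: split_indicator)
    finally show ?thesis by simp
  qed
  then have finD: "finite_measure D"
    by (intro finite_measureI) (metis emeasure_finite infinity_ennreal_def top.extremum_uniqueI)
  have fin: "finite_measure (distr D N \<pi>)" by (rule finite_measure.finite_measure_distr[OF finD \<pi>D])
  have fin': "finite_measure (distr \<Lambda> N \<pi>)" by (rule finite_measure_distr[OF \<pi>])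
  have "absolutely_continuous \<Lambda> D" unfolding D_def by (rule absolutely_continuousI_density) measurable
  then have "absolutely_continuous (distr \<Lambda> N \<pi>) (distr D N \<pi>)"
    unfolding absolutely_continuous_def by (auto simp: null_sets_distr_iff D_def)
  then obtain k where k: "integrable (distr \<Lambda> N \<pi>) k" "\<And>x. 0 \<le> k x" "distr D N \<pi> = density (distr \<Lambda> N \<pi>) (\<lambda>x. ennreal (k x))"
    using finite_Radon_Nikodym_real[OF fin' fin] by (metis sets_distr)
  have "(LINT x|\<Lambda>. \<omega> x *\<^sub>R v (\<pi> x)) = (LINT z|distr \<Lambda> N \<pi>. k z *\<^sub>R v z)"
    if v[measurable]: "v \<in> borel_measurable N" for v :: "_ \<Rightarrow> complex"
  proof -
    have "(LINT x|\<Lambda>. \<omega> x *\<^sub>R v (\<pi> x)) = (LINT x|D. v (\<pi> x))"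
      unfolding D_def using \<omega>_ge by (intro integral_density[symmetric]) auto
    also have "\<dots> = (LINT z|distr D N \<pi>. v z)" by (intro integral_distr[symmetric] \<pi>D v)
    also have "\<dots> = (LINT z|distr \<Lambda> N \<pi>. k z *\<^sub>R v z)"
      unfolding k(3) using k(1,2) v by (intro integral_density) (auto simp: borel_measurable_integrable)
    finally show ?thesis .
  qed
  then show ?thesis by (intro that[OF k(1)])
qed

lemma weighted_pushforward:
  fixes h :: "'b \<Rightarrow> complex"
  assumes \<Lambda>: "finite_measure \<Lambda>" and \<pi>[measurable]: "\<pi> \<in> measurable \<Lambda> N"
    and h[measurable]: "h \<in> borel_measurable \<Lambda>" and h_le: "\<And>x. x \<in> space \<Lambda> \<Longrightarrow> cmod (h x) \<le> 1"
  obtains \<kappa> where "integrable (distr \<Lambda> N \<pi>) \<kappa>"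
    "\<And>v B. v \<in> borel_measurable N \<Longrightarrow> (\<And>z. z \<in> space N \<Longrightarrow> cmod (v z) \<le> B) \<Longrightarrow>
      (LINT x|\<Lambda>. h x * v (\<pi> x)) = (LINT z|distr \<Lambda> N \<pi>. \<kappa> z * v z)"
proof -
  interpret finite_measure \<Lambda> by fact
  \<comment> \<open>The positive parts of \<open>Re h\<close>, \<open>Im h\<close>,
    \<open>- Re h\<close> and \<open>- Im h\<close>, in this order, so that the weights
    \<open>\<i> ^ i\<close> restore \<open>h\<close>.\<close>
  define W :: "nat \<Rightarrow> 'b \<Rightarrow> real" where "W i x = max 0 (Re ((-\<i>) ^ i * h x))" for i x
  have W_le: "W i x \<le> 1" if "x \<in> space \<Lambda>" for i x
    using complex_Re_le_cmod[of "(-\<i>) ^ i * h x"] h_le[OF that] by (simp add: W_def norm_mult norm_power)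
  have W_ge: "0 \<le> W i x" for i x by (simp add: W_def)
  have Wm[measurable]: "W i \<in> borel_measurable \<Lambda>" for i unfolding W_def[abs_def] by measurable
  have dec: "h x = (\<Sum>i<4. \<i> ^ i * complex_of_real (W i x))" for x
    by (auto simp: W_def complex_eq_iff eval_nat_numeral lessThan_Suc max_def)
  have "\<exists>k. integrable (distr \<Lambda> N \<pi>) k \<and>
      (\<forall>v :: _ \<Rightarrow> complex. v \<in> borel_measurable N \<longrightarrow> (LINT x|\<Lambda>. W i x *\<^sub>R v (\<pi> x)) = (LINT z|distr \<Lambda> N \<pi>. k z *\<^sub>R v z))" for i
    using weighted_pushforward_real[OF \<Lambda> \<pi> Wm W_ge W_le] by metis
  then obtain k where k: "\<And>i. integrable (distr \<Lambda> N \<pi>) (k i)"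
    "\<And>i v. (v :: _ \<Rightarrow> complex) \<in> borel_measurable N \<Longrightarrow> (LINT x|\<Lambda>. W i x *\<^sub>R v (\<pi> x)) = (LINT z|distr \<Lambda> N \<pi>. k i z *\<^sub>R v z)"
    by metis
  define \<kappa> where "\<kappa> z = (\<Sum>i<4. \<i> ^ i * complex_of_real (k i z))" for z
  show ?thesis
  proof (rule that[of \<kappa>])
    show "integrable (distr \<Lambda> N \<pi>) \<kappa>" unfolding \<kappa>_def[abs_def] using k(1) by auto
    fix v B assume v[measurable]: "v \<in> borel_measurable N" and B: "\<And>z. z \<in> space N \<Longrightarrow> cmod (v z) \<le> B"
    have i1: "integrable \<Lambda> (\<lambda>x. W i x *\<^sub>R v (\<pi> x))" for i
    proof (rule integrable_const_bound[of _ B])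
      show "AE x in \<Lambda>. norm (W i x *\<^sub>R v (\<pi> x)) \<le> B"
      proof (rule AE_I2)
        fix x assume x: "x \<in> space \<Lambda>"
        have "norm (W i x *\<^sub>R v (\<pi> x)) \<le> 1 * cmod (v (\<pi> x))"
          unfolding norm_scaleR using W_le[OF x] W_ge by (intro mult_right_mono) auto
        also have "\<dots> \<le> B" using B[OF measurable_space[OF \<pi> x]] by simp
        finally show "norm (W i x *\<^sub>R v (\<pi> x)) \<le> B" .
      qed
    qed measurable
    have i2: "integrable (distr \<Lambda> N \<pi>) (\<lambda>z. k i z *\<^sub>R v z)" for i
    proof (rule Bochner_Integration.integrable_bound[of _ "\<lambda>z. B * k i z"])
      show "integrable (distr \<Lambda> N \<pi>) (\<lambda>z. B * k i z)" using k(1) by simp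
      show "(\<lambda>z. k i z *\<^sub>R v z) \<in> borel_measurable (distr \<Lambda> N \<pi>)"
        using borel_measurable_integrable[OF k(1)[of i]] v by auto
      show "AE z in distr \<Lambda> N \<pi>. norm (k i z *\<^sub>R v z) \<le> norm (B * k i z)"
      proof (rule AE_I2)
        fix z assume "z \<in> space (distr \<Lambda> N \<pi>)"
        then have "cmod (v z) \<le> \<bar>B\<bar>" using B[of z] by simp
        then show "norm (k i z *\<^sub>R v z) \<le> norm (B * k i z)"
          unfolding real_norm_def abs_mult norm_scaleR mult.commute[of "\<bar>k i z\<bar>"] by (rule mult_right_mono) simp
      qed
    qed
    have "(LINT x|\<Lambda>. h x * v (\<pi> x)) = (LINT x|\<Lambda>. (\<Sum>i<4. \<i> ^ i * (W i x *\<^sub>R v (\<pi> x))))"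
      by (subst dec) (simp add: sum_distrib_right scaleR_conv_of_real mult.assoc)
    also have "\<dots> = (\<Sum>i<4. \<i> ^ i * (LINT x|\<Lambda>. W i x *\<^sub>R v (\<pi> x)))"
      using i1 by (subst Bochner_Integration.integral_sum) (auto simp del: mult_scaleR_right)
    also have "\<dots> = (\<Sum>i<4. \<i> ^ i * (LINT z|distr \<Lambda> N \<pi>. k i z *\<^sub>R v z))" by (simp add: k(2)[OF v])
    also have "\<dots> = (LINT z|distr \<Lambda> N \<pi>. (\<Sum>i<4. \<i> ^ i * (k i z *\<^sub>R v z)))"
      using i2 by (subst Bochner_Integration.integral_sum) (auto simp del: mult_scaleR_right)
    also have "\<dots> = (LINT z|distr \<Lambda> N \<pi>. \<kappa> z * v z)"
      by (simp add: \<kappa>_def sum_distrib_right scaleR_conv_of_real mult.assoc)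
    finally show "(LINT x|\<Lambda>. h x * v (\<pi> x)) = (LINT z|distr \<Lambda> N \<pi>. \<kappa> z * v z)" .
  qed
qed

context apostol_functional
begin

text \<open>The unimodular coordinate \<open>snd x\<close> is a polar factor: a complex measure on the torus is the
  push-forward of a positive measure on the torus times the circle, weighted by that coordinate.\<close>

lemma polar_representation:
  obtains \<Lambda> :: "((complex^'n) \<times> complex) measure" where
    "finite_measure \<Lambda>" "sets \<Lambda> = sets (restrict_space borel (torus \<times> sphere 0 1))"
    "\<And>u. u \<in> polydisc_algebra \<Longrightarrow> \<phi> u = (LINT x|\<Lambda>. snd x * u (fst x))"
proof -
  define K :: "((complex^'n) \<times> complex) set" where "K = torus \<times> sphere 0 1"
  have K: "compact K" unfolding K_def by (intro compact_Times compact_torus compact_sphere)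
  have cont: "continuous_on K (\<lambda>x. snd x * u (fst x))" if "u \<in> polydisc_algebra" for u
    unfolding K_def
    by (intro continuous_intros continuous_on_compose2[OF polydisc_algebra_continuous[OF that]]) auto
  \<comment> \<open>The demands are that \<open>Re (snd x * u (fst x))\<close> integrate to at most
    \<open>Re (\<phi> u)\<close> and that a constant \<open>s \<ge> 0\<close> integrate to at most
    \<open>s * C\<close>.\<close>
  define Q where "Q = {(f :: (complex^'n) \<times> complex \<Rightarrow> real, c). continuous_on K f \<and> (\<exists>u\<in>polydisc_algebra. \<exists>s\<ge>0.
    (\<forall>x\<in>K. f x \<le> Re (snd x * u (fst x)) + s) \<and> c = Re (\<phi> u) + s * C)}"
  have QI: "(f, c) \<in> Q" if "continuous_on K f" "u \<in> polydisc_algebra" "0 \<le> s"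
    "\<And>x. x \<in> K \<Longrightarrow> f x \<le> Re (snd x * u (fst x)) + s" "c = Re (\<phi> u) + s * C" for f c u s
    using that unfolding Q_def by blast
  have zero: "(\<lambda>_. 0) \<in> polydisc_algebra" "\<phi> (\<lambda>_. 0) = 0"
    using polydisc_algebra_const scale[of "\<lambda>_. 0" 0] by auto
  obtain \<Lambda> where \<Lambda>: "sets \<Lambda> = sets (restrict_space borel K)" "finite_measure \<Lambda>"
    "\<And>f c. (f, c) \<in> Q \<Longrightarrow> integral\<^sup>L \<Lambda> f \<le> c"
  proof (rule cone_measure[OF K, of Q])
    show "continuous_on K f" if "(f, c) \<in> Q" for f c using that by (simp add: Q_def)
    show "((\<lambda>_. 0), 0) \<in> Q" by (rule QI[OF _ zero(1), of _ 0]) (auto simp: zero)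
    show "((\<lambda>_. 1), C) \<in> Q" by (rule QI[OF _ zero(1), of _ 1]) (auto simp: zero)
    fix f c assume "(f, c) \<in> Q"
    then obtain u s where f: "continuous_on K f" and u: "u \<in> polydisc_algebra" and s: "0 \<le> s"
      "\<And>x. x \<in> K \<Longrightarrow> f x \<le> Re (snd x * u (fst x)) + s" "c = Re (\<phi> u) + s * C"
      unfolding Q_def by blast
    show "((\<lambda>x. f x + g x), c + d) \<in> Q" if gd: "(g, d) \<in> Q" for g d
    proof -
      obtain v t where g: "continuous_on K g" and v: "v \<in> polydisc_algebra" and t: "0 \<le> t"
        "\<And>x. x \<in> K \<Longrightarrow> g x \<le> Re (snd x * v (fst x)) + t" "d = Re (\<phi> v) + t * C"
        using gd unfolding Q_def by blast
      show ?thesis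
      proof (rule QI[OF _ polydisc_algebra_add[OF u v], of _ "s + t"])
        show "continuous_on K (\<lambda>x. f x + g x)" using f g by (rule continuous_on_add)
        show "f x + g x \<le> Re (snd x * (u (fst x) + v (fst x))) + (s + t)" if "x \<in> K" for x
          using s(2)[OF that] t(2)[OF that] by (simp add: distrib_left)
      qed (use s t add[OF u v] in \<open>auto simp: algebra_simps\<close>)
    qed
    show "((\<lambda>x. t * f x), t * c) \<in> Q" if t: "0 < t" for t
    proof (rule QI[OF _ polydisc_algebra_cmult[OF u, of "complex_of_real t"], of _ "t * s"])
      show "continuous_on K (\<lambda>x. t * f x)" using f by (rule continuous_on_mult_left)
      show "t * f x \<le> Re (snd x * (complex_of_real t * u (fst x))) + t * s" if "x \<in> K" for x
      proof -
        have "t * f x \<le> t * (Re (snd x * u (fst x)) + s)" using s(2)[OF that] t by (intro mult_left_mono) auto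
        then show ?thesis by (simp add: algebra_simps)
      qed
    qed (use s t scale[OF u] in \<open>auto simp: algebra_simps\<close>)
    show "(g, c) \<in> Q" if "continuous_on K g" "\<And>x. x \<in> K \<Longrightarrow> g x \<le> f x" for g
      using that by (intro QI[OF _ u s(1) _ s(3)] order_trans[OF _ s(2)])
  next
    fix c assume "((\<lambda>_. 0), c) \<in> Q"
    then obtain u s where u: "u \<in> polydisc_algebra" and s: "0 \<le> s"
      "\<And>x. x \<in> K \<Longrightarrow> 0 \<le> Re (snd x * u (fst x)) + s" "c = Re (\<phi> u) + s * C"
      unfolding Q_def by blast
    have "cmod (u z) \<le> s" if z: "z \<in> torus" for z
    proof (cases "u z = 0")
      case False
      \<comment> \<open>At the point where the circle coordinate turns \<open>u z\<close> onto the
        negative real axis, the inequality bounds \<open>cmod (u z)\<close> by \<open>s\<close>; the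
        norm bound of \<open>\<phi>\<close> then gives consistency.\<close>
      define w where "w = - cnj (sgn (u z))"
      have "cmod w = 1" using False by (simp add: w_def norm_sgn)
      then have "(z, w) \<in> K" using z by (simp add: K_def)
      moreover have "w * u z = - complex_of_real (cmod (u z))"
        using False by (simp add: w_def sgn_eq field_simps complex_norm_square[symmetric] power2_eq_square)
      ultimately show ?thesis using s(2)[of "(z, w)"] by simp
    qed (simp add: s)
    then have "cmod (\<phi> u) \<le> C * s" by (rule bound[OF u])
    then show "0 \<le> c" using abs_Re_le_cmod[of "\<phi> u"] by (simp add: s(3) mult.commute)
  qed blast
  interpret finite_measure \<Lambda> by fact
  have sp: "space \<Lambda> = K" using sets_eq_imp_space_eq[OF \<Lambda>(1)] by (simp add: space_restrict_space)
  have int: "integrable \<Lambda> (\<lambda>x. snd x * u (fst x))" if u: "u \<in> polydisc_algebra" for u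
  proof -
    have "(\<lambda>x. snd x * u (fst x)) \<in> borel_measurable \<Lambda>"
      using borel_measurable_continuous_on_restrict[OF cont[OF u]] measurable_cong_sets[OF \<Lambda>(1) refl] by blast
    moreover have "bounded ((\<lambda>x. snd x * u (fst x)) ` K)"
      by (intro compact_imp_bounded compact_continuous_image cont u K)
    then obtain b where "\<And>x. x \<in> K \<Longrightarrow> cmod (snd x * u (fst x)) \<le> b" unfolding bounded_iff by blast
    ultimately show ?thesis by (intro integrable_const_bound[of _ b]) (auto simp: sp)
  qed
  have Re_le: "(LINT x|\<Lambda>. Re (snd x * u (fst x))) \<le> Re (\<phi> u)" if u: "u \<in> polydisc_algebra" for u
    by (intro \<Lambda>(3) QI[OF _ u, of _ 0] continuous_on_Re cont u) auto
  have Re_eq: "Re (LINT x|\<Lambda>. snd x * u (fst x)) = Re (\<phi> u)" if u: "u \<in> polydisc_algebra" for u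
  proof (rule antisym)
    show "Re (LINT x|\<Lambda>. snd x * u (fst x)) \<le> Re (\<phi> u)"
      using Re_le[OF u] integral_Re[OF int[OF u]] by simp
    have "(LINT x|\<Lambda>. Re (snd x * (- 1 * u (fst x)))) \<le> Re (\<phi> (\<lambda>z. - 1 * u z))"
      by (rule Re_le[OF polydisc_algebra_cmult[OF u]])
    moreover have "(\<lambda>x. Re (snd x * (- 1 * u (fst x)))) = (\<lambda>x. - Re (snd x * u (fst x)))" by simp
    ultimately have "- (LINT x|\<Lambda>. Re (snd x * u (fst x))) \<le> Re (- 1 * \<phi> u)"
      unfolding scale[OF u] by (simp only: Bochner_Integration.integral_minus)
    then show "Re (\<phi> u) \<le> Re (LINT x|\<Lambda>. snd x * u (fst x))"
      unfolding integral_Re[OF int[OF u]] by simp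
  qed
  have "\<phi> u = (LINT x|\<Lambda>. snd x * u (fst x))" if u: "u \<in> polydisc_algebra" for u
  proof (rule complex_eqI)
    have "Re (LINT x|\<Lambda>. snd x * (- \<i> * u (fst x))) = Re (- \<i> * \<phi> u)"
      unfolding scale[OF u, symmetric] by (rule Re_eq[OF polydisc_algebra_cmult[OF u]])
    moreover have "(LINT x|\<Lambda>. snd x * (- \<i> * u (fst x))) = - \<i> * (LINT x|\<Lambda>. snd x * u (fst x))"
      by (subst integral_mult_right_zero[symmetric]) (simp add: mult.left_commute)
    ultimately show "Im (\<phi> u) = Im (LINT x|\<Lambda>. snd x * u (fst x))" by simp
  qed (simp add: Re_eq[OF u])
  then show ?thesis using that \<Lambda>(1,2) unfolding K_def by blast
qed

text \<open>The polar factor lives on the product with the circle, the set \<open>F\<close> on the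
  torus. The push-forward turns the factor into a density \<open>\<kappa>\<close> with respect to
  \<open>\<theta>\<close>, after which passing to the continuous part is multiplication by the
  indicator of \<open>F\<close>.\<close>

lemma representing_M0_measure: "\<exists>\<mu>\<in>M\<^sub>0. \<forall>u\<in>polydisc_algebra. \<phi> u = complex_measure_integral torus_borel \<mu> u"
proof -
  obtain \<Lambda> :: "((complex^'n) \<times> complex) measure" where \<Lambda>: "finite_measure \<Lambda>"
    "sets \<Lambda> = sets (restrict_space borel (torus \<times> sphere 0 1))"
    and rep: "\<And>u. u \<in> polydisc_algebra \<Longrightarrow> \<phi> u = (LINT x|\<Lambda>. snd x * u (fst x))"
    using polar_representation by blast
  interpret finite_measure \<Lambda> by fact
  have sp: "space \<Lambda> = torus \<times> sphere 0 1" using sets_eq_imp_space_eq[OF \<Lambda>(2)] by (simp add: space_restrict_space)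
  have cm: "f \<in> borel_measurable \<Lambda>" if "continuous_on (torus \<times> sphere 0 1) f"
    for f :: "(complex^'n) \<times> complex \<Rightarrow> 'z::topological_space"
    using borel_measurable_continuous_on_restrict[OF that] measurable_cong_sets[OF \<Lambda>(2) refl] by blast
  have snd_m: "snd \<in> borel_measurable \<Lambda>" by (intro cm continuous_on_snd continuous_on_id)
  have fst_m[measurable]: "fst \<in> measurable \<Lambda> torus_borel"
    unfolding torus_borel_def
    by (intro measurable_restrict_space2 cm continuous_on_fst continuous_on_id) (auto simp: sp)
  have snd_le: "cmod (snd x) \<le> 1" if "x \<in> space \<Lambda>" for x using that by (auto simp: sp)
  define \<theta> where "\<theta> = distr \<Lambda> torus_borel fst"
  have \<theta>: "finite_measure \<theta>" "sets \<theta> = sets torus_borel" by (auto simp: \<theta>_def finite_measure_distr)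
  have sp\<theta>: "space \<theta> = torus" by (rule space_torus_borel[OF \<theta>(2)])
  obtain F \<nu> G where F: "F \<in> sets torus_borel" and \<nu>: "representing_measure 0 \<nu>"
    and null: "\<And>A. A \<in> null_sets \<nu> \<Longrightarrow> emeasure \<theta> (A \<inter> F) = 0"
    and G: "\<And>k::nat. G k \<in> polydisc_algebra" "\<And>k z. z \<in> torus \<Longrightarrow> cmod (G k z) \<le> 1"
    and G0: "(\<lambda>k. G k 0) \<longlonglongrightarrow> 1" and G1: "(\<lambda>k. LINT z|\<theta>. cmod (indicator F z - G k z)) \<longlonglongrightarrow> 0"
    using continuous_split[OF \<theta>] by blast
  obtain \<kappa> where \<kappa>: "integrable \<theta> \<kappa>"
    "\<And>v B. v \<in> borel_measurable torus_borel \<Longrightarrow> (\<And>z. z \<in> space torus_borel \<Longrightarrow> cmod (v z) \<le> B) \<Longrightarrow>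
      (LINT x|\<Lambda>. snd x * v (fst x)) = (LINT z|\<theta>. \<kappa> z * v z)"
    using weighted_pushforward[OF \<Lambda>(1) fst_m snd_m snd_le] unfolding \<theta>_def by blast
  have Fm: "(\<lambda>z. indicator F z :: complex) \<in> borel_measurable torus_borel" using F by measurable
  define \<kappa>' where "\<kappa>' z = indicator F z *\<^sub>R \<kappa> z" for z
  have \<kappa>': "integrable \<theta> \<kappa>'" unfolding \<kappa>'_def[abs_def]
    by (rule integrable_mult_indicator[OF _ \<kappa>(1)]) (simp add: F \<theta>)
  define \<mu> where "\<mu> A = (LINT z:A|\<theta>. \<kappa>' z)" for A
  have "\<mu> A = 0" if A: "A \<in> null_sets \<nu>" for A
  proof -
    have "A \<in> sets \<theta>" using A representing_measureD(2)[OF \<nu>] by (auto simp: \<theta>)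
    then have "A \<inter> F \<in> null_sets \<theta>" using null[OF A] F by (auto simp: null_sets_def \<theta>)
    then have "AE z in \<theta>. indicat_real A z *\<^sub>R \<kappa>' z = 0"
      by (rule AE_mp[OF AE_not_in]) (auto simp: \<kappa>'_def indicator_def)
    then show ?thesis unfolding \<mu>_def set_lebesgue_integral_def by (rule integral_eq_zero_AE)
  qed
  then have "\<mu> \<in> M\<^sub>0"
    using density_in_torus_measures[OF \<theta>(2) \<kappa>'] \<nu> by (auto simp: M\<^sub>0_def \<mu>_def[abs_def])
  moreover have "\<phi> u = complex_measure_integral torus_borel \<mu> u" if u: "u \<in> polydisc_algebra" for u
  proof -
    have uc: "continuous_on torus u" by (rule polydisc_algebra_continuous[OF u])
    have um: "u \<in> borel_measurable torus_borel" by (rule torus_measurable[OF refl uc])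
    \<comment> \<open>The summand \<open>1\<close> allows division by \<open>B\<close> when
      \<open>u\<close> vanishes on the torus.\<close>
    define B where "B = sup_norm u + 1"
    have B: "0 < B" "\<And>z. z \<in> torus \<Longrightarrow> cmod (u z) \<le> B"
      using sup_norm_nonneg[OF uc] by (auto simp: B_def add_nonneg_pos intro: order_trans[OF sup_norm_upper[OF uc]])
    \<comment> \<open>The representation of \<open>\<phi>\<close> cut off to \<open>F\<close>. It is
      compared with \<open>\<phi> u\<close> before passing to \<open>\<kappa>\<close>: upstairs the
      weight has modulus at most \<open>1\<close>, so the error is bounded by \<open>B\<close> times
      the distance of \<open>G k\<close> from the indicator of \<open>F\<close> in mean.\<close>
    define J where "J = (LINT x|\<Lambda>. snd x * (indicator F (fst x) * u (fst x)))"
    have Gm: "G k \<in> borel_measurable torus_borel" for k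
      by (intro torus_measurable[OF refl] polydisc_algebra_continuous G)
    have bnd: "integrable \<Lambda> (\<lambda>x. snd x * v (fst x))"
      if v[measurable]: "v \<in> borel_measurable torus_borel" and b: "\<And>z. z \<in> torus \<Longrightarrow> cmod (v z) \<le> b" for v b
    proof (rule integrable_const_bound[of _ b])
      show "AE x in \<Lambda>. cmod (snd x * v (fst x)) \<le> b" using b by (intro AE_I2) (auto simp: sp norm_mult)
      show "(\<lambda>x. snd x * v (fst x)) \<in> borel_measurable \<Lambda>" using snd_m by measurable
    qed
    have "cmod (\<phi> u - J) \<le> 0"
    proof (rule field_le_epsilon)
      fix e :: real assume e: "0 < e"
      define d where "d = e / 2 / B"
      have d: "0 < d" "B * d = e / 2" using e B(1) by (auto simp: d_def)
      obtain \<delta> where \<delta>: "0 < \<delta>" "\<And>G u. G \<in> polydisc_algebra \<Longrightarrow> (\<And>z. z \<in> torus \<Longrightarrow> cmod (G z) \<le> 1) \<Longrightarrow> cmod (1 - G 0) \<le> \<delta> \<Longrightarrow>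
          u \<in> polydisc_algebra \<Longrightarrow> (\<And>z. z \<in> torus \<Longrightarrow> cmod (u z) \<le> 1) \<Longrightarrow> cmod (\<phi> (\<lambda>z. (1 - G z) * u z)) \<le> d"
        using small_defect[OF d(1)] by blast
      have "eventually (\<lambda>k. dist (G k 0) 1 < \<delta>) sequentially" by (rule tendstoD[OF G0 \<delta>(1)])
      moreover have "eventually (\<lambda>k. dist (LINT z|\<theta>. cmod (indicator F z - G k z)) 0 < d) sequentially"
        by (rule tendstoD[OF G1 d(1)])
      ultimately have "eventually (\<lambda>k. dist (G k 0) 1 < \<delta> \<and> dist (LINT z|\<theta>. cmod (indicator F z - G k z)) 0 < d) sequentially"
        by (rule eventually_conj)
      then obtain k where k: "dist (G k 0) 1 < \<delta>" "dist (LINT z|\<theta>. cmod (indicator F z - G k z)) 0 < d"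
        by (auto simp: eventually_sequentially)
      define v where "v z = complex_of_real (1 / B) * u z" for z
      have v: "v \<in> polydisc_algebra" unfolding v_def[abs_def] by (rule polydisc_algebra_cmult[OF u])
      have "cmod (\<phi> (\<lambda>z. (1 - G k z) * v z)) \<le> d"
      proof (rule \<delta>(2)[OF G(1) _ _ v])
        show "cmod (G k z) \<le> 1" if "z \<in> torus" for z using G(2) that .
        show "cmod (1 - G k 0) \<le> \<delta>" using k(1) by (simp add: dist_norm norm_minus_commute)
        show "cmod (v z) \<le> 1" if "z \<in> torus" for z using B(1) B(2)[OF that] by (simp add: v_def norm_mult norm_divide field_simps)
      qed
      moreover have alg: "(\<lambda>z. (1 - G k z) * w z) \<in> polydisc_algebra" if "w \<in> polydisc_algebra" for w
        by (intro polydisc_algebra_mult polydisc_algebra_diff polydisc_algebra_const G that)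
      have "\<phi> (\<lambda>z. (1 - G k z) * u z) = complex_of_real B * \<phi> (\<lambda>z. (1 - G k z) * v z)"
        using B(1) by (subst scale[OF alg[OF v], symmetric]) (simp add: v_def mult.left_commute)
      ultimately have 1: "cmod (\<phi> (\<lambda>z. (1 - G k z) * u z)) \<le> B * d"
        using B(1) by (simp add: norm_mult)
      have uG: "(\<lambda>z. G k z * u z) \<in> polydisc_algebra" by (intro polydisc_algebra_mult G u)
      have dec: "\<phi> u = \<phi> (\<lambda>z. (1 - G k z) * u z) + \<phi> (\<lambda>z. G k z * u z)"
        by (subst add[OF alg[OF u] uG, symmetric]) (simp add: algebra_simps)
      define q where "q z = (G k z - indicator F z) * u z" for z
      have q_le: "cmod (q z) \<le> cmod (indicator F z - G k z) * B" if "z \<in> torus" for z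
        unfolding q_def norm_mult using B(2)[OF that] by (intro mult_mono) (auto simp: norm_minus_commute)
      have diff_le: "cmod (indicator F z - G k z) \<le> 2" if "z \<in> torus" for z
        using norm_triangle_ineq4[of "indicator F z" "G k z"] G(2)[OF that, of k] by (auto simp: indicator_def split: if_splits)
      have q_m: "q \<in> borel_measurable torus_borel" unfolding q_def[abs_def] by (rule borel_measurable_times[OF borel_measurable_diff[OF Gm Fm] um])
      have q_b: "cmod (q z) \<le> 2 * B" if "z \<in> torus" for z
        using q_le[OF that] mult_right_mono[OF diff_le[OF that], of B] B(1) by linarith
      have dm: "(\<lambda>z. cmod (indicator F z - G k z)) \<in> borel_measurable torus_borel" by (rule measurable_compose[OF borel_measurable_diff[OF Fm Gm] borel_measurable_norm])
      have "\<phi> (\<lambda>z. G k z * u z) - J = (LINT x|\<Lambda>. snd x * q (fst x))"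
      proof -
        have "integrable \<Lambda> (\<lambda>x. snd x * (G k (fst x) * u (fst x)))"
        proof (rule bnd[of "\<lambda>z. G k z * u z" "1 * B"])
          show "cmod (G k z * u z) \<le> 1 * B" if "z \<in> torus" for z
            unfolding norm_mult using that G B by (intro mult_mono) auto
        qed (rule borel_measurable_times[OF Gm um])
        moreover have "integrable \<Lambda> (\<lambda>x. snd x * (indicator F (fst x) * u (fst x)))"
        proof (rule bnd[of "\<lambda>z. indicator F z * u z" "1 * B"])
          show "cmod (indicator F z * u z) \<le> 1 * B" if "z \<in> torus" for z
            unfolding norm_mult using that B by (intro mult_mono) (auto simp: indicator_def)
        qed (rule borel_measurable_times[OF Fm um])
        ultimately show ?thesis
          unfolding J_def rep[OF uG] q_def
          by (subst Bochner_Integration.integral_diff[symmetric]) (auto simp: algebra_simps)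
      qed
      also have "cmod \<dots> \<le> (LINT x|\<Lambda>. cmod (indicator F (fst x) - G k (fst x)) * B)"
      proof (rule Bochner_Integration.integral_norm_bound_integral)
        show "integrable \<Lambda> (\<lambda>x. snd x * q (fst x))" by (rule bnd[OF q_m q_b])
        show "integrable \<Lambda> (\<lambda>x. cmod (indicator F (fst x) - G k (fst x)) * B)"
        proof (rule integrable_mult_left, rule integrable_const_bound[of _ 2])
          show "AE x in \<Lambda>. norm (cmod (indicator F (fst x) - G k (fst x))) \<le> 2"
            using diff_le by (intro AE_I2) (auto simp: sp)
          show "(\<lambda>x. cmod (indicator F (fst x) - G k (fst x))) \<in> borel_measurable \<Lambda>"
            by (rule measurable_compose[OF fst_m dm])
        qed
        show "cmod (snd x * q (fst x)) \<le> cmod (indicator F (fst x) - G k (fst x)) * B" if "x \<in> space \<Lambda>" for x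
          using that q_le by (auto simp: sp norm_mult)
      qed
      also have "\<dots> = (LINT z|\<theta>. cmod (indicator F z - G k z)) * B"
        unfolding \<theta>_def using dm by (subst integral_distr) auto
      also have "\<dots> \<le> d * B" using k(2) B(1) by (intro mult_right_mono) auto
      finally have 2: "cmod (\<phi> (\<lambda>z. G k z * u z) - J) \<le> e / 2" using d(2) by (simp add: mult.commute)
      have "cmod (\<phi> u - J) \<le> cmod (\<phi> (\<lambda>z. (1 - G k z) * u z)) + cmod (\<phi> (\<lambda>z. G k z * u z) - J)"
        unfolding dec by (rule order_trans[OF _ norm_triangle_ineq]) (simp add: add_diff_eq)
      then show "cmod (\<phi> u - J) \<le> 0 + e" using 1 2 d(2) by simp
    qed
    then have "\<phi> u = J" by simp
    also have "J = (LINT z|\<theta>. \<kappa> z * (indicator F z * u z))"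
      unfolding J_def
    proof (rule \<kappa>(2)[of "\<lambda>z. indicator F z * u z" "1 * B"])
      show "cmod (indicator F z * u z) \<le> 1 * B" if "z \<in> space torus_borel" for z
        unfolding norm_mult using that B by (intro mult_mono) (auto simp: indicator_def space_torus_borel_eq)
    qed (rule borel_measurable_times[OF Fm um])
    also have "\<dots> = (LINT z|\<theta>. \<kappa>' z * u z)"
      by (simp add: \<kappa>'_def scaleR_conv_of_real of_real_indicator ac_simps)
    also have "\<dots> = complex_measure_integral torus_borel \<mu> u"
      by (rule complex_measure_integral_density[OF \<theta>(2) \<kappa>' \<mu>_def torus_measurable[OF \<theta>(2) uc], symmetric])
        (use B(2) sp\<theta> in blast)
    finally show ?thesis .
  qed
  ultimately show ?thesis by blast
qed

end

section \<open>Transfer between the tuple and its elementary functionals\<close>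

context poly_bounded_tuple
begin

lemma op_poly_shift_apply:
  "blinfun_apply (op_poly T p) (blinfun_apply (op_power (T j) m) x) = blinfun_apply (natural_rep T (\<lambda>z. eval_poly p z * z $ j ^ m)) x"
proof -
  have "eval_poly p \<in> polydisc_algebra" using polydisc_algebra_pol is_pol_iff by blast
  then show ?thesis by (simp add: natural_rep_shift natural_rep_eval_poly)
qed

text \<open>One density serves all polynomials at once, which makes the estimate uniform over the
  ball.\<close>

lemma apostol_limit:
  assumes \<mu>: "\<mu> \<in> M\<^sub>0"
    and rep: "\<And>u. u \<in> polydisc_algebra \<Longrightarrow> blinfun_apply y (blinfun_apply (natural_rep T u) x) = complex_measure_integral torus_borel \<mu> u"
  shows "(\<lambda>m. SUP p\<in>{p. sup_norm (eval_poly p) \<le> 1}.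
    cmod (blinfun_apply y (blinfun_apply (op_poly T p) (blinfun_apply (op_power (T j) m) x)))) \<longlonglongrightarrow> 0"
proof (rule LIMSEQ_I)
  fix r :: real assume r: "0 < r"
  obtain \<nu> \<kappa> where \<nu>: "representing_measure 0 \<nu>" "integrable \<nu> \<kappa>"
    "\<And>u. continuous_on torus u \<Longrightarrow> complex_measure_integral torus_borel \<mu> u = (LINT z|\<nu>. \<kappa> z * u z)"
    using M0_density[OF \<mu>] by blast
  obtain m0 where m0: "\<And>m p. m \<ge> m0 \<Longrightarrow> is_pol p \<Longrightarrow> (\<And>z. z \<in> torus \<Longrightarrow> cmod (p z) \<le> 1) \<Longrightarrow>
      cmod (LINT z|\<nu>. z $ j ^ m * p z * \<kappa> z) \<le> r / 2"
    using shifted_balls_integrable[OF \<nu>(1,2) half_gt_zero[OF r], of j] by metis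
  show "\<exists>m0. \<forall>m\<ge>m0. norm ((SUP p\<in>{p. sup_norm (eval_poly p) \<le> 1}.
    cmod (blinfun_apply y (blinfun_apply (op_poly T p) (blinfun_apply (op_power (T j) m) x)))) - 0) < r"
  proof (intro exI allI impI)
    fix m assume m: "m0 \<le> m"
    define g where "g p = cmod (blinfun_apply y (blinfun_apply (op_poly T p) (blinfun_apply (op_power (T j) m) x)))" for p
    have g: "g p \<le> r / 2" if p: "p \<in> {p. sup_norm (eval_poly p) \<le> 1}" for p
    proof -
      have 1: "cmod (eval_poly p z) \<le> 1" if "z \<in> torus" for z
        using sup_norm_upper[OF eval_poly_continuous that, of p] p by simp
      have pol: "is_pol (eval_poly p)" using is_pol_iff by blast
      have alg: "(\<lambda>z. eval_poly p z * z $ j ^ m) \<in> polydisc_algebra"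
        by (intro polydisc_algebra_mult polydisc_algebra_pol[OF pol] polydisc_algebra_power polydisc_algebra_nth)
      have "g p = cmod (LINT z|\<nu>. \<kappa> z * (eval_poly p z * z $ j ^ m))"
        unfolding g_def op_poly_shift_apply rep[OF alg] by (simp add: \<nu>(3)[OF polydisc_algebra_continuous[OF alg]])
      also have "\<dots> = cmod (LINT z|\<nu>. z $ j ^ m * eval_poly p z * \<kappa> z)" by (simp add: ac_simps)
      also have "\<dots> \<le> r / 2" by (rule m0[OF m pol 1])
      finally show ?thesis .
    qed
    \<comment> \<open>The zero polynomial makes the supremum one over a nonempty set and, as a
      competitor with nonnegative value, keeps it nonnegative.\<close>
    have zero: "(0 :: 'n cpoly) \<in> {p. sup_norm (eval_poly p) \<le> 1}"
      by (auto simp: eval_poly_def intro!: sup_norm_least)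
    have "(SUP p\<in>{p. sup_norm (eval_poly p) \<le> 1}. g p) \<le> r / 2"
      using zero g by (intro cSUP_least) auto
    moreover have "0 \<le> (SUP p\<in>{p. sup_norm (eval_poly p) \<le> 1}. g p)"
      using zero g by (intro cSUP_upper2[of _ _ 0] bdd_aboveI2[of _ _ "r / 2"]) (auto simp: g_def)
    ultimately show "norm ((SUP p\<in>{p. sup_norm (eval_poly p) \<le> 1}.
      cmod (blinfun_apply y (blinfun_apply (op_poly T p) (blinfun_apply (op_power (T j) m) x)))) - 0) < r"
      using r by (simp add: g_def[symmetric])
  qed
qed

text \<open>Apostol's condition speaks of polynomials, the functional of the whole algebra. A
  polynomial close to an element of the unit ball has sup norm at most \<open>2\<close>, so half of
  it is an admissible competitor. The summand \<open>1\<close> keeps the constant positive when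
  \<open>x\<close> or \<open>y\<close> is 0.\<close>

lemma elementary_functional:
  assumes y: "y \<in> complex_dual" and apostol: "apostol_condition T"
  shows "apostol_functional (\<lambda>u. blinfun_apply y (blinfun_apply (natural_rep T u) x)) (norm y * (C * norm x) + 1)"
proof
  show "0 < norm y * (C * norm x) + 1" using C_pos by (simp add: add_nonneg_pos)
  fix u :: "complex^'n \<Rightarrow> complex" assume u: "u \<in> polydisc_algebra"
  show "blinfun_apply y (blinfun_apply (natural_rep T (\<lambda>z. u z + v z)) x) =
      blinfun_apply y (blinfun_apply (natural_rep T u) x) + blinfun_apply y (blinfun_apply (natural_rep T v) x)"
    if "v \<in> polydisc_algebra" for v
    by (simp add: natural_rep_add u that blinfun.add_left blinfun.add_right)
  show "blinfun_apply y (blinfun_apply (natural_rep T (\<lambda>z. a * u z)) x) = a * blinfun_apply y (blinfun_apply (natural_rep T u) x)" for a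
    using y by (simp add: natural_rep_scale u scaleC_blinfun.rep_eq complex_dual_def complex_homogeneous_def scaleC_complex_def)
  show "cmod (blinfun_apply y (blinfun_apply (natural_rep T u) x)) \<le> (norm y * (C * norm x) + 1) * B"
    if B: "\<And>z. z \<in> torus \<Longrightarrow> cmod (u z) \<le> B" for B
  proof -
    obtain z :: "complex^'n" where "z \<in> torus" using torus_nonempty by blast
    then have B0: "0 \<le> B" using B norm_ge_zero order_trans by blast
    have "cmod (blinfun_apply y (blinfun_apply (natural_rep T u) x)) \<le> norm y * norm (blinfun_apply (natural_rep T u) x)"
      by (rule norm_blinfun)
    also have "\<dots> \<le> norm y * ((C * B) * norm x)"
      by (intro mult_left_mono order_trans[OF norm_blinfun] mult_right_mono natural_rep_bound u B) auto
    also have "\<dots> \<le> (norm y * (C * norm x) + 1) * B" using B0 by (simp add: algebra_simps)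
    finally show ?thesis .
  qed
next
  fix \<epsilon> :: real and j :: 'n assume \<epsilon>: "0 < \<epsilon>"
  define g where "g m p = cmod (blinfun_apply y (blinfun_apply (op_poly T p) (blinfun_apply (op_power (T j) m) x)))" for m p
  have "(\<lambda>m. SUP p\<in>{p. sup_norm (eval_poly p) \<le> 1}. g m p) \<longlonglongrightarrow> 0"
    using apostol y unfolding apostol_condition_def g_def by blast
  then have "eventually (\<lambda>m. (SUP p\<in>{p. sup_norm (eval_poly p) \<le> 1}. g m p) < \<epsilon> / 4) sequentially"
    using \<epsilon> by (intro order_tendstoD(2)) auto
  then obtain m where m: "(SUP p\<in>{p. sup_norm (eval_poly p) \<le> 1}. g m p) < \<epsilon> / 4"
    by (auto simp: eventually_sequentially)
  define w where "w = blinfun_apply (op_power (T j) m) x"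
  have y_le: "cmod (blinfun_apply y (blinfun_apply S w)) \<le> norm y * (b * norm w)" if "norm S \<le> b" for S b
    by (intro order_trans[OF norm_blinfun] mult_left_mono mult_right_mono that) auto
  have g_le: "g m p < \<epsilon> / 4" if p: "sup_norm (eval_poly p) \<le> 1" for p
  proof -
    \<comment> \<open>A real supremum bounds its members only over a bounded set; the bound here
      comes from polynomial boundedness.\<close>
    have "bdd_above (g m ` {p. sup_norm (eval_poly p) \<le> 1})"
    proof (rule bdd_aboveI2[where M = "norm y * (C * 1 * norm w)"])
      fix q :: "'n cpoly" assume "q \<in> {p. sup_norm (eval_poly p) \<le> 1}"
      then have "C * sup_norm (eval_poly q) \<le> C * 1" using C_pos by (intro mult_left_mono) auto
      then show "g m q \<le> norm y * (C * 1 * norm w)"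
        unfolding g_def w_def[symmetric] by (intro y_le order_trans[OF C_bound])
    qed
    then have "g m p \<le> (SUP p\<in>{p. sup_norm (eval_poly p) \<le> 1}. g m p)" using p by (intro cSUP_upper) auto
    then show ?thesis using m by linarith
  qed
  define D where "D = norm y * (C * norm w) + 1"
  have D: "0 < D" using C_pos by (simp add: D_def add_nonneg_pos)
  define d where "d = min 1 (\<epsilon> / 2 / D)"
  have d: "0 < d" "d \<le> 1" "D * d \<le> \<epsilon> / 2"
    using D \<epsilon> mult_left_mono[of d "\<epsilon> / 2 / D" D] by (auto simp: d_def)
  show "\<exists>m. \<forall>u\<in>polydisc_algebra. (\<forall>z\<in>torus. cmod (u z) \<le> 1) \<longrightarrow>
      cmod (blinfun_apply y (blinfun_apply (natural_rep T (\<lambda>z. z $ j ^ m * u z)) x)) \<le> \<epsilon>"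
  proof (intro exI[of _ m] ballI impI)
    fix u :: "complex^'n \<Rightarrow> complex" assume u: "u \<in> polydisc_algebra" and u1: "\<forall>z\<in>torus. cmod (u z) \<le> 1"
    obtain p where p: "\<And>z. z \<in> torus \<Longrightarrow> cmod (eval_poly p z - u z) \<le> d" "norm (op_poly T p - natural_rep T u) \<le> C * d"
      using approx_poly[OF u d(1)] by blast
    obtain q where q: "\<And>z. eval_poly q z = complex_of_real (1 / 2) * eval_poly p z"
      "\<And>S :: 'n \<Rightarrow> 'a \<Rightarrow>\<^sub>L 'a. op_poly S q = complex_of_real (1 / 2) *\<^sub>C op_poly S p"
      using exists_poly_scale[of "complex_of_real (1 / 2)" p] by metis
    have "sup_norm (eval_poly q) \<le> 1"
    proof (rule sup_norm_least)
      fix z :: "complex^'n" assume z: "z \<in> torus"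
      have "cmod (eval_poly p z) \<le> cmod (u z) + cmod (eval_poly p z - u z)" by (rule norm_triangle_sub)
      then show "cmod (eval_poly q z) \<le> 1" using p(1)[OF z] u1 z d(2) by (force simp: q(1) norm_mult)
    qed
    then have "g m q < \<epsilon> / 4" by (rule g_le)
    then have 1: "cmod (blinfun_apply y (blinfun_apply (op_poly T p) w)) \<le> \<epsilon> / 2"
      unfolding g_def w_def[symmetric] q(2) scaleC_of_real by (simp add: blinfun.scaleR_left blinfun.scaleR_right)
    have "cmod (blinfun_apply y (blinfun_apply (op_poly T p - natural_rep T u) w)) \<le> norm y * (C * d * norm w)"
      by (rule y_le[OF p(2)])
    also have "\<dots> \<le> D * d" using d(1) by (simp add: D_def algebra_simps)
    finally have 2: "cmod (blinfun_apply y (blinfun_apply (op_poly T p) w) - blinfun_apply y (blinfun_apply (natural_rep T u) w)) \<le> \<epsilon> / 2"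
      using d(3) by (simp add: blinfun.diff_left blinfun.diff_right)
    have "natural_rep T (\<lambda>z. z $ j ^ m * u z) = natural_rep T u o\<^sub>L op_power (T j) m"
      using natural_rep_shift[OF u] by (simp add: mult.commute)
    then have "blinfun_apply (natural_rep T (\<lambda>z. z $ j ^ m * u z)) x = blinfun_apply (natural_rep T u) w"
      by (simp add: w_def)
    then show "cmod (blinfun_apply y (blinfun_apply (natural_rep T (\<lambda>z. z $ j ^ m * u z)) x)) \<le> \<epsilon>"
      using 1 2 norm_triangle_sub[of "blinfun_apply y (blinfun_apply (natural_rep T u) w)" "blinfun_apply y (blinfun_apply (op_poly T p) w)"]
      by (simp add: norm_minus_commute)
  qed
qed

end

theorem theorem4p2:
  fixes T :: "'n::finite \<Rightarrow> 'a::{complex_normed_vector, banach} \<Rightarrow>\<^sub>L 'a"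
  assumes "\<And>j. contraction (T j)"
    and "commuting_tuple T"
    and "polynomially_bounded T"
  shows "absolutely_continuous_tuple T \<longleftrightarrow> apostol_condition T"
proof -
  obtain C where "0 < C" "\<And>p. norm (op_poly T p) \<le> C * sup_norm (eval_poly p)"
    using assms(3) unfolding polynomially_bounded_def by blast
  then interpret poly_bounded_tuple T C by unfold_locales (use assms(2) in auto)
  show ?thesis
  proof
    assume "absolutely_continuous_tuple T"
    then obtain \<mu> where "elementary_measures T \<mu>" and M0: "\<And>x y. y \<in> complex_dual \<Longrightarrow> \<mu> x y \<in> M\<^sub>0"
      unfolding absolutely_continuous_tuple_def by blast
    then have "blinfun_apply y (blinfun_apply (natural_rep T u) x) = complex_measure_integral torus_borel (\<mu> x y) u"
      if "y \<in> complex_dual" "u \<in> polydisc_algebra" for x y u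
      using that unfolding elementary_measures_def by blast
    then show "apostol_condition T"
      unfolding apostol_condition_def using apostol_limit[OF M0] by blast
  next
    assume "apostol_condition T"
    then have ex: "\<exists>\<mu>\<in>M\<^sub>0. \<forall>u\<in>polydisc_algebra.
        blinfun_apply y (blinfun_apply (natural_rep T u) x) = complex_measure_integral torus_borel \<mu> u"
      if "y \<in> complex_dual" for x y
      by (rule apostol_functional.representing_M0_measure[OF elementary_functional[OF that]])
    \<comment> \<open>The choice carries information only for \<open>y \<in> complex_dual\<close>,
      where \<open>ex\<close> provides a witness.\<close>
    define \<mu> where "\<mu> x y = (SOME \<mu>. \<mu> \<in> M\<^sub>0 \<and> (\<forall>u\<in>polydisc_algebra.
        blinfun_apply y (blinfun_apply (natural_rep T u) x) = complex_measure_integral torus_borel \<mu> u))" for x y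
    have \<mu>: "\<mu> x y \<in> M\<^sub>0 \<and> (\<forall>u\<in>polydisc_algebra.
        blinfun_apply y (blinfun_apply (natural_rep T u) x) = complex_measure_integral torus_borel (\<mu> x y) u)"
      if "y \<in> complex_dual" for x y
      unfolding \<mu>_def using ex[OF that, of x] unfolding Bex_def by (rule someI_ex)
    then have "elementary_measures T \<mu>"
      unfolding elementary_measures_def by (auto simp: M\<^sub>0_def)
    then show "absolutely_continuous_tuple T"
      unfolding absolutely_continuous_tuple_def using \<mu> by blast
  qed
qed

end
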